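(* Let $(X,v)$ be a smooth irreducible complex $D$-variety of dimension $2$, and let $\mathcal{F}(v)$ denote the foliation on $X$ tangent to $v$. Assume there exists a zero $p \in X(\mathbb{C})$ of $v$ such that there is no complex closed algebraic curve on $X$ containing $p$ and invariant under $v$. Then every algebraic web on $X$ invariant under the vector field $v$ is of the form $\mathcal{W} = \mathcal{F}(v)\boxtimes\cdots\boxtimes\mathcal{F}(v)$. Moreover, $(X,v)$ does not have any algebraic factor of dimension $1$.
   Context: A complex $D$-variety $(X,v)$ is a complex algebraic variety $X$ with an algebraic vector field $v$, equivalently a derivation $\delta_v$ of $\mathcal{O}_X$ ($\delta_v(f) = df(v)$). A closed curve $C\subset X$ is invariant under $v$ if its ideal sheaf is stable under $\delta_v$. Let $\Omega^1_X$ be the sheaf of $1$-forms and $\mathrm{Sym}^\bullet(\Omega^1_X) = \bigoplus_{r}\mathrm{Sym}^r(\Omega^1_X)$ its symmetric algebra, with product denoted $\boxtimes$. For $r\ge1$, an $r$-web on $X$ is an invertible subsheaf $\mathcal{W}\subset \mathrm{Sym}^r(\Omega^1_X)$ with $\mathrm{Sym}^r(\Omega^1_X)/\mathcal{W}$ torsion-free; a foliation is a $1$-web; the product $\mathcal{W}_1\boxtimes\mathcal{W}_2$ of an $r_1$-web and an $r_2$-web is the $(r_1+r_2)$-web generated locally by products $\omega_1\boxtimes\omega_2$ of local generators. The foliation $\mathcal{F}(v)$ is the foliation consisting of the local $1$-forms $\omega$ with $\omega(v)=0$. The Lie derivative $\mathcal{L}_v$ is the unique derivation of $\mathrm{Sym}^\bullet(\Omega^1_X)$,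 homogeneous of degree $0$, extending $\delta_v$ on $\mathcal{O}_X$ and satisfying $\mathcal{L}_v(df) = d(\delta_v f)$; a web $\mathcal{W}$ is invariant under $v$ if $\mathcal{L}_v(\mathcal{W})\subset \mathcal{W}$. A rational factor of $(X,v)$ is a dominant rational map $\phi: X\dashrightarrow Y$ to a $D$-variety $(Y,w)$ with $d\phi(v) = w$; a generically finite extension of $(X,v)$ is a dominant rational morphism $(X',v')\dashrightarrow (X,v)$ of $D$-varieties with finite generic fibre; an algebraic factor of $(X,v)$ is a rational factor of some generically finite extension of $(X,v)$; its dimension is $\dim Y$. *)

theory Defs
  imports "HOL-Analysis.Analysis" "HOL-Library.Extended_Nat" "HOL-Library.Function_Algebras"
begin

section \<open>Complex algebraic varieties\<close>

text \<open>
  Varieties are taken in the sense of Serre: a complex algebraic variety is the set of its complex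
  points with the Zariski topology and the sheaf of regular complex-valued functions, locally
  isomorphic to an affine algebraic set, quasi-compact and separated.

  Functions on an open set are represented by total functions; membership in \<open>reg X U\<close> only depends
  on the restriction to \<open>U\<close> (part of \<open>function_sheaf\<close> below).
  Sums and products of functions are pointwise.
\<close>

record 'a fspace =
  zar :: "'a topology"
  reg :: "'a set \<Rightarrow> ('a \<Rightarrow> complex) set"

abbreviation points :: "'a fspace \<Rightarrow> 'a set" where
  "points X \<equiv> topspace (zar X)"

definition function_sheaf :: "'a fspace \<Rightarrow> bool" where
  "function_sheaf X \<longleftrightarrow>
     (\<forall>U f g. openin (zar X) U \<and> f \<in> reg X U \<and> (\<forall>x\<in>U. g x = f x) \<longrightarrow> g \<in> reg X U) \<and>
     (\<forall>U V f. openin (zar X) U \<and> openin (zar X) V \<and> V \<subseteq> U \<and> f \<in> reg X U \<longrightarrow> f \<in> reg X V) \<and>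
     (\<forall>U f. openin (zar X) U \<and> (\<forall>x\<in>U. \<exists>V. openin (zar X) V \<and> x \<in> V \<and> V \<subseteq> U \<and> f \<in> reg X V)
        \<longrightarrow> f \<in> reg X U)"

definition cspace :: "nat \<Rightarrow> (nat \<Rightarrow> complex) set" where
  "cspace n = {..<n} \<rightarrow>\<^sub>E UNIV"

inductive_set polyfun :: "nat \<Rightarrow> ((nat \<Rightarrow> complex) \<Rightarrow> complex) set" for n :: nat where
  const: "(\<lambda>_. c) \<in> polyfun n"
| coord: "i < n \<Longrightarrow> (\<lambda>z. z i) \<in> polyfun n"
| add: "f \<in> polyfun n \<Longrightarrow> g \<in> polyfun n \<Longrightarrow> f + g \<in> polyfun n"
| mult: "f \<in> polyfun n \<Longrightarrow> g \<in> polyfun n \<Longrightarrow> f * g \<in> polyfun n"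

definition algebraic_set :: "nat \<Rightarrow> (nat \<Rightarrow> complex) set \<Rightarrow> bool" where
  "algebraic_set n Z \<longleftrightarrow> (\<exists>F \<subseteq> polyfun n. Z = {z \<in> cspace n. \<forall>f\<in>F. f z = 0})"

definition affine_zariski :: "nat \<Rightarrow> (nat \<Rightarrow> complex) set \<Rightarrow> (nat \<Rightarrow> complex) topology" where
  "affine_zariski n Z = topology_generated_by {{z \<in> Z. f z \<noteq> 0} | f. f \<in> polyfun n}"

definition affine_reg ::
    "nat \<Rightarrow> (nat \<Rightarrow> complex) set \<Rightarrow> (nat \<Rightarrow> complex) set \<Rightarrow> ((nat \<Rightarrow> complex) \<Rightarrow> complex) set" where
  "affine_reg n Z V = {h. \<forall>z\<in>V. \<exists>W. openin (affine_zariski n Z) W \<and> z \<in> W \<and> W \<subseteq> V \<and>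
     (\<exists>a\<in>polyfun n. \<exists>b\<in>polyfun n. \<forall>y\<in>W. b y \<noteq> 0 \<and> h y = a y / b y)}"

definition affine_space_on :: "nat \<Rightarrow> (nat \<Rightarrow> complex) set \<Rightarrow> (nat \<Rightarrow> complex) fspace" where
  "affine_space_on n Z = \<lparr>zar = affine_zariski n Z, reg = affine_reg n Z\<rparr>"

definition iso_from_open :: "'a fspace \<Rightarrow> 'a set \<Rightarrow> ('a \<Rightarrow> 'b) \<Rightarrow> 'b fspace \<Rightarrow> bool" where
  "iso_from_open X U \<phi> Y \<longleftrightarrow>
     openin (zar X) U \<and> bij_betw \<phi> U (points Y) \<and>
     (\<forall>W \<subseteq> U. openin (zar X) W \<longleftrightarrow> openin (zar Y) (\<phi> ` W)) \<and>
     (\<forall>W \<subseteq> U. openin (zar X) W \<longrightarrow>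
        (\<forall>f. f \<in> reg X W \<longleftrightarrow> f \<circ> inv_into U \<phi> \<in> reg Y (\<phi> ` W)))"

definition affine_open :: "'a fspace \<Rightarrow> 'a set \<Rightarrow> bool" where
  "affine_open X U \<longleftrightarrow> (\<exists>n Z \<phi>. algebraic_set n Z \<and> iso_from_open X U \<phi> (affine_space_on n Z))"

text \<open>
  The topology of the product variety (not the product of the Zariski topologies): regular functions
  on \<open>U \<times> V\<close>, for \<open>U\<close> and \<open>V\<close> affine, are the finite sums of products \<open>f x * g y\<close>.
\<close>

definition product_zariski :: "'a fspace \<Rightarrow> 'b fspace \<Rightarrow> ('a \<times> 'b) topology" where
  "product_zariski X Y = topology_generated_by
     {{(x, y). x \<in> U \<and> y \<in> V \<and> (\<Sum>i<k. f i x * g i y) \<noteq> 0} | U V k f g.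
        openin (zar X) U \<and> openin (zar Y) V \<and>
        (\<forall>i<(k::nat). f i \<in> reg X U) \<and> (\<forall>i<k. g i \<in> reg Y V)}"

definition separated :: "'a fspace \<Rightarrow> bool" where
  "separated X \<longleftrightarrow> closedin (product_zariski X X) {(x, x) | x. x \<in> points X}"

definition variety :: "'a fspace \<Rightarrow> bool" where
  "variety X \<longleftrightarrow> function_sheaf X \<and>
     (\<exists>\<U>. finite \<U> \<and> (\<forall>U\<in>\<U>. affine_open X U) \<and> \<Union>\<U> = points X) \<and>
     separated X"

definition irreducible_in :: "'a topology \<Rightarrow> 'a set \<Rightarrow> bool" where
  "irreducible_in T S \<longleftrightarrow> S \<noteq> {} \<and> S \<subseteq> topspace T \<and>
     (\<forall>A B. closedin T A \<and> closedin T B \<and> S \<subseteq> A \<union> B \<longrightarrow> S \<subseteq> A \<or> S \<subseteq> B)"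

definition irreducible_component :: "'a topology \<Rightarrow> 'a set \<Rightarrow> 'a set \<Rightarrow> bool" where
  "irreducible_component T C Z \<longleftrightarrow> irreducible_in T Z \<and> Z \<subseteq> C \<and>
     (\<forall>Z'. irreducible_in T Z' \<and> Z \<subseteq> Z' \<and> Z' \<subseteq> C \<longrightarrow> Z' = Z)"

text \<open>Krull dimension, used for nonempty spaces only.\<close>

definition krull_dim :: "'a topology \<Rightarrow> enat" where
  "krull_dim T = (SUP n \<in> {n. \<exists>C :: nat \<Rightarrow> 'a set.
     (\<forall>i\<le>n. closedin T (C i) \<and> irreducible_in T (C i)) \<and> (\<forall>i<n. C i \<subset> C (Suc i))}. enat n)"

definition irreducible_variety :: "'a fspace \<Rightarrow> bool" where
  "irreducible_variety X \<longleftrightarrow> variety X \<and> irreducible_in (zar X) (points X)"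

section \<open>Tangent vectors and vector fields\<close>

definition near_eq :: "'a fspace \<Rightarrow> 'a \<Rightarrow> ('a \<Rightarrow> complex) \<Rightarrow> ('a \<Rightarrow> complex) \<Rightarrow> bool" where
  "near_eq X x f g \<longleftrightarrow> (\<exists>U. openin (zar X) U \<and> x \<in> U \<and> (\<forall>y\<in>U. f y = g y))"

text \<open>The functions regular near \<open>x\<close>; the local ring at \<open>x\<close> is its quotient by \<open>near_eq X x\<close>.\<close>

definition reg_at :: "'a fspace \<Rightarrow> 'a \<Rightarrow> ('a \<Rightarrow> complex) set" where
  "reg_at X x = {f. \<exists>U. openin (zar X) U \<and> x \<in> U \<and> f \<in> reg X U}"

text \<open>
  Tangent vectors are the derivations of the local ring with values in its residue field; a tangent
  vector is made a total function by the value \<open>0\<close> outside \<open>reg_at X x\<close>.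
\<close>

definition tangent_space :: "'a fspace \<Rightarrow> 'a \<Rightarrow> (('a \<Rightarrow> complex) \<Rightarrow> complex) set" where
  "tangent_space X x = {\<xi>.
     (\<forall>f. f \<notin> reg_at X x \<longrightarrow> \<xi> f = 0) \<and>
     (\<forall>f\<in>reg_at X x. \<forall>g\<in>reg_at X x. near_eq X x f g \<longrightarrow> \<xi> f = \<xi> g) \<and>
     (\<forall>f\<in>reg_at X x. \<forall>g\<in>reg_at X x. \<xi> (f + g) = \<xi> f + \<xi> g) \<and>
     (\<forall>c. \<forall>f\<in>reg_at X x. \<xi> (\<lambda>y. c * f y) = c * \<xi> f) \<and>
     (\<forall>f\<in>reg_at X x. \<forall>g\<in>reg_at X x. \<xi> (f * g) = f x * \<xi> g + g x * \<xi> f)}"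

text \<open>
  For an irreducible variety, regularity of all local rings means that the tangent spaces have the
  dimension of the variety.
\<close>

definition smooth_variety :: "'a fspace \<Rightarrow> bool" where
  "smooth_variety X \<longleftrightarrow> irreducible_variety X \<and>
     (\<forall>x\<in>points X. enat (vector_space.dim (\<lambda>c \<xi> f. c * \<xi> f) (tangent_space X x)) = krull_dim (zar X))"

type_synonym 'a vfield = "'a \<Rightarrow> ('a \<Rightarrow> complex) \<Rightarrow> complex"

definition vector_field :: "'a fspace \<Rightarrow> 'a vfield \<Rightarrow> bool" where
  "vector_field X v \<longleftrightarrow> (\<forall>x\<in>points X. v x \<in> tangent_space X x) \<and>
     (\<forall>U f. openin (zar X) U \<and> f \<in> reg X U \<longrightarrow> (\<lambda>x. v x f) \<in> reg X U)"

definition deriv_of :: "'a vfield \<Rightarrow> ('a \<Rightarrow> complex) \<Rightarrow> 'a \<Rightarrow> complex" where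
  "deriv_of v f = (\<lambda>x. v x f)"

definition D_variety :: "'a fspace \<Rightarrow> 'a vfield \<Rightarrow> bool" where
  "D_variety X v \<longleftrightarrow> variety X \<and> vector_field X v"

definition zero_of_field :: "'a fspace \<Rightarrow> 'a vfield \<Rightarrow> 'a \<Rightarrow> bool" where
  "zero_of_field X v p \<longleftrightarrow> p \<in> points X \<and> (\<forall>f\<in>reg_at X p. v p f = 0)"

text \<open>Curves may be reducible, and are of pure dimension 1.\<close>

definition closed_curve :: "'a fspace \<Rightarrow> 'a set \<Rightarrow> bool" where
  "closed_curve X C \<longleftrightarrow> closedin (zar X) C \<and> C \<noteq> {} \<and>
     (\<forall>Z. irreducible_component (zar X) C Z \<longrightarrow> krull_dim (subtopology (zar X) Z) = 1)"

definition ideal_sheaf :: "'a fspace \<Rightarrow> 'a set \<Rightarrow> 'a set \<Rightarrow> ('a \<Rightarrow> complex) set" where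
  "ideal_sheaf X C U = {f \<in> reg X U. \<forall>x \<in> C \<inter> U. f x = 0}"

definition invariant_closed :: "'a fspace \<Rightarrow> 'a vfield \<Rightarrow> 'a set \<Rightarrow> bool" where
  "invariant_closed X v C \<longleftrightarrow>
     (\<forall>U f. openin (zar X) U \<and> f \<in> ideal_sheaf X C U \<longrightarrow> deriv_of v f \<in> ideal_sheaf X C U)"

section \<open>The symmetric algebra of the sheaf of 1-forms\<close>

text \<open>
  The stalk at \<open>x\<close> of the symmetric algebra of the sheaf of Kaehler differentials is, over the local
  ring \<open>A\<close> at \<open>x\<close>, the commutative \<open>A\<close>-algebra generated by symbols \<open>df\<close> with the relations
  \<open>d(f + g) = df + dg\<close>, \<open>d(fg) = f dg + g df\<close> and \<open>dc = 0\<close> for constants \<open>c\<close>.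
  Its elements are represented by expressions in functions (\<open>Fn\<close>) and symbols \<open>df\<close> (\<open>Dif\<close>),
  modulo the congruence \<open>sym_eq X x\<close> generated by these relations, the commutative ring axioms and
  the identification of functions with equal germs.
\<close>

datatype 'a sexp =
    Fn "'a \<Rightarrow> complex"
  | Dif "'a \<Rightarrow> complex"
  | Plus "'a sexp" "'a sexp"
  | Times "'a sexp" "'a sexp"

primrec leaves :: "'a sexp \<Rightarrow> ('a \<Rightarrow> complex) set" where
  "leaves (Fn f) = {f}"
| "leaves (Dif f) = {f}"
| "leaves (Plus s t) = leaves s \<union> leaves t"
| "leaves (Times s t) = leaves s \<union> leaves t"

abbreviation sexp_at :: "'a fspace \<Rightarrow> 'a \<Rightarrow> 'a sexp \<Rightarrow> bool" where
  "sexp_at X x t \<equiv> leaves t \<subseteq> reg_at X x"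

inductive sym_eq :: "'a fspace \<Rightarrow> 'a \<Rightarrow> 'a sexp \<Rightarrow> 'a sexp \<Rightarrow> bool" for X x where
  refl: "sexp_at X x t \<Longrightarrow> sym_eq X x t t"
| sym: "sym_eq X x s t \<Longrightarrow> sym_eq X x t s"
| trans: "sym_eq X x s t \<Longrightarrow> sym_eq X x t u \<Longrightarrow> sym_eq X x s u"
| cong_plus: "sym_eq X x s s' \<Longrightarrow> sym_eq X x t t' \<Longrightarrow> sym_eq X x (Plus s t) (Plus s' t')"
| cong_times: "sym_eq X x s s' \<Longrightarrow> sym_eq X x t t' \<Longrightarrow> sym_eq X x (Times s t) (Times s' t')"
| plus_assoc: "sexp_at X x s \<Longrightarrow> sexp_at X x t \<Longrightarrow> sexp_at X x u \<Longrightarrow>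
    sym_eq X x (Plus (Plus s t) u) (Plus s (Plus t u))"
| plus_comm: "sexp_at X x s \<Longrightarrow> sexp_at X x t \<Longrightarrow> sym_eq X x (Plus s t) (Plus t s)"
| times_assoc: "sexp_at X x s \<Longrightarrow> sexp_at X x t \<Longrightarrow> sexp_at X x u \<Longrightarrow>
    sym_eq X x (Times (Times s t) u) (Times s (Times t u))"
| times_comm: "sexp_at X x s \<Longrightarrow> sexp_at X x t \<Longrightarrow> sym_eq X x (Times s t) (Times t s)"
| distrib: "sexp_at X x s \<Longrightarrow> sexp_at X x t \<Longrightarrow> sexp_at X x u \<Longrightarrow>
    sym_eq X x (Times s (Plus t u)) (Plus (Times s t) (Times s u))"
| plus_zero: "(\<lambda>_. 0) \<in> reg_at X x \<Longrightarrow> sexp_at X x t \<Longrightarrow> sym_eq X x (Plus (Fn (\<lambda>_. 0)) t) t"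
| times_zero: "(\<lambda>_. 0) \<in> reg_at X x \<Longrightarrow> sexp_at X x t \<Longrightarrow>
    sym_eq X x (Times (Fn (\<lambda>_. 0)) t) (Fn (\<lambda>_. 0))"
| times_one: "(\<lambda>_. 1) \<in> reg_at X x \<Longrightarrow> sexp_at X x t \<Longrightarrow> sym_eq X x (Times (Fn (\<lambda>_. 1)) t) t"
| fn_germ: "f \<in> reg_at X x \<Longrightarrow> g \<in> reg_at X x \<Longrightarrow> near_eq X x f g \<Longrightarrow> sym_eq X x (Fn f) (Fn g)"
| fn_plus: "f \<in> reg_at X x \<Longrightarrow> g \<in> reg_at X x \<Longrightarrow> sym_eq X x (Plus (Fn f) (Fn g)) (Fn (f + g))"
| fn_times: "f \<in> reg_at X x \<Longrightarrow> g \<in> reg_at X x \<Longrightarrow> sym_eq X x (Times (Fn f) (Fn g)) (Fn (f * g))"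
| dif_germ: "f \<in> reg_at X x \<Longrightarrow> g \<in> reg_at X x \<Longrightarrow> near_eq X x f g \<Longrightarrow> sym_eq X x (Dif f) (Dif g)"
| dif_plus: "f \<in> reg_at X x \<Longrightarrow> g \<in> reg_at X x \<Longrightarrow> sym_eq X x (Dif (f + g)) (Plus (Dif f) (Dif g))"
| dif_times: "f \<in> reg_at X x \<Longrightarrow> g \<in> reg_at X x \<Longrightarrow>
    sym_eq X x (Dif (f * g)) (Plus (Times (Fn f) (Dif g)) (Times (Fn g) (Dif f)))"
| dif_const: "(\<lambda>_. c) \<in> reg_at X x \<Longrightarrow> (\<lambda>_. 0) \<in> reg_at X x \<Longrightarrow> sym_eq X x (Dif (\<lambda>_. c)) (Fn (\<lambda>_. 0))"

inductive homog :: "nat \<Rightarrow> 'a sexp \<Rightarrow> bool" where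
  "homog 0 (Fn f)"
| "homog 1 (Dif f)"
| "homog r s \<Longrightarrow> homog r t \<Longrightarrow> homog r (Plus s t)"
| "homog r s \<Longrightarrow> homog q t \<Longrightarrow> homog (r + q) (Times s t)"

text \<open>
  A section assigns to each point of its domain an element of the stalk, that is, a class of
  \<open>sym_eq X x\<close>, and the empty set to each point outside. It has to be given, locally, by a single
  expression in functions regular on the neighbourhood.
\<close>

type_synonym 'a symsec = "'a \<Rightarrow> 'a sexp set"

definition stalk_class :: "'a fspace \<Rightarrow> 'a \<Rightarrow> 'a sexp \<Rightarrow> 'a sexp set" where
  "stalk_class X x t = {u. sym_eq X x t u}"

definition Sym :: "'a fspace \<Rightarrow> nat \<Rightarrow> 'a set \<Rightarrow> 'a symsec set" where
  "Sym X r U = {s. (\<forall>x. x \<notin> U \<longrightarrow> s x = {}) \<and>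
     (\<forall>x\<in>U. \<exists>V t. openin (zar X) V \<and> x \<in> V \<and> V \<subseteq> U \<and> leaves t \<subseteq> reg X V \<and> homog r t \<and>
        (\<forall>y\<in>V. s y = stalk_class X y t))}"

definition sec_restrict :: "'a set \<Rightarrow> 'a symsec \<Rightarrow> 'a symsec" where
  "sec_restrict V s = (\<lambda>x. if x \<in> V then s x else {})"

definition sec_fn :: "'a fspace \<Rightarrow> 'a set \<Rightarrow> ('a \<Rightarrow> complex) \<Rightarrow> 'a symsec" where
  "sec_fn X U f = (\<lambda>x. if x \<in> U then stalk_class X x (Fn f) else {})"

definition sec_plus :: "'a fspace \<Rightarrow> 'a symsec \<Rightarrow> 'a symsec \<Rightarrow> 'a symsec" where
  "sec_plus X s1 s2 = (\<lambda>x. \<Union>t1\<in>s1 x. \<Union>t2\<in>s2 x. stalk_class X x (Plus t1 t2))"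

definition sec_times :: "'a fspace \<Rightarrow> 'a symsec \<Rightarrow> 'a symsec \<Rightarrow> 'a symsec" where
  "sec_times X s1 s2 = (\<lambda>x. \<Union>t1\<in>s1 x. \<Union>t2\<in>s2 x. stalk_class X x (Times t1 t2))"

text \<open>
  The Lie derivative: the derivation with \<open>f \<mapsto> \<delta> f\<close> and \<open>df \<mapsto> d(\<delta> f)\<close> on generators, where
  \<open>\<delta> = deriv_of v\<close>. It is compatible with \<open>sym_eq\<close> by \<open>lie_sym_eq\<close> below.
\<close>

primrec lie :: "'a vfield \<Rightarrow> 'a sexp \<Rightarrow> 'a sexp" where
  "lie v (Fn f) = Fn (deriv_of v f)"
| "lie v (Dif f) = Dif (deriv_of v f)"
| "lie v (Plus s t) = Plus (lie v s) (lie v t)"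
| "lie v (Times s t) = Plus (Times (lie v s) t) (Times s (lie v t))"

definition sec_lie :: "'a fspace \<Rightarrow> 'a vfield \<Rightarrow> 'a symsec \<Rightarrow> 'a symsec" where
  "sec_lie X v s = (\<lambda>x. \<Union>t\<in>s x. stalk_class X x (lie v t))"

text \<open>
  Evaluation on \<open>v\<close>: the algebra homomorphism to functions with \<open>df \<mapsto> df(v)\<close>; in degree 1 this is
  the contraction of a form with \<open>v\<close>. It is compatible with \<open>sym_eq\<close> by \<open>contract_sym_eq\<close> below.
\<close>

primrec contract :: "'a vfield \<Rightarrow> 'a sexp \<Rightarrow> 'a \<Rightarrow> complex" where
  "contract v (Fn f) = f"
| "contract v (Dif f) = deriv_of v f"
| "contract v (Plus s t) = contract v s + contract v t"
| "contract v (Times s t) = contract v s * contract v t"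

section \<open>Webs and foliations\<close>

type_synonym 'a subsheaf = "'a set \<Rightarrow> 'a symsec set"

definition Sym_subsheaf :: "'a fspace \<Rightarrow> nat \<Rightarrow> 'a subsheaf \<Rightarrow> bool" where
  "Sym_subsheaf X r W \<longleftrightarrow> (\<forall>U. openin (zar X) U \<longrightarrow>
     W U \<subseteq> Sym X r U \<and> W U \<noteq> {} \<and>
     (\<forall>s\<in>W U. \<forall>t\<in>W U. sec_plus X s t \<in> W U) \<and>
     (\<forall>f\<in>reg X U. \<forall>s\<in>W U. sec_times X (sec_fn X U f) s \<in> W U) \<and>
     (\<forall>V s. openin (zar X) V \<and> V \<subseteq> U \<and> s \<in> W U \<longrightarrow> sec_restrict V s \<in> W V) \<and>
     (\<forall>s\<in>Sym X r U. (\<forall>x\<in>U. \<exists>V. openin (zar X) V \<and> x \<in> V \<and> V \<subseteq> U \<and> sec_restrict V s \<in> W V)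
        \<longrightarrow> s \<in> W U))"

definition local_generator :: "'a fspace \<Rightarrow> 'a subsheaf \<Rightarrow> 'a set \<Rightarrow> 'a symsec \<Rightarrow> bool" where
  "local_generator X W U \<omega> \<longleftrightarrow> openin (zar X) U \<and> \<omega> \<in> W U \<and>
     (\<forall>V. openin (zar X) V \<and> V \<subseteq> U \<longrightarrow>
        W V = {sec_times X (sec_fn X V f) (sec_restrict V \<omega>) | f. f \<in> reg X V} \<and>
        (\<forall>f\<in>reg X V. sec_times X (sec_fn X V f) (sec_restrict V \<omega>) = sec_fn X V (\<lambda>_. 0)
           \<longrightarrow> (\<forall>x\<in>V. f x = 0)))"

definition invertible_sheaf :: "'a fspace \<Rightarrow> 'a subsheaf \<Rightarrow> bool" where
  "invertible_sheaf X W \<longleftrightarrow> (\<forall>x\<in>points X. \<exists>U \<omega>. x \<in> U \<and> local_generator X W U \<omega>)"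

definition nonzerodivisor :: "'a fspace \<Rightarrow> 'a set \<Rightarrow> ('a \<Rightarrow> complex) \<Rightarrow> bool" where
  "nonzerodivisor X U f \<longleftrightarrow> f \<in> reg X U \<and>
     (\<forall>V g. openin (zar X) V \<and> V \<subseteq> U \<and> g \<in> reg X V \<and> (\<forall>x\<in>V. f x * g x = 0) \<longrightarrow> (\<forall>x\<in>V. g x = 0))"

text \<open>
  \<open>W\<close> being a sheaf, the quotient sheaf is torsion-free iff the presheaf quotients
  \<open>Sym X r U / W U\<close> are.
\<close>

definition torsion_free_quotient :: "'a fspace \<Rightarrow> nat \<Rightarrow> 'a subsheaf \<Rightarrow> bool" where
  "torsion_free_quotient X r W \<longleftrightarrow>
     (\<forall>U f s. openin (zar X) U \<and> nonzerodivisor X U f \<and> s \<in> Sym X r U \<and>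
        sec_times X (sec_fn X U f) s \<in> W U \<longrightarrow> s \<in> W U)"

definition web :: "'a fspace \<Rightarrow> nat \<Rightarrow> 'a subsheaf \<Rightarrow> bool" where
  "web X r W \<longleftrightarrow> r \<ge> 1 \<and> Sym_subsheaf X r W \<and> invertible_sheaf X W \<and> torsion_free_quotient X r W"

definition invariant_web :: "'a fspace \<Rightarrow> 'a vfield \<Rightarrow> 'a subsheaf \<Rightarrow> bool" where
  "invariant_web X v W \<longleftrightarrow> (\<forall>U s. openin (zar X) U \<and> s \<in> W U \<longrightarrow> sec_lie X v s \<in> W U)"

definition web_prod :: "'a fspace \<Rightarrow> 'a subsheaf \<Rightarrow> 'a subsheaf \<Rightarrow> 'a subsheaf" where
  "web_prod X W1 W2 U = {s. (\<forall>x. x \<notin> U \<longrightarrow> s x = {}) \<and>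
     (\<forall>x\<in>U. \<exists>V \<omega>1 \<omega>2 f. x \<in> V \<and> V \<subseteq> U \<and>
        local_generator X W1 V \<omega>1 \<and> local_generator X W2 V \<omega>2 \<and> f \<in> reg X V \<and>
        sec_restrict V s = sec_times X (sec_fn X V f) (sec_times X \<omega>1 \<omega>2))}"

text \<open>Only meaningful for \<open>r \<ge> 1\<close>.\<close>

definition web_power :: "'a fspace \<Rightarrow> 'a subsheaf \<Rightarrow> nat \<Rightarrow> 'a subsheaf" where
  "web_power X W r = (web_prod X W ^^ (r - 1)) W"

definition foliation_of :: "'a fspace \<Rightarrow> 'a vfield \<Rightarrow> 'a subsheaf" where
  "foliation_of X v U = {s \<in> Sym X 1 U. \<forall>x\<in>U. \<forall>t\<in>s x. contract v t x = 0}"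

section \<open>Factors of D-varieties\<close>

text \<open>A rational map is given by a representative \<open>\<phi>\<close> on a dense open set \<open>U\<close>.\<close>

definition morphism_on :: "'a fspace \<Rightarrow> 'a set \<Rightarrow> ('a \<Rightarrow> 'b) \<Rightarrow> 'b fspace \<Rightarrow> bool" where
  "morphism_on X U \<phi> Y \<longleftrightarrow> openin (zar X) U \<and> \<phi> ` U \<subseteq> points Y \<and>
     (\<forall>V. openin (zar Y) V \<longrightarrow> openin (zar X) {x \<in> U. \<phi> x \<in> V} \<and>
        (\<forall>f\<in>reg Y V. f \<circ> \<phi> \<in> reg X {x \<in> U. \<phi> x \<in> V}))"

definition dominant_rational_map :: "'a fspace \<Rightarrow> 'a set \<Rightarrow> ('a \<Rightarrow> 'b) \<Rightarrow> 'b fspace \<Rightarrow> bool" where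
  "dominant_rational_map X U \<phi> Y \<longleftrightarrow> morphism_on X U \<phi> Y \<and>
     zar X closure_of U = points X \<and> zar Y closure_of (\<phi> ` U) = points Y"

definition field_related ::
    "'a fspace \<Rightarrow> 'a vfield \<Rightarrow> 'a set \<Rightarrow> ('a \<Rightarrow> 'b) \<Rightarrow> 'b fspace \<Rightarrow> 'b vfield \<Rightarrow> bool" where
  "field_related X v U \<phi> Y w \<longleftrightarrow> (\<forall>x\<in>U. \<forall>f\<in>reg_at Y (\<phi> x). v x (f \<circ> \<phi>) = w (\<phi> x) f)"

definition rational_factor :: "'a fspace \<Rightarrow> 'a vfield \<Rightarrow> 'b fspace \<Rightarrow> 'b vfield \<Rightarrow> bool" where
  "rational_factor X v Y w \<longleftrightarrow>
     irreducible_variety X \<and> D_variety X v \<and> irreducible_variety Y \<and> D_variety Y w \<and>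
     (\<exists>U \<phi>. dominant_rational_map X U \<phi> Y \<and> field_related X v U \<phi> Y w)"

text \<open>
  The map goes from \<open>(X', v')\<close> to \<open>(X, v)\<close>. On complex points, finiteness of the generic fibre means
  finiteness of the fibres over a dense open set.
\<close>

definition generically_finite_extension ::
    "'a fspace \<Rightarrow> 'a vfield \<Rightarrow> 'b fspace \<Rightarrow> 'b vfield \<Rightarrow> bool" where
  "generically_finite_extension X v X' v' \<longleftrightarrow>
     irreducible_variety X \<and> D_variety X v \<and> irreducible_variety X' \<and> D_variety X' v' \<and>
     (\<exists>U \<psi>. dominant_rational_map X' U \<psi> X \<and> field_related X' v' U \<psi> X v \<and>
        (\<exists>V. openin (zar X) V \<and> V \<noteq> {} \<and> (\<forall>y\<in>V. finite {x \<in> U. \<psi> x = y})))"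

section \<open>Well-definedness on stalks\<close>

lemma affine_reg_const: "(\<lambda>_. c) \<in> affine_reg n Z V" if "openin (affine_zariski n Z) V"
  unfolding affine_reg_def
proof (intro CollectI ballI)
  fix z assume "z \<in> V"
  then show "\<exists>W. openin (affine_zariski n Z) W \<and> z \<in> W \<and> W \<subseteq> V \<and>
     (\<exists>a\<in>polyfun n. \<exists>b\<in>polyfun n. \<forall>y\<in>W. b y \<noteq> 0 \<and> c = a y / b y)"
    by (intro exI[of _ V] conjI bexI[OF _ polyfun.const[of c]] bexI[OF _ polyfun.const[of 1]])
       (use that in auto)
qed

lemma affine_reg_ring:
  assumes f: "f \<in> affine_reg n Z V" and g: "g \<in> affine_reg n Z V"
  shows "f + g \<in> affine_reg n Z V" "f * g \<in> affine_reg n Z V"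
proof -
  have *: "\<exists>W. openin (affine_zariski n Z) W \<and> z \<in> W \<and> W \<subseteq> V \<and>
     (\<exists>a\<in>polyfun n. \<exists>b\<in>polyfun n. \<forall>y\<in>W. b y \<noteq> 0 \<and> (f + g) y = a y / b y) \<and>
     (\<exists>a\<in>polyfun n. \<exists>b\<in>polyfun n. \<forall>y\<in>W. b y \<noteq> 0 \<and> (f * g) y = a y / b y)" if z: "z \<in> V" for z
  proof -
    obtain W1 a1 b1 where 1: "openin (affine_zariski n Z) W1" "z \<in> W1" "W1 \<subseteq> V"
      "a1 \<in> polyfun n" "b1 \<in> polyfun n" "\<forall>y\<in>W1. b1 y \<noteq> 0 \<and> f y = a1 y / b1 y"
      using f z unfolding affine_reg_def by blast
    obtain W2 a2 b2 where 2: "openin (affine_zariski n Z) W2" "z \<in> W2" "W2 \<subseteq> V"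
      "a2 \<in> polyfun n" "b2 \<in> polyfun n" "\<forall>y\<in>W2. b2 y \<noteq> 0 \<and> g y = a2 y / b2 y"
      using g z unfolding affine_reg_def by blast
    have "\<forall>y\<in>W1 \<inter> W2. (b1 * b2) y \<noteq> 0 \<and> (f + g) y = (a1 * b2 + a2 * b1) y / (b1 * b2) y"
      using 1 2 by (auto simp: add_frac_eq)
    moreover have "\<forall>y\<in>W1 \<inter> W2. (b1 * b2) y \<noteq> 0 \<and> (f * g) y = (a1 * a2) y / (b1 * b2) y"
      using 1 2 by auto
    moreover have "b1 * b2 \<in> polyfun n" "a1 * b2 + a2 * b1 \<in> polyfun n" "a1 * a2 \<in> polyfun n"
      using 1 2 by (auto intro: polyfun.intros)
    moreover have "openin (affine_zariski n Z) (W1 \<inter> W2)" "z \<in> W1 \<inter> W2" "W1 \<inter> W2 \<subseteq> V"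
      using 1 2 by auto
    ultimately show ?thesis by blast
  qed
  show "f + g \<in> affine_reg n Z V" "f * g \<in> affine_reg n Z V"
    unfolding affine_reg_def
    by (intro CollectI ballI, drule *, elim exE conjE, intro exI conjI; assumption)+
qed

lemma affine_open_reg:
  assumes "affine_open X U" "openin (zar X) W" "W \<subseteq> U"
  shows "(\<lambda>_. c) \<in> reg X W"
    and "f \<in> reg X W \<Longrightarrow> g \<in> reg X W \<Longrightarrow> f + g \<in> reg X W"
    and "f \<in> reg X W \<Longrightarrow> g \<in> reg X W \<Longrightarrow> f * g \<in> reg X W"
proof -
  obtain n Z \<phi> where iso: "iso_from_open X U \<phi> (affine_space_on n Z)"
    using assms(1) unfolding affine_open_def by blast
  have op: "openin (affine_zariski n Z) (\<phi> ` W)"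
    using iso assms(2,3) unfolding iso_from_open_def affine_space_on_def by auto
  have r: "f \<in> reg X W \<longleftrightarrow> f \<circ> inv_into U \<phi> \<in> affine_reg n Z (\<phi> ` W)" for f
    using iso assms(2,3) unfolding iso_from_open_def affine_space_on_def by auto
  have c: "(\<lambda>_. c) \<circ> inv_into U \<phi> = (\<lambda>_. c)" for c :: complex
    by auto
  have p: "(f + g) \<circ> inv_into U \<phi> = (f \<circ> inv_into U \<phi>) + (g \<circ> inv_into U \<phi>)"
    "(f * g) \<circ> inv_into U \<phi> = (f \<circ> inv_into U \<phi>) * (g \<circ> inv_into U \<phi>)" for f g :: "'a \<Rightarrow> complex"
    by auto
  show "(\<lambda>_. c) \<in> reg X W" unfolding r c by (rule affine_reg_const[OF op])
  show "f \<in> reg X W \<Longrightarrow> g \<in> reg X W \<Longrightarrow> f + g \<in> reg X W"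
    and "f \<in> reg X W \<Longrightarrow> g \<in> reg X W \<Longrightarrow> f * g \<in> reg X W"
    unfolding r p by (simp_all add: affine_reg_ring)
qed

lemma reg_at_ring:
  assumes X: "variety X" and x: "x \<in> points X"
  shows "(\<lambda>_. c) \<in> reg_at X x"
    and "f \<in> reg_at X x \<Longrightarrow> g \<in> reg_at X x \<Longrightarrow> f + g \<in> reg_at X x"
    and "f \<in> reg_at X x \<Longrightarrow> g \<in> reg_at X x \<Longrightarrow> f * g \<in> reg_at X x"
proof -
  obtain U where U: "affine_open X U" "x \<in> U"
    using X x unfolding variety_def by blast
  have oU: "openin (zar X) U"
    using U(1) unfolding affine_open_def iso_from_open_def by blast
  have small: "f \<in> reg X V" if "openin (zar X) V" "openin (zar X) W" "V \<subseteq> W" "f \<in> reg X W" for f V W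
  proof -
    have "function_sheaf X" using X unfolding variety_def by simp
    then have "\<forall>U V f. openin (zar X) U \<and> openin (zar X) V \<and> V \<subseteq> U \<and> f \<in> reg X U \<longrightarrow> f \<in> reg X V"
      unfolding function_sheaf_def by (elim conjE)
    with that show ?thesis by blast
  qed
  show "(\<lambda>_. c) \<in> reg_at X x"
    using affine_open_reg(1)[OF U(1) oU] U(2) oU unfolding reg_at_def by blast
  have *: "f + g \<in> reg_at X x \<and> f * g \<in> reg_at X x" if fg: "f \<in> reg_at X x" "g \<in> reg_at X x"
  proof -
    obtain V1 V2 where V: "openin (zar X) V1" "x \<in> V1" "f \<in> reg X V1"
      "openin (zar X) V2" "x \<in> V2" "g \<in> reg X V2"
      using fg unfolding reg_at_def by blast
    define W where "W = V1 \<inter> V2 \<inter> U"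
    have W: "openin (zar X) W" "x \<in> W" "W \<subseteq> U" "W \<subseteq> V1" "W \<subseteq> V2"
      unfolding W_def using V U(2) oU by auto
    have "f \<in> reg X W" "g \<in> reg X W"
      using small W V by blast+
    then show ?thesis
      using affine_open_reg(2,3)[OF U(1) W(1,3)] W unfolding reg_at_def by blast
  qed
  show "f \<in> reg_at X x \<Longrightarrow> g \<in> reg_at X x \<Longrightarrow> f + g \<in> reg_at X x"
    and "f \<in> reg_at X x \<Longrightarrow> g \<in> reg_at X x \<Longrightarrow> f * g \<in> reg_at X x"
    using * by auto
qed

lemma sym_eq_sexp_at:
  assumes "variety X" "x \<in> points X" "sym_eq X x s t"
  shows "sexp_at X x s" "sexp_at X x t"
  using assms(3) by induction (auto intro: reg_at_ring[OF assms(1,2)])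

lemma vector_field_rules:
  assumes "vector_field X v" "x \<in> points X" "f \<in> reg_at X x" "g \<in> reg_at X x"
  shows "v x (f + g) = v x f + v x g" "v x (f * g) = f x * v x g + g x * v x f"
    "v x (\<lambda>y. c * f y) = c * v x f" "near_eq X x f g \<Longrightarrow> v x f = v x g"
  using assms unfolding vector_field_def tangent_space_def by blast+

lemma vector_field_const:
  assumes "variety X" "vector_field X v" "x \<in> points X"
  shows "v x (\<lambda>_. c) = 0"
proof -
  have r: "(\<lambda>_. c) \<in> reg_at X x" "(\<lambda>_. 1) \<in> reg_at X x" "(\<lambda>_. 0) \<in> reg_at X x" for c
    by (rule reg_at_ring[OF assms(1,3)])+
  have 1: "v x (\<lambda>_. 1) = 0"
  proof -
    have "(\<lambda>_::'a. 1::complex) * (\<lambda>_. 1) = (\<lambda>_. 1)" by auto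
    with vector_field_rules(2)[OF assms(2,3) r(2) r(2)] show ?thesis by simp
  qed
  have "v x (\<lambda>y. c * (\<lambda>_. 1) y) = c * v x (\<lambda>_. 1)"
    by (rule vector_field_rules(3)[OF assms(2,3) r(2) r(2)])
  with 1 show ?thesis by simp
qed

lemma reg_at_nbhd:
  assumes "f \<in> reg_at X x"
  obtains U where "openin (zar X) U" "x \<in> U" "\<And>y. y \<in> U \<Longrightarrow> y \<in> points X \<and> f \<in> reg_at X y"
  using assms unfolding reg_at_def by (blast dest: openin_subset)

lemma deriv_of_reg_at:
  assumes "vector_field X v" "f \<in> reg_at X x"
  shows "deriv_of v f \<in> reg_at X x"
  using assms unfolding vector_field_def reg_at_def deriv_of_def by blast

lemma deriv_of_near:
  assumes X: "variety X" and v: "vector_field X v" and f: "f \<in> reg_at X x" and g: "g \<in> reg_at X x"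
  shows "near_eq X x (deriv_of v (f + g)) (deriv_of v f + deriv_of v g)"
    and "near_eq X x (deriv_of v (f * g)) (f * deriv_of v g + g * deriv_of v f)"
    and "near_eq X x f g \<Longrightarrow> near_eq X x (deriv_of v f) (deriv_of v g)"
proof -
  obtain U1 where U1: "openin (zar X) U1" "x \<in> U1" "\<And>y. y \<in> U1 \<Longrightarrow> y \<in> points X \<and> f \<in> reg_at X y"
    using reg_at_nbhd[OF f] by blast
  obtain U2 where U2: "openin (zar X) U2" "x \<in> U2" "\<And>y. y \<in> U2 \<Longrightarrow> y \<in> points X \<and> g \<in> reg_at X y"
    using reg_at_nbhd[OF g] by blast
  have U: "openin (zar X) (U1 \<inter> U2)" "x \<in> U1 \<inter> U2"
    using U1 U2 by auto
  show "near_eq X x (deriv_of v (f + g)) (deriv_of v f + deriv_of v g)"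
    and "near_eq X x (deriv_of v (f * g)) (f * deriv_of v g + g * deriv_of v f)"
    unfolding near_eq_def deriv_of_def
    by (rule exI[of _ "U1 \<inter> U2"]; use U U1(3) U2(3) vector_field_rules[OF v] in auto)+
  assume "near_eq X x f g"
  then obtain V where V: "openin (zar X) V" "x \<in> V" "\<And>y. y \<in> V \<Longrightarrow> f y = g y"
    unfolding near_eq_def by blast
  have "near_eq X y f g" if "y \<in> V" for y
    unfolding near_eq_def using that V by blast
  then have "v y f = v y g" if "y \<in> U1 \<inter> U2 \<inter> V" for y
    using vector_field_rules(4)[OF v] U1(3) U2(3) that by blast
  moreover have "openin (zar X) (U1 \<inter> U2 \<inter> V)" "x \<in> U1 \<inter> U2 \<inter> V"
    using U V by auto
  ultimately show "near_eq X x (deriv_of v f) (deriv_of v g)"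
    unfolding near_eq_def deriv_of_def by blast
qed

lemma contract_sym_eq:
  assumes X: "variety X" and v: "vector_field X v" and x: "x \<in> points X" and "sym_eq X x s t"
  shows "contract v s x = contract v t x"
  using assms(4)
proof induction
  case (dif_const c)
  then show ?case by (simp add: deriv_of_def vector_field_const[OF X v x])
qed (auto simp: algebra_simps deriv_of_def near_eq_def vector_field_rules[OF v x])

lemma leaves_lie: "vector_field X v \<Longrightarrow> sexp_at X x t \<Longrightarrow> sexp_at X x (lie v t)"
  by (induction t) (auto simp: deriv_of_reg_at)

declare sym_eq.trans [trans]

lemma sym_eq_distrib2:
  assumes "sexp_at X x s" "sexp_at X x t" "sexp_at X x u"
  shows "sym_eq X x (Times (Plus s t) u) (Plus (Times s u) (Times t u))"
proof -
  have "sym_eq X x (Times (Plus s t) u) (Times u (Plus s t))"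
    using assms by (intro sym_eq.times_comm) auto
  also have "sym_eq X x \<dots> (Plus (Times u s) (Times u t))"
    using assms by (intro sym_eq.distrib) auto
  also have "sym_eq X x \<dots> (Plus (Times s u) (Times t u))"
    using assms by (intro sym_eq.cong_plus sym_eq.times_comm) auto
  finally show ?thesis .
qed

lemma sym_eq_plus_swap:
  assumes "sexp_at X x a" "sexp_at X x b" "sexp_at X x c" "sexp_at X x d"
  shows "sym_eq X x (Plus (Plus a b) (Plus c d)) (Plus (Plus a c) (Plus b d))"
proof -
  have "sym_eq X x (Plus (Plus a b) (Plus c d)) (Plus a (Plus b (Plus c d)))"
    using assms by (intro sym_eq.plus_assoc) auto
  also have "sym_eq X x \<dots> (Plus a (Plus (Plus b c) d))"
    using assms by (intro sym_eq.cong_plus sym_eq.refl sym_eq.sym[OF sym_eq.plus_assoc]) auto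
  also have "sym_eq X x \<dots> (Plus a (Plus (Plus c b) d))"
    using assms by (intro sym_eq.cong_plus sym_eq.refl sym_eq.plus_comm) auto
  also have "sym_eq X x \<dots> (Plus a (Plus c (Plus b d)))"
    using assms by (intro sym_eq.cong_plus sym_eq.refl sym_eq.plus_assoc) auto
  also have "sym_eq X x \<dots> (Plus (Plus a c) (Plus b d))"
    using assms by (intro sym_eq.sym[OF sym_eq.plus_assoc]) auto
  finally show ?thesis .
qed

theorem lie_sym_eq:
  assumes X: "variety X" and v: "vector_field X v" and x: "x \<in> points X" and st: "sym_eq X x s t"
  shows "sym_eq X x (lie v s) (lie v t)"
  using st
proof induction
  note L = leaves_lie[OF v]
  note c = reg_at_ring(1)[OF X x] and p = reg_at_ring(2,3)[OF X x] and d = deriv_of_reg_at[OF v]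
  have dc: "sym_eq X x (Fn (deriv_of v (\<lambda>_. k))) (Fn (\<lambda>_. 0))" for k
  proof (rule sym_eq.fn_germ)
    show "near_eq X x (deriv_of v (\<lambda>_. k)) (\<lambda>_. 0)"
      unfolding near_eq_def deriv_of_def
      by (intro exI[of _ "points X"]) (use x vector_field_const[OF X v] in auto)
  qed (use c d in auto)
  have zt: "sym_eq X x (Plus (Times (Fn (deriv_of v (\<lambda>_. k))) t) u) u"
    if "sexp_at X x t" "sexp_at X x u" for k t u
  proof -
    have "sym_eq X x (Times (Fn (deriv_of v (\<lambda>_. k))) t) (Times (Fn (\<lambda>_. 0)) t)"
      by (intro sym_eq.cong_times dc sym_eq.refl that)
    also have "sym_eq X x \<dots> (Fn (\<lambda>_. 0))"
      by (intro sym_eq.times_zero c that)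
    finally
    have "sym_eq X x (Plus (Times (Fn (deriv_of v (\<lambda>_. k))) t) u) (Plus (Fn (\<lambda>_. 0)) u)"
      by (intro sym_eq.cong_plus sym_eq.refl that)
    also have "sym_eq X x \<dots> u"
      by (intro sym_eq.plus_zero c that)
    finally show ?thesis .
  qed
  {
    case (refl t)
    then show ?case by (intro sym_eq.refl L)
  next
    case (sym s t)
    then show ?case by (auto intro: sym_eq.sym)
  next
    case (trans s t u)
    then show ?case by (auto intro: sym_eq.trans)
  next
    case (cong_plus s s' t t')
    then show ?case by (auto intro: sym_eq.cong_plus)
  next
    case (cong_times s s' t t')
    then show ?case by (auto intro: sym_eq.cong_plus sym_eq.cong_times)
  next
    case (plus_assoc s t u)
    then show ?case by (auto intro!: sym_eq.plus_assoc L)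
  next
    case (plus_comm s t)
    then show ?case by (auto intro!: sym_eq.plus_comm L)
  next
    case (times_assoc s t u)
    let ?s = "lie v s" and ?t = "lie v t" and ?u = "lie v u"
    have l: "sexp_at X x ?s" "sexp_at X x ?t" "sexp_at X x ?u"
      using times_assoc L by auto
    note a = times_assoc l
    have "sym_eq X x (Plus (Times (Plus (Times ?s t) (Times s ?t)) u) (Times (Times s t) ?u))
       (Plus (Plus (Times (Times ?s t) u) (Times (Times s ?t) u)) (Times (Times s t) ?u))"
      using a by (intro sym_eq.cong_plus sym_eq.refl sym_eq_distrib2) auto
    also have "sym_eq X x \<dots>
       (Plus (Plus (Times ?s (Times t u)) (Times s (Times ?t u))) (Times s (Times t ?u)))"
      using a by (intro sym_eq.cong_plus sym_eq.times_assoc) auto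
    also have "sym_eq X x \<dots>
       (Plus (Times ?s (Times t u)) (Plus (Times s (Times ?t u)) (Times s (Times t ?u))))"
      using a by (intro sym_eq.plus_assoc) auto
    also have "sym_eq X x \<dots> (Plus (Times ?s (Times t u)) (Times s (Plus (Times ?t u) (Times t ?u))))"
      using a by (intro sym_eq.cong_plus sym_eq.refl sym_eq.sym[OF sym_eq.distrib]) auto
    finally show ?case by simp
  next
    case (times_comm s t)
    then have l: "sexp_at X x (lie v s)" "sexp_at X x (lie v t)" using L by auto
    have "sym_eq X x (Plus (Times (lie v s) t) (Times s (lie v t)))
        (Plus (Times s (lie v t)) (Times (lie v s) t))"
      using times_comm l by (intro sym_eq.plus_comm) auto
    also have "sym_eq X x \<dots> (Plus (Times (lie v t) s) (Times t (lie v s)))"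
      using times_comm l by (intro sym_eq.cong_plus sym_eq.times_comm) auto
    finally show ?case by simp
  next
    case (distrib s t u)
    then have l: "sexp_at X x (lie v s)" "sexp_at X x (lie v t)" "sexp_at X x (lie v u)"
      using L by auto
    have "sym_eq X x (Plus (Times (lie v s) (Plus t u)) (Times s (Plus (lie v t) (lie v u))))
      (Plus (Plus (Times (lie v s) t) (Times (lie v s) u))
            (Plus (Times s (lie v t)) (Times s (lie v u))))"
      using distrib l by (intro sym_eq.cong_plus sym_eq.distrib) auto
    also have "sym_eq X x \<dots>
      (Plus (Plus (Times (lie v s) t) (Times s (lie v t)))
            (Plus (Times (lie v s) u) (Times s (lie v u))))"
      using distrib l by (intro sym_eq_plus_swap) auto
    finally show ?case by simp
  next
    case (plus_zero t)
    then have l: "sexp_at X x (lie v t)" using L by auto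
    have "sym_eq X x (Plus (Fn (deriv_of v (\<lambda>_. 0))) (lie v t)) (Plus (Fn (\<lambda>_. 0)) (lie v t))"
      by (intro sym_eq.cong_plus dc sym_eq.refl l)
    also have "sym_eq X x \<dots> (lie v t)"
      by (intro sym_eq.plus_zero c l)
    finally show ?case by simp
  next
    case (times_zero t)
    then have l: "sexp_at X x (lie v t)" using L by auto
    have "sym_eq X x (Plus (Times (Fn (deriv_of v (\<lambda>_. 0))) t) (Times (Fn (\<lambda>_. 0)) (lie v t)))
        (Times (Fn (\<lambda>_. 0)) (lie v t))"
      using times_zero l by (intro zt) auto
    also have "sym_eq X x \<dots> (Fn (\<lambda>_. 0))"
      by (intro sym_eq.times_zero c l)
    also have "sym_eq X x \<dots> (Fn (deriv_of v (\<lambda>_. 0)))"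
      by (intro sym_eq.sym[OF dc])
    finally show ?case by simp
  next
    case (times_one t)
    then have l: "sexp_at X x (lie v t)" using L by auto
    have "sym_eq X x (Plus (Times (Fn (deriv_of v (\<lambda>_. 1))) t) (Times (Fn (\<lambda>_. 1)) (lie v t)))
        (Times (Fn (\<lambda>_. 1)) (lie v t))"
      using times_one l by (intro zt) auto
    also have "sym_eq X x \<dots> (lie v t)"
      by (intro sym_eq.times_one c l)
    finally show ?case by simp
  next
    case (fn_germ f g)
    then show ?case by (auto intro!: sym_eq.fn_germ d deriv_of_near(3)[OF X v])
  next
    case (fn_plus f g)
    have "sym_eq X x (Plus (Fn (deriv_of v f)) (Fn (deriv_of v g))) (Fn (deriv_of v f + deriv_of v g))"
      using fn_plus by (intro sym_eq.fn_plus d)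
    also have "sym_eq X x \<dots> (Fn (deriv_of v (f + g)))"
      using fn_plus by (intro sym_eq.sym[OF sym_eq.fn_germ] d p deriv_of_near(1)[OF X v])
    finally show ?case by simp
  next
    case (fn_times f g)
    have "sym_eq X x (Plus (Times (Fn (deriv_of v f)) (Fn g)) (Times (Fn f) (Fn (deriv_of v g))))
       (Plus (Fn (deriv_of v f * g)) (Fn (f * deriv_of v g)))"
      using fn_times by (intro sym_eq.cong_plus sym_eq.fn_times d)
    also have "sym_eq X x \<dots> (Fn (deriv_of v f * g + f * deriv_of v g))"
      using fn_times by (intro sym_eq.fn_plus p d)
    also have "deriv_of v f * g + f * deriv_of v g = f * deriv_of v g + g * deriv_of v f"
      by (simp add: ac_simps)
    also have "sym_eq X x (Fn (f * deriv_of v g + g * deriv_of v f)) (Fn (deriv_of v (f * g)))"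
      using fn_times by (intro sym_eq.sym[OF sym_eq.fn_germ] d p deriv_of_near(2)[OF X v])
    finally show ?case by simp
  next
    case (dif_germ f g)
    then show ?case by (auto intro!: sym_eq.dif_germ d deriv_of_near(3)[OF X v])
  next
    case (dif_plus f g)
    have "sym_eq X x (Dif (deriv_of v (f + g))) (Dif (deriv_of v f + deriv_of v g))"
      using dif_plus by (intro sym_eq.dif_germ d p deriv_of_near(1)[OF X v])
    also have "sym_eq X x \<dots> (Plus (Dif (deriv_of v f)) (Dif (deriv_of v g)))"
      using dif_plus by (intro sym_eq.dif_plus d)
    finally show ?case by simp
  next
    case (dif_times f g)
    let ?f = "deriv_of v f" and ?g = "deriv_of v g"
    note r = dif_times d[OF dif_times(1)] d[OF dif_times(2)]
    have "sym_eq X x (Dif (deriv_of v (f * g))) (Dif (f * ?g + g * ?f))"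
      using r by (intro sym_eq.dif_germ d p deriv_of_near(2)[OF X v])
    also have "sym_eq X x \<dots> (Plus (Dif (f * ?g)) (Dif (g * ?f)))"
      using r by (intro sym_eq.dif_plus p)
    also have "sym_eq X x \<dots> (Plus (Plus (Times (Fn f) (Dif ?g)) (Times (Fn ?g) (Dif f)))
        (Plus (Times (Fn g) (Dif ?f)) (Times (Fn ?f) (Dif g))))"
      using r by (intro sym_eq.cong_plus sym_eq.dif_times)
    also have "sym_eq X x \<dots> (Plus (Plus (Times (Fn f) (Dif ?g)) (Times (Fn ?g) (Dif f)))
        (Plus (Times (Fn ?f) (Dif g)) (Times (Fn g) (Dif ?f))))"
      using r by (intro sym_eq.cong_plus sym_eq.refl sym_eq.plus_comm) auto
    also have "sym_eq X x \<dots> (Plus (Plus (Times (Fn f) (Dif ?g)) (Times (Fn ?f) (Dif g)))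
        (Plus (Times (Fn ?g) (Dif f)) (Times (Fn g) (Dif ?f))))"
      using r by (intro sym_eq_plus_swap) auto
    also have "sym_eq X x \<dots> (Plus (Plus (Times (Fn ?f) (Dif g)) (Times (Fn f) (Dif ?g)))
        (Plus (Times (Fn ?g) (Dif f)) (Times (Fn g) (Dif ?f))))"
      using r by (intro sym_eq.cong_plus sym_eq.refl sym_eq.plus_comm) auto
    finally show ?case by simp
  next
    case (dif_const k)
    have "sym_eq X x (Dif (deriv_of v (\<lambda>_. k))) (Dif (\<lambda>_. 0))"
    proof (rule sym_eq.dif_germ)
      show "near_eq X x (deriv_of v (\<lambda>_. k)) (\<lambda>_. 0)"
        unfolding near_eq_def deriv_of_def
        by (intro exI[of _ "points X"]) (use x vector_field_const[OF X v] in auto)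
    qed (use c d in auto)
    also have "sym_eq X x \<dots> (Fn (\<lambda>_. 0))"
      by (intro sym_eq.dif_const c)
    also have "sym_eq X x \<dots> (Fn (deriv_of v (\<lambda>_. 0)))"
      by (intro sym_eq.sym[OF dc])
    finally show ?case by simp
  }
qed

end

theory Submission
 imports Defs "HOL-Computational_Algebra.Fundamental_Theorem_Algebra"
begin

text \<open>A germ \<open>h\<close> at \<open>p\<close> with \<open>h(p) = 0\<close> and \<open>\<delta> h \<in> (h)\<close> would cut out an invariant curve through
  \<open>p\<close>, so there is none. If \<open>L\<^sub>v \<omega> = g \<omega>\<close> near \<open>p\<close>, then \<open>\<delta> (\<omega>(v)) = g \<omega>(v)\<close> and \<open>\<omega>(v)\<close> vanishes
  with \<open>v\<close> at \<open>p\<close>, so \<open>\<omega>(v) = 0\<close> and \<open>\<omega>\<close> is divisible by the form \<open>\<alpha>\<close> defining \<open>\<F>(v)\<close>; by induction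
  on its degree \<open>r\<close> it is a multiple of \<open>\<alpha> ^ r\<close>.

  A factor of dimension 1 gives a function \<open>f\<close>, algebraic over \<open>\<complex>(X)\<close>, such that \<open>f\<close> and \<open>\<delta> f\<close> are
  algebraically dependent. If \<open>\<delta> f = 0\<close>, then \<open>X\<close> has a rational first integral, and its coprime numerator
  and denominator are invariant germs. Otherwise the average over the conjugates of the invariant form
  \<open>df / \<delta> f\<close> is a rational invariant form on \<open>X\<close> with value 1 on \<open>v\<close>. The ideal of its denominators at \<open>p\<close>
  is generated by an invariant germ, so the form is regular at \<open>p\<close>, where \<open>v\<close> vanishes.\<close>

section \<open>Rings of generically defined functions\<close>

text \<open>Germs are not quotient classes: a rational function is a total function, and equality
  means agreement on a nonempty open set. All local rings and the function field thus share one type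
  and one filter. The hypothesis on \<open>p\<close> speaks only about \<open>p\<close>, while a web
  has to be determined everywhere. The bridge is a condition tested at general points: a form, as a
  function on tangent vectors, is unchanged by translation along \<open>v\<close>. It can be proved
  at \<open>p\<close> and used at every point, where it characterises the multiples of \<alpha>^r.
  Of unique factorisation, only the principality of the ideals (e) : S is extracted; it provides
  both the greatest common divisor of two germs and the generator of an ideal of denominators.
  Averaging is legitimate because a component \<open>A\<close> of the invariant form satisfies an
  affine equation \<delta> A = \<mu> A + \<nu> with \<mu>, \<nu> in \<complex>(X); the mean of the
  conjugates is read off the second coefficient of the minimal polynomial of \<open>A\<close>,
  without constructing conjugates.\<close>

locale generic_ring =
 fixes G :: "'a filter" and R :: "('a => complex) set"
 assumes G_ne_bot: "G ~= bot"
  and const_R [simp, intro]: "(%_. c) \<in> R"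
  and add_R [intro]: "f \<in> R ==> g \<in> R ==> (%y. f y + g y) \<in> R"
  and mult_R [intro]: "f \<in> R ==> g \<in> R ==> (%y. f y * g y) \<in> R"
  and dichotomy: "f \<in> R ==> (\<forall>\<^sub>F y in G. f y = 0) \<or> (\<forall>\<^sub>F y in G. f y ~= 0)"
begin

lemma minus_R [intro]: "f \<in> R ==> (%y. - f y) \<in> R"
 using mult_R[OF const_R[of "-1"], of f] by simp

lemma diff_R [intro]: "f \<in> R ==> g \<in> R ==> (%y. f y - g y) \<in> R"
 using add_R[OF _ minus_R, of f g] by simp

lemma power_R [intro]: "f \<in> R ==> (%y. f y ^ n) \<in> R"
 by (induction n) (auto intro: mult_R)

lemma sum_R [intro]: "(\<And>i. i \<in> I ==> f i \<in> R) ==> (%y. \<Sum>i\<in>I. f i y) \<in> R"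
 by (induction I rule: infinite_finite_induct) (auto intro: add_R)

abbreviation generically :: "('a => bool) => bool" (binder "GEN " 10) where
 "generically P \<equiv> eventually P G"

abbreviation ev_eq :: "('a => complex) => ('a => complex) => bool" (infix "\<doteq>" 50) where
 "f \<doteq> g \<equiv> GEN y. f y = g y"

definition dvdR :: "('a => complex) => ('a => complex) => bool" (infix "dvd\<^sub>R" 50) where
 "a dvd\<^sub>R b \<longleftrightarrow> (\<exists>c\<in>R. GEN y. b y = a y * c y)"

lemma dvdRI: "c \<in> R ==> GEN y. b y = a y * c y ==> a dvd\<^sub>R b"
 unfolding dvdR_def by blast

lemma dvdRE:
 assumes "a dvd\<^sub>R b"
 obtains c where "c \<in> R" "GEN y. b y = a y * c y"
 using assms unfolding dvdR_def by (elim bexE)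

lemma ev_nonzero: "f \<in> R ==> \<not> f \<doteq> (%_. 0) ==> GEN y. f y ~= 0"
 using dichotomy by blast

lemma not_ev_zeroI: "GEN y. f y ~= 0 ==> \<not> (GEN y. f y = 0)"
proof
 assume "GEN y. f y ~= 0" "GEN y. f y = 0"
 then have "GEN y. False" by eventually_elim simp
 then show False using G_ne_bot by (simp add: trivial_limit_def)
qed

lemma ev_mult_zero:
 assumes "f \<in> R" "GEN y. f y * g y = 0" "\<not> (GEN y. f y = 0)"
 shows "GEN y. g y = 0"
 using ev_nonzero[OF assms(1,3)] assms(2) by eventually_elim simp

lemma ev_cancel:
 assumes "f \<in> R" "GEN y. f y * g y = f y * h y" "\<not> (GEN y. f y = 0)"
 shows "GEN y. g y = h y"
 using ev_nonzero[OF assms(1,3)] assms(2) by eventually_elim simp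

lemma dvdR_scaled:
 assumes c: "c \<in> R" "\<not> c \<doteq> (%_. 0)" and A: "GEN y. A y = c y * a y" and B: "GEN y. B y = c y * b y"
 shows "A dvd\<^sub>R B \<longleftrightarrow> a dvd\<^sub>R b"
proof -
 have "(GEN y. B y = A y * k y) \<longleftrightarrow> (GEN y. b y = a y * k y)" for k
 proof
  assume "GEN y. B y = A y * k y"
  with A B have "GEN y. c y * b y = c y * (a y * k y)" by eventually_elim (metis mult.assoc)
  then show "GEN y. b y = a y * k y" by (rule ev_cancel[OF c(1) _ c(2)])
 next
  assume "GEN y. b y = a y * k y"
  with A B show "GEN y. B y = A y * k y" by eventually_elim (simp add: mult.assoc)
 qed
 then show ?thesis unfolding dvdR_def by simp
qed

definition idealR :: "('a => complex) set => bool" where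
 "idealR J \<longleftrightarrow> J \<subseteq> R \<and> (\<forall>f\<in>R. f \<doteq> (%_. 0) --> f \<in> J) \<and>
   (\<forall>f\<in>J. \<forall>g\<in>J. (%y. f y + g y) \<in> J) \<and> (\<forall>f\<in>R. \<forall>g\<in>J. (%y. f y * g y) \<in> J)"

lemma idealR_rules:
 assumes "idealR J"
 shows "J \<subseteq> R" "f \<in> R ==> f \<doteq> (%_. 0) ==> f \<in> J"
  "f \<in> J ==> g \<in> J ==> (%y. f y + g y) \<in> J" "f \<in> R ==> g \<in> J ==> (%y. f y * g y) \<in> J"
 using assms unfolding idealR_def by simp_all

lemma idealR_ev_eq:
 assumes J: "idealR J" and "g \<in> J" "f \<in> R" "f \<doteq> g"
 shows "f \<in> J"
proof -
 have g: "g \<in> R" using assms(2) idealR_rules(1)[OF J] by auto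
 have "(%y. f y - g y) \<doteq> (%_. 0)" using assms(4) by eventually_elim simp
 then have "(%y. f y - g y) \<in> J"
  by (rule idealR_rules(2)[OF J diff_R[OF assms(3) g]])
 from idealR_rules(3)[OF J this assms(2)] show ?thesis by simp
qed

lemma idealR_span:
 assumes "a \<in> R" "f \<in> R"
 shows "idealR {g\<in>R. \<exists>c\<in>R. \<exists>h\<in>R. GEN y. g y = c y * f y + a y * h y}" (is "idealR ?I")
proof -
 have I: "g \<in> ?I" if "g \<in> R" "c \<in> R" "h \<in> R" "GEN y. g y = c y * f y + a y * h y" for g c h
  using that by auto
 show ?thesis unfolding idealR_def
 proof (intro conjI ballI impI)
  show "g \<in> ?I" if "g \<in> R" "g \<doteq> (%_. 0)" for g
   by (rule I[OF that(1) const_R[of 0] const_R[of 0]]) (use that(2) in simp)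
  fix g assume "g \<in> ?I"
  then obtain c h where g: "g \<in> R" "c \<in> R" "h \<in> R" "GEN y. g y = c y * f y + a y * h y" by blast
  show "(%y. g y + g' y) \<in> ?I" if *: "g' \<in> ?I" for g'
  proof -
   obtain c' h' where g': "g' \<in> R" "c' \<in> R" "h' \<in> R" "GEN y. g' y = c' y * f y + a y * h' y" using * by blast
   show ?thesis
    by (rule I[OF add_R[OF g(1) g'(1)] add_R[OF g(2) g'(2)] add_R[OF g(3) g'(3)]])
     (use g(4) g'(4) in "eventually_elim, simp add: algebra_simps")
  qed
  show "(%y. r y * g y) \<in> ?I" if r: "r \<in> R" for r
   by (rule I[OF mult_R[OF r g(1)] mult_R[OF r g(2)] mult_R[OF r g(3)]])
    (use g(4) in "eventually_elim, simp add: algebra_simps")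
 qed auto
qed

lemma idealR_colon:
 assumes I: "idealR I" and s: "s \<in> R"
 shows "idealR {g\<in>R. (%y. s y * g y) \<in> I}"
 unfolding idealR_def
proof (intro conjI ballI impI; clarsimp)
 note r = idealR_rules[OF I]
 show "(%y. s y * g y) \<in> I" if "g \<in> R" "g \<doteq> (%_. 0)" for g
  by (rule r(2)[OF mult_R[OF s that(1)]]) (use that(2) in "auto elim: eventually_mono")
 fix g assume g: "g \<in> R" "(%y. s y * g y) \<in> I"
 show "(%y. g y + g' y) \<in> R \<and> (%y. s y * (g y + g' y)) \<in> I" if "g' \<in> R" "(%y. s y * g' y) \<in> I" for g'
  using r(3)[OF g(2) that(2)] g that by (simp add: distrib_left add_R)
 show "(%y. f y * g y) \<in> R \<and> (%y. s y * (f y * g y)) \<in> I" if "f \<in> R" for f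
  using r(4)[OF that g(2)] g that by (simp add: mult.left_commute mult_R)
qed

end

text \<open>\<open>acc\<close> asks for a single repetition in each ascending chain, which is the
  form used in Krull's theorem. \<open>ev_at\<close> says that a germ, which \<open>G\<close> sees
  only generically, still has a well-defined value at \<open>x\<close>.\<close>

locale generic_local_ring = generic_ring G R for G :: "'a filter" and R +
 fixes x :: 'a
 assumes inverse_R [intro]: "f \<in> R ==> f x ~= 0 ==> (%y. inverse (f y)) \<in> R"
  and ev_at: "f \<in> R ==> g \<in> R ==> f \<doteq> g ==> f x = g x"
  and acc: "(\<And>n. idealR (J n)) ==> (\<And>n. J n \<subseteq> J (Suc n)) ==> \<exists>N. J (Suc N) = J N"
begin

lemma unit_nonzero: "f \<in> R ==> f x ~= 0 ==> GEN y. f y ~= 0"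
 by (rule ev_nonzero) (use ev_at[OF _ const_R[of 0]] in auto)

text \<open>Krull's intersection theorem for a principal ideal. The chain of the ideals \<open>J n\<close> of all \<open>g\<close>
  with \<open>s ^ n * g \<in> (f) + (a)\<close> is stationary, and the equality \<open>J (N + 1) = J N\<close> gives
  \<open>f * (1 - c * s) \<in> (a)\<close>.\<close>

lemma krull_principal:
 assumes a: "a \<in> R" and s: "s \<in> R" "s x = 0" and f: "f \<in> R"
  and H: "\<And>n. \<exists>g\<in>R. \<exists>h\<in>R. GEN y. f y = s y ^ n * g y + a y * h y"
 shows "a dvd\<^sub>R f"
proof -
 define I where "I = {g\<in>R. \<exists>c\<in>R. \<exists>h\<in>R. GEN y. g y = c y * f y + a y * h y}"
 define J where "J n = {g\<in>R. (%y. s y ^ n * g y) \<in> I}" for n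
 have I: "idealR I" unfolding I_def by (rule idealR_span[OF a f])
 have "idealR (J n)" for n unfolding J_def by (rule idealR_colon[OF I power_R[OF s(1)]])
 moreover have "J n \<subseteq> J (Suc n)" for n
 proof
  fix g assume "g \<in> J n"
  then show "g \<in> J (Suc n)" using idealR_rules(4)[OF I s(1)] unfolding J_def by (fastforce simp: mult.assoc)
 qed
 ultimately obtain N where N: "J (Suc N) = J N" using acc by blast
 obtain g h where gh: "g \<in> R" "h \<in> R" "GEN y. f y = s y ^ Suc N * g y + a y * h y"
  using H by blast
 have "GEN y. s y ^ Suc N * g y = 1 * f y + a y * (- h y)"
  using gh(3) by eventually_elim (simp add: algebra_simps)
 then have "g \<in> J (Suc N)"
  unfolding J_def I_def
  by (intro CollectI conjI gh(1) bexI[of _ "%_. 1"] bexI[of _ "%y. - h y"] minus_R gh mult_R power_R s const_R)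
 then obtain c h' where *: "c \<in> R" "h' \<in> R" "GEN y. s y ^ N * g y = c y * f y + a y * h' y"
  unfolding N unfolding J_def I_def by blast
 \<comment> \<open>\<open>s\<close> vanishes at \<open>x\<close>, so \<open>e\<close> is a unit
   there.\<close>
 define e where "e = (%y. 1 - s y * c y)"
 have e: "e \<in> R" "e x ~= 0" unfolding e_def using s *(1) by auto
 have "GEN y. f y = a y * (inverse (e y) * (s y * h' y + h y))"
  using gh(3) *(3) unit_nonzero[OF e]
 proof eventually_elim
  case (elim y)
  have "f y = s y * (s y ^ N * g y) + a y * h y" using elim(1) by (simp add: mult.assoc)
  then have "f y * e y = a y * (s y * h' y + h y)"
   unfolding e_def elim(2) by (simp add: algebra_simps)
  then show ?case using elim(3) by (simp add: field_simps)
 qed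
 then show ?thesis
  by (intro dvdRI[of "%y. inverse (e y) * (s y * h' y + h y)"] mult_R inverse_R add_R)
    (use e s * gh in auto)
qed

end

text \<open>\<open>t_power_not\<close> says that the quotient by \<open>u\<close> is not artinian.
  Together with \<open>maximal_gen\<close> it makes that quotient behave as a discrete valuation
  ring with parameter \<open>t\<close>, the source of the divisibility results below.\<close>

locale regular_local_ring2 = generic_local_ring G R x for G :: "'a filter" and R x +
 fixes u t :: "'a => complex"
 assumes ut_R [simp, intro]: "u \<in> R" "t \<in> R" and ut_at [simp]: "u x = 0" "t x = 0"
  and maximal_gen: "f \<in> R ==> f x = 0 ==>
   \<exists>a\<in>R. \<exists>b\<in>R. \<forall>\<^sub>F y in G. f y = u y * a y + t y * b y"
  and t_power_not: "c \<in> R ==> \<not> (\<forall>\<^sub>F y in G. t y ^ k = u y * c y)"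
  and u_not: "c \<in> R ==> \<not> (\<forall>\<^sub>F y in G. u y = t y * c y)"
begin

lemma u_nonzero: "\<not> u \<doteq> (%_. 0)"
 using u_not[of "%_. 0"] by auto

text \<open>As long as the cofactor of t^n modulo \<open>u\<close> vanishes at \<open>x\<close>, it
  lies in (u, t) and another factor \<open>t\<close> can be split off. If this never stopped,
  \<open>f\<close> would lie in (t^n) + (u) for all n, hence in (u) by Krull's theorem.\<close>

lemma u_regular_form:
 assumes f: "f \<in> R" "\<not> u dvd\<^sub>R f"
 obtains (that') k e h where "e \<in> R" "h \<in> R" "e x ~= 0" "GEN y. f y = t y ^ k * e y + u y * h y"
proof (rule ccontr)
 assume nt: "\<not> thesis"
 have no: "e x = 0" if "e \<in> R" "h \<in> R" "GEN y. f y = t y ^ k * e y + u y * h y" for k e h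
  by (rule ccontr) (rule notE[OF nt that'[OF that(1,2) _ that(3)]])
 have "\<exists>g\<in>R. \<exists>h\<in>R. GEN y. f y = t y ^ n * g y + u y * h y" for n
 proof (induction n)
  case 0
  show ?case by (intro bexI[of _ f] bexI[of _ "%_. 0"]) (use f in auto)
 next
  case (Suc n)
  then obtain g h where gh: "g \<in> R" "h \<in> R" "GEN y. f y = t y ^ n * g y + u y * h y" by blast
  obtain a b where ab: "a \<in> R" "b \<in> R" "GEN y. g y = u y * a y + t y * b y"
   using maximal_gen[OF gh(1) no[OF gh]] by (elim bexE)
  from gh(3) ab(3) have "GEN y. f y = t y ^ Suc n * b y + u y * (t y ^ n * a y + h y)"
   by eventually_elim (simp add: algebra_simps)
  then show ?case using ab gh
   by (intro bexI[of _ b] bexI[of _ "%y. t y ^ n * a y + h y"] add_R mult_R power_R) auto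
 qed
 then have "u dvd\<^sub>R f" by (rule krull_principal[OF ut_R(1,2) ut_at(2) f(1)])
 with f show False by simp
qed

text \<open>Modulo \<open>u\<close> both factors would be units times powers of \<open>t\<close>,
  and so would their product; but no power of \<open>t\<close> lies in (u).\<close>

lemma u_prime:
 assumes "f \<in> R" "g \<in> R" "u dvd\<^sub>R (%y. f y * g y)"
 shows "u dvd\<^sub>R f \<or> u dvd\<^sub>R g"
proof (rule ccontr)
 assume "\<not> ?thesis"
 then have n: "\<not> u dvd\<^sub>R f" "\<not> u dvd\<^sub>R g" by auto
 obtain k e h where f: "e \<in> R" "h \<in> R" "e x ~= 0" "GEN y. f y = t y ^ k * e y + u y * h y"
  using u_regular_form[OF assms(1) n(1)] .
 obtain k' e' h' where g: "e' \<in> R" "h' \<in> R" "e' x ~= 0" "GEN y. g y = t y ^ k' * e' y + u y * h' y"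
  using u_regular_form[OF assms(2) n(2)] .
 obtain c where c: "c \<in> R" "GEN y. f y * g y = u y * c y"
  using assms(3) unfolding dvdR_def by blast
 \<comment> \<open>Obtained by multiplying the two normal forms, solving for the power of
   \<open>t\<close> and dividing by the units \<open>e\<close> and \<open>e'\<close>.\<close>
 define d where "d = (%y. inverse (e y) * inverse (e' y) *
   (c y - t y ^ k * e y * h' y - h y * g y))"
 have d: "d \<in> R" unfolding d_def
  by (intro mult_R diff_R inverse_R power_R) (use f g c assms in auto)
 have "GEN y. t y ^ (k + k') = u y * d y"
  using f(4) g(4) c(2) unit_nonzero[OF f(1,3)] unit_nonzero[OF g(1,3)]
 proof eventually_elim
  case (elim y)
  have "t y ^ (k + k') * (e y * e' y) = (t y ^ k * e y) * (t y ^ k' * e' y)"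
   by (simp add: power_add)
  also have "\<dots> = (f y - u y * h y) * (g y - u y * h' y)"
   using elim(1,2) by simp
  also have "\<dots> = f y * g y - (f y - u y * h y) * (u y * h' y) - u y * (h y * g y)"
   by (simp add: algebra_simps)
  also have "\<dots> = u y * (c y - t y ^ k * e y * h' y - h y * g y)"
   unfolding elim(3) using elim(1) by (simp add: algebra_simps)
  finally have "t y ^ (k + k') * (e y * e' y) = u y * (c y - t y ^ k * e y * h' y - h y * g y)" .
  moreover
  then show ?case using elim(4,5) unfolding d_def by (simp add: field_simps)
 qed
 with t_power_not[OF d] show False by blast
qed

text \<open>Krull's theorem for the zero ideal: a germ divisible by all powers of \<open>u\<close>
  is zero.\<close>

lemma u_power_not_dvd:
 assumes "f \<in> R" "\<not> f \<doteq> (%_. 0)"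
 obtains (that') j f' where "f' \<in> R" "\<not> u dvd\<^sub>R f'" "GEN y. f y = u y ^ j * f' y"
proof (rule ccontr)
 assume nt: "\<not> thesis"
 have no: "u dvd\<^sub>R f'" if "f' \<in> R" "GEN y. f y = u y ^ j * f' y" for j f'
  by (rule ccontr) (rule notE[OF nt that'[OF that(1) _ that(2)]])
 have "\<exists>g\<in>R. GEN y. f y = u y ^ n * g y" for n
 proof (induction n)
  case 0
  show ?case by (intro bexI[of _ f]) (use assms in auto)
 next
  case (Suc n)
  then obtain g where g: "g \<in> R" "GEN y. f y = u y ^ n * g y" by blast
  obtain c where c: "c \<in> R" "GEN y. g y = u y * c y"
   using no[OF g] unfolding dvdR_def by (elim bexE)
  from g(2) c(2) have "GEN y. f y = u y ^ Suc n * c y"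
   by eventually_elim simp
  with c show ?case by blast
 qed
 then have "\<exists>g\<in>R. \<exists>h\<in>R. GEN y. f y = u y ^ n * g y + 0 * h y" for n
  using assms(1) by fastforce
 then have "(%_. 0) dvd\<^sub>R f" by (rule krull_principal[OF const_R ut_R(1) ut_at(1) assms(1)])
 with assms show False unfolding dvdR_def by auto
qed

text \<open>An element \<open>p\<close> of \<open>P\<close> whose order in \<open>t\<close> modulo
  \<open>u\<close> is least divides every f in \<open>P\<close> up to a multiple of
  \<open>u\<close>, and by saturation the cofactor of \<open>u\<close> is again in \<open>P\<close>.
  Iterating, f lies in (u^n) + (p) for all n, hence in (p).\<close>

lemma saturated_ideal_principal:
 assumes P: "idealR P" and sat: "\<And>c. c \<in> R ==> (%y. u y * c y) \<in> P ==> c \<in> P"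
 shows "\<exists>p\<in>P. \<forall>f\<in>P. p dvd\<^sub>R f"
proof (cases "\<exists>f\<in>P. \<not> f \<doteq> (%_. 0)")
 case False
 show ?thesis
 proof (intro bexI[of _ "%_. 0"] ballI)
  show "(%_. 0) \<in> P" using idealR_rules(2)[OF P, of "%_. 0"] by auto
  show "(%_. 0) dvd\<^sub>R f" if "f \<in> P" for f
   using that False unfolding dvdR_def by auto
 qed
next
 case True
 have PR: "P \<subseteq> R" using P unfolding idealR_def by blast
 define Q where "Q k \<longleftrightarrow> (\<exists>f\<in>P. \<exists>e\<in>R. \<exists>h\<in>R. e x ~= 0 \<and> (GEN y. f y = t y ^ k * e y + u y * h y))" for k
 from True obtain f where f: "f \<in> P" "\<not> f \<doteq> (%_. 0)" by (elim bexE)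
 obtain j f' where f': "f' \<in> R" "\<not> u dvd\<^sub>R f'" "GEN y. f y = u y ^ j * f' y"
  using u_power_not_dvd[OF subsetD[OF PR f(1)] f(2)] .
 have "(%y. u y ^ i * f' y) \<in> P ==> f' \<in> P" for i
 proof (induction i)
  case (Suc i)
  have "(%y. u y * (u y ^ i * f' y)) \<in> P" using Suc.prems by (simp add: mult.assoc)
  then have "(%y. u y ^ i * f' y) \<in> P" by (rule sat[rotated]) (intro mult_R power_R ut_R f'(1))
  then show ?case by (rule Suc.IH)
 qed simp
 moreover have "(%y. u y ^ j * f' y) \<in> P"
  by (rule idealR_ev_eq[OF P f(1) mult_R[OF power_R[OF ut_R(1)] f'(1)]])
    (use f'(3) in "auto elim: eventually_mono")
 ultimately have f'P: "f' \<in> P" by blast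
 obtain k0 e0 h0 where 0: "e0 \<in> R" "h0 \<in> R" "e0 x ~= 0" "GEN y. f' y = t y ^ k0 * e0 y + u y * h0 y"
  using u_regular_form[OF f'(1,2)] .
 have "Q k0" unfolding Q_def
  by (rule bexI[OF _ f'P], rule bexI[OF _ 0(1)], rule bexI[OF _ 0(2)], rule conjI[OF 0(3,4)])
 define k where "k = (LEAST k. Q k)"
 have "Q k" unfolding k_def using \<open>Q k0\<close> by (rule LeastI)
 have least: "k \<le> j" if "Q j" for j unfolding k_def using that by (rule Least_le)
 obtain p e h where p: "p \<in> P" "e \<in> R" "h \<in> R" "e x ~= 0" "GEN y. p y = t y ^ k * e y + u y * h y"
  using \<open>Q k\<close> unfolding Q_def by auto
 have pR: "p \<in> R" using p PR by blast
 have step: "\<exists>a\<in>R. \<exists>f1\<in>P. GEN y. f y = p y * a y + u y * f1 y" if "f \<in> P" for f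
 proof (cases "u dvd\<^sub>R f")
  case True
  then obtain c where c: "c \<in> R" "GEN y. f y = u y * c y" unfolding dvdR_def by blast
  have "(%y. u y * c y) \<in> P"
   by (rule idealR_ev_eq[OF P that mult_R[OF ut_R(1) c(1)]]) (use c(2) in "auto elim: eventually_mono")
  then have "c \<in> P" by (rule sat[OF c(1)])
  then show ?thesis using c by (intro bexI[of _ "%_. 0"] bexI[of _ c]) auto
 next
  case False
  have fR: "f \<in> R" using that PR by blast
  obtain j e' h' where *: "e' \<in> R" "h' \<in> R" "e' x ~= 0" "GEN y. f y = t y ^ j * e' y + u y * h' y"
   using u_regular_form[OF fR False] .
  have "Q j" unfolding Q_def
   by (rule bexI[OF _ that], rule bexI[OF _ *(1)], rule bexI[OF _ *(2)], rule conjI[OF *(3,4)])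
  then have "k \<le> j" by (rule least)
  \<comment> \<open>Quotient of the normal forms of \<open>f\<close> and \<open>p\<close> modulo
    \<open>u\<close>, so that f - a p is divisible by \<open>u\<close>.\<close>
  define a where "a = (%y. t y ^ (j - k) * (e' y * inverse (e y)))"
  define f1 where "f1 = (%y. h' y - a y * h y)"
  have aR: "a \<in> R" unfolding a_def by (intro mult_R power_R inverse_R) (use * p in auto)
  have f1R: "f1 \<in> R" unfolding f1_def by (intro diff_R mult_R) (use * p aR in auto)
  have eq: "GEN y. f y = p y * a y + u y * f1 y"
   using p(5) *(4) unit_nonzero[OF p(2,4)]
  proof eventually_elim
   case (elim y)
   have "t y ^ j = t y ^ k * t y ^ (j - k)" using \<open>k \<le> j\<close> by (simp flip: power_add)
   then show ?case using elim unfolding a_def f1_def by (simp add: field_simps)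
  qed
  have "(%y. f y + (- a y) * p y) \<in> P"
   by (rule idealR_rules(3)[OF P that idealR_rules(4)[OF P minus_R[OF aR] p(1)]])
  moreover have "GEN y. u y * f1 y = f y + (- a y) * p y"
   using eq by eventually_elim (simp add: algebra_simps)
  ultimately have "(%y. u y * f1 y) \<in> P"
   by (rule idealR_ev_eq[OF P _ mult_R[OF ut_R(1) f1R]])
  then have "f1 \<in> P" by (rule sat[OF f1R])
  with aR eq show ?thesis by (intro bexI)
 qed
 have "p dvd\<^sub>R f" if "f \<in> P" for f
 proof -
  have "\<exists>g\<in>P. \<exists>h\<in>R. GEN y. f y = u y ^ n * g y + p y * h y" for n
  proof (induction n)
   case 0
   show ?case by (intro bexI[of _ f] bexI[of _ "%_. 0"]) (use that in auto)
  next
   case (Suc n)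
   then obtain g h where gh: "g \<in> P" "h \<in> R" "GEN y. f y = u y ^ n * g y + p y * h y" by blast
   obtain a f1 where af: "a \<in> R" "f1 \<in> P" "GEN y. g y = p y * a y + u y * f1 y"
    using step[OF gh(1)] by blast
   from gh(3) af(3) have "GEN y. f y = u y ^ Suc n * f1 y + p y * (u y ^ n * a y + h y)"
    by eventually_elim (simp add: algebra_simps)
   then show ?case using af gh
    by (intro bexI[of _ f1] bexI[of _ "%y. u y ^ n * a y + h y"] add_R mult_R power_R) auto
  qed
  then have "\<exists>g\<in>R. \<exists>h\<in>R. GEN y. f y = u y ^ n * g y + p y * h y" for n
   using PR by blast
  then show ?thesis by (rule krull_principal[OF pR ut_R(1) ut_at(1) subsetD[OF PR that]])
 qed
 with p(1) show ?thesis by blast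
qed

lemma idealR_quotient:
 assumes "e \<in> R" "S \<subseteq> R"
 shows "idealR {c\<in>R. \<forall>a\<in>S. e dvd\<^sub>R (%y. c y * a y)}" (is "idealR ?P")
 unfolding idealR_def
proof (intro conjI ballI impI)
 fix g assume g: "g \<in> R" "g \<doteq> (%_. 0)"
 have "e dvd\<^sub>R (%y. g y * a y)" if "a \<in> S" for a
  by (rule dvdRI[of "%_. 0"]) (use g(2) in "auto elim: eventually_mono")
 with g show "g \<in> ?P" by auto
next
 fix g g' assume *: "g \<in> ?P" "g' \<in> ?P"
 have "e dvd\<^sub>R (%y. (g y + g' y) * a y)" if "a \<in> S" for a
 proof -
  obtain c c' where c: "c \<in> R" "GEN y. g y * a y = e y * c y"
   "c' \<in> R" "GEN y. g' y * a y = e y * c' y"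
   using * \<open>a \<in> S\<close> unfolding dvdR_def by blast
  from c(2,4) have "GEN y. (g y + g' y) * a y = e y * (c y + c' y)"
   by eventually_elim (simp add: distrib_left distrib_right)
  then show ?thesis by (rule dvdRI[OF add_R[OF c(1,3)]])
 qed
 then show "(%y. g y + g' y) \<in> ?P" using * by auto
next
 fix r g assume *: "r \<in> R" "g \<in> ?P"
 have "e dvd\<^sub>R (%y. (r y * g y) * a y)" if "a \<in> S" for a
 proof -
  obtain c where c: "c \<in> R" "GEN y. g y * a y = e y * c y"
   using * \<open>a \<in> S\<close> unfolding dvdR_def by blast
  show ?thesis
   using c * by (intro dvdRI[of "%y. r y * c y"]) (auto elim!: eventually_mono)
 qed
 then show "(%y. r y * g y) \<in> ?P" using * by auto
qed auto

text \<open>Divisorial ideals are principal; for \<open>u\<close> not dividing \<open>e\<close> the ideal is saturated, and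
  the factors \<open>u\<close> of \<open>e\<close> are split off one at a time.\<close>

lemma quotient_ideal_principal:
 assumes e: "e \<in> R" "\<not> e \<doteq> (%_. 0)" and S: "S \<subseteq> R"
 obtains D where "D \<in> R" "\<And>a. a \<in> S ==> e dvd\<^sub>R (%y. D y * a y)"
  "\<And>c. c \<in> R ==> (\<And>a. a \<in> S ==> e dvd\<^sub>R (%y. c y * a y)) ==> D dvd\<^sub>R c"
proof -
 let ?P = "%e S. {c\<in>R. \<forall>a\<in>S. e dvd\<^sub>R (%y. c y * a y)}"
 have "\<exists>D\<in>?P e S. \<forall>c\<in>?P e S. D dvd\<^sub>R c"
  if "GEN y. e y = u y ^ j * e' y" "e \<in> R" "e' \<in> R" "\<not> u dvd\<^sub>R e'" "S \<subseteq> R" for j e e' S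
  using that
 proof (induction j arbitrary: e S)
  case 0
  have ev: "e \<doteq> e'" using 0(1) by simp
  have sat: "c \<in> ?P e S" if c: "c \<in> R" "(%y. u y * c y) \<in> ?P e S" for c
  proof -
   have "e dvd\<^sub>R (%y. c y * a y)" if "a \<in> S" for a
   proof -
    obtain d where d: "d \<in> R" "GEN y. u y * c y * a y = e y * d y"
     using c(2) \<open>a \<in> S\<close> unfolding dvdR_def by blast
    have "GEN y. e' y * d y = u y * (c y * a y)"
     using d(2) ev by eventually_elim (simp add: ac_simps)
    then have "u dvd\<^sub>R (%y. e' y * d y)"
     by (intro dvdRI[of "%y. c y * a y"] mult_R c(1)) (use \<open>a \<in> S\<close> 0 in auto)
    then have "u dvd\<^sub>R d" using u_prime[OF 0(3) d(1)] 0(4) by blast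
    then obtain d' where d': "d' \<in> R" "GEN y. d y = u y * d' y" unfolding dvdR_def by blast
    have "GEN y. u y * (c y * a y) = u y * (e y * d' y)"
     using d(2) d'(2) by eventually_elim (simp add: ac_simps)
    then show ?thesis using ev_cancel[of u] u_nonzero by (intro dvdRI[OF d'(1)]) auto
   qed
   with c show ?thesis by simp
  qed
  show ?case
   by (rule saturated_ideal_principal[OF idealR_quotient[OF 0(2,5)] sat])
 next
  case (Suc j)
  define e1 where "e1 = (%y. u y ^ j * e' y)"
  have e1: "e1 \<in> R" "GEN y. e1 y = u y ^ j * e' y"
   unfolding e1_def by (auto intro!: mult_R power_R ut_R Suc.prems(3))
  have ee: "GEN y. e y = u y * e1 y" unfolding e1_def
   using Suc.prems(1) by eventually_elim simp
  show ?case
  proof (cases "\<forall>a\<in>S. u dvd\<^sub>R a")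
   \<comment> \<open>All numerators share the factor \<open>u\<close>; cancelling it in
     \<open>e\<close> and in \<open>S\<close> leaves the ideal unchanged.\<close>
   case True
   define S' where "S' = {a'\<in>R. \<exists>a\<in>S. GEN y. a y = u y * a' y}"
   have iff: "e dvd\<^sub>R (%y. c y * a y) \<longleftrightarrow> e1 dvd\<^sub>R (%y. c y * a' y)" if "GEN y. a y = u y * a' y" for c a a'
    by (rule dvdR_scaled[OF ut_R(1) u_nonzero ee]) (use that in eventually_elim, simp)
   have "\<exists>a'\<in>S'. GEN y. a y = u y * a' y" if "a \<in> S" for a
    using True that unfolding S'_def dvdR_def by blast
   moreover have "\<exists>a\<in>S. GEN y. a y = u y * a' y" if "a' \<in> S'" for a'
    using that unfolding S'_def by blast
   ultimately have "(\<forall>a\<in>S. e dvd\<^sub>R (%y. c y * a y)) \<longleftrightarrow> (\<forall>a\<in>S'. e1 dvd\<^sub>R (%y. c y * a y))" for c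
    using iff[of _ _ c] by metis
   then have "?P e S = ?P e1 S'" by simp
   moreover have "S' \<subseteq> R" unfolding S'_def by auto
   ultimately show ?thesis using Suc.IH[OF e1(2,1) Suc.prems(3,4), of S'] by simp
  next
   \<comment> \<open>\<open>u\<close> is prime and does not divide \<open>a0\<close>, so it divides
     every element of the ideal for \<open>e\<close>, which is therefore \<open>u\<close> times the
     ideal for \<open>e1\<close>.\<close>
   case False
   then obtain a0 where a0: "a0 \<in> S" "\<not> u dvd\<^sub>R a0" by blast
   obtain D where D: "D \<in> ?P e1 S" "\<forall>c\<in>?P e1 S. D dvd\<^sub>R c"
    using Suc.IH[OF e1(2,1) Suc.prems(3,4,5)] by blast
   have "e1 dvd\<^sub>R (%y. c y * a y) \<longleftrightarrow> e dvd\<^sub>R (%y. u y * c y * a y)" for c a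
    by (rule dvdR_scaled[OF ut_R(1) u_nonzero ee, symmetric]) (simp add: mult.assoc)
   then have *: "c \<in> ?P e1 S \<longleftrightarrow> (%y. u y * c y) \<in> ?P e S" if "c \<in> R" for c using that by auto
   show ?thesis
   proof (intro bexI[of _ "%y. u y * D y"] ballI)
    show "(%y. u y * D y) \<in> ?P e S" using D(1) * by blast
    fix c assume c: "c \<in> ?P e S"
    then obtain d where d: "d \<in> R" "GEN y. c y * a0 y = e y * d y"
     using a0 unfolding dvdR_def by blast
    have "GEN y. c y * a0 y = u y * (e1 y * d y)"
     using d(2) ee by eventually_elim (simp add: ac_simps)
    then have "u dvd\<^sub>R (%y. c y * a0 y)"
     by (intro dvdRI[of "%y. e1 y * d y"] mult_R d(1) e1(1))
    then have "u dvd\<^sub>R c" using u_prime[of c a0] a0 c Suc.prems by auto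
    then obtain c' where c': "c' \<in> R" "GEN y. c y = u y * c' y" unfolding dvdR_def by blast
    have "(%y. u y * c' y) \<in> ?P e S"
     by (rule idealR_ev_eq[OF idealR_quotient[OF Suc.prems(2,5)] c])
       (use c' in "auto simp: eq_commute")
    then have "c' \<in> ?P e1 S" using * c' by blast
    then have "D dvd\<^sub>R c'" using D by blast
    then show "(%y. u y * D y) dvd\<^sub>R c" using dvdR_scaled[OF ut_R(1) u_nonzero _ c'(2), of "%y. u y * D y" D] by simp
   qed
  qed
 qed
 moreover obtain j e' where "e' \<in> R" "\<not> u dvd\<^sub>R e'" "GEN y. e y = u y ^ j * e' y"
  using u_power_not_dvd[OF e] .
 ultimately have "\<exists>D\<in>?P e S. \<forall>c\<in>?P e S. D dvd\<^sub>R c" using e(1) S by blast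
 then show thesis using that by auto
qed

text \<open>The ideal (a) : (b) is principal. Its generator \<open>D\<close> is \<open>a\<close>
  divided by the greatest common divisor of \<open>a\<close> and \<open>b\<close>; it serves as
  \<open>a'\<close>, and the cofactor is \<open>g\<close>.\<close>

lemma coprime_decomposition:
 assumes a: "a \<in> R" "\<not> a \<doteq> (%_. 0)" and b: "b \<in> R"
 obtains g a' b' where "g \<in> R" "a' \<in> R" "b' \<in> R" "\<not> a' \<doteq> (%_. 0)" "\<not> g \<doteq> (%_. 0)"
  "GEN y. a y = g y * a' y" "GEN y. b y = g y * b' y"
  "\<And>c. c \<in> R ==> a' dvd\<^sub>R (%y. b' y * c y) ==> a' dvd\<^sub>R c"
proof -
 obtain D where D: "D \<in> R" "a dvd\<^sub>R (%y. D y * b y)"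
  "\<And>c. c \<in> R ==> a dvd\<^sub>R (%y. c y * b y) ==> D dvd\<^sub>R c"
  using quotient_ideal_principal[OF a, of "{b}"] b by auto
 have "D dvd\<^sub>R a" by (rule D(3)[OF a(1) dvdRI[OF b]]) simp
 then obtain g where g: "g \<in> R" "GEN y. a y = D y * g y" unfolding dvdR_def by blast
 obtain b' where b': "b' \<in> R" "GEN y. D y * b y = a y * b' y"
  using D(2) unfolding dvdR_def by blast
 have D0: "\<not> D \<doteq> (%_. 0)"
 proof
  assume "D \<doteq> (%_. 0)"
  then have "a \<doteq> (%_. 0)" using g(2) by eventually_elim simp
  with a show False by blast
 qed
 have g0: "\<not> g \<doteq> (%_. 0)"
 proof
  assume "g \<doteq> (%_. 0)"
  then have "a \<doteq> (%_. 0)" using g(2) by eventually_elim simp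
  with a show False by blast
 qed
 have "GEN y. D y * b y = D y * (g y * b' y)"
  using b'(2) g(2) by eventually_elim (simp add: ac_simps)
 then have bg: "GEN y. b y = g y * b' y" by (rule ev_cancel[OF D(1) _ D0])
 have "D dvd\<^sub>R c" if c: "c \<in> R" "D dvd\<^sub>R (%y. b' y * c y)" for c
 proof -
  obtain d where d: "d \<in> R" "GEN y. b' y * c y = D y * d y" using c unfolding dvdR_def by blast
  have "GEN y. c y * b y = a y * d y"
   using d(2) bg g(2)
  proof eventually_elim
   case (elim y)
   then show ?case by algebra
  qed
  then show ?thesis by (intro D(3)[OF c(1)] dvdRI[OF d(1)])
 qed
 moreover have "GEN y. a y = g y * D y" using g(2) by eventually_elim simp
 ultimately show thesis using that[OF g(1) D(1) b'(1) D0 g0 _ bg] by blast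
qed

text \<open>A plane curve germ has no isolated point.\<close>

lemma no_isolated_zero:
 assumes h: "h \<in> R" "h x = 0" and "h dvd\<^sub>R (%y. u y ^ n)" "h dvd\<^sub>R (%y. t y ^ m)"
 shows False
proof -
 obtain a b where ab: "a \<in> R" "GEN y. u y ^ n = h y * a y" "b \<in> R" "GEN y. t y ^ m = h y * b y"
  using assms unfolding dvdR_def by blast
 have "\<not> u dvd\<^sub>R h"
 proof
  assume "u dvd\<^sub>R h"
  then obtain c where c: "c \<in> R" "GEN y. h y = u y * c y" unfolding dvdR_def by blast
  have "GEN y. t y ^ m = u y * (c y * b y)" using ab(4) c(2) by eventually_elim simp
  with t_power_not[of "%y. c y * b y"] c ab show False by auto
 qed
 \<comment> \<open>\<open>h\<close> divides u^n but \<open>u\<close> does not divide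
   \<open>h\<close>, so the factors \<open>u\<close> cancel one by one and \<open>h\<close> is a
   unit, contrary to h(x) = 0.\<close>
 then have "\<exists>a\<in>R. GEN y. 1 = h y * a y" using ab(1,2)
 proof (induction n arbitrary: a)
  case (Suc n)
  have "GEN y. h y * a y = u y * u y ^ n"
   using Suc.prems(3) by eventually_elim simp
  then have "u dvd\<^sub>R (%y. h y * a y)" by (intro dvdRI[of "%y. u y ^ n"]) auto
  then have "u dvd\<^sub>R a" using u_prime[OF h(1) Suc.prems(2)] Suc.prems(1) by blast
  then obtain c where c: "c \<in> R" "GEN y. a y = u y * c y" unfolding dvdR_def by blast
  have "GEN y. u y * u y ^ n = u y * (h y * c y)"
   using c(2) Suc.prems(3) by eventually_elim (simp add: ac_simps)
  then have "GEN y. u y ^ n = h y * c y" using ev_cancel[of u] u_nonzero by auto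
  with Suc c show ?case by blast
 qed auto
 then obtain a where a: "a \<in> R" "GEN y. 1 = h y * a y" by blast
 have "1 = h x * a x"
  using ev_at[of "%_. 1" "%y. h y * a y"] a h by auto
 with h show False by simp
qed

end

section \<open>Polynomial functions\<close>

lemma polyfun_add: "f \<in> polyfun n ==> g \<in> polyfun n ==> (%z. f z + g z) \<in> polyfun n"
 and polyfun_mult: "f \<in> polyfun n ==> g \<in> polyfun n ==> (%z. f z * g z) \<in> polyfun n"
 using polyfun.add[of f n g] polyfun.mult[of f n g] by (simp_all add: plus_fun_def times_fun_def)

lemma polyfun_minus: "f \<in> polyfun n ==> (%z. - f z) \<in> polyfun n"
 using polyfun_mult[OF polyfun.const[of "-1"], of f n] by simp

lemma polyfun_diff: "f \<in> polyfun n ==> g \<in> polyfun n ==> (%z. f z - g z) \<in> polyfun n"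
 using polyfun_add[OF _ polyfun_minus, of f n g] by simp

lemma polyfun_power: "f \<in> polyfun n ==> (%z. f z ^ k) \<in> polyfun n"
 by (induction k) (auto intro: polyfun_mult polyfun.const)

lemmas polyfun_rules = polyfun.const polyfun.coord polyfun_add polyfun_mult polyfun_minus
 polyfun_diff polyfun_power

lemma polyfun_mono: "m \<le> n ==> polyfun m \<subseteq> polyfun n"
proof
 fix f assume "m \<le> n" "f \<in> polyfun m"
 from this(2,1) show "f \<in> polyfun n"
  by induction (auto intro: polyfun.intros)
qed

lemma polyfun_cong: "f \<in> polyfun n ==> (\<And>i. i < n ==> z i = w i) ==> f z = f w"
 by (induction rule: polyfun.induct) auto

lemma polyfun_0: "f \<in> polyfun 0 ==> \<exists>c. f = (%_. c)"
 by (induction rule: polyfun.induct) (auto simp: plus_fun_def times_fun_def)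

text \<open>Polynomials are functions here and carry no coefficients, so a degree in the last
  variable \<open>z m\<close> can only be bounded by exhibiting an expansion. The bound is strict;
  bound 0 leaves the zero polynomial.\<close>

primrec deg_less :: "nat => nat => ((nat => complex) => complex) set" where
 "deg_less m 0 = {%_. 0}"
| "deg_less m (Suc d) = {(%z. g z + c z * z m ^ d) | g c. g \<in> deg_less m d \<and> c \<in> polyfun m}"

lemma deg_less_SucI: "g \<in> deg_less m d ==> c \<in> polyfun m ==> (%z. g z + c z * z m ^ d) \<in> deg_less m (Suc d)"
 by auto

lemma deg_less_SucE:
 assumes "f \<in> deg_less m (Suc d)"
 obtains g c where "g \<in> deg_less m d" "c \<in> polyfun m" "f = (%z. g z + c z * z m ^ d)"
 using assms by auto

lemma deg_less_zero: "(%_. 0) \<in> deg_less m d"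
proof (induction d)
 case (Suc d)
 from deg_less_SucI[OF this polyfun.const[of 0]] show ?case by simp
qed simp

lemma deg_less_Suc: "deg_less m d \<subseteq> deg_less m (Suc d)"
proof
 fix f assume "f \<in> deg_less m d"
 from deg_less_SucI[OF this polyfun.const[of 0]] show "f \<in> deg_less m (Suc d)" by simp
qed

lemma deg_less_mono: "d \<le> e ==> deg_less m d \<subseteq> deg_less m e"
 by (induction e rule: dec_induct) (use deg_less_Suc in blast)+

lemma deg_less_add: "f \<in> deg_less m d ==> g \<in> deg_less m d ==> (%z. f z + g z) \<in> deg_less m d"
proof (induction d arbitrary: f g)
 case (Suc d)
 obtain f' c where f: "f' \<in> deg_less m d" "c \<in> polyfun m" "f = (%z. f' z + c z * z m ^ d)"
  using Suc.prems(1) by (rule deg_less_SucE)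
 obtain g' b where g: "g' \<in> deg_less m d" "b \<in> polyfun m" "g = (%z. g' z + b z * z m ^ d)"
  using Suc.prems(2) by (rule deg_less_SucE)
 have "(%z. f z + g z) = (%z. (f' z + g' z) + (c z + b z) * z m ^ d)"
  unfolding f g by (auto simp: algebra_simps)
 with deg_less_SucI[OF Suc.IH[OF f(1) g(1)] polyfun_add[OF f(2) g(2)]] show ?case by simp
qed simp

lemma deg_less_scale: "f \<in> deg_less m d ==> c \<in> polyfun m ==> (%z. c z * f z) \<in> deg_less m d"
proof (induction d arbitrary: f)
 case (Suc d)
 obtain f' b where f: "f' \<in> deg_less m d" "b \<in> polyfun m" "f = (%z. f' z + b z * z m ^ d)"
  using Suc.prems(1) by (rule deg_less_SucE)
 have "(%z. c z * f z) = (%z. (c z * f' z) + (c z * b z) * z m ^ d)"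
  unfolding f by (auto simp: algebra_simps)
 with deg_less_SucI[OF Suc.IH[OF f(1) Suc.prems(2)] polyfun_mult[OF Suc.prems(2) f(2)]] show ?case
  by simp
qed simp

lemma deg_less_diff: "f \<in> deg_less m d ==> g \<in> deg_less m d ==> (%z. f z - g z) \<in> deg_less m d"
 using deg_less_add[OF _ deg_less_scale[OF _ polyfun.const[of "-1"]], of f m d g] by simp

lemma deg_less_shift: "f \<in> deg_less m d ==> (%z. z m ^ k * f z) \<in> deg_less m (k + d)"
proof (induction d arbitrary: f)
 case 0
 then show ?case using deg_less_zero by simp
next
 case (Suc d)
 obtain f' b where f: "f' \<in> deg_less m d" "b \<in> polyfun m" "f = (%z. f' z + b z * z m ^ d)"
  using Suc.prems(1) by (rule deg_less_SucE)
 have "(%z. z m ^ k * f z) = (%z. (z m ^ k * f' z) + b z * z m ^ (k + d))"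
  unfolding f by (auto simp: algebra_simps power_add)
 with deg_less_SucI[OF Suc.IH[OF f(1)] f(2)] show ?case by simp
qed

lemma deg_less_mult: "f \<in> deg_less m d ==> g \<in> deg_less m e ==> (%z. f z * g z) \<in> deg_less m (d + e)"
proof (induction d arbitrary: f)
 case 0
 then show ?case using deg_less_zero by simp
next
 case (Suc d)
 obtain f' b where f: "f' \<in> deg_less m d" "b \<in> polyfun m" "f = (%z. f' z + b z * z m ^ d)"
  using Suc.prems(1) by (rule deg_less_SucE)
 have 1: "(%z. f' z * g z) \<in> deg_less m (Suc d + e)"
  using Suc.IH[OF f(1) Suc.prems(2)] deg_less_mono[of "d + e" "Suc d + e" m] by auto
 have 2: "(%z. b z * (z m ^ d * g z)) \<in> deg_less m (Suc d + e)"
  using deg_less_scale[OF deg_less_shift[OF Suc.prems(2)] f(2), of d]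
   deg_less_mono[of "d + e" "Suc d + e" m] by auto
 show ?case using deg_less_add[OF 1 2] unfolding f by (simp add: algebra_simps)
qed

lemma deg_less_polyfun: "f \<in> deg_less m d ==> f \<in> polyfun (Suc m)"
proof (induction d arbitrary: f)
 case (Suc d)
 obtain f' b where f: "f' \<in> deg_less m d" "b \<in> polyfun m" "f = (%z. f' z + b z * z m ^ d)"
  using Suc.prems(1) by (rule deg_less_SucE)
 have "b \<in> polyfun (Suc m)" using f(2) polyfun_mono[of m "Suc m"] by auto
 with Suc.IH[OF f(1)] show ?case unfolding f(3) by (intro polyfun_rules) auto
qed (auto intro: polyfun.const)

lemma polyfun_Suc: "f \<in> polyfun (Suc m) ==> \<exists>d. f \<in> deg_less m d"
proof (induction rule: polyfun.induct)
 case (const c)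
 have "(%_. c) \<in> deg_less m (Suc 0)"
  using deg_less_SucI[OF deg_less_zero polyfun.const[of c m], of 0] by simp
 then show ?case by blast
next
 case (coord i)
 show ?case
 proof (cases "i = m")
  case True
  have "(%z. z i) \<in> deg_less m (Suc 1)"
   using deg_less_SucI[OF deg_less_zero polyfun.const[of 1 m], of 1] True by simp
  then show ?thesis by blast
 next
  case False
  with coord have "(%z. z i) \<in> polyfun m" by (intro polyfun.coord) simp
  then have "(%z. z i) \<in> deg_less m (Suc 0)"
   using deg_less_SucI[OF deg_less_zero, of "%z. z i" m 0] by simp
  then show ?thesis by blast
 qed
next
 case (add f g)
 then obtain d e where "f \<in> deg_less m d" "g \<in> deg_less m e" by blast
 then have "f \<in> deg_less m (max d e)" "g \<in> deg_less m (max d e)"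
  using deg_less_mono[of d "max d e" m] deg_less_mono[of e "max d e" m] by auto
 then show ?case using deg_less_add unfolding plus_fun_def by blast
next
 case (mult f g)
 then show ?case using deg_less_mult unfolding times_fun_def by blast
qed

definition poly_ideal :: "nat => ((nat => complex) => complex) set => bool" where
 "poly_ideal n I \<longleftrightarrow> I \<subseteq> polyfun n \<and> (%_. 0) \<in> I \<and>
   (\<forall>f\<in>I. \<forall>g\<in>I. (%z. f z + g z) \<in> I) \<and> (\<forall>f\<in>polyfun n. \<forall>g\<in>I. (%z. f z * g z) \<in> I)"

lemma poly_ideal_rules:
 assumes "poly_ideal n I"
 shows "I \<subseteq> polyfun n" "(%_. 0) \<in> I" "f \<in> I ==> g \<in> I ==> (%z. f z + g z) \<in> I"
  "f \<in> polyfun n ==> g \<in> I ==> (%z. f z * g z) \<in> I"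
 using assms unfolding poly_ideal_def by simp_all

lemma poly_ideal_diff:
 assumes I: "poly_ideal n I" and "f \<in> I" "g \<in> I"
 shows "(%z. f z - g z) \<in> I"
 using poly_ideal_rules(3)[OF I assms(2) poly_ideal_rules(4)[OF I polyfun.const[of "-1"] assms(3)]]
 by simp

section \<open>The Hilbert basis theorem\<close>

definition lead_ideal :: "nat => ((nat => complex) => complex) set => nat => ((nat => complex) => complex) set" where
 "lead_ideal m I d = {c \<in> polyfun m. \<exists>g\<in>deg_less m d. (%z. g z + c z * z m ^ d) \<in> I}"

lemma lead_idealI: "c \<in> polyfun m ==> g \<in> deg_less m d ==> (%z. g z + c z * z m ^ d) \<in> I ==> c \<in> lead_ideal m I d"
 unfolding lead_ideal_def by (intro CollectI conjI bexI[of _ g])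

lemma lead_idealE:
 assumes "c \<in> lead_ideal m I d"
 obtains g where "c \<in> polyfun m" "g \<in> deg_less m d" "(%z. g z + c z * z m ^ d) \<in> I"
 using assms unfolding lead_ideal_def by auto

lemma poly_ideal_lead:
 assumes I: "poly_ideal (Suc m) I"
 shows "poly_ideal m (lead_ideal m I d)"
 unfolding poly_ideal_def
proof (intro conjI ballI)
 show "lead_ideal m I d \<subseteq> polyfun m" unfolding lead_ideal_def by auto
 show "(%_. 0) \<in> lead_ideal m I d"
  by (rule lead_idealI[OF polyfun.const deg_less_zero]) (use poly_ideal_rules(2)[OF I] in simp)
next
 fix f g assume "f \<in> lead_ideal m I d" "g \<in> lead_ideal m I d"
 then obtain f' g' where *: "f \<in> polyfun m" "g \<in> polyfun m" "f' \<in> deg_less m d" "g' \<in> deg_less m d"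
  "(%z. f' z + f z * z m ^ d) \<in> I" "(%z. g' z + g z * z m ^ d) \<in> I"
  by (elim lead_idealE)
 have "(%z. (f' z + g' z) + (f z + g z) * z m ^ d) \<in> I"
  using poly_ideal_rules(3)[OF I *(5,6)] by (simp add: algebra_simps)
 then show "(%z. f z + g z) \<in> lead_ideal m I d"
  by (rule lead_idealI[OF polyfun_add[OF *(1,2)] deg_less_add[OF *(3,4)]])
next
 fix f g assume f: "f \<in> polyfun m" and "g \<in> lead_ideal m I d"
 then obtain g' where *: "g \<in> polyfun m" "g' \<in> deg_less m d" "(%z. g' z + g z * z m ^ d) \<in> I"
  by (elim lead_idealE)
 have "f \<in> polyfun (Suc m)" using f polyfun_mono[of m "Suc m"] by auto
 from poly_ideal_rules(4)[OF I this *(3)]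
 have "(%z. (f z * g' z) + (f z * g z) * z m ^ d) \<in> I" by (simp add: algebra_simps)
 then show "(%z. f z * g z) \<in> lead_ideal m I d"
  by (rule lead_idealI[OF polyfun_mult[OF f *(1)] deg_less_scale[OF *(2) f]])
qed

lemma lead_ideal_mono: "I \<subseteq> I' ==> lead_ideal m I d \<subseteq> lead_ideal m I' d"
 unfolding lead_ideal_def by auto

lemma lead_ideal_mono_deg:
 assumes I: "poly_ideal (Suc m) I" and "d \<le> e"
 shows "lead_ideal m I d \<subseteq> lead_ideal m I e"
proof
 fix c assume "c \<in> lead_ideal m I d"
 then obtain g where g: "c \<in> polyfun m" "g \<in> deg_less m d" "(%z. g z + c z * z m ^ d) \<in> I"
  by (elim lead_idealE)
 have p: "(%z. z m ^ (e - d)) \<in> polyfun (Suc m)" by (intro polyfun_rules) auto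
 have "z m ^ e = z m ^ (e - d) * z m ^ d" for z :: "nat => complex"
  using \<open>d \<le> e\<close> by (simp flip: power_add)
 then have "(%z. (z m ^ (e - d) * g z) + c z * z m ^ e) \<in> I"
  using poly_ideal_rules(4)[OF I p g(3)] by (simp add: algebra_simps)
 moreover have "(%z. z m ^ (e - d) * g z) \<in> deg_less m e"
  using deg_less_shift[OF g(2), of "e - d"] \<open>d \<le> e\<close> by simp
 ultimately show "c \<in> lead_ideal m I e" using lead_idealI[OF g(1)] by blast
qed

text \<open>Subtract from an element of \<open>I'\<close> an element of \<open>I\<close> with the
  same leading term and induct on the degree in the last variable.\<close>

lemma lead_ideal_eq_imp:
 assumes I: "poly_ideal (Suc m) I" "poly_ideal (Suc m) I'" "I \<subseteq> I'"
  and L: "\<And>d. lead_ideal m I' d \<subseteq> lead_ideal m I d"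
 shows "I' \<subseteq> I"
proof -
 have "f \<in> I" if "f \<in> deg_less m d" "f \<in> I'" for d f
  using that
 proof (induction d arbitrary: f)
  case 0
  then show ?case using poly_ideal_rules(2)[OF I(1)] by simp
 next
  case (Suc d)
  obtain g c where g: "g \<in> deg_less m d" "c \<in> polyfun m" "f = (%z. g z + c z * z m ^ d)"
   using Suc.prems(1) by (rule deg_less_SucE)
  have "c \<in> lead_ideal m I d"
   using L lead_idealI[OF g(2,1)] Suc.prems(2) unfolding g(3) by blast
  then obtain h where h: "h \<in> deg_less m d" "(%z. h z + c z * z m ^ d) \<in> I"
   by (elim lead_idealE)
  have "(%z. f z - (h z + c z * z m ^ d)) \<in> I'"
   using poly_ideal_diff[OF I(2) Suc.prems(2)] h(2) I(3) by blast
  then have "(%z. g z - h z) \<in> I'" unfolding g(3) by (simp add: algebra_simps)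
  then have "(%z. g z - h z) \<in> I" by (rule Suc.IH[OF deg_less_diff[OF g(1) h(1)]])
  from poly_ideal_rules(3)[OF I(1) this h(2)] show ?case unfolding g(3) by (simp add: algebra_simps)
 qed
 moreover have "\<exists>d. f \<in> deg_less m d" if "f \<in> I'" for f
  using polyfun_Suc poly_ideal_rules(1)[OF I(2)] that by blast
 ultimately show ?thesis by blast
qed

text \<open>The ideals \<open>lead_ideal (I k) d\<close> increase with \<open>k\<close> and with \<open>d\<close>; the diagonal chain bounds the
  large degrees, and the finitely many small degrees are treated one at a time.\<close>

theorem polyfun_acc:
 assumes "\<And>k. poly_ideal n (I k)" "\<And>k. I k \<subseteq> I (Suc k)"
 shows "\<exists>N. \<forall>k\<ge>N. I k = I N"
 using assms
proof (induction n arbitrary: I)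
 case 0
 note rules = poly_ideal_rules[OF 0(1)]
 have mono: "I j \<subseteq> I k" if "j \<le> k" for j k using lift_Suc_mono_le[of I, OF 0(2) that] .
 show ?case
 proof (cases "\<exists>N f. f \<in> I N \<and> f ~= (%_. 0)")
  case True
  then obtain N f where f: "f \<in> I N" "f ~= (%_. 0)" by (elim exE conjE)
  obtain c where c: "f = (%_. c)" using polyfun_0[OF subsetD[OF rules(1) f(1)]] by (elim exE)
  have "polyfun 0 \<subseteq> I N"
  proof
   fix g :: "(nat => complex) => complex" assume "g \<in> polyfun 0"
   then obtain b where b: "g = (%_. b)" by (elim exE[OF polyfun_0])
   have "(%z. b / c * f z) \<in> I N" by (rule rules(4)[OF polyfun.const f(1)])
   moreover have "c ~= 0" using f(2) c by auto
   ultimately show "g \<in> I N" unfolding b c by simp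
  qed
  then have "I k = I N" if "k \<ge> N" for k
   using mono[OF that] subset_trans[OF rules(1)] by (intro subset_antisym)
  then show ?thesis by (intro exI[of _ N] allI impI)
 next
  case False
  then have "f = (%_. 0)" if "f \<in> I k" for f k using that by metis
  then have sub: "I k \<subseteq> {%_. 0}" for k by (intro subsetI, unfold singleton_iff)
  have "I k = I 0" for k
   by (rule HOL.trans[OF subset_antisym[OF sub] subset_antisym[OF sub, symmetric]])
    (use rules(2) in auto)
  then show ?thesis by (intro exI[of _ 0] allI impI)
 qed
next
 case (Suc n)
 let ?L = "%k d. lead_ideal n (I k) d"
 have mono: "I j \<subseteq> I k" if "j \<le> k" for j k using lift_Suc_mono_le[of I, OF Suc.prems(2) that] .
 have L: "?L j d \<subseteq> ?L k e" if "j \<le> k" "d \<le> e" for j k d e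
  by (rule subset_trans[OF lead_ideal_mono[OF mono[OF that(1)]] lead_ideal_mono_deg[OF Suc.prems(1) that(2)]])
 have P: "poly_ideal n (?L k d)" for k d by (rule poly_ideal_lead[OF Suc.prems(1)])
 have "\<exists>N. \<forall>k\<ge>N. ?L k k = ?L N N" by (rule Suc.IH[OF P L]) simp_all
 then obtain M where "\<forall>k\<ge>M. ?L k k = ?L M M" by (elim exE)
 then have M: "?L k k = ?L M M" if "k \<ge> M" for k using that by (elim allE impE)
 have "\<exists>N. \<forall>k\<ge>N. ?L k d = ?L N d" for d by (rule Suc.IH[OF P L]) auto
 then have "\<forall>d. \<exists>N. \<forall>k\<ge>N. ?L k d = ?L N d" by (intro allI)
 then obtain N where "\<forall>d. \<forall>k\<ge>N d. ?L k d = ?L (N d) d" by (elim exE[OF choice])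
 then have N: "?L k d = ?L (N d) d" if "k \<ge> N d" for d k using that by (elim allE impE)
 define K where "K = Max (insert M (N ` {..<M}))"
 have K: "K \<ge> M" "\<And>d. d < M ==> K \<ge> N d" unfolding K_def by auto
 have "I k = I K" if "k \<ge> K" for k
 proof
  show "I k \<subseteq> I K"
  proof (rule lead_ideal_eq_imp[OF Suc.prems(1) Suc.prems(1) mono[OF that]])
   fix d
   show "?L k d \<subseteq> ?L K d"
   proof (cases "d < M")
    case True
    have "?L k d = ?L K d"
     by (rule HOL.trans[OF N N[symmetric]]) (use K(2)[OF True] that in simp_all)
    then show ?thesis by (rule equalityD1)
   next
    case False
    have "?L k d \<subseteq> ?L (max k d) (max k d)" by (rule L) auto
    also have "\<dots> = ?L M M" by (rule M) (use False in auto)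
    also have "\<dots> \<subseteq> ?L K d" by (rule L) (use False K in auto)
    finally show ?thesis .
   qed
  qed
 qed (rule mono[OF that])
 then show ?case by (intro exI[of _ K] allI impI)
qed

text \<open>Without a maximal member, iterating a choice of strictly larger members gives a chain
  that contradicts \<open>polyfun_acc\<close>.\<close>

lemma poly_ideal_maximal:
 assumes "A ~= {}" and A: "\<And>J. J \<in> A ==> poly_ideal n J"
 shows "\<exists>Q\<in>A. \<forall>J\<in>A. Q \<subseteq> J --> J = Q"
proof (rule ccontr)
 assume "\<not> ?thesis"
 then have "\<forall>Q\<in>A. \<exists>J. J \<in> A \<and> Q \<subset> J" by (simp add: psubset_eq) metis
 then obtain S where S: "\<forall>Q\<in>A. S Q \<in> A \<and> Q \<subset> S Q" using bchoice[of A "%Q J. J \<in> A \<and> Q \<subset> J"] by auto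
 obtain I where "I \<in> A" using assms(1) by blast
 define F where "F k = (S ^^ k) I" for k
 have FA: "F k \<in> A" for k unfolding F_def by (induction k) (use S \<open>I \<in> A\<close> in auto)
 have FS: "F k \<subset> F (Suc k)" for k using S FA[of k] unfolding F_def by simp
 have "\<exists>N. \<forall>k\<ge>N. F k = F N"
  by (rule polyfun_acc[of n]) (use FA FS A in "simp_all add: psubset_imp_subset")
 then obtain N where N: "\<forall>k\<ge>N. F k = F N" by (elim exE)
 have "F (Suc N) = F N" by (rule N[rule_format]) simp
 with FS[of N] show False by simp
qed

section \<open>Prime ideals, elimination and the Nullstellensatz\<close>

definition poly_prime :: "nat => ((nat => complex) => complex) set => bool" where
 "poly_prime n Q \<longleftrightarrow> poly_ideal n Q \<and> (%_. 1) \<notin> Q \<and>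
   (\<forall>f\<in>polyfun n. \<forall>g\<in>polyfun n. (%z. f z * g z) \<in> Q --> f \<in> Q \<or> g \<in> Q)"

lemma poly_prime_rules:
 assumes "poly_prime n Q"
 shows "poly_ideal n Q" "(%_. 1) \<notin> Q"
  "f \<in> polyfun n ==> g \<in> polyfun n ==> (%z. f z * g z) \<in> Q ==> f \<in> Q \<or> g \<in> Q"
 using assms unfolding poly_prime_def by simp_all

lemma poly_prime_power:
 assumes "poly_prime n Q" "f \<in> polyfun n" "(%z. f z ^ k) \<in> Q"
 shows "f \<in> Q"
 using assms(3)
proof (induction k)
 case 0
 then show ?case using poly_prime_rules(2)[OF assms(1)] by simp
next
 case (Suc k)
 then show ?case
  using poly_prime_rules(3)[OF assms(1,2) polyfun_power[OF assms(2)], of k] by auto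
qed

lemma poly_ideal_adjoin:
 assumes I: "poly_ideal n I" and f: "f \<in> polyfun n"
 shows "poly_ideal n {h. \<exists>q\<in>I. \<exists>r\<in>polyfun n. h = (%z. q z + r z * f z)}" (is "poly_ideal n ?J")
 unfolding poly_ideal_def
proof (intro conjI ballI)
 note rules = poly_ideal_rules[OF I]
 show "?J \<subseteq> polyfun n" using f rules(1) by (auto intro!: polyfun_rules)
 show "(%_. 0) \<in> ?J"
  by (intro CollectI bexI[of _ "%_. 0"]) (auto intro: rules polyfun.const)
 fix g h assume "h \<in> ?J"
 then obtain q r where h: "q \<in> I" "r \<in> polyfun n" "h = (%z. q z + r z * f z)" by blast
 {
  assume "g \<in> ?J"
  then obtain q' r' where g: "q' \<in> I" "r' \<in> polyfun n" "g = (%z. q' z + r' z * f z)" by blast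
  show "(%z. g z + h z) \<in> ?J"
   by (intro CollectI bexI[OF _ rules(3)[OF g(1) h(1)]] bexI[OF _ polyfun_add[OF g(2) h(2)]])
    (auto simp: g(3) h(3) algebra_simps)
 next
  assume g: "g \<in> polyfun n"
  show "(%z. g z * h z) \<in> ?J"
   by (intro CollectI bexI[OF _ rules(4)[OF g h(1)]] bexI[OF _ polyfun_mult[OF g h(2)]])
    (auto simp: h(3) algebra_simps)
 }
qed

text \<open>An ideal maximal among those that contain \<open>I\<close> and no power of
  \<open>a\<close> is prime: adjoining either of two elements outside it produces a power of
  \<open>a\<close>, and if their product were inside, so would be the product of these two
  powers.\<close>

lemma ex_poly_prime:
 assumes I: "poly_ideal n I" and a: "a \<in> polyfun n" and no: "\<And>k. (%z. a z ^ k) \<notin> I"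
 obtains Q where "poly_prime n Q" "I \<subseteq> Q" "a \<notin> Q"
proof -
 define A where "A = {J. poly_ideal n J \<and> I \<subseteq> J \<and> (\<forall>k. (%z. a z ^ k) \<notin> J)}"
 have "\<exists>Q\<in>A. \<forall>J\<in>A. Q \<subseteq> J --> J = Q"
 proof (rule poly_ideal_maximal[where n = n])
  show "A ~= {}" using I no unfolding A_def by blast
 qed (simp add: A_def)
 then obtain Q where Q: "Q \<in> A" "\<forall>J\<in>A. Q \<subseteq> J --> J = Q" by (elim bexE)
 from Q(2) have max: "J = Q" if "J \<in> A" "Q \<subseteq> J" for J using that by simp
 have QI: "poly_ideal n Q" and IQ: "I \<subseteq> Q" and Qa: "\<And>k. (%z. a z ^ k) \<notin> Q"
  using Q(1) unfolding A_def by simp_all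
 note rules = poly_ideal_rules[OF QI]
 have pw: "\<exists>k. \<exists>q\<in>Q. \<exists>r\<in>polyfun n. (%z. a z ^ k) = (%z. q z + r z * f z)"
  if f: "f \<in> polyfun n" "f \<notin> Q" for f
 proof (rule ccontr)
  let ?J = "{h. \<exists>q\<in>Q. \<exists>r\<in>polyfun n. h = (%z. q z + r z * f z)}"
  assume no: "\<not> ?thesis"
  have QJ: "Q \<subseteq> ?J"
  proof
   fix q assume "q \<in> Q"
   then show "q \<in> ?J" by (intro CollectI bexI[of _ q] bexI[of _ "%_. 0"] polyfun.const) simp
  qed
  have "?J \<in> A" unfolding A_def
  proof (intro CollectI conjI allI)
   show "poly_ideal n ?J" by (rule poly_ideal_adjoin[OF QI f(1)])
   show "I \<subseteq> ?J" using IQ QJ by (rule subset_trans)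
   show "(%z. a z ^ k) \<notin> ?J" for k using no by simp
  qed
  then have "?J = Q" by (rule max) (rule QJ)
  moreover have "f \<in> ?J"
   by (intro CollectI bexI[of _ "%_. 0"] bexI[of _ "%_. 1"] polyfun.const rules(2)) simp
  ultimately show False using f by simp
 qed
 have "f \<in> Q \<or> g \<in> Q" if fg: "f \<in> polyfun n" "g \<in> polyfun n" "(%z. f z * g z) \<in> Q" for f g
 proof (rule ccontr)
  assume "\<not> ?thesis"
  then have nf: "f \<notin> Q" and ng: "g \<notin> Q" by auto
  obtain k q r where 1: "q \<in> Q" "r \<in> polyfun n" "(%z. a z ^ k) = (%z. q z + r z * f z)"
   using pw[OF fg(1) nf] by blast
  obtain l q' r' where 2: "q' \<in> Q" "r' \<in> polyfun n" "(%z. a z ^ l) = (%z. q' z + r' z * g z)"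
   using pw[OF fg(2) ng] by blast
  have e: "a z ^ (k + l) = (q' z + r' z * g z) * q z + (r z * f z * q' z + r z * r' z * (f z * g z))" for z
   using fun_cong[OF 1(3), of z] fun_cong[OF 2(3), of z]
   by (simp add: power_add algebra_simps)
  have "(%z. (q' z + r' z * g z) * q z + (r z * f z * q' z + r z * r' z * (f z * g z))) \<in> Q"
   by (rule rules(3)[OF rules(4)[OF _ 1(1)] rules(3)[OF rules(4)[OF _ 2(1)] rules(4)[OF _ fg(3)]]])
    (use subsetD[OF rules(1) 2(1)] fg 1(2) 2(2) in "auto intro!: polyfun_add polyfun_mult")
  then have "(%z. a z ^ (k + l)) \<in> Q" unfolding e .
  then show False using Qa by simp
 qed
 moreover have "(%_. 1) \<notin> Q" using Qa[of 0] by simp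
 moreover have "a \<notin> Q" using Qa[of 1] by simp
 ultimately show thesis using that[of Q] QI IQ unfolding poly_prime_def by blast
qed

lemma deg_less_poly:
 assumes "g \<in> deg_less m d"
 shows "\<exists>q. (\<forall>i\<ge>d. coeff q i = 0) \<and> (\<forall>\<zeta>. g (\<eta>(m := \<zeta>)) = poly q \<zeta>)"
 using assms
proof (induction d arbitrary: g)
 case 0
 then show ?case by (intro exI[of _ 0]) auto
next
 case (Suc d)
 obtain g' c where g: "g' \<in> deg_less m d" "c \<in> polyfun m" "g = (%z. g' z + c z * z m ^ d)"
  using Suc.prems by (rule deg_less_SucE)
 obtain q where q: "\<forall>i\<ge>d. coeff q i = 0" "\<forall>\<zeta>. g' (\<eta>(m := \<zeta>)) = poly q \<zeta>"
  using Suc.IH[OF g(1)] by blast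
 have "c (\<eta>(m := \<zeta>)) = c \<eta>" for \<zeta> by (rule polyfun_cong[OF g(2)]) auto
 with q g(3) show ?case
  by (intro exI[of _ "q + monom (c \<eta>) d"]) (simp add: poly_monom del: fun_upd_apply, simp)
qed

lemma deg_less_lead_poly:
 assumes "g \<in> deg_less m d" "c \<in> polyfun m" "c \<eta> ~= 0"
 obtains q where "degree q = d" "q ~= 0" "\<And>\<zeta>. g (\<eta>(m := \<zeta>)) + c \<eta> * \<zeta> ^ d = poly q \<zeta>"
proof -
 obtain q where q: "\<forall>i\<ge>d. coeff q i = 0" "\<forall>\<zeta>. g (\<eta>(m := \<zeta>)) = poly q \<zeta>"
  using deg_less_poly[OF assms(1)] by blast
 let ?q = "q + monom (c \<eta>) d"
 have "coeff ?q d ~= 0" "\<forall>i>d. coeff ?q i = 0" using q assms(3) by auto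
 then have "degree ?q = d" by (metis degree_le le_degree order_antisym)
 moreover have "?q ~= 0" using \<open>coeff ?q d ~= 0\<close> by (metis coeff_0)
 moreover have "g (\<eta>(m := \<zeta>)) + c \<eta> * \<zeta> ^ d = poly ?q \<zeta>" for \<zeta>
  using q(2) by (simp add: poly_monom)
 ultimately show thesis by (rule that)
qed

text \<open>Multiplying by the leading coefficient \<open>b\<close> before each cancellation avoids
  fractions. The degree bound on \<open>S\<close> makes it possible to identify leading terms of
  quotients later.\<close>

lemma pseudo_division:
 assumes h': "h' \<in> deg_less m e" and b: "b \<in> polyfun m" and h: "h = (%z. h' z + b z * z m ^ e)"
  and "g \<in> deg_less m d"
 shows "\<exists>k. \<exists>S\<in>deg_less m (d - e). \<exists>r\<in>deg_less m e. \<forall>z. b z ^ k * g z = S z * h z + r z"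
 using assms(4)
proof (induction d arbitrary: g)
 case 0
 then show ?case
  by (intro exI[of _ 0] bexI[of _ "%_. 0"]) (auto simp: deg_less_zero)
next
 case (Suc d)
 show ?case
 proof (cases "Suc d \<le> e")
  case True
  then have "g \<in> deg_less m e" using Suc.prems deg_less_mono[of "Suc d" e m] by blast
  then show ?thesis
   by (intro exI[of _ 0] bexI[of _ "%_. 0"] bexI[of _ g]) (auto simp: deg_less_zero)
 next
  case False
  obtain g' c where g: "g' \<in> deg_less m d" "c \<in> polyfun m" "g = (%z. g' z + c z * z m ^ d)"
   using Suc.prems by (rule deg_less_SucE)
  have pd: "z m ^ d = z m ^ (d - e) * z m ^ e" for z :: "nat => complex"
   using False by (simp flip: power_add)
  define g1 where "g1 = (%z. b z * g' z - c z * (z m ^ (d - e) * h' z))"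
  have g1: "g1 \<in> deg_less m d"
   unfolding g1_def using deg_less_shift[OF h', of "d - e"] False
   by (intro deg_less_diff deg_less_scale[OF g(1) b] deg_less_scale[OF _ g(2)]) simp
  have g1e: "g1 z = b z * g z - c z * z m ^ (d - e) * h z" for z
   unfolding g1_def g(3) h by (simp add: pd algebra_simps)
  obtain k S r where S: "S \<in> deg_less m (d - e)" "r \<in> deg_less m e"
   "\<And>z. b z ^ k * g1 z = S z * h z + r z"
   using Suc.IH[OF g1] by blast
  have S': "(%z. S z + (b z ^ k * c z) * z m ^ (d - e)) \<in> deg_less m (Suc d - e)"
   using deg_less_SucI[OF S(1), of "%z. b z ^ k * c z"] b g(2) False
   by (simp add: Suc_diff_le polyfun_mult polyfun_power)
  have "b z ^ Suc k * g z = (S z + (b z ^ k * c z) * z m ^ (d - e)) * h z + r z" for z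
   using S(3)[of z] unfolding g1e by (simp add: algebra_simps)
  with S' S(2) show ?thesis by (intro exI[of _ "Suc k"] bexI[OF _ S'] bexI[OF _ S(2)]) blast
 qed
qed

text \<open>Modulo \<open>Q\<close>, the coordinate \<open>z m\<close> is transcendental over the
  first m coordinates, and then almost every \<zeta> works, or algebraic, and then \<zeta> is a root
  of its minimal equation specialised at \<eta>. The polynomial \<open>b\<close> collects the
  leading coefficients that must not vanish at \<eta>.\<close>

lemma extension_step:
 assumes Q: "poly_prime n Q" and m: "m < n" and a: "a \<in> polyfun (Suc m)" "a \<notin> Q"
 obtains b where "b \<in> polyfun m" "b \<notin> Q"
  "\<And>\<eta>. (\<And>F. F \<in> Q ==> F \<in> polyfun m ==> F \<eta> = 0) ==> b \<eta> ~= 0 ==>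
    \<exists>\<zeta>. (\<forall>F\<in>Q \<inter> polyfun (Suc m). F (\<eta>(m := \<zeta>)) = 0) \<and> a (\<eta>(m := \<zeta>)) ~= 0"
proof -
 note prime = poly_prime_rules[OF Q]
 note rules = poly_ideal_rules[OF prime(1)]
 have pm: "f \<in> polyfun n" if "f \<in> polyfun m" for f using that polyfun_mono[of m n] m by auto
 have pm1: "f \<in> polyfun n" if "f \<in> polyfun (Suc m)" for f using that polyfun_mono[of "Suc m" n] m by auto
 have zm: "(%z. z m ^ k) \<in> polyfun n" for k by (intro polyfun_rules m)
 have eta: "c (\<eta>(m := \<zeta>)) = c \<eta>" if "c \<in> polyfun m" for c and \<eta> :: "nat => complex" and \<zeta>
  by (rule polyfun_cong[OF that]) auto
 define B where "B d \<longleftrightarrow> (\<exists>g\<in>deg_less m d. \<exists>c\<in>polyfun m. c \<notin> Q \<and> (%z. g z + c z * z m ^ d) \<in> Q)" for d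
 have coefQ: "c \<in> Q \<and> g \<in> Q"
  if "g \<in> deg_less m d" "c \<in> polyfun m" "(%z. g z + c z * z m ^ d) \<in> Q" "\<not> B d" for g c d
 proof -
  have c: "c \<in> Q" using that unfolding B_def by blast
  have "(%z. z m ^ d * c z) \<in> Q" by (rule rules(4)[OF zm c])
  from poly_ideal_diff[OF prime(1) that(3) this] have "g \<in> Q" by (simp add: mult.commute)
  with c show ?thesis by simp
 qed
 have vanish: "f (\<eta>(m := \<zeta>)) = 0"
  if "\<And>F. F \<in> Q ==> F \<in> polyfun m ==> F \<eta> = 0" "\<And>e. e < d ==> \<not> B e" "f \<in> deg_less m d" "f \<in> Q"
  for f d \<eta> \<zeta>
  using that(2-)
 proof (induction d arbitrary: f)
  case (Suc d)
  obtain g c where g: "g \<in> deg_less m d" "c \<in> polyfun m" "f = (%z. g z + c z * z m ^ d)"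
   using Suc.prems(2) by (rule deg_less_SucE)
  have "c \<in> Q \<and> g \<in> Q" using coefQ[OF g(1,2)] Suc.prems(1,3) unfolding g(3) by blast
  moreover have "g (\<eta>(m := \<zeta>)) = 0"
   by (rule Suc.IH[OF _ g(1)]) (use Suc.prems(1) calculation in auto)
  moreover have "c (\<eta>(m := \<zeta>)) = 0" using that(1) eta[OF g(2)] g(2) calculation by simp
  ultimately show ?case unfolding g(3) by simp
 qed simp
 obtain da where da: "a \<in> deg_less m da" using polyfun_Suc[OF a(1)] by blast
 show thesis
 proof (cases "\<exists>d. B d")
  \<comment> \<open>Transcendental case: every element of \<open>Q\<close> in m + 1 variables
    vanishes on the whole fibre over \<eta>, so only the finitely many roots of \<open>a\<close>
    have to be avoided.\<close>
  case False
  have "\<exists>b\<in>polyfun m. b \<notin> Q \<and> (\<forall>\<eta>. (\<forall>F\<in>Q. F \<in> polyfun m --> F \<eta> = 0) \<and> b \<eta> ~= 0 -->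
    finite {\<zeta>. f (\<eta>(m := \<zeta>)) = 0})" if "f \<in> deg_less m d" "f \<notin> Q" for f d
   using that
  proof (induction d arbitrary: f)
   case 0
   then show ?case using rules(2) by simp
  next
   case (Suc d)
   obtain g c where g: "g \<in> deg_less m d" "c \<in> polyfun m" "f = (%z. g z + c z * z m ^ d)"
    using Suc.prems(1) by (rule deg_less_SucE)
   show ?case
   proof (cases "c \<in> Q")
    case True
    have "(%z. z m ^ d * c z) \<in> Q" by (rule rules(4)[OF zm True])
    then have "g \<notin> Q"
     using rules(3)[of g "%z. z m ^ d * c z"] Suc.prems(2) unfolding g(3) by (auto simp: mult.commute)
    from Suc.IH[OF g(1) this] obtain b where b: "b \<in> polyfun m" "b \<notin> Q"
     "\<And>\<eta>. \<forall>F\<in>Q. F \<in> polyfun m --> F \<eta> = 0 ==> b \<eta> ~= 0 ==> finite {\<zeta>. g (\<eta>(m := \<zeta>)) = 0}"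
     by blast
    show ?thesis
    proof (intro bexI[OF _ b(1)] conjI b(2) allI impI)
     fix \<eta> assume *: "(\<forall>F\<in>Q. F \<in> polyfun m --> F \<eta> = 0) \<and> b \<eta> ~= 0"
     then have "c (\<eta>(m := \<zeta>)) = 0" for \<zeta> using True eta[OF g(2)] g(2) by simp
     then show "finite {\<zeta>. f (\<eta>(m := \<zeta>)) = 0}" using b(3)[of \<eta>] * unfolding g(3) by simp
    qed
   next
    case c: False
    show ?thesis
    proof (intro bexI[OF _ g(2)] conjI c allI impI)
     fix \<eta> assume "(\<forall>F\<in>Q. F \<in> polyfun m --> F \<eta> = 0) \<and> c \<eta> ~= 0"
     then obtain q where "degree q = d" "q ~= 0" "\<And>\<zeta>. g (\<eta>(m := \<zeta>)) + c \<eta> * \<zeta> ^ d = poly q \<zeta>"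
      using deg_less_lead_poly[OF g(1,2)] by metis
     then show "finite {\<zeta>. f (\<eta>(m := \<zeta>)) = 0}"
      unfolding g(3) using poly_roots_finite[of q] eta[OF g(2)] by simp
    qed
   qed
  qed
  from this[OF da a(2)] obtain b where b: "b \<in> polyfun m" "b \<notin> Q"
   "\<And>\<eta>. \<forall>F\<in>Q. F \<in> polyfun m --> F \<eta> = 0 ==> b \<eta> ~= 0 ==> finite {\<zeta>. a (\<eta>(m := \<zeta>)) = 0}"
   by blast
  show thesis
  proof (rule that[OF b(1,2)])
   fix \<eta> assume \<eta>: "\<And>F. F \<in> Q ==> F \<in> polyfun m ==> F \<eta> = 0" "b \<eta> ~= 0"
   have "finite {\<zeta>. a (\<eta>(m := \<zeta>)) = 0}" by (rule b(3)) (use \<eta> in auto)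
   then have "{\<zeta>. a (\<eta>(m := \<zeta>)) = 0} ~= UNIV" using infinite_UNIV_char_0[where 'a = complex] by metis
   then obtain \<zeta> where "a (\<eta>(m := \<zeta>)) ~= 0" by blast
   moreover have "F (\<eta>(m := \<zeta>)) = 0" if "F \<in> Q \<inter> polyfun (Suc m)" for F
    using polyfun_Suc[of F m] vanish[of \<eta>] \<eta>(1) False that by blast
   ultimately show "\<exists>\<zeta>. (\<forall>F\<in>Q \<inter> polyfun (Suc m). F (\<eta>(m := \<zeta>)) = 0) \<and> a (\<eta>(m := \<zeta>)) ~= 0"
    by blast
  qed
 next
  \<comment> \<open>Algebraic case: \<open>P\<close> is an equation of least degree d for
    \<open>z m\<close> modulo \<open>Q\<close>. An element of \<open>Q\<close> of smaller degree has
    all its coefficients in \<open>Q\<close>, which is why \<open>vanish\<close> applies to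
    remainders.\<close>
  case True
  define d where "d = (LEAST d. B d)"
  have "B d" unfolding d_def using True by (rule LeastI_ex)
  have least: "\<not> B e" if "e < d" for e using that not_less_Least unfolding d_def by blast
  obtain P' c where P': "P' \<in> deg_less m d" "c \<in> polyfun m" "c \<notin> Q" "(%z. P' z + c z * z m ^ d) \<in> Q"
   using \<open>B d\<close> unfolding B_def by blast
  define P where "P = (%z. P' z + c z * z m ^ d)"
  have PQ: "P \<in> Q" unfolding P_def by (rule P'(4))
  have d0: "d > 0"
  proof (rule ccontr)
   assume "\<not> ?thesis"
   then show False using P' by simp
  qed
  \<comment> \<open>The multiples of \<open>a\<close> modulo \<open>Q\<close>. As \<open>z m\<close>
    is algebraic, \<open>a\<close> divides modulo \<open>Q\<close> some polynomial in m variables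
    outside \<open>Q\<close>; it is found as an element of \<open>J\<close> of least degree.\<close>
  define J where "J = {g \<in> polyfun (Suc m). \<exists>s\<in>polyfun (Suc m). (%z. g z - s z * a z) \<in> Q}"
  have J: "(%z. s z * g z - q z) \<in> J"
   if g: "g \<in> J" and s: "s \<in> polyfun (Suc m)" and q: "q \<in> Q" "q \<in> polyfun (Suc m)" for g s q
  proof -
   obtain s' where s': "s' \<in> polyfun (Suc m)" "(%z. g z - s' z * a z) \<in> Q" "g \<in> polyfun (Suc m)"
    using g unfolding J_def by blast
   have "(%z. s z * (g z - s' z * a z) - q z) \<in> Q"
    by (intro poly_ideal_diff[OF prime(1)] rules(4) pm1 s s' q)
   then have "(%z. (s z * g z - q z) - (s z * s' z) * a z) \<in> Q" by (simp add: algebra_simps)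
   then show ?thesis unfolding J_def
    by (intro CollectI conjI bexI[of _ "%z. s z * s' z"] polyfun_rules s s' q)
  qed
  define C where "C e \<longleftrightarrow> (\<exists>g\<in>deg_less m e. \<exists>b\<in>polyfun m. b \<notin> Q \<and> (%z. g z + b z * z m ^ e) \<in> J)" for e
  have strip: "\<exists>e'<e. C e'" if "f \<in> deg_less m e" "f \<in> J" "f \<notin> Q" for e f
   using that
  proof (induction e arbitrary: f)
   case 0
   then show ?case using rules(2) by simp
  next
   case (Suc e)
   obtain g b where g: "g \<in> deg_less m e" "b \<in> polyfun m" "f = (%z. g z + b z * z m ^ e)"
    using Suc.prems(1) by (rule deg_less_SucE)
   show ?case
   proof (cases "b \<in> Q")
    case True
    have bQ: "(%z. z m ^ e * b z) \<in> Q" by (rule rules(4)[OF zm True])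
    have "(%z. z m ^ e * b z) \<in> polyfun (Suc m)"
     using g(2) polyfun_mono[of m "Suc m"] by (intro polyfun_rules) auto
    from J[OF Suc.prems(2) polyfun.const[of 1] bQ this] have "g \<in> J"
     unfolding g(3) by (simp add: mult.commute)
    moreover have "g \<notin> Q"
     using rules(3)[of g "%z. z m ^ e * b z"] bQ Suc.prems(3) unfolding g(3) by (auto simp: mult.commute)
    ultimately obtain e' where "e' < e" "C e'" using Suc.IH[OF g(1)] by blast
    then show ?thesis by (intro exI[of _ e']) auto
   next
    case False
    then have "C e" using g Suc.prems(2) unfolding C_def by blast
    then show ?thesis by blast
   qed
  qed
  have aJ: "a \<in> J" unfolding J_def
   by (intro CollectI conjI bexI[of _ "%_. 1"]) (auto intro: a rules polyfun.const)
  have "\<exists>e<d. C e"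
  proof -
   obtain k S r where S: "S \<in> deg_less m (da - d)" "r \<in> deg_less m d"
    "\<And>z. c z ^ k * a z = S z * P z + r z"
    using pseudo_division[OF P'(1,2) P_def da] by blast
   have SP: "(%z. S z * P z) \<in> Q" by (intro rules(4) pm1 deg_less_polyfun[OF S(1)] PQ)
   have re: "r = (%z. c z ^ k * a z - S z * P z)" using S(3) by auto
   have "(%z. S z * P z) \<in> polyfun (Suc m)" unfolding P_def
    using P'(2) polyfun_mono[of m "Suc m"]
    by (intro polyfun_rules deg_less_polyfun[OF S(1)] deg_less_polyfun[OF P'(1)]) auto
   moreover have "(%z. c z ^ k) \<in> polyfun (Suc m)"
    using P'(2) polyfun_mono[of m "Suc m"] by (intro polyfun_rules) auto
   ultimately have "r \<in> J" unfolding re using J[OF aJ _ SP] by blast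
   moreover have "r \<notin> Q"
   proof
    assume "r \<in> Q"
    from rules(3)[OF SP this] have "(%z. c z ^ k * a z) \<in> Q" unfolding S(3) .
    then show False
     using prime(3)[OF polyfun_power[OF pm[OF P'(2)]] pm1[OF a(1)], of k] a(2)
      poly_prime_power[OF Q pm[OF P'(2)], of k] P'(3) by blast
   qed
   ultimately show ?thesis using strip[OF S(2)] by blast
  qed
  then obtain e0 where e0: "e0 < d" "C e0" by blast
  define e where "e = (LEAST e. C e)"
  have "C e" unfolding e_def using e0(2) by (rule LeastI)
  have ed: "e < d" using Least_le[of C, OF e0(2)] e0(1) unfolding e_def by simp
  have leastC: "\<not> C e'" if "e' < e" for e' using that not_less_Least unfolding e_def by blast
  obtain h' b where h': "h' \<in> deg_less m e" "b \<in> polyfun m" "b \<notin> Q" "(%z. h' z + b z * z m ^ e) \<in> J"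
   using \<open>C e\<close> unfolding C_def by blast
  define h where "h = (%z. h' z + b z * z m ^ e)"
  have hJ: "h \<in> J" unfolding h_def by (rule h'(4))
  \<comment> \<open>Division of \<open>P\<close> by \<open>h\<close> leaves a remainder in
    \<open>J\<close> of degree below \<open>e\<close>, hence in \<open>Q\<close>. So S' h lies in
    \<open>Q\<close>, and then \<open>S'\<close> does; but \<open>S'\<close> has degree d - e < d
    and leading coefficient b^k c outside \<open>Q\<close>, against the choice of d.\<close>
  have "e = 0"
  proof (rule ccontr)
   assume "e ~= 0"
   have hp: "h \<in> polyfun (Suc m)" using hJ unfolding J_def by blast
   have hQ: "h \<notin> Q"
   proof
    assume "h \<in> Q"
    then have "B e" using h' unfolding B_def h_def by blast
    with least[OF ed] show False by blast
   qed
   define g1 where "g1 = (%z. b z * P' z - c z * (z m ^ (d - e) * h' z))"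
   have g1: "g1 \<in> deg_less m d"
    unfolding g1_def using deg_less_shift[OF h'(1), of "d - e"] ed
    by (intro deg_less_diff deg_less_scale[OF P'(1) h'(2)] deg_less_scale[OF _ P'(2)]) simp
   have pd: "z m ^ d = z m ^ (d - e) * z m ^ e" for z :: "nat => complex"
    using ed by (simp flip: power_add)
   have g1e: "g1 z = b z * P z - c z * z m ^ (d - e) * h z" for z
    unfolding g1_def P_def h_def by (simp add: pd algebra_simps)
   obtain k S r where S: "S \<in> deg_less m (d - e)" "r \<in> deg_less m e"
    "\<And>z. b z ^ k * g1 z = S z * h z + r z"
    using pseudo_division[OF h'(1,2) h_def g1] by blast
   define S' where "S' = (%z. S z + (b z ^ k * c z) * z m ^ (d - e))"
   have bk: "(%z. b z ^ k * c z) \<in> polyfun m" by (intro polyfun_rules h' P')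
   have S'p: "S' \<in> polyfun (Suc m)"
    unfolding S'_def by (rule deg_less_polyfun[OF deg_less_SucI[OF S(1) bk]])
   have eq: "b z ^ Suc k * P z = S' z * h z + r z" for z
    using S(3)[of z] unfolding g1e S'_def by (simp add: algebra_simps)
   have bP: "(%z. b z ^ Suc k * P z) \<in> Q" by (intro rules(4) polyfun_power pm h' PQ)
   have bPp: "(%z. b z ^ Suc k * P z) \<in> polyfun (Suc m)"
    unfolding P_def using P'(2) h'(2) polyfun_mono[of m "Suc m"]
    by (intro polyfun_rules deg_less_polyfun[OF P'(1)]) auto
   have re: "r = (%z. (-1) * (- S' z * h z) * (-1) - (-1) * (b z ^ Suc k * P z))"
    using eq by (auto simp: algebra_simps)
   have "(%z. (- S' z) * h z - (- 1) * (b z ^ Suc k * P z)) \<in> J"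
    by (rule J[OF hJ polyfun_minus[OF S'p] rules(4)[OF polyfun.const bP]
       polyfun_mult[OF polyfun.const bPp]])
   moreover have "(%z. (- S' z) * h z - (- 1) * (b z ^ Suc k * P z)) = r"
    using eq by (auto simp: algebra_simps)
   ultimately have "r \<in> J" by simp
   then have "r \<in> Q" using strip[OF S(2)] leastC by blast
   from poly_ideal_diff[OF prime(1) bP this] have "(%z. S' z * h z) \<in> Q" unfolding eq by simp
   then have "S' \<in> Q" using prime(3)[OF pm1[OF S'p] pm1[OF hp]] hQ by blast
   moreover have "(%z. b z ^ k * c z) \<notin> Q"
    using prime(3)[OF polyfun_power[OF pm[OF h'(2)]] pm[OF P'(2)], of k]
     poly_prime_power[OF Q pm[OF h'(2)], of k] P'(3) h'(3) by blast
   ultimately have "B (d - e)" using S(1) bk unfolding B_def S'_def by blast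
   then show False using least[of "d - e"] ed \<open>e ~= 0\<close> by simp
  qed
  then have "b \<in> J" using h' by simp
  then obtain s where s: "s \<in> polyfun (Suc m)" "(%z. b z - s z * a z) \<in> Q" unfolding J_def by blast
  show thesis
  \<comment> \<open>\<open>c\<close> keeps the degree of \<open>P\<close> at \<eta>, so that a root
    exists and division by \<open>P\<close> loses nothing; \<open>b\<close>, a multiple of
    \<open>a\<close> modulo \<open>Q\<close>, keeps \<open>a\<close> from vanishing at the new
    point.\<close>
  proof (rule that[of "%z. c z * b z"])
   show "(%z. c z * b z) \<in> polyfun m" by (intro polyfun_rules P' h')
   show "(%z. c z * b z) \<notin> Q" using prime(3)[OF pm[OF P'(2)] pm[OF h'(2)]] P'(3) h'(3) by blast
   fix \<eta> assume \<eta>: "\<And>F. F \<in> Q ==> F \<in> polyfun m ==> F \<eta> = 0" and cb: "c \<eta> * b \<eta> ~= 0"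
   obtain q where q: "degree q = d" "q ~= 0" "\<And>\<zeta>. P' (\<eta>(m := \<zeta>)) + c \<eta> * \<zeta> ^ d = poly q \<zeta>"
    using deg_less_lead_poly[OF P'(1,2)] cb by (metis mult_eq_0_iff)
   have "\<not> constant (poly q)" using q(1) d0 by (simp add: constant_degree)
   then obtain \<zeta> where \<zeta>: "poly q \<zeta> = 0" using fundamental_theorem_of_algebra by blast
   have P0: "P (\<eta>(m := \<zeta>)) = 0" using q(3)[of \<zeta>] \<zeta> eta[OF P'(2)] unfolding P_def by simp
   have F0: "F (\<eta>(m := \<zeta>)) = 0" if F: "F \<in> Q" "F \<in> polyfun (Suc m)" for F
   proof -
    obtain dF where "F \<in> deg_less m dF" using polyfun_Suc[OF F(2)] by blast
    then obtain k S r where S: "S \<in> deg_less m (dF - d)" "r \<in> deg_less m d"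
     "\<And>z. c z ^ k * F z = S z * P z + r z"
     using pseudo_division[OF P'(1,2) P_def] by blast
    have re: "r = (%z. c z ^ k * F z - S z * P z)" using S(3) by auto
    have "r \<in> Q" unfolding re
     by (intro poly_ideal_diff[OF prime(1)] rules(4) F PQ polyfun_power pm P' pm1 deg_less_polyfun[OF S(1)])
    then have "r (\<eta>(m := \<zeta>)) = 0" using vanish[of \<eta> d r] \<eta> least S(2) by blast
    with S(3)[of "\<eta>(m := \<zeta>)"] P0 cb eta[OF P'(2)] show ?thesis by simp
   qed
   have "(%z. b z - s z * a z) \<in> polyfun (Suc m)"
    using s a h'(2) polyfun_mono[of m "Suc m"] by (intro polyfun_rules) auto
   from F0[OF s(2) this] have "a (\<eta>(m := \<zeta>)) ~= 0" using cb eta[OF h'(2)] by auto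
   with F0 show "\<exists>\<zeta>. (\<forall>F\<in>Q \<inter> polyfun (Suc m). F (\<eta>(m := \<zeta>)) = 0) \<and> a (\<eta>(m := \<zeta>)) ~= 0" by blast
  qed
 qed
qed

text \<open>The coordinates m, ..., n - 1 are added one at a time, the induction running down from m
  = n with b = a. This is Chevalley's theorem for a projection: the image contains a nonempty open
  part of its closure.\<close>

theorem extension_lemma:
 assumes Q: "poly_prime n Q" and "m \<le> n" and a: "a \<in> polyfun n" "a \<notin> Q"
 shows "\<exists>b\<in>polyfun m. b \<notin> Q \<and> (\<forall>\<eta>. (\<forall>F\<in>Q \<inter> polyfun m. F \<eta> = 0) \<and> b \<eta> ~= 0 -->
   (\<exists>\<eta>'. (\<forall>i<m. \<eta>' i = \<eta> i) \<and> (\<forall>F\<in>Q. F \<eta>' = 0) \<and> a \<eta>' ~= 0))"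
 using \<open>m \<le> n\<close>
proof (induction rule: inc_induct)
 case base
 have "Q \<inter> polyfun n = Q" using poly_ideal_rules(1)[OF poly_prime_rules(1)[OF Q]] by blast
 then show ?case by (intro bexI[OF _ a(1)] conjI a(2)) auto
next
 case (step m)
 then obtain a' where a': "a' \<in> polyfun (Suc m)" "a' \<notin> Q"
  "\<And>\<eta>. \<forall>F\<in>Q \<inter> polyfun (Suc m). F \<eta> = 0 ==> a' \<eta> ~= 0 ==>
    \<exists>\<eta>'. (\<forall>i<Suc m. \<eta>' i = \<eta> i) \<and> (\<forall>F\<in>Q. F \<eta>' = 0) \<and> a \<eta>' ~= 0" by blast
 obtain b where b: "b \<in> polyfun m" "b \<notin> Q"
  "\<And>\<eta>. (\<And>F. F \<in> Q ==> F \<in> polyfun m ==> F \<eta> = 0) ==> b \<eta> ~= 0 ==>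
    \<exists>\<zeta>. (\<forall>F\<in>Q \<inter> polyfun (Suc m). F (\<eta>(m := \<zeta>)) = 0) \<and> a' (\<eta>(m := \<zeta>)) ~= 0"
  using extension_step[OF Q step(2) a'(1,2)] by metis
 show ?case
 proof (intro bexI[OF _ b(1)] conjI b(2) allI impI)
  fix \<eta> assume "(\<forall>F\<in>Q \<inter> polyfun m. F \<eta> = 0) \<and> b \<eta> ~= 0"
  then obtain \<zeta> where \<zeta>: "\<forall>F\<in>Q \<inter> polyfun (Suc m). F (\<eta>(m := \<zeta>)) = 0" "a' (\<eta>(m := \<zeta>)) ~= 0"
   using b(3)[of \<eta>] by blast
  obtain \<eta>' where "\<forall>i<Suc m. \<eta>' i = (\<eta>(m := \<zeta>)) i" "\<forall>F\<in>Q. F \<eta>' = 0" "a \<eta>' ~= 0"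
   using a'(3)[OF \<zeta>] by blast
  then show "\<exists>\<eta>'. (\<forall>i<m. \<eta>' i = \<eta> i) \<and> (\<forall>F\<in>Q. F \<eta>' = 0) \<and> a \<eta>' ~= 0"
   by (intro exI[of _ \<eta>']) auto
 qed
qed

text \<open>If no power of \<open>a\<close> lies in \<open>I\<close>, some prime ideal over
  \<open>I\<close> avoids \<open>a\<close>. Extending from zero variables then yields a zero of
  \<open>I\<close> at which \<open>a\<close> does not vanish.\<close>

theorem nullstellensatz:
 assumes I: "poly_ideal n I" and a: "a \<in> polyfun n"
  and van: "\<And>z. z \<in> cspace n ==> (\<And>F. F \<in> I ==> F z = 0) ==> a z = 0"
 shows "\<exists>k. (%z. a z ^ k) \<in> I"
proof (rule ccontr)
 assume "\<not> ?thesis"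
 then have no: "(%z. a z ^ k) \<notin> I" for k by blast
 obtain Q where Q: "poly_prime n Q" "I \<subseteq> Q" "a \<notin> Q" using ex_poly_prime[OF I a no] .
 note prime = poly_prime_rules[OF Q(1)]
 obtain b where b: "b \<in> polyfun 0" "b \<notin> Q" "\<And>\<eta>. \<forall>F\<in>Q \<inter> polyfun 0. F \<eta> = 0 ==> b \<eta> ~= 0 ==>
   \<exists>\<eta>'. (\<forall>i<0. \<eta>' i = \<eta> i) \<and> (\<forall>F\<in>Q. F \<eta>' = 0) \<and> a \<eta>' ~= 0"
  using extension_lemma[OF Q(1) le0 a Q(3)] by blast
 obtain c where c: "b = (%_. c)" using polyfun_0[OF b(1)] by blast
 have "b (%_. 0) ~= 0" using b(2) poly_ideal_rules(2)[OF prime(1)] unfolding c by auto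
 moreover have "F (%_. 0) = 0" if F: "F \<in> Q" "F \<in> polyfun 0" for F
 proof (rule ccontr)
  assume n: "F (%_. 0) ~= 0"
  obtain e where e: "F = (%_. e)" using polyfun_0[OF F(2)] by blast
  have "(%z. inverse e * F z) \<in> Q" by (intro poly_ideal_rules(4)[OF prime(1)] polyfun.const F)
  then show False using n prime(2) unfolding e by simp
 qed
 ultimately obtain \<eta>' where \<eta>': "\<And>F. F \<in> Q ==> F \<eta>' = 0" "a \<eta>' ~= 0" using b(3)[of "%_. 0"] by blast
 \<comment> \<open>Points of \<open>cspace n\<close> are extensional; cutting off \<eta>' does not
   change the values of polynomials in n variables.\<close>
 let ?z = "restrict \<eta>' {..<n}"
 have eq: "F ?z = F \<eta>'" if "F \<in> polyfun n" for F by (rule polyfun_cong[OF that]) auto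
 have "a ?z = 0"
 proof (rule van)
  show "?z \<in> cspace n" unfolding cspace_def by auto
  show "F ?z = 0" if "F \<in> I" for F
   unfolding eq[OF subsetD[OF poly_ideal_rules(1)[OF I] that]] by (rule \<eta>'(1)[OF subsetD[OF Q(2) that]])
 qed
 with eq[OF a] \<eta>'(2) show False by simp
qed

section \<open>Regular functions and affine charts\<close>

abbreviation zopen :: "'a fspace => 'a set => bool" where
 "zopen X \<equiv> openin (zar X)"

lemma reg_cong:
 assumes "variety X" "zopen X U" "f \<in> reg X U" "\<And>x. x \<in> U ==> g x = f x"
 shows "g \<in> reg X U"
proof -
 have "function_sheaf X" using assms(1) unfolding variety_def by simp
 then have "\<forall>U f g. zopen X U \<and> f \<in> reg X U \<and> (\<forall>x\<in>U. g x = f x) --> g \<in> reg X U"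
  unfolding function_sheaf_def by (elim conjE)
 with assms(2-4) show ?thesis by blast
qed

lemma reg_restrict:
 assumes "variety X" "zopen X U" "zopen X V" "V \<subseteq> U" "f \<in> reg X U"
 shows "f \<in> reg X V"
proof -
 have "function_sheaf X" using assms(1) unfolding variety_def by simp
 then have "\<forall>U V f. zopen X U \<and> zopen X V \<and> V \<subseteq> U \<and> f \<in> reg X U --> f \<in> reg X V"
  unfolding function_sheaf_def by (elim conjE)
 with assms show ?thesis by blast
qed

lemma reg_local:
 assumes "variety X" "zopen X U"
  and "\<And>x. x \<in> U ==> \<exists>V. zopen X V \<and> x \<in> V \<and> V \<subseteq> U \<and> f \<in> reg X V"
 shows "f \<in> reg X U"
proof -
 have "function_sheaf X" using assms(1) unfolding variety_def by simp
 then have "\<forall>U f. zopen X U \<and> (\<forall>x\<in>U. \<exists>V. zopen X V \<and> x \<in> V \<and> V \<subseteq> U \<and> f \<in> reg X V)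
  --> f \<in> reg X U"
  unfolding function_sheaf_def by (elim conjE)
 with assms(2,3) show ?thesis by blast
qed

lemma affine_cover:
 assumes "variety X"
 shows "\<exists>\<U>. finite \<U> \<and> (\<forall>U\<in>\<U>. affine_open X U) \<and> \<Union>\<U> = points X"
 using assms unfolding variety_def by (elim conjE)

lemma affine_open_openin: "affine_open X U ==> zopen X U"
 unfolding affine_open_def iso_from_open_def by (elim exE conjE)

lemma affine_nbhd:
 assumes "variety X" "x \<in> points X"
 obtains U where "affine_open X U" "zopen X U" "x \<in> U"
proof -
 obtain \<U> where "\<forall>U\<in>\<U>. affine_open X U" "\<Union>\<U> = points X"
  using affine_cover[OF assms(1)] by (elim exE conjE)
 then obtain U where "affine_open X U" "x \<in> U" using assms(2) by blast
 with that affine_open_openin show thesis by blast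
qed

text \<open>The algebraic set behind an affine open set is forgotten: \<open>chart_image\<close>
  says that the image is closed, \<open>chart_base\<close> that the basic open sets form a base,
  \<open>chart_fraction\<close> and \<open>chart_regI\<close> that regular functions are the local
  quotients of polynomials in the coordinates.\<close>

locale chart =
 fixes X :: "'a fspace" and U :: "'a set" and n :: nat and \<phi> :: "'a => nat => complex"
 assumes chart_open: "zopen X U"
  and chart_cspace: "y \<in> U ==> \<phi> y \<in> cspace n"
  and chart_inj: "inj_on \<phi> U"
  and chart_image: "z \<in> cspace n ==> (\<And>F. F \<in> polyfun n ==> (\<And>y. y \<in> U ==> F (\<phi> y) = 0) ==> F z = 0) ==> z \<in> \<phi> ` U"
  and chart_basic_open: "F \<in> polyfun n ==> zopen X {y\<in>U. F (\<phi> y) ~= 0}"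
  and chart_base: "zopen X W ==> W \<subseteq> U ==> y \<in> W ==> \<exists>F\<in>polyfun n. F (\<phi> y) ~= 0 \<and> {y'\<in>U. F (\<phi> y') ~= 0} \<subseteq> W"
  and chart_reg: "F \<in> polyfun n ==> (%y. F (\<phi> y)) \<in> reg X U"
  and chart_fraction: "zopen X W ==> W \<subseteq> U ==> f \<in> reg X W ==> y \<in> W ==>
   \<exists>a\<in>polyfun n. \<exists>b\<in>polyfun n. \<exists>W'. zopen X W' \<and> y \<in> W' \<and> W' \<subseteq> W \<and>
    (\<forall>y'\<in>W'. b (\<phi> y') ~= 0 \<and> f y' = a (\<phi> y') / b (\<phi> y'))"
  and chart_regI: "zopen X W ==> W \<subseteq> U ==>
   (\<And>y. y \<in> W ==> \<exists>a\<in>polyfun n. \<exists>b\<in>polyfun n. \<exists>W'. zopen X W' \<and> y \<in> W' \<and> W' \<subseteq> W \<and>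
    (\<forall>y'\<in>W'. b (\<phi> y') ~= 0 \<and> f y' = a (\<phi> y') / b (\<phi> y'))) ==> f \<in> reg X W"

lemmas chart_rules = chart.chart_open chart.chart_cspace chart.chart_inj chart.chart_image chart.chart_basic_open
 chart.chart_base chart.chart_reg chart.chart_fraction chart.chart_regI

lemma topspace_affine_zariski: "topspace (affine_zariski n Z) = Z"
proof -
 have "Z = {z \<in> Z. (%_. 1) z ~= (0 :: complex)}" by simp
 then have "Z \<in> {{z \<in> Z. f z ~= 0} | f. f \<in> polyfun n}" 
  by (intro CollectI exI[of _ "%_. 1"] conjI polyfun.const)
 then show ?thesis unfolding affine_zariski_def topology_generated_by_topspace by blast
qed

lemma affine_zariski_base:
 assumes "openin (affine_zariski n Z) S" "z \<in> S"
 shows "\<exists>F\<in>polyfun n. F z ~= 0 \<and> {z\<in>Z. F z ~= 0} \<subseteq> S"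
proof -
 let ?B = "{{z \<in> Z. f z ~= 0} | f. f \<in> polyfun n}"
 have "generate_topology_on ?B S"
  using assms(1) unfolding affine_zariski_def openin_topology_generated_by_iff .
 from this assms(2) show ?thesis
 proof induction
  case (Int a b)
  then obtain F F' where "F \<in> polyfun n" "F z ~= 0" "{z\<in>Z. F z ~= 0} \<subseteq> a"
   "F' \<in> polyfun n" "F' z ~= 0" "{z\<in>Z. F' z ~= 0} \<subseteq> b" by blast
  then show ?case by (intro bexI[of _ "%z. F z * F' z"] polyfun_mult) auto
 next
  case (UN \<K>)
  then obtain k where k: "k \<in> \<K>" "z \<in> k" by blast
  then obtain F where "F \<in> polyfun n" "F z ~= 0" "{z\<in>Z. F z ~= 0} \<subseteq> k" using UN by blast
  then show ?case using k(1) by (intro bexI[of _ F]) auto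
 qed auto
qed

lemma chart_exists:
 assumes "affine_open X U"
 shows "\<exists>n \<phi>. chart X U n \<phi>"
proof -
 obtain n Z \<phi> where Z: "algebraic_set n Z" and iso: "iso_from_open X U \<phi> (affine_space_on n Z)"
  using assms unfolding affine_open_def by blast
 let ?T = "affine_zariski n Z"
 have U: "zopen X U" and bij: "bij_betw \<phi> U Z"
  and op: "\<And>W. W \<subseteq> U ==> zopen X W \<longleftrightarrow> openin ?T (\<phi> ` W)"
  and rg: "\<And>W f. W \<subseteq> U ==> zopen X W ==> f \<in> reg X W \<longleftrightarrow> f \<circ> inv_into U \<phi> \<in> affine_reg n Z (\<phi> ` W)"
  using iso unfolding iso_from_open_def affine_space_on_def by (auto simp: topspace_affine_zariski)
 have inj: "inj_on \<phi> U" and im: "\<phi> ` U = Z" using bij unfolding bij_betw_def by auto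
 have inv: "inv_into U \<phi> (\<phi> y) = y" if "y \<in> U" for y using that inj by simp
 obtain F0 where F0: "F0 \<subseteq> polyfun n" "Z = {z \<in> cspace n. \<forall>f\<in>F0. f z = 0}"
  using Z unfolding algebraic_set_def by blast
 have preim: "\<phi> ` {y\<in>U. \<phi> y \<in> S} = S" if "S \<subseteq> Z" for S using that im by auto
 have preim_open: "zopen X {y\<in>U. \<phi> y \<in> S}" if "openin ?T S" for S
  using op[of "{y\<in>U. \<phi> y \<in> S}"] preim[of S] openin_subset[OF that] that
  by (auto simp: topspace_affine_zariski)
 have "chart X U n \<phi>"
 proof
  show "zopen X U" "inj_on \<phi> U" by (rule U inj)+
  show "\<phi> y \<in> cspace n" if "y \<in> U" for y using that im F0(2) by auto
 next
  fix z assume z: "z \<in> cspace n" "\<And>F. F \<in> polyfun n ==> (\<And>y. y \<in> U ==> F (\<phi> y) = 0) ==> F z = 0"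
  have "f z = 0" if "f \<in> F0" for f
   by (rule z(2)) (use that im F0 in auto)
  then show "z \<in> \<phi> ` U" unfolding im using z(1) F0(2) by auto
 next
  fix F assume F: "F \<in> polyfun n"
  have "openin ?T {z\<in>Z. F z ~= 0}" unfolding affine_zariski_def
   by (rule topology_generated_by_Basis) (use F in blast)
  from preim_open[OF this] show "zopen X {y\<in>U. F (\<phi> y) ~= 0}"
   using im by (elim back_subst[of "zopen X"]) auto
  have oZ: "openin ?T Z" using openin_topspace[of ?T] unfolding topspace_affine_zariski .
  have "(%y. F (\<phi> y)) \<circ> inv_into U \<phi> \<in> affine_reg n Z (\<phi> ` U)"
   unfolding affine_reg_def im
  proof (intro CollectI ballI)
   fix z assume "z \<in> Z"
   have "\<phi> (inv_into U \<phi> y) = y" if "y \<in> Z" for y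
    using that im by (metis f_inv_into_f)
   then show "\<exists>W. openin ?T W \<and> z \<in> W \<and> W \<subseteq> Z \<and>
    (\<exists>a\<in>polyfun n. \<exists>b\<in>polyfun n. \<forall>y\<in>W. b y ~= 0 \<and> ((%y. F (\<phi> y)) \<circ> inv_into U \<phi>) y = a y / b y)"
    by (intro exI[of _ Z] conjI oZ \<open>z \<in> Z\<close> subset_refl bexI[OF _ F] bexI[OF _ polyfun.const[of 1]])
      simp
  qed
  then show "(%y. F (\<phi> y)) \<in> reg X U" using rg[OF subset_refl U] by blast
 next
  fix W y assume W: "zopen X W" "W \<subseteq> U" "y \<in> W"
  then have "openin ?T (\<phi> ` W)" "\<phi> y \<in> \<phi> ` W" using op by auto
  from affine_zariski_base[OF this] obtain F where F: "F \<in> polyfun n" "F (\<phi> y) ~= 0" "{z\<in>Z. F z ~= 0} \<subseteq> \<phi> ` W"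
   by blast
  have "{y'\<in>U. F (\<phi> y') ~= 0} \<subseteq> W"
  proof
   fix y' assume y': "y' \<in> {y'\<in>U. F (\<phi> y') ~= 0}"
   then have "\<phi> y' \<in> \<phi> ` W" using F(3) im by auto
   then show "y' \<in> W" using inj y' W by (auto simp: inj_on_def)
  qed
  then show "\<exists>F\<in>polyfun n. F (\<phi> y) ~= 0 \<and> {y'\<in>U. F (\<phi> y') ~= 0} \<subseteq> W" using F by blast
 next
  fix W f y assume W: "zopen X W" "W \<subseteq> U" "f \<in> reg X W" "y \<in> W"
  then have "f \<circ> inv_into U \<phi> \<in> affine_reg n Z (\<phi> ` W)" "\<phi> y \<in> \<phi> ` W" using rg by auto
  then obtain S a b where S: "openin ?T S" "\<phi> y \<in> S" "S \<subseteq> \<phi> ` W" "a \<in> polyfun n" "b \<in> polyfun n"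
   "\<forall>z\<in>S. b z ~= 0 \<and> (f \<circ> inv_into U \<phi>) z = a z / b z"
   unfolding affine_reg_def by blast
  have "{y\<in>U. \<phi> y \<in> S} \<subseteq> W"
  proof
   fix y' assume y': "y' \<in> {y\<in>U. \<phi> y \<in> S}"
   then have "\<phi> y' \<in> \<phi> ` W" using S(3) by auto
   then show "y' \<in> W" using inj y' W by (auto simp: inj_on_def)
  qed
  moreover have "\<forall>y'\<in>{y\<in>U. \<phi> y \<in> S}. b (\<phi> y') ~= 0 \<and> f y' = a (\<phi> y') / b (\<phi> y')"
   using S(6) inv by fastforce
  moreover have "y \<in> {y\<in>U. \<phi> y \<in> S}" using S(2) W by auto
  ultimately show "\<exists>a\<in>polyfun n. \<exists>b\<in>polyfun n. \<exists>W'. zopen X W' \<and> y \<in> W' \<and> W' \<subseteq> W \<and>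
      (\<forall>y'\<in>W'. b (\<phi> y') ~= 0 \<and> f y' = a (\<phi> y') / b (\<phi> y'))"
   using preim_open[OF S(1)] by (intro bexI[OF _ S(4)] bexI[OF _ S(5)] exI conjI)
 next
  fix W f assume W: "zopen X W" "W \<subseteq> U" "
    (\<And>y. y \<in> W ==> \<exists>a\<in>polyfun n. \<exists>b\<in>polyfun n. \<exists>W'. zopen X W' \<and> y \<in> W' \<and> W' \<subseteq> W \<and>
      (\<forall>y'\<in>W'. b (\<phi> y') ~= 0 \<and> f y' = a (\<phi> y') / b (\<phi> y')))"
  have "f \<circ> inv_into U \<phi> \<in> affine_reg n Z (\<phi> ` W)"
   unfolding affine_reg_def
  proof (intro CollectI ballI)
   fix z assume "z \<in> \<phi> ` W"
   then obtain y where y: "y \<in> W" "z = \<phi> y" by blast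
   then obtain a b W' where ab: "a \<in> polyfun n" "b \<in> polyfun n" "zopen X W'" "y \<in> W'" "W' \<subseteq> W"
    "\<forall>y'\<in>W'. b (\<phi> y') ~= 0 \<and> f y' = a (\<phi> y') / b (\<phi> y')"
    using W(3)[OF y(1)] by blast
   have "\<forall>z\<in>\<phi> ` W'. b z ~= 0 \<and> (f \<circ> inv_into U \<phi>) z = a z / b z"
    using ab(5,6) W inv by auto
   moreover have "openin ?T (\<phi> ` W')" using op[of W'] ab W by auto
   ultimately show "\<exists>S. openin ?T S \<and> z \<in> S \<and> S \<subseteq> \<phi> ` W \<and>
     (\<exists>a\<in>polyfun n. \<exists>b\<in>polyfun n. \<forall>y\<in>S. b y ~= 0 \<and> (f \<circ> inv_into U \<phi>) y = a y / b y)"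
    using ab(4,5) y by (intro exI[of _ "\<phi> ` W'"] conjI bexI[OF _ ab(1)] bexI[OF _ ab(2)]) auto
  qed
  then show "f \<in> reg X W" using rg W by blast
 qed
 then show ?thesis by blast
qed

lemma chart_nbhd:
 assumes "variety X" "x \<in> points X"
 obtains U n \<phi> where "chart X U n \<phi>" "x \<in> U"
 using affine_nbhd[OF assms] chart_exists by metis

context
 fixes X :: "'a fspace"
 assumes X: "variety X"
begin

lemma reg_const: "zopen X W ==> (%_. c) \<in> reg X W"
 and reg_add: "zopen X W ==> f \<in> reg X W ==> g \<in> reg X W ==> (%y. f y + g y) \<in> reg X W"
 and reg_mult: "zopen X W ==> f \<in> reg X W ==> g \<in> reg X W ==> (%y. f y * g y) \<in> reg X W"
proof -
 have *: "\<exists>V U. affine_open X U \<and> zopen X V \<and> x \<in> V \<and> V \<subseteq> W \<and> V \<subseteq> U"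
  if W: "zopen X W" "x \<in> W" for x W
 proof -
  obtain U where U: "affine_open X U" "zopen X U" "x \<in> U"
   using affine_nbhd[OF X] openin_subset[OF W(1)] W(2) by blast
  show ?thesis by (rule exI[of _ "W \<inter> U"], rule exI[of _ U]) (use U W in auto)
 qed
 show "(%_. c) \<in> reg X W" if W: "zopen X W" for c
 proof (rule reg_local[OF X W])
  fix x assume "x \<in> W"
  then obtain V U where V: "affine_open X U" "zopen X V" "x \<in> V" "V \<subseteq> W" "V \<subseteq> U" using *[OF W] by blast
  then show "\<exists>V. zopen X V \<and> x \<in> V \<and> V \<subseteq> W \<and> (%_. c) \<in> reg X V"
   using affine_open_reg(1)[OF V(1,2,5)] by blast
 qed
 assume W: "zopen X W" and f: "f \<in> reg X W" and g: "g \<in> reg X W"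
 have fg: "\<exists>V. zopen X V \<and> x \<in> V \<and> V \<subseteq> W \<and> f + g \<in> reg X V \<and> f * g \<in> reg X V" if "x \<in> W" for x
 proof -
  obtain V U where V: "affine_open X U" "zopen X V" "x \<in> V" "V \<subseteq> W" "V \<subseteq> U"
   using *[OF W] \<open>x \<in> W\<close> by blast
  have "f \<in> reg X V" "g \<in> reg X V" using reg_restrict[OF X W V(2,4)] f g by auto
  then have "f + g \<in> reg X V" "f * g \<in> reg X V" by (rule affine_open_reg(2,3)[OF V(1,2,5)])+
  with V(2,3,4) show ?thesis by (intro exI[of _ V] conjI)
 qed
 show "(%y. f y + g y) \<in> reg X W"
  by (rule reg_local[OF X W], drule fg) (unfold plus_fun_def, elim exE conjE, intro exI conjI)
 show "(%y. f y * g y) \<in> reg X W"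
  by (rule reg_local[OF X W], drule fg) (unfold times_fun_def, elim exE conjE, intro exI conjI)
qed

lemma reg_minus: "zopen X W ==> f \<in> reg X W ==> (%y. - f y) \<in> reg X W"
 using reg_mult[of W "%_. -1" f] reg_const[of W "-1"] by simp

lemma reg_diff: "zopen X W ==> f \<in> reg X W ==> g \<in> reg X W ==> (%y. f y - g y) \<in> reg X W"
 using reg_add[OF _ _ reg_minus, of W f g] by simp

lemma reg_atE:
 assumes "f \<in> reg_at X x"
 obtains U where "zopen X U" "x \<in> U" "f \<in> reg X U"
 using assms unfolding reg_at_def by blast

lemma reg_at_fraction:
 assumes U: "chart X U n \<phi>" and x: "x \<in> U" and f: "f \<in> reg_at X x"
 obtains a b W where "a \<in> polyfun n" "b \<in> polyfun n" "zopen X W" "x \<in> W" "W \<subseteq> U"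
  "\<forall>y\<in>W. b (\<phi> y) ~= 0 \<and> f y = a (\<phi> y) / b (\<phi> y)"
proof -
 note rules = chart_rules[OF U]
 obtain V where V: "zopen X V" "x \<in> V" "f \<in> reg X V" using reg_atE[OF f] .
 have VU: "zopen X (V \<inter> U)" "V \<inter> U \<subseteq> U" "x \<in> V \<inter> U" using V x rules(1) by auto
 have "f \<in> reg X (V \<inter> U)" by (rule reg_restrict[OF X V(1) VU(1) _ V(3)]) auto
 from rules(8)[OF VU(1,2) this VU(3)] show thesis using that by (elim bexE exE conjE) auto
qed

text \<open>Locally f = a / b with \<open>a\<close> nonzero near \<open>x\<close>, and b / a is
  again a quotient of polynomials.\<close>

lemma reg_nonzero_inverse:
 assumes W: "zopen X W" and f: "f \<in> reg X W" and x: "x \<in> W" "f x ~= 0"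
 obtains V where "zopen X V" "x \<in> V" "V \<subseteq> W" "\<forall>y\<in>V. f y ~= 0" "(%y. inverse (f y)) \<in> reg X V"
proof -
 obtain U n \<phi> where U: "chart X U n \<phi>" "x \<in> U"
  using chart_nbhd[OF X] openin_subset[OF W] x by blast
 note U_rules = chart_rules[OF U(1)]
 have "f \<in> reg_at X x" unfolding reg_at_def using W f x by blast
 then obtain a b W1 where ab1: "a \<in> polyfun n" "b \<in> polyfun n" "zopen X W1" "x \<in> W1" "W1 \<subseteq> U"
  "\<forall>y\<in>W1. b (\<phi> y) ~= 0 \<and> f y = a (\<phi> y) / b (\<phi> y)"
  by (rule reg_at_fraction[OF U])
 define W' where "W' = W1 \<inter> W"
 have ab: "a \<in> polyfun n" "b \<in> polyfun n" "zopen X W'" "x \<in> W'" "W' \<subseteq> W \<inter> U"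
  "\<forall>y'\<in>W'. b (\<phi> y') ~= 0 \<and> f y' = a (\<phi> y') / b (\<phi> y')"
  using ab1 W x unfolding W'_def by auto
 let ?V = "W' \<inter> {y\<in>U. a (\<phi> y) ~= 0}"
 have oV: "zopen X ?V" using ab U_rules(5)[OF ab(1)] by auto
 have "a (\<phi> x) ~= 0" using ab(4,6) x(2) by auto
 then have xV: "x \<in> ?V" using ab(4) U(2) by auto
 have "(%y. inverse (f y)) \<in> reg X ?V"
 proof (rule U_rules(9)[OF oV])
  fix y assume "y \<in> ?V"
  then show "\<exists>a\<in>polyfun n. \<exists>b\<in>polyfun n. \<exists>W'. zopen X W' \<and> y \<in> W' \<and> W' \<subseteq> ?V \<and>
     (\<forall>y'\<in>W'. b (\<phi> y') ~= 0 \<and> inverse (f y') = a (\<phi> y') / b (\<phi> y'))"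
   by (intro bexI[OF _ ab(2)] bexI[OF _ ab(1)] exI[of _ ?V] conjI oV) (use ab(6) in auto)
 qed auto
 then show thesis by (rule that[OF oV xV, rotated 2]) (use ab(5,6) \<open>a (\<phi> x) ~= 0\<close> in auto)
qed

lemma open_nonzero:
 assumes W: "zopen X W" and f: "f \<in> reg X W"
 shows "zopen X {y\<in>W. f y ~= 0}"
proof (subst openin_subopen, intro ballI)
 fix x assume "x \<in> {y\<in>W. f y ~= 0}"
 then have x: "x \<in> W" "f x ~= 0" by auto
 show "\<exists>T. zopen X T \<and> x \<in> T \<and> T \<subseteq> {y\<in>W. f y ~= 0}"
  by (rule reg_nonzero_inverse[OF W f x]) blast
qed

lemma closedin_point:
 assumes x: "x \<in> points X"
 shows "closedin (zar X) {x}"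
 unfolding closedin_def
proof (intro conjI)
 show "zopen X (points X - {x})"
 proof (subst openin_subopen, intro ballI)
  fix y assume y: "y \<in> points X - {x}"
  obtain U n \<phi> where U: "chart X U n \<phi>" "y \<in> U" using chart_nbhd[OF X, of y] y by blast
  note rules = chart_rules[OF U(1)]
  show "\<exists>T. zopen X T \<and> y \<in> T \<and> T \<subseteq> points X - {x}"
  proof (cases "x \<in> U")
   case False
   then show ?thesis using U(2) rules(1) openin_subset[OF rules(1)] by (intro exI[of _ U]) auto
  next
   case True
   have "\<phi> x ~= \<phi> y" using rules(3) True U(2) y by (auto simp: inj_on_def)
   moreover have "\<phi> x \<in> cspace n" "\<phi> y \<in> cspace n" using rules(2) True U(2) by auto
   ultimately obtain i where i: "i < n" "\<phi> x i ~= \<phi> y i"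
    unfolding cspace_def by (metis PiE_ext lessThan_iff)
   have p: "(%z. z i - \<phi> x i) \<in> polyfun n" using i(1) by (intro polyfun_rules)
   show ?thesis
    by (rule exI[of _ "{y'\<in>U. \<phi> y' i - \<phi> x i ~= 0}"])
     (use rules(5)[OF p] openin_subset[OF rules(1)] U(2) i in auto)
  qed
 qed
qed (use x in simp)

lemma poly_reg_at:
 assumes U: "chart X U n \<phi>" and x: "x \<in> U" and F: "F \<in> polyfun n"
 shows "(%y. F (\<phi> y)) \<in> reg_at X x"
 using chart_rules(1,7)[OF U] F x unfolding reg_at_def by blast

section \<open>The Zariski topology is noetherian\<close>

text \<open>On each of finitely many charts the polynomials vanishing on \<open>C k\<close> form an
  ascending chain of ideals, and a closed set is recovered from its ideal by
  \<open>chart_base\<close>.\<close>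

lemma closed_chain_stationary:
 assumes C: "\<And>k. closedin (zar X) (C k)" and dec: "\<And>k. C (Suc k) \<subseteq> C k"
 shows "\<exists>N. C (Suc N) = C N"
proof -
 obtain \<U> where \<U>: "finite \<U>" "\<And>U. U \<in> \<U> ==> affine_open X U" "\<Union>\<U> = points X"
  using affine_cover[OF X] by (elim exE conjE) simp
 have "\<exists>N. \<forall>k\<ge>N. C k \<inter> U = C N \<inter> U" if UU: "U \<in> \<U>" for U
 proof -
  obtain n \<phi> where "chart X U n \<phi>" using chart_exists[OF \<U>(2)[OF UU]] by blast
  note rules = chart_rules[OF this]
  define I where "I k = {F\<in>polyfun n. \<forall>y\<in>C k \<inter> U. F (\<phi> y) = 0}" for k
  have "poly_ideal n (I k)" for k
   unfolding poly_ideal_def I_def by (auto intro: polyfun_rules)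
  moreover have "I k \<subseteq> I (Suc k)" for k unfolding I_def using dec by blast
  ultimately have "\<exists>N. \<forall>k\<ge>N. I k = I N" by (rule polyfun_acc)
  then obtain N where N: "\<forall>k\<ge>N. I k = I N" by (elim exE)
  have sub: "C k \<inter> U \<subseteq> C j \<inter> U" if "I j \<subseteq> I k" for j k
  proof (rule ccontr)
   assume "\<not> ?thesis"
   then obtain y where y: "y \<in> C k" "y \<in> U" "y \<notin> C j" by blast
   have "zopen X (U \<inter> (points X - C j))" using C[of j] rules(1) by (intro openin_Int) auto
   moreover have "y \<in> U \<inter> (points X - C j)" using y openin_subset[OF rules(1)] by auto
   ultimately obtain F where F: "F \<in> polyfun n" "F (\<phi> y) ~= 0" "{y'\<in>U. F (\<phi> y') ~= 0} \<subseteq> U \<inter> (points X - C j)"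
    using rules(6)[of "U \<inter> (points X - C j)" y] by blast
   then have "F \<in> I j" unfolding I_def by blast
   then have "F \<in> I k" using that by blast
   then show False using F(2) y unfolding I_def by blast
  qed
  have "C k \<inter> U = C N \<inter> U" if "k \<ge> N" for k
  proof -
   have "I k = I N" by (rule N[rule_format, OF that])
   then show ?thesis using sub[of k N] sub[of N k] by (intro subset_antisym) simp_all
  qed
  then show ?thesis by (intro exI[of _ N] allI impI)
 qed
 then have "\<forall>U\<in>\<U>. \<exists>N. \<forall>k\<ge>N. C k \<inter> U = C N \<inter> U" by blast
 then obtain N where N: "\<forall>U\<in>\<U>. \<forall>k\<ge>N U. C k \<inter> U = C (N U) \<inter> U"
  by (elim exE[OF bchoice])
 define M where "M = Max (insert 0 (N ` \<U>))"
 have M: "N U \<le> M" if "U \<in> \<U>" for U unfolding M_def using that \<U>(1) by simp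
 have "C (Suc M) \<inter> U = C M \<inter> U" if "U \<in> \<U>" for U
  using N[rule_format, OF that, of "Suc M"] N[rule_format, OF that, of M] M[OF that] by simp
 then have "y \<in> C (Suc M) \<longleftrightarrow> y \<in> C M" if "y \<in> points X" for y
  using \<U>(3) that by blast
 then have "C (Suc M) = C M"
  using closedin_subset[OF C[of M]] closedin_subset[OF C[of "Suc M"]] by blast
 then show ?thesis ..
qed

lemma closed_minimal:
 assumes "A ~= {}" and A: "\<And>C. C \<in> A ==> closedin (zar X) C"
 shows "\<exists>C\<in>A. \<forall>D\<in>A. D \<subseteq> C --> D = C"
proof (rule ccontr)
 assume n: "\<not> ?thesis"
 have "\<exists>D. D \<in> A \<and> D \<subset> C" if "C \<in> A" for C
 proof (rule ccontr)
  assume "\<not> (\<exists>D. D \<in> A \<and> D \<subset> C)"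
  then have "\<forall>D\<in>A. D \<subseteq> C --> D = C" by blast
  with n that show False by blast
 qed
 then have "\<forall>C\<in>A. \<exists>D. D \<in> A \<and> D \<subset> C" by (intro ballI)
 then obtain S where S: "\<forall>C\<in>A. S C \<in> A \<and> S C \<subset> C" by (elim exE[OF bchoice])
 obtain C where "C \<in> A" using assms(1) by blast
 define F where "F k = (S ^^ k) C" for k
 have FA: "F k \<in> A" for k unfolding F_def by (induction k) (use S \<open>C \<in> A\<close> in auto)
 have FS: "F (Suc k) \<subset> F k" for k using S FA[of k] unfolding F_def by simp
 have "\<exists>N. F (Suc N) = F N"
  by (rule closed_chain_stationary) (use FA FS A in "simp_all add: psubset_imp_subset")
 with FS show False by blast
qed

text \<open>Noetherian induction: a minimal closed set without a decomposition is nonempty and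
  reducible, so it is the union of two smaller closed sets that do decompose.\<close>

lemma irreducible_decomposition:
 assumes "closedin (zar X) C"
 shows "\<exists>\<Z>. finite \<Z> \<and> (\<forall>Z\<in>\<Z>. closedin (zar X) Z \<and> irreducible_in (zar X) Z) \<and> \<Union>\<Z> = C"
proof (rule ccontr)
 define P where "P C \<longleftrightarrow> (\<exists>\<Z>. finite \<Z> \<and> (\<forall>Z\<in>\<Z>. closedin (zar X) Z \<and> irreducible_in (zar X) Z) \<and> \<Union>\<Z> = C)" for C
 assume "\<not> ?thesis"
 then have "C \<in> {C. closedin (zar X) C \<and> \<not> P C}" using assms unfolding P_def by blast
 then have "\<exists>C\<in>{C. closedin (zar X) C \<and> \<not> P C}. \<forall>D\<in>{C. closedin (zar X) C \<and> \<not> P C}. D \<subseteq> C --> D = C"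
  by (intro closed_minimal) auto
 then obtain D where D: "closedin (zar X) D" "\<not> P D"
  and min: "\<And>E. closedin (zar X) E ==> E \<subset> D ==> P E" by blast
 have "D ~= {}"
 proof
  assume "D = {}"
  then have "P D" unfolding P_def by (intro exI[of _ "{}"]) auto
  with D show False by simp
 qed
 moreover have "\<not> irreducible_in (zar X) D"
 proof
  assume "irreducible_in (zar X) D"
  then have "P D" unfolding P_def using D(1) by (intro exI[of _ "{D}"]) auto
  with D show False by simp
 qed
 moreover have "D \<subseteq> points X" by (rule closedin_subset[OF D(1)])
 ultimately obtain A B where AB: "closedin (zar X) A" "closedin (zar X) B" "D \<subseteq> A \<union> B" "\<not> D \<subseteq> A" "\<not> D \<subseteq> B"
  unfolding irreducible_in_def by blast
 have PAB: "P (D \<inter> A)" "P (D \<inter> B)" using AB by (intro min closedin_Int D(1); blast)+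
 obtain \<Z>1 where Z1: "finite \<Z>1" "\<forall>Z\<in>\<Z>1. closedin (zar X) Z \<and> irreducible_in (zar X) Z" "\<Union>\<Z>1 = D \<inter> A"
  using PAB(1) unfolding P_def by (elim exE conjE)
 obtain \<Z>2 where Z2: "finite \<Z>2" "\<forall>Z\<in>\<Z>2. closedin (zar X) Z \<and> irreducible_in (zar X) Z" "\<Union>\<Z>2 = D \<inter> B"
  using PAB(2) unfolding P_def by (elim exE conjE)
 from Z1 Z2 have "P D" unfolding P_def using AB(3) by (intro exI[of _ "\<Z>1 \<union> \<Z>2"]) auto
 with D show False by simp
qed

end

section \<open>Irreducible varieties: the generic point\<close>

text \<open>The trace on closed points of the neighbourhoods of the scheme-theoretic generic point.
  For irreducible \<open>X\<close> the nonempty open sets form a base of this filter.\<close>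

definition generic :: "'a fspace => 'a filter" where
 "generic X = (INF U\<in>{U. zopen X U \<and> U ~= {}}. principal U)"

text \<open>The function field without passing to classes: values outside the domain of regularity
  are arbitrary, so field identities are to be read generically.\<close>

definition ratfun :: "'a fspace => ('a => complex) set" where
 "ratfun X = {f. \<exists>U. zopen X U \<and> U ~= {} \<and> f \<in> reg X U}"

locale generic_field = generic_ring +
 assumes inverse_K [intro]: "f \<in> R ==> (%y. inverse (f y)) \<in> R"

locale irreducible_var =
 fixes X :: "'a fspace"
 assumes irr: "irreducible_variety X"
begin

lemma var: "variety X" using irr unfolding irreducible_variety_def by simp

lemma points_nonempty: "points X ~= {}"
 using irr unfolding irreducible_variety_def irreducible_in_def by simp

abbreviation gen_point :: "('a => bool) => bool" (binder "GEN " 10) where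
 "gen_point P \<equiv> eventually P (generic X)"

lemma open_Int_nonempty:
 assumes U: "zopen X U" "U ~= {}" and V: "zopen X V" "V ~= {}"
 shows "U \<inter> V ~= {}"
proof
 assume e: "U \<inter> V = {}"
 have "points X \<subseteq> (points X - U) \<union> (points X - V)" using e by blast
 moreover have "closedin (zar X) (points X - U)" "closedin (zar X) (points X - V)" using U V by auto
 ultimately have "points X \<subseteq> points X - U \<or> points X \<subseteq> points X - V"
  using irr unfolding irreducible_variety_def irreducible_in_def by blast
 then show False using U V openin_subset by blast
qed

lemma eventually_generic:
 "eventually P (generic X) \<longleftrightarrow> (\<exists>U. zopen X U \<and> U ~= {} \<and> (\<forall>y\<in>U. P y))"
 unfolding generic_def
proof (subst eventually_INF_base)
 show "{U. zopen X U \<and> U ~= {}} ~= {}" using points_nonempty by auto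
 fix A B assume "A \<in> {U. zopen X U \<and> U ~= {}}" "B \<in> {U. zopen X U \<and> U ~= {}}"
 then show "\<exists>x\<in>{U. zopen X U \<and> U ~= {}}. principal x \<le> inf (principal A) (principal B)"
  using open_Int_nonempty[of A B] by (intro bexI[of _ "A \<inter> B"]) auto
qed (auto simp: eventually_principal)

lemma eventually_genericI:
 "zopen X U ==> x \<in> U ==> (\<And>y. y \<in> U ==> P y) ==> eventually P (generic X)"
 unfolding eventually_generic by blast

lemma eventually_generic_Int:
 assumes "eventually P (generic X)" "zopen X W" "W ~= {}"
 shows "\<exists>U. zopen X U \<and> U ~= {} \<and> U \<subseteq> W \<and> (\<forall>y\<in>U. P y)"
proof -
 obtain U where U: "zopen X U" "U ~= {}" "\<forall>y\<in>U. P y" using assms(1) unfolding eventually_generic by blast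
 show ?thesis using open_Int_nonempty[OF U(1,2) assms(2,3)] U assms by (intro exI[of _ "U \<inter> W"]) auto
qed

text \<open>The set where \<open>f\<close> and \<open>g\<close> differ is open, so if nonempty it
  meets the open set on which they agree. This is what allows generic identities to be evaluated at
  a given point.\<close>

lemma reg_identity:
 assumes W: "zopen X W" and f: "f \<in> reg X W" "g \<in> reg X W"
  and ev: "GEN y. f y = g y" and y: "y \<in> W"
 shows "f y = g y"
proof (rule ccontr)
 assume ne: "f y ~= g y"
 have d: "(%y. f y - g y) \<in> reg X W" by (rule reg_diff[OF var W f])
 let ?V = "{y\<in>W. f y - g y ~= 0}"
 have o: "zopen X ?V" by (rule open_nonzero[OF var W d])
 have n: "?V ~= {}" using ne y by auto
 obtain U where "U ~= {}" "U \<subseteq> ?V" "\<forall>y\<in>U. f y = g y"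
  using eventually_generic_Int[OF ev o n] by (elim exE conjE)
 then show False by auto
qed

lemma generic_not_bot: "generic X ~= bot"
 unfolding trivial_limit_def eventually_generic by auto

lemma ratfunI: "zopen X U ==> x \<in> U ==> f \<in> reg X U ==> f \<in> ratfun X"
 unfolding ratfun_def by blast

lemma reg_at_ratfun: "f \<in> reg_at X x ==> f \<in> ratfun X"
 unfolding ratfun_def reg_at_def by blast

lemma reg_dichotomy:
 assumes W: "zopen X W" and f: "f \<in> reg X W"
 shows "(\<forall>y\<in>W. f y = 0) \<or> (GEN y. f y ~= 0)"
 using open_nonzero[OF var W f] unfolding eventually_generic by blast

lemma ratfun_common:
 assumes "f \<in> ratfun X" "g \<in> ratfun X"
 obtains U where "zopen X U" "U ~= {}" "f \<in> reg X U" "g \<in> reg X U"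
proof -
 obtain U V where UV: "zopen X U" "U ~= {}" "f \<in> reg X U" "zopen X V" "V ~= {}" "g \<in> reg X V"
  using assms unfolding ratfun_def by blast
 have "zopen X (U \<inter> V)" "U \<inter> V ~= {}" using open_Int_nonempty UV by auto
 then show thesis
  by (rule that) (use UV in "auto intro: reg_restrict[OF var UV(1)] reg_restrict[OF var UV(4)]")
qed

sublocale rat: generic_field "generic X" "ratfun X"
proof
 show "generic X ~= bot" by (rule generic_not_bot)
 show "(%_. c) \<in> ratfun X" for c
  using reg_const[OF var openin_topspace] points_nonempty openin_topspace unfolding ratfun_def by blast
 fix f assume f: "f \<in> ratfun X"
 then obtain U where U: "zopen X U" "U ~= {}" "f \<in> reg X U" unfolding ratfun_def by blast
 have "GEN y. f y = 0" if "\<forall>y\<in>U. f y = 0"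
  unfolding eventually_generic using that U by blast
 then show "(GEN y. f y = 0) \<or> (GEN y. f y ~= 0)"
  using reg_dichotomy[OF U(1,3)] by blast
 show "(%y. inverse (f y)) \<in> ratfun X"
 proof (cases "\<forall>y\<in>U. f y = 0")
  case True
  then have "(%y. inverse (f y)) \<in> reg X U"
   by (intro reg_cong[OF var U(1) reg_const[OF var U(1), of 0]]) auto
  then show ?thesis using U unfolding ratfun_def by blast
 next
  case False
  then obtain x where x: "x \<in> U" "f x ~= 0" by blast
  show ?thesis
   by (rule reg_nonzero_inverse[OF var U(1,3) x]) (rule ratfunI)
 qed
 fix g assume g: "g \<in> ratfun X"
 obtain V where V: "zopen X V" "V ~= {}" "f \<in> reg X V" "g \<in> reg X V"
  using ratfun_common[OF f g] .
 then obtain x where x: "x \<in> V" by blast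
 show "(%y. f y + g y) \<in> ratfun X" by (rule ratfunI[OF V(1) x reg_add[OF var V(1,3,4)]])
 show "(%y. f y * g y) \<in> ratfun X" by (rule ratfunI[OF V(1) x reg_mult[OF var V(1,3,4)]])
qed

lemma ev_reg_at_nbhd:
 assumes f: "f \<in> reg_at X x" and g: "g \<in> reg_at X x" and ev: "GEN y. f y = g y"
 obtains U where "zopen X U" "x \<in> U" "f \<in> reg X U" "g \<in> reg X U" "\<And>y. y \<in> U ==> f y = g y"
proof -
 obtain U V where UV: "zopen X U" "x \<in> U" "f \<in> reg X U" "zopen X V" "x \<in> V" "g \<in> reg X V"
  using f g unfolding reg_at_def by blast
 have o: "zopen X (U \<inter> V)" using UV by auto
 have fg: "f \<in> reg X (U \<inter> V)" "g \<in> reg X (U \<inter> V)"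
  using UV o by (auto intro: reg_restrict[OF var UV(1)] reg_restrict[OF var UV(4)])
 show thesis by (rule that[OF o _ fg reg_identity[OF o fg ev]]) (use UV in auto)
qed

lemma near_eq_iff:
 assumes f: "f \<in> reg_at X x" and g: "g \<in> reg_at X x"
 shows "near_eq X x f g \<longleftrightarrow> (GEN y. f y = g y)"
proof
 assume "near_eq X x f g"
 then obtain U where "zopen X U" "x \<in> U" "\<forall>y\<in>U. f y = g y" unfolding near_eq_def by (elim exE conjE)
 then show "GEN y. f y = g y" by (intro eventually_genericI[of U x]) auto
next
 assume "GEN y. f y = g y"
 then show "near_eq X x f g"
  by (rule ev_reg_at_nbhd[OF f g]) (auto simp: near_eq_def)
qed

lemma reg_at_ev_cong:
 assumes "f \<in> reg_at X x" "zopen X U" "x \<in> U" "\<And>y. y \<in> U ==> g y = f y"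
 shows "g \<in> reg_at X x"
proof -
 obtain V where V: "zopen X V" "x \<in> V" "f \<in> reg X V" using reg_atE[OF var assms(1)] .
 have o: "zopen X (U \<inter> V)" using V assms by auto
 have "f \<in> reg X (U \<inter> V)" by (rule reg_restrict[OF var V(1) o _ V(3)]) auto
 then have "g \<in> reg X (U \<inter> V)" by (rule reg_cong[OF var o]) (use assms in auto)
 then show ?thesis using o V assms unfolding reg_at_def by blast
qed

lemma generic_ring_reg_at:
 assumes x: "x \<in> points X"
 shows "generic_ring (generic X) (reg_at X x)"
proof
 show "generic X ~= bot" by (rule generic_not_bot)
 show "(%_. c) \<in> reg_at X x" for c by (rule reg_at_ring(1)[OF var x])
 show "(%y. f y + g y) \<in> reg_at X x" "(%y. f y * g y) \<in> reg_at X x" if "f \<in> reg_at X x" "g \<in> reg_at X x" for f g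
  using reg_at_ring(2,3)[OF var x that] by (simp_all add: plus_fun_def times_fun_def)
 show "(GEN y. f y = 0) \<or> (GEN y. f y ~= 0)" if "f \<in> reg_at X x" for f
  by (rule rat.dichotomy[OF reg_at_ratfun[OF that]])
qed

lemma generic_local_ring_reg_at:
 assumes x: "x \<in> points X"
 shows "generic_local_ring (generic X) (reg_at X x) x"
proof -
 interpret generic_ring "generic X" "reg_at X x" by (rule generic_ring_reg_at[OF x])
 have inv: "(%y. inverse (f y)) \<in> reg_at X x" if f: "f \<in> reg_at X x" "f x ~= 0" for f
 proof -
  obtain U where U: "zopen X U" "x \<in> U" "f \<in> reg X U" using reg_atE[OF var f(1)] .
  show ?thesis
   by (rule reg_nonzero_inverse[OF var U(1,3,2) f(2)]) (auto simp: reg_at_def)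
 qed
 show ?thesis
 proof
  show "(%y. inverse (f y)) \<in> reg_at X x" if f: "f \<in> reg_at X x" "f x ~= 0" for f by (rule inv[OF f])
  show "f x = g x" if "f \<in> reg_at X x" "g \<in> reg_at X x" "GEN y. f y = g y" for f g
   using ev_reg_at_nbhd[OF that] by blast
  fix J assume J: "\<And>n. idealR (J n)" "\<And>n. J n \<subseteq> J (Suc n)"
  obtain U n \<phi> where U: "chart X U n \<phi>" "x \<in> U" using chart_nbhd[OF var x] .
  \<comment> \<open>An ideal of the local ring is determined by its polynomial numerators, so the
    chain condition is inherited from polynomials.\<close>
  define I where "I k = {F\<in>polyfun n. (%y. F (\<phi> y)) \<in> J k}" for k
  note pr = poly_reg_at[OF var U]
  have "poly_ideal n (I k)" for k
   unfolding poly_ideal_def I_def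
   using idealR_rules[OF J(1)[of k]] pr by (auto intro: polyfun_rules)
  moreover have "I k \<subseteq> I (Suc k)" for k unfolding I_def using J(2) by blast
  ultimately have "\<exists>N. \<forall>k\<ge>N. I k = I N" by (rule polyfun_acc)
  then obtain N where "\<forall>k\<ge>N. I k = I N" by (elim exE)
  then have N: "I (Suc N) = I N" by (elim allE[of _ "Suc N"] impE) auto
  have "J (Suc N) \<subseteq> J N"
  proof
   fix f assume fJ: "f \<in> J (Suc N)"
   have f: "f \<in> reg_at X x" using idealR_rules(1)[OF J(1)] fJ by blast
   obtain a b W where ab: "a \<in> polyfun n" "b \<in> polyfun n" "zopen X W" "x \<in> W" "W \<subseteq> U"
    "\<forall>y\<in>W. b (\<phi> y) ~= 0 \<and> f y = a (\<phi> y) / b (\<phi> y)"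
    using reg_at_fraction[OF var U f] .
   have "(%y. b (\<phi> y) * f y) \<in> J (Suc N)" by (rule idealR_rules(4)[OF J(1) pr[OF ab(2)] fJ])
   then have "(%y. a (\<phi> y)) \<in> J (Suc N)"
    by (rule idealR_ev_eq[OF J(1) _ pr[OF ab(1)]])
     (rule eventually_genericI[OF ab(3,4)], use ab(6) in auto)
   then have "a \<in> I (Suc N)" using ab(1) unfolding I_def by simp
   then have "(%y. a (\<phi> y)) \<in> J N" unfolding N unfolding I_def by simp
   moreover have "(%y. inverse (b (\<phi> y))) \<in> reg_at X x" using inv[OF pr[OF ab(2)]] ab(4,6) by simp
   ultimately have "(%y. inverse (b (\<phi> y)) * a (\<phi> y)) \<in> J N" using idealR_rules(4)[OF J(1)] by blast
   then show "f \<in> J N"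
    by (rule idealR_ev_eq[OF J(1) _ f])
     (rule eventually_genericI[OF ab(3,4)], use ab(6) in "auto simp: field_simps")
  qed
  then show "\<exists>N. J (Suc N) = J N" using J(2)[of N] by blast
 qed
qed

text \<open>The Nullstellensatz in the local ring at \<open>x\<close>. The function \<open>g\<close> cuts out a neighbourhood on
  which everything is a quotient of polynomials.\<close>

lemma local_nullstellensatz:
 assumes x: "x \<in> points X" and q: "q \<in> reg_at X x" and f: "f \<in> reg_at X x"
  and W: "zopen X W" "x \<in> W" "\<And>y. y \<in> W ==> q y = 0 ==> f y = 0"
 shows "\<exists>k. \<exists>c\<in>reg_at X x. GEN y. f y ^ k = q y * c y"
proof -
 interpret R: generic_local_ring "generic X" "reg_at X x" x by (rule generic_local_ring_reg_at[OF x])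
 obtain U n \<phi> where U: "chart X U n \<phi>" "x \<in> U" using chart_nbhd[OF var x] .
 note rules = chart_rules[OF U(1)]
 note pr = poly_reg_at[OF var U]
 obtain a b W1 where ab: "a \<in> polyfun n" "b \<in> polyfun n" "zopen X W1" "x \<in> W1" "W1 \<subseteq> U"
  "\<forall>y\<in>W1. b (\<phi> y) ~= 0 \<and> q y = a (\<phi> y) / b (\<phi> y)"
  using reg_at_fraction[OF var U q] .
 obtain a' b' W2 where ab': "a' \<in> polyfun n" "b' \<in> polyfun n" "zopen X W2" "x \<in> W2" "W2 \<subseteq> U"
  "\<forall>y\<in>W2. b' (\<phi> y) ~= 0 \<and> f y = a' (\<phi> y) / b' (\<phi> y)"
  using reg_at_fraction[OF var U f] .
 let ?V = "W \<inter> W1 \<inter> W2"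
 have V: "zopen X ?V" "?V \<subseteq> U" "x \<in> ?V" using W ab ab' by auto
 obtain g where g: "g \<in> polyfun n" "g (\<phi> x) ~= 0" "{y'\<in>U. g (\<phi> y') ~= 0} \<subseteq> ?V"
  using rules(6)[OF V] by blast
 \<comment> \<open>Polynomials that agree on the chart with a multiple of \<open>a\<close>. Those
   vanishing on the chart belong to it, so its zeros in \<open>cspace n\<close> come from points of
   the chart at which \<open>a\<close> is zero.\<close>
 define I where "I = {F\<in>polyfun n. \<exists>c\<in>polyfun n. \<forall>y\<in>U. F (\<phi> y) = a (\<phi> y) * c (\<phi> y)}"
 have I: "poly_ideal n I"
  unfolding poly_ideal_def
 proof (intro conjI ballI)
  show "(%_. 0) \<in> I" unfolding I_def by (auto intro: polyfun.const bexI[of _ "%_. 0"])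
  fix h k assume "k \<in> I"
  then obtain c where k: "k \<in> polyfun n" "c \<in> polyfun n" "\<forall>y\<in>U. k (\<phi> y) = a (\<phi> y) * c (\<phi> y)"
   unfolding I_def by auto
  {
   assume "h \<in> I"
   then obtain c' where h: "h \<in> polyfun n" "c' \<in> polyfun n" "\<forall>y\<in>U. h (\<phi> y) = a (\<phi> y) * c' (\<phi> y)"
    unfolding I_def by auto
   show "(%z. h z + k z) \<in> I" unfolding I_def
    by (intro CollectI conjI bexI[OF _ polyfun_add[OF h(2) k(2)]] polyfun_add h k)
     (simp add: h(3) k(3) distrib_left)
  next
   assume h: "h \<in> polyfun n"
   show "(%z. h z * k z) \<in> I" unfolding I_def
    by (intro CollectI conjI bexI[OF _ polyfun_mult[OF h k(2)]] polyfun_mult h k) (simp add: k(3))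
  }
 qed (auto simp: I_def)
 have "\<exists>k. (%z. (a' z * g z) ^ k) \<in> I"
 proof (rule nullstellensatz[OF I polyfun_mult[OF ab'(1) g(1)]])
  fix z assume z: "z \<in> cspace n" "\<And>F. F \<in> I ==> F z = 0"
  have "F \<in> I" if "F \<in> polyfun n" "\<And>y. y \<in> U ==> F (\<phi> y) = 0" for F
   unfolding I_def using that by (auto intro!: bexI[of _ "%_. 0"] polyfun.const)
  then have "z \<in> \<phi> ` U" using rules(4)[OF z(1)] z(2) by blast
  then obtain y where y: "y \<in> U" "z = \<phi> y" by blast
  have "a \<in> I" unfolding I_def by (intro CollectI conjI ab(1) bexI[of _ "%_. 1"]) (auto intro: polyfun.const)
  then have a0: "a (\<phi> y) = 0" using z(2) y by blast
  show "a' z * g z = 0"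
  proof (cases "g z = 0")
   case False
   then have yV: "y \<in> ?V" using g(3) y by auto
   then have "q y = 0" using bspec[OF ab(6), of y] a0 by auto
   then have "f y = 0" using W(3) yV by auto
   then show ?thesis using bspec[OF ab'(6), of y] yV y(2) by auto
  qed simp
 qed
 then obtain k c where kc: "c \<in> polyfun n" "\<forall>y\<in>U. (a' (\<phi> y) * g (\<phi> y)) ^ k = a (\<phi> y) * c (\<phi> y)"
  unfolding I_def by auto
 define d where "d = (%y. b (\<phi> y) * c (\<phi> y) * inverse ((b' (\<phi> y) * g (\<phi> y)) ^ k))"
 have "b' (\<phi> x) ~= 0" using ab'(4,6) by blast
 then have dR: "d \<in> reg_at X x" unfolding d_def
  by (intro R.mult_R R.inverse_R R.power_R pr ab ab' g kc) (use g(2) in auto)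
 have "GEN y. f y ^ k = q y * d y"
 proof (rule eventually_genericI)
  let ?D = "{y'\<in>U. g (\<phi> y') ~= 0}"
  show "zopen X ?D" by (rule rules(5)[OF g(1)])
  show "x \<in> ?D" using U g by auto
  fix y assume y: "y \<in> ?D"
  then have "y \<in> W1" "y \<in> W2" using g(3) by auto
  then have "b (\<phi> y) ~= 0" "q y = a (\<phi> y) / b (\<phi> y)" "b' (\<phi> y) ~= 0" "f y = a' (\<phi> y) / b' (\<phi> y)"
   using ab(6) ab'(6) by auto
  note e = this
  have "g (\<phi> y) ~= 0" using y by simp
  have "f y ^ k * (b' (\<phi> y) * g (\<phi> y)) ^ k = (a' (\<phi> y) * g (\<phi> y)) ^ k"
   using e(3,4) by (simp add: power_mult_distrib power_divide)
  also have "\<dots> = q y * (b (\<phi> y) * c (\<phi> y))" using kc(2) y e(1,2) by simp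
  finally show "f y ^ k = q y * d y"
   using e(3) \<open>g (\<phi> y) ~= 0\<close> unfolding d_def by (simp add: field_simps)
 qed
 with dR show ?thesis by blast
qed

end

section \<open>Stalks of the symmetric algebra\<close>

definition near :: "'a fspace => 'a => 'a filter" where
 "near X x = (INF U\<in>{U. zopen X U \<and> x \<in> U}. principal U)"

lemma eventually_near:
 assumes "x \<in> points X"
 shows "eventually P (near X x) \<longleftrightarrow> (\<exists>U. zopen X U \<and> x \<in> U \<and> (\<forall>y\<in>U. P y))"
 unfolding near_def
proof (subst eventually_INF_base)
 show "{U. zopen X U \<and> x \<in> U} ~= {}" using assms by auto
 fix A B assume "A \<in> {U. zopen X U \<and> x \<in> U}" "B \<in> {U. zopen X U \<and> x \<in> U}"
 then show "\<exists>U\<in>{U. zopen X U \<and> x \<in> U}. principal U \<le> inf (principal A) (principal B)"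
  by (intro bexI[of _ "A \<inter> B"]) auto
qed (auto simp: eventually_principal)

text \<open>Membership in a span inside the stalk. \<open>Q\<close> pairs each generator with its
  admissible coefficients, so that a mixed span such as R S + \<mm> W, the one in Nakayama's lemma,
  is a single instance.\<close>

inductive lin :: "'a fspace => 'a => (('a => complex) \<times> 'a sexp) set => 'a sexp => bool" for X x Q where
 lin_zero: "lin X x Q (Fn (%_. 0))"
| lin_mem: "(c, s) \<in> Q ==> lin X x Q (Times (Fn c) s)"
| lin_plus: "lin X x Q s ==> lin X x Q t ==> lin X x Q (Plus s t)"
| lin_eq: "lin X x Q s ==> sym_eq X x s t ==> lin X x Q t"

lemma lin_trans:
 assumes "lin X x Q s" "\<And>c w. (c, w) \<in> Q ==> lin X x Q' (Times (Fn c) w)"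
 shows "lin X x Q' s"
 using assms(1)
proof induction
 case (lin_mem c s)
 then show ?case by (rule assms(2))
qed (auto intro: lin.intros)

lemma lin_mono: "lin X x Q s ==> Q \<subseteq> Q' ==> lin X x Q' s"
 by (erule lin_trans) (auto intro: lin.intros)

locale variety_point =
 fixes X :: "'a fspace" and x :: 'a
 assumes var: "variety X" and pt: "x \<in> points X"
begin

abbreviation R :: "('a => complex) set" where "R \<equiv> reg_at X x"
abbreviation \<mm> :: "('a => complex) set" where "\<mm> \<equiv> {f \<in> R. f x = 0}"
abbreviation seq :: "'a sexp => 'a sexp => bool" (infix "\<sim>" 50) where "s \<sim> t \<equiv> sym_eq X x s t"
abbreviation wf :: "'a sexp => bool" where "wf t \<equiv> sexp_at X x t"

lemma near_iff: "eventually P (near X x) \<longleftrightarrow> (\<exists>U. zopen X U \<and> x \<in> U \<and> (\<forall>y\<in>U. P y))"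
 by (rule eventually_near[OF pt])

lemma R_const [simp]: "(%_. c) \<in> R"
 by (rule reg_at_ring(1)[OF var pt])

lemma R_add: "f \<in> R ==> g \<in> R ==> (%y. f y + g y) \<in> R"
 and R_mult: "f \<in> R ==> g \<in> R ==> (%y. f y * g y) \<in> R"
 using reg_at_ring(2,3)[OF var pt, of f g] by (simp_all add: plus_fun_def times_fun_def)

lemma R_minus: "f \<in> R ==> (%y. - f y) \<in> R"
 using R_mult[of "%_. -1" f] by simp

lemma R_diff: "f \<in> R ==> g \<in> R ==> (%y. f y - g y) \<in> R"
 using R_add[OF _ R_minus, of f g] by simp

lemma R_inverse:
 assumes "f \<in> R" "f x ~= 0"
 shows "(%y. inverse (f y)) \<in> R" "\<forall>\<^sub>F y in near X x. f y ~= 0"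
proof -
 obtain U where U: "zopen X U" "x \<in> U" "f \<in> reg X U" using reg_atE[OF var assms(1)] .
 obtain V where V: "zopen X V" "x \<in> V" "V \<subseteq> U" "\<forall>y\<in>V. f y ~= 0" "(%y. inverse (f y)) \<in> reg X V"
  using reg_nonzero_inverse[OF var U(1,3,2) assms(2)] .
 then show "(%y. inverse (f y)) \<in> R" unfolding reg_at_def by blast
 show "\<forall>\<^sub>F y in near X x. f y ~= 0" unfolding near_iff using V by blast
qed

lemmas R_rules = R_const R_add R_mult R_minus R_diff

lemma near_eqI: "\<forall>\<^sub>F y in near X x. f y = g y ==> near_eq X x f g"
 unfolding near_iff near_eq_def .

lemma Fn_cong:
 assumes "f \<in> R" "g \<in> R" "\<forall>\<^sub>F y in near X x. f y = g y"
 shows "Fn f \<sim> Fn g" "Dif f \<sim> Dif g"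
 using sym_eq.fn_germ[OF assms(1,2) near_eqI[OF assms(3)]]
  sym_eq.dif_germ[OF assms(1,2) near_eqI[OF assms(3)]] by auto

lemma Fn_plus: "f \<in> R ==> g \<in> R ==> Plus (Fn f) (Fn g) \<sim> Fn (%y. f y + g y)"
 using sym_eq.fn_plus[of f X x g] by (simp add: plus_fun_def)

lemma Fn_times: "f \<in> R ==> g \<in> R ==> Times (Fn f) (Fn g) \<sim> Fn (%y. f y * g y)"
 using sym_eq.fn_times[of f X x g] by (simp add: times_fun_def)

lemma Dif_plus: "f \<in> R ==> g \<in> R ==> Dif (%y. f y + g y) \<sim> Plus (Dif f) (Dif g)"
 using sym_eq.dif_plus[of f X x g] by (simp add: plus_fun_def)

lemma Dif_times: "f \<in> R ==> g \<in> R ==>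
  Dif (%y. f y * g y) \<sim> Plus (Times (Fn f) (Dif g)) (Times (Fn g) (Dif f))"
 using sym_eq.dif_times[of f X x g] by (simp add: times_fun_def)

lemma Dif_const: "Dif (%_. c) \<sim> Fn (%_. 0)"
 by (rule sym_eq.dif_const) simp_all

lemma wf_seq: "s \<sim> t ==> wf s" "s \<sim> t ==> wf t"
 using sym_eq_sexp_at[OF var pt] by auto

lemma plus_congL: "s \<sim> s' ==> wf t ==> Plus s t \<sim> Plus s' t"
 and plus_congR: "t \<sim> t' ==> wf s ==> Plus s t \<sim> Plus s t'"
 and times_congL: "s \<sim> s' ==> wf t ==> Times s t \<sim> Times s' t"
 and times_congR: "t \<sim> t' ==> wf s ==> Times s t \<sim> Times s t'"
 by (auto intro: sym_eq.intros)

lemma plus_zeroL: "wf t ==> Plus (Fn (%_. 0)) t \<sim> t"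
 by (rule sym_eq.plus_zero) simp_all

lemma plus_zeroR:
 assumes "wf t" shows "Plus t (Fn (%_. 0)) \<sim> t"
proof -
 have "Plus t (Fn (%_. 0)) \<sim> Plus (Fn (%_. 0)) t" using assms by (intro sym_eq.plus_comm) simp_all
 also have "\<dots> \<sim> t" by (rule plus_zeroL[OF assms])
 finally show ?thesis .
qed

lemma times_zeroL: "wf t ==> Times (Fn (%_. 0)) t \<sim> Fn (%_. 0)"
 by (rule sym_eq.times_zero) simp_all

lemma times_oneL: "wf t ==> Times (Fn (%_. 1)) t \<sim> t"
 by (rule sym_eq.times_one) simp_all

lemma times_zeroR:
 assumes "wf t" shows "Times t (Fn (%_. 0)) \<sim> Fn (%_. 0)"
proof -
 have "Times t (Fn (%_. 0)) \<sim> Times (Fn (%_. 0)) t" using assms by (intro sym_eq.times_comm) simp_all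
 also have "\<dots> \<sim> Fn (%_. 0)" by (rule times_zeroL[OF assms])
 finally show ?thesis .
qed

lemma scale_scale:
 assumes "c \<in> R" "d \<in> R" "wf s"
 shows "Times (Fn c) (Times (Fn d) s) \<sim> Times (Fn (%y. c y * d y)) s"
proof -
 have "Times (Fn c) (Times (Fn d) s) \<sim> Times (Times (Fn c) (Fn d)) s"
  using assms by (intro sym_eq.sym[OF sym_eq.times_assoc]) simp_all
 also have "\<dots> \<sim> Times (Fn (%y. c y * d y)) s" by (intro times_congL Fn_times assms)
 finally show ?thesis .
qed

lemma scale_add:
 assumes "c \<in> R" "d \<in> R" "wf s"
 shows "Plus (Times (Fn c) s) (Times (Fn d) s) \<sim> Times (Fn (%y. c y + d y)) s"
proof -
 have "Plus (Times (Fn c) s) (Times (Fn d) s) \<sim> Times (Plus (Fn c) (Fn d)) s"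
  using assms by (intro sym_eq.sym[OF sym_eq_distrib2]) simp_all
 also have "\<dots> \<sim> Times (Fn (%y. c y + d y)) s" by (intro times_congL Fn_plus assms)
 finally show ?thesis .
qed

lemma scale_distrib:
 assumes "c \<in> R" "wf s" "wf t"
 shows "Times (Fn c) (Plus s t) \<sim> Plus (Times (Fn c) s) (Times (Fn c) t)"
 using assms by (intro sym_eq.distrib) simp_all

lemma cancel_minus:
 assumes "c \<in> R" "wf w" "wf s"
 shows "Plus (Plus s (Times (Fn c) w)) (Times (Fn (%y. - c y)) w) \<sim> s"
proof -
 let ?a = "Times (Fn c) w" and ?b = "Times (Fn (%y. - c y)) w"
 have "Plus (Plus s ?a) ?b \<sim> Plus s (Plus ?a ?b)"
  using assms R_minus by (intro sym_eq.plus_assoc) simp_all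
 also have "\<dots> \<sim> Plus s (Times (Fn (%y. c y + - c y)) w)"
  using assms R_minus by (intro plus_congR scale_add) simp_all
 also have "\<dots> \<sim> Plus s (Fn (%_. 0))"
  using assms times_zeroL[of w] by (intro plus_congR) simp_all
 also have "\<dots> \<sim> s" by (rule plus_zeroR[OF assms(3)])
 finally show ?thesis .
qed

lemma scale_inverse:
 assumes "c \<in> R" "c x ~= 0" "wf w"
 shows "Times (Fn (%y. inverse (c y))) (Times (Fn c) w) \<sim> w"
proof -
 have "Times (Fn (%y. inverse (c y))) (Times (Fn c) w) \<sim> Times (Fn (%y. inverse (c y) * c y)) w"
  by (rule scale_scale[OF R_inverse(1)[OF assms(1,2)] assms(1,3)])
 also have "\<dots> \<sim> Times (Fn (%_. 1)) w"
 proof (intro times_congL Fn_cong assms R_mult R_inverse R_const)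
  show "\<forall>\<^sub>F y in near X x. inverse (c y) * c y = 1"
   using R_inverse(2)[OF assms(1,2)] by eventually_elim simp
 qed
 also have "\<dots> \<sim> w" by (rule times_oneL[OF assms(3)])
 finally show ?thesis .
qed

lemma lin_wf:
 assumes "lin X x Q s" "\<And>c w. (c, w) \<in> Q ==> c \<in> R \<and> wf w"
 shows "wf s"
 using assms(1) by induction (use assms(2) wf_seq in auto)

lemma lin_scale:
 assumes "lin X x Q s" "d \<in> R" "\<And>c w. (c, w) \<in> Q ==> c \<in> R \<and> wf w"
  and "\<And>c w. (c, w) \<in> Q ==> ((%y. d y * c y), w) \<in> Q'"
 shows "lin X x Q' (Times (Fn d) s)"
 using assms(1)
proof induction
 case lin_zero
 show ?case by (rule lin_eq[OF lin.lin_zero sym_eq.sym[OF times_zeroR]]) (use assms(2) in simp)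
next
 case (lin_mem c s)
 show ?case
  by (rule lin_eq[OF lin.lin_mem[OF assms(4)[OF lin_mem]] sym_eq.sym[OF scale_scale]])
   (use assms lin_mem in auto)
next
 case (lin_plus s t)
 show ?case
  by (rule lin_eq[OF lin.lin_plus[OF lin_plus.IH] sym_eq.sym[OF scale_distrib[OF assms(2)]]])
   (use lin_wf lin_plus.hyps assms(3) in auto)
next
 case (lin_eq s t)
 show ?case by (rule lin.lin_eq[OF lin_eq.IH times_congR[OF lin_eq.hyps(2)]]) (use assms(2) in simp)
qed

text \<open>Gathers all multiples of one generator into a single coefficient, which stays in
  \<open>I\<close>.\<close>

lemma lin_insert:
 assumes "lin X x (Q \<union> I \<times> {w}) s" and w: "wf w" and Q: "\<And>c w. (c, w) \<in> Q ==> c \<in> R \<and> wf w"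
  and I: "I \<subseteq> R" "(%_. 0) \<in> I" "\<And>f g. f \<in> I ==> g \<in> I ==> (%y. f y + g y) \<in> I"
 shows "\<exists>s0 c. lin X x Q s0 \<and> c \<in> I \<and> s \<sim> Plus s0 (Times (Fn c) w)"
 using assms(1)
proof induction
 case lin_zero
 have "Fn (%_. 0) \<sim> Plus (Fn (%_. 0)) (Times (Fn (%_. 0)) w)"
  using w by (intro sym_eq.sym[OF sym_eq.trans[OF plus_congR[OF times_zeroL] plus_zeroL]]) simp_all
 then show ?case
  by (intro exI[of _ "Fn (%_. 0)"] exI[of _ "%_. 0"] conjI lin.lin_zero I(2))
next
 case (lin_mem c s)
 show ?case
 proof (cases "(c, s) \<in> Q")
  case True
  have wfs: "wf (Times (Fn c) s)" using Q[OF True] by simp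
  have "Times (Fn c) s \<sim> Plus (Times (Fn c) s) (Times (Fn (%_. 0)) w)"
   using w wfs by (intro sym_eq.sym[OF sym_eq.trans[OF plus_congR[OF times_zeroL] plus_zeroR]]) simp_all
  then show ?thesis
   by (intro exI[of _ "Times (Fn c) s"] exI[of _ "%_. 0"] conjI lin.lin_mem[OF True] I(2))
 next
  case False
  then have c: "c \<in> I" "s = w" using lin_mem by auto
  have "Times (Fn c) w \<sim> Plus (Fn (%_. 0)) (Times (Fn c) w)"
   using w c I(1) by (intro sym_eq.sym[OF plus_zeroL]) auto
  then show ?thesis unfolding c(2)
   by (intro exI[of _ "Fn (%_. 0)"] exI[of _ c] conjI lin.lin_zero c(1))
 qed
next
 case (lin_plus s t)
 then obtain s0 c t0 d where *: "lin X x Q s0" "c \<in> I" "s \<sim> Plus s0 (Times (Fn c) w)"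
  "lin X x Q t0" "d \<in> I" "t \<sim> Plus t0 (Times (Fn d) w)" by blast
 have wfs: "wf s0" "wf t0" using lin_wf[OF *(1) Q] lin_wf[OF *(4) Q] by auto
 have cd: "c \<in> R" "d \<in> R" using * I by auto
 have "Plus s t \<sim> Plus (Plus s0 (Times (Fn c) w)) (Plus t0 (Times (Fn d) w))"
  by (rule sym_eq.cong_plus[OF *(3,6)])
 also have "\<dots> \<sim> Plus (Plus s0 t0) (Plus (Times (Fn c) w) (Times (Fn d) w))"
  using wfs cd w by (intro sym_eq_plus_swap) simp_all
 also have "\<dots> \<sim> Plus (Plus s0 t0) (Times (Fn (%y. c y + d y)) w)"
  using wfs cd w by (intro plus_congR scale_add) simp_all
 finally show ?case
  by (intro exI[of _ "Plus s0 t0"] exI[of _ "%y. c y + d y"] conjI lin.lin_plus[OF *(1,4)] I(3)[OF *(2,5)])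
next
 case (lin_eq s t)
 then show ?case by (meson sym_eq.sym sym_eq.trans)
qed

text \<open>The elements of \<open>W\<close> are eliminated one at a time: w = s + c w with c(x) = 0
  can be solved for w because 1 - c is a unit.\<close>

lemma nakayama:
 assumes "finite W" "\<And>s. s \<in> S ==> wf s" "\<And>w. w \<in> W ==> wf w"
  and "\<And>w. w \<in> W ==> lin X x (R \<times> S \<union> \<mm> \<times> W) w"
 shows "\<forall>w\<in>W. lin X x (R \<times> S) w"
 using assms(1,3,4)
proof (induction W rule: finite_induct)
 case (insert w W)
 let ?Q = "R \<times> S \<union> \<mm> \<times> W"
 have w: "wf w" and W: "\<And>w'. w' \<in> W ==> wf w'" using insert.prems(1) by auto
 have Q: "c \<in> R \<and> wf w'" if "(c, w') \<in> ?Q" for c w' using that assms(2) W by auto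
 have scale: "lin X x ?Q (Times (Fn d) s)" if "lin X x ?Q s" "d \<in> R" for d s
  by (rule lin_scale[OF that(1,2) Q]) (use that(2) R_mult in auto)
 have eq: "R \<times> S \<union> \<mm> \<times> insert w W = ?Q \<union> \<mm> \<times> {w}" by auto
 have "\<exists>s0 c. lin X x ?Q s0 \<and> c \<in> \<mm> \<and> w \<sim> Plus s0 (Times (Fn c) w)"
  by (rule lin_insert[OF _ w Q]) (use insert.prems(2)[of w] R_add in "auto simp: eq")
 then obtain s0 c where s0: "lin X x ?Q s0" "c \<in> \<mm>" "w \<sim> Plus s0 (Times (Fn c) w)" by blast
 have wf0: "wf s0" by (rule lin_wf[OF s0(1) Q])
 have c: "c \<in> R" "c x = 0" using s0(2) by auto
 have d: "(%y. 1 - c y) \<in> R" "(%y. 1 - c y) x ~= 0" using c R_diff by auto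
 have "Times (Fn (%y. 1 + - c y)) w \<sim> Plus (Times (Fn (%_. 1)) w) (Times (Fn (%y. - c y)) w)"
  using c w R_minus by (intro sym_eq.sym[OF scale_add]) auto
 also have "\<dots> \<sim> Plus w (Times (Fn (%y. - c y)) w)"
  using c w R_minus by (intro plus_congL times_oneL) auto
 also have "\<dots> \<sim> Plus (Plus s0 (Times (Fn c) w)) (Times (Fn (%y. - c y)) w)"
  using c w R_minus by (intro plus_congL s0(3)) auto
 also have "\<dots> \<sim> s0" by (rule cancel_minus[OF c(1) w wf0])
 finally have 1: "Times (Fn (%y. 1 - c y)) w \<sim> s0" by simp
 have "Times (Fn (%y. inverse (1 - c y))) s0 \<sim> Times (Fn (%y. inverse (1 - c y))) (Times (Fn (%y. 1 - c y)) w)"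
  using R_inverse(1)[OF d] by (intro times_congR sym_eq.sym[OF 1]) simp
 also have "\<dots> \<sim> w" by (rule scale_inverse[OF d w])
 finally have lw: "lin X x ?Q w"
  using scale[OF s0(1) R_inverse(1)[OF d]] by (rule lin_eq[rotated])
 have "\<forall>w'\<in>W. lin X x (R \<times> S) w'"
 proof (rule insert.IH[OF W])
  fix w' assume "w' \<in> W"
  then have "lin X x (R \<times> S \<union> \<mm> \<times> insert w W) w'" by (intro insert.prems(2)) simp
  then show "lin X x ?Q w'"
  proof (rule lin_trans)
   fix c s assume "(c, s) \<in> R \<times> S \<union> \<mm> \<times> insert w W"
   then consider "(c, s) \<in> ?Q" | "c \<in> R" "s = w" by auto
   then show "lin X x ?Q (Times (Fn c) s)"
    by cases (auto intro: lin_mem scale lw)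
  qed
 qed
 moreover from lw have "lin X x (R \<times> S) w"
 proof (rule lin_trans)
  fix c s assume cs: "(c, s) \<in> ?Q"
  show "lin X x (R \<times> S) (Times (Fn c) s)"
  proof (cases "(c, s) \<in> R \<times> S")
   case False
   then have "c \<in> R" "s \<in> W" using cs by auto
   then show ?thesis using calculation
    by (intro lin_scale[of "R \<times> S"]) (use assms(2) R_mult in auto)
  qed (rule lin_mem)
 qed
 ultimately show ?case by simp
qed simp

lemma lin_pair:
 assumes "lin X x (R \<times> {s, t}) w" "wf s" "wf t"
 obtains a b where "a \<in> R" "b \<in> R" "w \<sim> Plus (Times (Fn a) s) (Times (Fn b) t)"
proof -
 have eq: "R \<times> {s, t} = R \<times> {s} \<union> R \<times> {t}" "R \<times> {s} = {} \<union> R \<times> {s}" by auto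
 have "\<exists>w0 b. lin X x (R \<times> {s}) w0 \<and> b \<in> R \<and> w \<sim> Plus w0 (Times (Fn b) t)"
  by (rule lin_insert) (use assms R_add in "auto simp: eq(1)")
 then obtain w0 b where w0: "lin X x (R \<times> {s}) w0" "b \<in> R" "w \<sim> Plus w0 (Times (Fn b) t)" by blast
 have "\<exists>w1 a. lin X x {} w1 \<and> a \<in> R \<and> w0 \<sim> Plus w1 (Times (Fn a) s)"
  by (rule lin_insert) (use assms R_add w0(1) in "auto")
 then obtain w1 a where w1: "lin X x {} w1" "a \<in> R" "w0 \<sim> Plus w1 (Times (Fn a) s)" by blast
 have "w1 \<sim> Fn (%_. 0)" using w1(1)
 proof induction
  case lin_zero
  show ?case by (rule sym_eq.refl) simp
 next
  case (lin_plus s t)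
  have "Plus s t \<sim> Plus (Fn (%_. 0)) (Fn (%_. 0))" by (rule sym_eq.cong_plus[OF lin_plus.IH])
  also have "\<dots> \<sim> Fn (%_. 0)" by (rule plus_zeroL) simp
  finally show ?case .
 next
  case (lin_eq s t)
  then show ?case by (meson sym_eq.sym sym_eq.trans)
 qed simp
 then have "Plus w1 (Times (Fn a) s) \<sim> Plus (Fn (%_. 0)) (Times (Fn a) s)"
  using w1(2) assms(2) by (intro plus_congL) auto
 also have "\<dots> \<sim> Times (Fn a) s" using w1(2) assms(2) by (intro plus_zeroL) auto
 finally have "w0 \<sim> Times (Fn a) s" using w1(3) by (rule sym_eq.trans[rotated])
 then have "Plus w0 (Times (Fn b) t) \<sim> Plus (Times (Fn a) s) (Times (Fn b) t)"
  using w0(2) assms(3) by (intro plus_congL) auto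
 with w0(3) have "w \<sim> Plus (Times (Fn a) s) (Times (Fn b) t)" by (rule sym_eq.trans)
 with w1(2) w0(2) show thesis by (rule that)
qed

lemma near_points: "\<forall>\<^sub>F y in near X x. y \<in> points X"
 unfolding near_iff by (intro exI[of _ "points X"]) (use pt in auto)

lemma near_reg_at: "f \<in> R ==> \<forall>\<^sub>F y in near X x. f \<in> reg_at X y"
 unfolding near_iff reg_at_def by blast

lemma near_sexp_at: "wf t ==> \<forall>\<^sub>F y in near X x. sexp_at X y t"
proof (induction t)
 case (Plus s t)
 then have "\<forall>\<^sub>F y in near X x. sexp_at X y s" "\<forall>\<^sub>F y in near X x. sexp_at X y t" by auto
 then show ?case by eventually_elim simp
next
 case (Times s t)
 then have "\<forall>\<^sub>F y in near X x. sexp_at X y s" "\<forall>\<^sub>F y in near X x. sexp_at X y t" by auto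
 then show ?case by eventually_elim simp
qed (auto intro: near_reg_at)

lemma near_near_eq: "near_eq X x f g ==> \<forall>\<^sub>F y in near X x. near_eq X y f g"
 unfolding near_iff near_eq_def by blast

text \<open>A derivation of \<open>sym_eq\<close> involves finitely many functions and identities of
  germs, each of which persists on a neighbourhood.\<close>

lemma sym_eq_near:
 assumes "s \<sim> t"
 shows "\<forall>\<^sub>F y in near X x. sym_eq X y s t"
 using assms
proof induction
 case (refl t)
 from near_sexp_at[OF refl] show ?case by eventually_elim (rule sym_eq.refl)
next
 case (sym s t)
 from sym.IH show ?case by eventually_elim (rule sym_eq.sym)
next
 case (trans s t u)
 from trans.IH show ?case by eventually_elim (rule sym_eq.trans)
next
 case (cong_plus s s' t t')
 from cong_plus.IH show ?case by eventually_elim (rule sym_eq.cong_plus)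
next
 case (cong_times s s' t t')
 from cong_times.IH show ?case by eventually_elim (rule sym_eq.cong_times)
next
 case (plus_assoc s t u)
 from plus_assoc[THEN near_sexp_at] show ?case by eventually_elim (rule sym_eq.plus_assoc)
next
 case (plus_comm s t)
 from plus_comm[THEN near_sexp_at] show ?case by eventually_elim (rule sym_eq.plus_comm)
next
 case (times_assoc s t u)
 from times_assoc[THEN near_sexp_at] show ?case by eventually_elim (rule sym_eq.times_assoc)
next
 case (times_comm s t)
 from times_comm[THEN near_sexp_at] show ?case by eventually_elim (rule sym_eq.times_comm)
next
 case (distrib s t u)
 from distrib[THEN near_sexp_at] show ?case by eventually_elim (rule sym_eq.distrib)
next
 case (plus_zero t)
 from near_reg_at[OF plus_zero(1)] near_sexp_at[OF plus_zero(2)]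
 show ?case by eventually_elim (rule sym_eq.plus_zero)
next
 case (times_zero t)
 from near_reg_at[OF times_zero(1)] near_sexp_at[OF times_zero(2)]
 show ?case by eventually_elim (rule sym_eq.times_zero)
next
 case (times_one t)
 from near_reg_at[OF times_one(1)] near_sexp_at[OF times_one(2)]
 show ?case by eventually_elim (rule sym_eq.times_one)
next
 case (fn_germ f g)
 from near_reg_at[OF fn_germ(1)] near_reg_at[OF fn_germ(2)] near_near_eq[OF fn_germ(3)]
 show ?case by eventually_elim (rule sym_eq.fn_germ)
next
 case (fn_plus f g)
 from near_reg_at[OF fn_plus(1)] near_reg_at[OF fn_plus(2)]
 show ?case by eventually_elim (rule sym_eq.fn_plus)
next
 case (fn_times f g)
 from near_reg_at[OF fn_times(1)] near_reg_at[OF fn_times(2)]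
 show ?case by eventually_elim (rule sym_eq.fn_times)
next
 case (dif_germ f g)
 from near_reg_at[OF dif_germ(1)] near_reg_at[OF dif_germ(2)] near_near_eq[OF dif_germ(3)]
 show ?case by eventually_elim (rule sym_eq.dif_germ)
next
 case (dif_plus f g)
 from near_reg_at[OF dif_plus(1)] near_reg_at[OF dif_plus(2)]
 show ?case by eventually_elim (rule sym_eq.dif_plus)
next
 case (dif_times f g)
 from near_reg_at[OF dif_times(1)] near_reg_at[OF dif_times(2)]
 show ?case by eventually_elim (rule sym_eq.dif_times)
next
 case (dif_const c)
 from near_reg_at[OF dif_const(1)] near_reg_at[OF dif_const(2)]
 show ?case by eventually_elim (rule sym_eq.dif_const)
qed

lemma tangent_rules:
 assumes "\<xi> \<in> tangent_space X x"
 shows "\<And>f. f \<notin> R ==> \<xi> f = 0"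
  "\<And>f g. f \<in> R ==> g \<in> R ==> near_eq X x f g ==> \<xi> f = \<xi> g"
  "\<And>f g. f \<in> R ==> g \<in> R ==> \<xi> (%y. f y + g y) = \<xi> f + \<xi> g"
  "\<And>c f. f \<in> R ==> \<xi> (%y. c * f y) = c * \<xi> f"
  "\<And>f g. f \<in> R ==> g \<in> R ==> \<xi> (%y. f y * g y) = f x * \<xi> g + g x * \<xi> f"
 using assms unfolding tangent_space_def plus_fun_def times_fun_def by simp_all

lemma tangent_const:
 assumes \<xi>: "\<xi> \<in> tangent_space X x"
 shows "\<xi> (%_. c) = 0"
proof -
 have "\<xi> (%y. (%_. 1) y * (%_. 1) y) = 1 * \<xi> (%_. 1) + 1 * \<xi> (%_. 1)"
  by (rule tangent_rules(5)[OF \<xi> R_const R_const])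
 then have "\<xi> (%_. 1) = 0" by simp
 with tangent_rules(4)[OF \<xi> R_const, of c 1] show ?thesis by simp
qed

text \<open>The constant assignment with value \<xi> turns \<open>contract\<close> into evaluation
  at the single tangent vector \<xi>, so forms can be tested on tangent vectors without extending
  these to vector fields.\<close>

lemma contract_tangent:
 assumes \<xi>: "\<xi> \<in> tangent_space X x" and "s \<sim> t"
 shows "contract (%_. \<xi>) s x = contract (%_. \<xi>) t x"
 using assms(2)
 by induction (auto simp: algebra_simps deriv_of_def near_eq_def plus_fun_def times_fun_def
   tangent_const[OF \<xi>] tangent_rules(3,5)[OF \<xi>] intro!: tangent_rules(2)[OF \<xi>])

end

section \<open>Local coordinates on a smooth surface\<close>

lemma vector_space_fun: "vector_space (%(c::complex) (\<xi>::'f => complex) f. c * \<xi> f)"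
 by unfold_locales (auto simp: fun_eq_iff algebra_simps plus_fun_def)

lemma functional_separates:
 fixes S :: "('f => complex) set"
 assumes zero: "(%_. 0) \<in> S" and add: "\<And>g h. g \<in> S ==> h \<in> S ==> (%y. g y + h y) \<in> S"
  and scale: "\<And>c g. g \<in> S ==> (%y. c * g y) \<in> S" and f: "f \<notin> S"
 shows "\<exists>L. (\<forall>g h. L (%y. g y + h y) = L g + L h) \<and> (\<forall>c g. L (%y. c * g y) = c * L g) \<and>
   (\<forall>s\<in>S. L s = (0::complex)) \<and> L f = 1"
proof -
 interpret vs: vector_space "%(c::complex) (\<xi>::'f => complex) f. c * \<xi> f" by (rule vector_space_fun)
 interpret c: vector_space "(*) :: complex => complex => complex"
  by unfold_locales (auto simp: algebra_simps)
 interpret p: vector_space_pair "%(c::complex) (\<xi>::'f => complex) f. c * \<xi> f" "(*) :: complex => complex => complex" ..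
 have sub: "vs.subspace S"
  unfolding vs.subspace_def using assms by (auto simp: plus_fun_def zero_fun_def)
 obtain B where B: "B \<subseteq> S" "vs.independent B" "S \<subseteq> vs.span B" by (rule vs.maximal_independent_subset)
 have "vs.span B \<subseteq> S" by (rule vs.span_minimal[OF B(1) sub])
 then have "f \<notin> vs.span B" using f by blast
 then have ind: "vs.independent (insert f B)" using B(2) by (rule vs.independent_insertI)
 obtain L where L: "Vector_Spaces.linear (%(c::complex) (\<xi>::'f => complex) f. c * \<xi> f) (*) L"
  "\<forall>x\<in>insert f B. L x = (if x = f then 1 else 0)"
  using p.linear_independent_extend[OF ind, of "%x. if x = f then 1 else 0"] by blast
 interpret L: Vector_Spaces.linear "%(c::complex) (\<xi>::'f => complex) f. c * \<xi> f" "(*) :: complex => complex => complex" L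
  by (rule L(1))
 have z: "Vector_Spaces.linear (%(c::complex) (\<xi>::'f => complex) f. c * \<xi> f) (*) (%_. 0)"
  by (rule p.linear_zero)
 have "L s = 0" if "s \<in> S" for s
 proof (rule p.linear_eq_on[OF L(1) z subsetD[OF B(3) that]])
  fix b assume "b \<in> B"
  then show "L b = 0" using L(2) B(1) f by auto
 qed
 moreover have "L (%y. g y + h y) = L g + L h" for g h using L.add[of g h] by (simp add: plus_fun_def)
 moreover have "L (%y. c * g y) = c * L g" for c g using L.scale[of c g] .
 ultimately show ?thesis using L(2) by (intro exI[of _ L]) simp
qed

lemma dim_2_basis:
 fixes V :: "('f => complex) set"
 assumes "vector_space.dim (%(c::complex) (\<xi>::'f => complex) f. c * \<xi> f) V = 2"
 obtains b1 b2 where "b1 \<in> V" "b2 \<in> V" "\<And>\<xi>. \<xi> \<in> V ==> \<exists>l m. \<forall>f. \<xi> f = l * b1 f + m * b2 f"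
  "\<And>l m. (\<And>f. l * b1 f + m * b2 f = 0) ==> l = 0 \<and> m = 0"
proof -
 interpret vs: vector_space "%(c::complex) (\<xi>::'f => complex) f. c * \<xi> f" by (rule vector_space_fun)
 obtain B where B: "B \<subseteq> V" "vs.independent B" "V \<subseteq> vs.span B" "card B = vs.dim V" by (rule vs.basis_exists)
 then obtain b1 b2 where b: "B = {b1, b2}" "b1 ~= b2" using assms by (auto simp: card_2_iff)
 have "\<exists>l m. \<forall>f. \<xi> f = l * b1 f + m * b2 f" if "\<xi> \<in> V" for \<xi>
 proof -
  have "\<xi> \<in> vs.span {b1, b2}" using that B(3) b by blast
  then obtain k where "\<xi> - (%f. k * b1 f) \<in> vs.span {b2}" unfolding vs.span_breakdown_eq by blast
  then obtain m where "\<xi> - (%f. k * b1 f) = (%f. m * b2 f)" unfolding vs.span_singleton by blast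
  then have "\<xi> f = k * b1 f + m * b2 f" for f
   using fun_cong[of "\<xi> - (%f. k * b1 f)" "%f. m * b2 f" f] by (simp add: algebra_simps)
  then show ?thesis by blast
 qed
 moreover have "l = 0 \<and> m = 0" if z: "\<And>f. l * b1 f + m * b2 f = 0" for l m
 proof -
  have n: "b1 \<notin> vs.span {b2}" "b2 \<notin> vs.span {b1}"
   using B(2) b unfolding vs.dependent_def by (auto simp: insert_Diff_if)
  have "l = 0"
  proof (rule ccontr)
   assume "l ~= 0"
   have "b1 = (%f. (- m / l) * b2 f)"
   proof
    fix f show "b1 f = (- m / l) * b2 f"
     using z[of f] \<open>l ~= 0\<close> by (simp add: field_simps eq_neg_iff_add_eq_0)
   qed
   then show False using n(1) unfolding vs.span_singleton by blast
  qed
  moreover have "m = 0"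
  proof (rule ccontr)
   assume "m ~= 0"
   have "b2 = (%f. 0 * b1 f)"
   proof
    fix f show "b2 f = 0 * b1 f" using z[of f] \<open>m ~= 0\<close> \<open>l = 0\<close> by simp
   qed
   then show False using n(2) unfolding vs.span_singleton by blast
  qed
  ultimately show ?thesis by blast
 qed
 ultimately show thesis using that[of b1 b2] B(1) b by blast
qed

text \<open>Functions whose differentials form a basis of the cotangent space at \<open>x\<close>,
  together with the dual basis of the tangent space.\<close>

definition dual_pair :: "'a fspace => 'a => ('a => complex) => ('a => complex) =>
  (('a => complex) => complex) => (('a => complex) => complex) => bool" where
 "dual_pair X x u t \<xi>1 \<xi>2 \<longleftrightarrow> u \<in> reg_at X x \<and> t \<in> reg_at X x \<and>
   \<xi>1 \<in> tangent_space X x \<and> \<xi>2 \<in> tangent_space X x \<and>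
   \<xi>1 u = 1 \<and> \<xi>1 t = 0 \<and> \<xi>2 u = 0 \<and> \<xi>2 t = 1 \<and>
   (\<forall>\<xi>\<in>tangent_space X x. \<forall>f. \<xi> f = \<xi> u * \<xi>1 f + \<xi> t * \<xi>2 f)"

lemma tangent_space_combine:
 assumes "\<xi> \<in> tangent_space X x" "\<eta> \<in> tangent_space X x"
 shows "(%f. a * \<xi> f + b * \<eta> f) \<in> tangent_space X x"
proof -
 have "a * \<xi> f + b * \<eta> f = a * \<xi> g + b * \<eta> g"
  if "f \<in> reg_at X x" "g \<in> reg_at X x" "near_eq X x f g" for f g
  using assms that unfolding tangent_space_def by auto
 then show ?thesis using assms unfolding tangent_space_def by (auto simp: algebra_simps)
qed

context variety_point
begin

lemma dual_pair_of_injective: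
 assumes dim: "vector_space.dim (%c \<xi> f. c * \<xi> f) (tangent_space X x) = 2"
  and ut: "u \<in> R" "t \<in> R"
  and inj: "\<And>\<xi>. \<xi> \<in> tangent_space X x ==> \<xi> u = 0 ==> \<xi> t = 0 ==> \<forall>f. \<xi> f = 0"
 shows "\<exists>\<xi>1 \<xi>2. dual_pair X x u t \<xi>1 \<xi>2"
proof -
 obtain b1 b2 where b: "b1 \<in> tangent_space X x" "b2 \<in> tangent_space X x"
  "\<And>\<xi>. \<xi> \<in> tangent_space X x ==> \<exists>l m. \<forall>f. \<xi> f = l * b1 f + m * b2 f"
  "\<And>l m. (\<And>f. l * b1 f + m * b2 f = 0) ==> l = 0 \<and> m = 0"
  using dim_2_basis[OF dim] by metis
 note comb = tangent_space_combine[OF b(1,2)]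
 have ind: "l = 0 \<and> m = 0" if "l * b1 u + m * b2 u = 0" "l * b1 t + m * b2 t = 0" for l m
  using inj[OF comb[of l m]] that b(4)[of l m] by blast
 \<comment> \<open>The determinant of (u, t) on the basis b1, b2; the dual basis is given by
   Cramer's rule.\<close>
 define D where "D = b1 u * b2 t - b1 t * b2 u"
 have D: "D ~= 0"
 proof
  assume D0: "D = 0"
  then have 1: "b2 t = 0" "b1 t = 0" using ind[of "b2 t" "- b1 t"] unfolding D_def by (auto simp: algebra_simps)
  have "b2 u = 0" "b1 u = 0" using ind[of "b2 u" "- b1 u"] 1 by (auto simp: algebra_simps)
  then show False using ind[of 1 0] 1 by simp
 qed
 define \<xi>1 where "\<xi>1 = (%f. (b2 t / D) * b1 f + (- b1 t / D) * b2 f)"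
 define \<xi>2 where "\<xi>2 = (%f. (- b2 u / D) * b1 f + (b1 u / D) * b2 f)"
 have 12: "\<xi>1 \<in> tangent_space X x" "\<xi>2 \<in> tangent_space X x"
  unfolding \<xi>1_def \<xi>2_def by (rule comb)+
 have "\<xi>1 u = D / D" "\<xi>2 t = D / D" unfolding \<xi>1_def \<xi>2_def D_def by (simp_all add: field_simps)
 then have v: "\<xi>1 u = 1" "\<xi>1 t = 0" "\<xi>2 u = 0" "\<xi>2 t = 1"
  using D unfolding \<xi>1_def \<xi>2_def by (simp_all add: field_simps)
 have "\<xi> f = \<xi> u * \<xi>1 f + \<xi> t * \<xi>2 f" if \<xi>: "\<xi> \<in> tangent_space X x" for \<xi> f
 proof -
  have "(%f. 1 * \<xi> f + (- 1) * (\<xi> u * \<xi>1 f + \<xi> t * \<xi>2 f)) \<in> tangent_space X x"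
   by (intro tangent_space_combine \<xi> 12)
  from inj[OF this] have "1 * \<xi> f + (- 1) * (\<xi> u * \<xi>1 f + \<xi> t * \<xi>2 f) = 0" using v by simp
  then show ?thesis by algebra
 qed
 then show ?thesis using ut 12 v unfolding dual_pair_def by blast
qed

lemma dual_pair_exists:
 assumes dim: "vector_space.dim (%c \<xi> f. c * \<xi> f) (tangent_space X x) = 2"
 shows "\<exists>u t \<xi>1 \<xi>2. dual_pair X x u t \<xi>1 \<xi>2"
proof -
 obtain b1 b2 where b: "b1 \<in> tangent_space X x" "b2 \<in> tangent_space X x"
  "\<And>\<xi>. \<xi> \<in> tangent_space X x ==> \<exists>l m. \<forall>f. \<xi> f = l * b1 f + m * b2 f"
  "\<And>l m. (\<And>f. l * b1 f + m * b2 f = 0) ==> l = 0 \<and> m = 0"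
  using dim_2_basis[OF dim] by metis
 obtain u where u: "b1 u ~= 0" using b(4)[of 1 0] by auto
 \<comment> \<open>The vector b2 - c b1 kills \<open>u\<close>; a function \<open>t\<close> on which
   it is nonzero completes \<open>u\<close> to a pair that separates tangent vectors.\<close>
 define c where "c = b2 u / b1 u"
 obtain t where t: "- c * b1 t + 1 * b2 t ~= 0" using b(4)[of "- c" 1] by auto
 have uR: "u \<in> R" using tangent_rules(1)[OF b(1)] u by blast
 have tR: "t \<in> R" using tangent_rules(1)[OF b(1)] tangent_rules(1)[OF b(2)] t by fastforce
 have "\<forall>f. \<xi> f = 0" if \<xi>: "\<xi> \<in> tangent_space X x" "\<xi> u = 0" "\<xi> t = 0" for \<xi>
 proof -
  obtain l m where lm: "\<And>f. \<xi> f = l * b1 f + m * b2 f" using b(3)[OF \<xi>(1)] by blast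
  have l: "l = - m * c" using lm[of u] \<xi>(2) u unfolding c_def by (simp add: field_simps eq_neg_iff_add_eq_0)
  have "m * (- c * b1 t + 1 * b2 t) = \<xi> t" unfolding lm[of t] l by (simp add: algebra_simps)
  then have "m * (- c * b1 t + 1 * b2 t) = 0" using \<xi>(3) by simp
  then have "m = 0" using t by simp
  then show ?thesis using lm l by simp
 qed
 then show ?thesis using dual_pair_of_injective[OF dim uR tR] by blast
qed

lemma lin_one: "s \<in> S ==> wf s ==> lin X x (R \<times> S) s"
 by (rule lin_eq[OF lin_mem[of "%_. 1"] times_oneL]) simp_all

lemma lin_ideal_scale:
 assumes "lin X x (C \<times> S) s" "d \<in> R" "\<And>s. s \<in> S ==> wf s" "C = R \<or> C = \<mm>"
 shows "lin X x (C \<times> S) (Times (Fn d) s)"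
 by (rule lin_scale[OF assms(1,2)]) (use assms(2-4) R_mult in auto)

lemma lin_\<mm>_scale:
 assumes "lin X x (R \<times> S) s" "d \<in> \<mm>" "\<And>s. s \<in> S ==> wf s"
 shows "lin X x (\<mm> \<times> S) (Times (Fn d) s)"
 by (rule lin_scale[OF assms(1)]) (use assms(2,3) R_mult in auto)

end

text \<open>The common properties of \<open>K f = df\<close> and \<open>K f = f - f x\<close>.\<close>

locale jet = variety_point X x for X :: "'a fspace" and x +
 fixes K :: "('a => complex) => 'a sexp"
 assumes K_wf: "f \<in> R ==> wf (K f)"
  and K_germ: "f \<in> R ==> g \<in> R ==> near_eq X x f g ==> K f \<sim> K g"
  and K_plus: "f \<in> R ==> g \<in> R ==> K (%y. f y + g y) \<sim> Plus (K f) (K g)"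
  and K_const: "K (%_. c) \<sim> Fn (%_. 0)"
  and K_times: "f \<in> R ==> g \<in> R ==>
   \<exists>g'\<in>R. g' x = g x \<and> K (%y. f y * g y) \<sim> Plus (Times (Fn f) (K g)) (Times (Fn g') (K f))"
begin

lemma lin_K_const: "lin X x Q (K (%_. c))"
 by (rule lin_eq[OF lin_zero sym_eq.sym[OF K_const]])

lemma lin_K_plus: "f \<in> R ==> g \<in> R ==> lin X x Q (K f) ==> lin X x Q (K g) ==> lin X x Q (K (%y. f y + g y))"
 by (rule lin_eq[OF lin_plus sym_eq.sym[OF K_plus]])

lemma lin_K_scale:
 assumes f: "f \<in> R" and l: "lin X x (C \<times> S) (K f)" and S: "\<And>s. s \<in> S ==> wf s" and C: "C = R \<or> C = \<mm>"
 shows "lin X x (C \<times> S) (K (%y. c * f y))"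
proof -
 obtain g' where g: "g' \<in> R" "K (%y. f y * c) \<sim> Plus (Times (Fn f) (K (%_. c))) (Times (Fn g') (K f))"
  using K_times[OF f R_const] by blast
 have "lin X x (C \<times> S) (K (%y. f y * c))"
  by (rule lin_eq[OF lin_plus sym_eq.sym[OF g(2)]]) (intro lin_ideal_scale lin_K_const f g l S C; assumption)+
 then show ?thesis by (simp add: mult.commute)
qed

context
 fixes U n \<phi>
 assumes chart: "chart X U n \<phi>" and xU: "x \<in> U"
begin

lemma pR: "F \<in> polyfun n ==> (%y. F (\<phi> y)) \<in> R"
 by (rule poly_reg_at[OF var chart xU])

lemma coordR: "i < n ==> (%y. \<phi> y i) \<in> R"
 by (rule pR) (rule polyfun.coord)

definition coords :: "'a sexp set" where "coords = (%i. K (%y. \<phi> y i)) ` {..<n}"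

lemma wf_coords: "s \<in> coords ==> wf s"
 unfolding coords_def using K_wf coordR by auto

lemma coords_span_poly: "F \<in> polyfun n ==> lin X x (R \<times> coords) (K (%y. F (\<phi> y)))"
proof (induction rule: polyfun.induct)
 case (coord i)
 then show ?case unfolding coords_def by (intro lin_one K_wf coordR) auto
next
 case (add f g)
 then show ?case unfolding plus_fun_def by (intro lin_K_plus pR)
next
 case (mult f g)
 obtain g' where g: "g' \<in> R" "K (%y. f (\<phi> y) * g (\<phi> y)) \<sim>
   Plus (Times (Fn (%y. f (\<phi> y))) (K (%y. g (\<phi> y)))) (Times (Fn g') (K (%y. f (\<phi> y))))"
  using K_times[OF pR[OF mult(1)] pR[OF mult(2)]] by blast
 show ?case unfolding times_fun_def
  by (rule lin_eq[OF lin_plus[OF lin_ideal_scale[OF mult.IH(2) pR[OF mult(1)] wf_coords]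
    lin_ideal_scale[OF mult.IH(1) g(1) wf_coords]] sym_eq.sym[OF g(2)]]) simp_all
qed (rule lin_K_const)

text \<open>From f b = a the product rule expresses a unit times K f through K a and K b, which are
  spanned by the coordinates.\<close>

lemma coords_span:
 assumes f: "f \<in> R"
 shows "lin X x (R \<times> coords) (K f)"
proof -
 obtain a b W where ab: "a \<in> polyfun n" "b \<in> polyfun n" "zopen X W" "x \<in> W" "W \<subseteq> U"
  "\<forall>y\<in>W. b (\<phi> y) ~= 0 \<and> f y = a (\<phi> y) / b (\<phi> y)"
  using reg_at_fraction[OF var chart xU f] .
 let ?a = "%y. a (\<phi> y)" and ?b = "%y. b (\<phi> y)" and ?c = "%y. - f y"
 have r: "?a \<in> R" "?b \<in> R" "?b x ~= 0" using ab pR by auto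
 obtain g where g: "g \<in> R" "g x ~= 0" "K (%y. f y * ?b y) \<sim> Plus (Times (Fn f) (K ?b)) (Times (Fn g) (K f))"
  using K_times[OF f r(2)] r(3) by metis
 note w = K_wf[OF f] K_wf[OF r(2)] R_minus[OF f] f g(1)
 have "near_eq X x ?a (%y. f y * ?b y)" unfolding near_eq_def by (intro exI[of _ W]) (use ab in auto)
 then have 1: "K ?a \<sim> Plus (Times (Fn f) (K ?b)) (Times (Fn g) (K f))"
  by (intro sym_eq.trans[OF K_germ g(3)] R_mult f r)
 have "Plus (K ?a) (Times (Fn ?c) (K ?b)) \<sim> Plus (Plus (Times (Fn f) (K ?b)) (Times (Fn g) (K f))) (Times (Fn ?c) (K ?b))"
  by (intro plus_congL 1) (use w in simp)
 also have "\<dots> \<sim> Plus (Plus (Times (Fn g) (K f)) (Times (Fn f) (K ?b))) (Times (Fn ?c) (K ?b))"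
  by (intro plus_congL sym_eq.plus_comm) (use w in simp_all)
 also have "\<dots> \<sim> Times (Fn g) (K f)" by (rule cancel_minus) (use w in simp_all)
 finally have 2: "Plus (K ?a) (Times (Fn ?c) (K ?b)) \<sim> Times (Fn g) (K f)" .
 have "lin X x (R \<times> coords) (Plus (K ?a) (Times (Fn ?c) (K ?b)))"
  by (rule lin_plus[OF coords_span_poly[OF ab(1)] lin_ideal_scale[OF coords_span_poly[OF ab(2)] w(3) wf_coords]]) simp_all
 from lin_ideal_scale[OF lin_eq[OF this 2] R_inverse(1)[OF g(1,2)] wf_coords]
 have "lin X x (R \<times> coords) (Times (Fn (%y. inverse (g y))) (Times (Fn g) (K f)))" by simp
 then show ?thesis by (rule lin_eq) (rule scale_inverse[OF g(1,2) w(1)])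
qed

text \<open>The functions on which \<open>K\<close> vanishes to second order at \<open>x\<close>; they contain the common kernel of
  the tangent vectors.\<close>

definition flat :: "('a => complex) set" where
 "flat = {f \<in> R. lin X x (\<mm> \<times> coords) (K f)}"

lemma flat_null:
 assumes "f \<in> R" "near_eq X x f (%_. 0)" shows "f \<in> flat"
 unfolding flat_def using assms lin_eq[OF lin_K_const sym_eq.sym[OF K_germ[OF assms(1) R_const assms(2)]]] by simp

lemma flat_mult:
 assumes "f \<in> \<mm>" "g \<in> \<mm>" shows "(%y. f y * g y) \<in> flat"
proof -
 have r: "f \<in> R" "g \<in> R" using assms by auto
 obtain g' where g: "g' \<in> \<mm>" "K (%y. f y * g y) \<sim> Plus (Times (Fn f) (K g)) (Times (Fn g') (K f))"
  using K_times[OF r] assms(2) by force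
 have "lin X x (\<mm> \<times> coords) (K (%y. f y * g y))"
  by (rule lin_eq[OF lin_plus[OF lin_\<mm>_scale[OF coords_span[OF r(2)] assms(1) wf_coords]
    lin_\<mm>_scale[OF coords_span[OF r(1)] g(1) wf_coords]] sym_eq.sym[OF g(2)]])
 then show ?thesis unfolding flat_def using R_mult[OF r] by simp
qed

text \<open>A function outside \<open>flat\<close> is separated from it by a linear functional.
  Since \<open>flat\<close> contains the constants, the functions that vanish near \<open>x\<close>
  and the products of two functions vanishing at \<open>x\<close>, such a functional is a tangent
  vector.\<close>

lemma tangent_kernel_flat:
 assumes f: "f \<in> R" and van: "\<And>\<xi>. \<xi> \<in> tangent_space X x ==> \<xi> f = 0"
 shows "f \<in> flat"
proof (rule ccontr)
 assume nf: "f \<notin> flat"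
 have "\<exists>L. (\<forall>g h. L (%y. g y + h y) = L g + L h) \<and> (\<forall>c g. L (%y. c * g y) = c * L g) \<and>
   (\<forall>s\<in>flat. L s = (0::complex)) \<and> L f = 1"
  by (rule functional_separates[OF _ _ _ nf])
   (auto simp: flat_def intro!: lin_K_const lin_K_plus lin_K_scale R_add R_mult wf_coords)
 then obtain L where L0: "\<forall>g h. L (%y. g y + h y) = L g + L h" "\<forall>c g. L (%y. c * g y) = c * L g"
  "\<forall>s\<in>flat. L s = (0::complex)" "L f = 1"
  by (elim exE conjE)
 have L: "\<And>g h. L (%y. g y + h y) = L g + L h" "\<And>c g. L (%y. c * g y) = c * L g"
  "\<And>s. s \<in> flat ==> L s = (0::complex)" "L f = 1"
  using L0 by simp_all
 define \<xi> where "\<xi> g = (if g \<in> R then L g else 0)" for g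
 have Lm: "L (%y. - g y) = - L g" for g using L(2)[of "-1" g] by simp
 have Ld: "L (%y. g y - h y) = L g - L h" for g h using L(1)[of g "%y. - h y"] Lm by simp
 have "\<xi> \<in> tangent_space X x"
  unfolding tangent_space_def plus_fun_def times_fun_def
 proof (intro CollectI conjI ballI allI impI)
  fix g h assume gh: "g \<in> R" "h \<in> R"
  show "\<xi> (%y. g y + h y) = \<xi> g + \<xi> h" using gh R_add L(1) unfolding \<xi>_def by simp
  show "\<xi> g = \<xi> h" if "near_eq X x g h"
  proof -
   have "near_eq X x (%y. g y - h y) (%_. 0)" using that unfolding near_eq_def by auto
   then have "(%y. g y - h y) \<in> flat" by (intro flat_null R_diff gh)
   then show ?thesis using L(3) Ld gh unfolding \<xi>_def by force
  qed
  \<comment> \<open>Expanding this product, on which \<open>L\<close> vanishes, gives the Leibniz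
    rule for \<open>L\<close>.\<close>
  have "(%y. (g y - g x) * (h y - h x)) \<in> flat" by (intro flat_mult) (use gh R_diff in auto)
  then have "0 = L (%y. (g y - g x) * (h y - h x))" using L(3) by simp
  also have "(%y. (g y - g x) * (h y - h x)) = (%y. (g y * h y - g x * h y) - (h x * g y - g x * h x))"
   by (auto simp: algebra_simps)
  also have "L \<dots> = L (%y. g y * h y) - g x * L h - h x * L g"
   using L(3)[of "%_. g x * h x"] by (simp add: Ld L(2) flat_def lin_K_const)
  finally show "\<xi> (%y. g y * h y) = g x * \<xi> h + h x * \<xi> g"
   using gh R_mult unfolding \<xi>_def by (simp add: algebra_simps)
 next
  fix c g assume "g \<in> R"
  then show "\<xi> (%y. c * g y) = c * \<xi> g" using R_mult[OF R_const] L(2) unfolding \<xi>_def by simp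
 qed (simp add: \<xi>_def)
 from van[OF this] show False using L(4) f unfolding \<xi>_def by simp
qed

text \<open>Each chart coordinate minus its linear part in \<open>u\<close> and \<open>t\<close> is
  killed by all tangent vectors, hence flat. So the coordinates are spanned by K u and K t modulo
  \<mm> times themselves, and Nakayama's lemma applies.\<close>

lemma dual_pair_span:
 assumes d: "dual_pair X x u t \<xi>1 \<xi>2" and f: "f \<in> R"
 shows "lin X x (R \<times> {K u, K t}) (K f)"
proof -
 have ut: "u \<in> R" "t \<in> R" and rep: "\<And>\<xi> f. \<xi> \<in> tangent_space X x ==> \<xi> f = \<xi> u * \<xi>1 f + \<xi> t * \<xi>2 f"
  using d unfolding dual_pair_def by auto
 let ?S = "{K u, K t}"
 have wfS: "wf s" if "s \<in> ?S" for s using that ut K_wf by auto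
 have "\<forall>w\<in>coords. lin X x (R \<times> ?S) w"
 proof (rule nakayama)
  show "finite coords" unfolding coords_def by simp
  fix w assume "w \<in> coords"
  then obtain i where i: "i < n" "w = K (%y. \<phi> y i)" unfolding coords_def by auto
  define \<alpha> \<beta> where ab: "\<alpha> = \<xi>1 (%y. \<phi> y i)" "\<beta> = \<xi>2 (%y. \<phi> y i)"
  let ?g = "%y. \<alpha> * u y" and ?h = "%y. \<beta> * t y"
  define f where "f = (%y. \<phi> y i + - 1 * (?g y + ?h y))"
  have r: "?g \<in> R" "?h \<in> R" "(%y. ?g y + ?h y) \<in> R" "(%y. - 1 * (?g y + ?h y)) \<in> R" by (intro R_add R_mult R_const ut)+
  have fR: "f \<in> R" unfolding f_def by (intro R_add coordR i r(4))
  have "f \<in> flat"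
  proof (rule tangent_kernel_flat[OF fR])
   fix \<xi> assume \<xi>: "\<xi> \<in> tangent_space X x"
   note tr = tangent_rules[OF \<xi>]
   have "\<xi> f = \<xi> (%y. \<phi> y i) - (\<alpha> * \<xi> u + \<beta> * \<xi> t)"
    unfolding f_def using tr(3)[OF coordR[OF i(1)] r(4)] tr(4)[OF r(3), of "- 1"] tr(3)[OF r(1,2)] tr(4)[OF ut(1), of \<alpha>] tr(4)[OF ut(2), of \<beta>]
    by simp
   then show "\<xi> f = 0" unfolding ab rep[OF \<xi>, of "%y. \<phi> y i"] by simp
  qed
  then have "lin X x (R \<times> ?S \<union> \<mm> \<times> coords) (K f)" unfolding flat_def by (auto intro: lin_mono)
  moreover have "lin X x (R \<times> ?S) (K (%y. ?g y + ?h y))"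
   using wfS by (intro lin_K_plus lin_K_scale lin_one r ut disjI1 refl) auto
  then have "lin X x (R \<times> ?S \<union> \<mm> \<times> coords) (K (%y. ?g y + ?h y))" by (rule lin_mono) auto
  ultimately have "lin X x (R \<times> ?S \<union> \<mm> \<times> coords) (K (%y. f y + (?g y + ?h y)))" by (rule lin_K_plus[OF fR r(3)])
  then show "lin X x (R \<times> ?S \<union> \<mm> \<times> coords) w" unfolding i(2) by (simp add: f_def)
 qed (use wfS wf_coords in auto)
 then show ?thesis by (intro lin_trans[OF coords_span[OF f]] lin_ideal_scale wfS) auto
qed

end

end

sublocale variety_point \<subseteq> dif: jet X x Dif
proof
 show "\<exists>g'\<in>R. g' x = g x \<and> Dif (%y. f y * g y) \<sim> Plus (Times (Fn f) (Dif g)) (Times (Fn g') (Dif f))"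
  if "f \<in> R" "g \<in> R" for f g using Dif_times[OF that] that by blast
qed (auto intro: sym_eq.dif_germ Dif_plus Dif_const)

text \<open>The instance \<open>dif\<close> yields that du and dt generate the differentials, the
  instance \<open>fn\<close> that u - u x and t - t x generate the maximal ideal. For
  \<open>fn\<close> the second factor in the product rule is the constant g x, which is why
  \<open>K_times\<close> leaves room for \<open>g'\<close>.\<close>

sublocale variety_point \<subseteq> fn: jet X x "%f. Fn (%y. f y - f x)"
proof
 fix f g assume fg: "f \<in> R" "g \<in> R"
 then have d: "(%y. f y - f x) \<in> R" "(%y. g y - g x) \<in> R" by (simp_all add: R_diff)
 show "Fn (%y. f y + g y - (f x + g x)) \<sim> Plus (Fn (%y. f y - f x)) (Fn (%y. g y - g x))"
  using sym_eq.sym[OF Fn_plus[OF d]] by (simp add: algebra_simps)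
 have "Plus (Times (Fn f) (Fn (%y. g y - g x))) (Times (Fn (%_. g x)) (Fn (%y. f y - f x))) \<sim>
  Plus (Fn (%y. f y * (g y - g x))) (Fn (%y. g x * (f y - f x)))"
  by (intro sym_eq.cong_plus Fn_times d fg R_const)
 also have "\<dots> \<sim> Fn (%y. f y * (g y - g x) + g x * (f y - f x))" by (intro Fn_plus R_mult d fg R_const)
 also have "(%y. f y * (g y - g x) + g x * (f y - f x)) = (%y. f y * g y - f x * g x)" by (auto simp: algebra_simps)
 finally have e: "Plus (Times (Fn f) (Fn (%y. g y - g x))) (Times (Fn (%_. g x)) (Fn (%y. f y - f x))) \<sim>
  Fn (%y. f y * g y - f x * g x)" .
 show "\<exists>g'\<in>R. g' x = g x \<and> Fn (%y. f y * g y - f x * g x) \<sim>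
   Plus (Times (Fn f) (Fn (%y. g y - g x))) (Times (Fn g') (Fn (%y. f y - f x)))"
  by (intro bexI[of _ "%_. g x"] conjI sym_eq.sym[OF e] R_const) simp
 show "Fn (%y. f y - f x) \<sim> Fn (%y. g y - g x)" if "near_eq X x f g"
  using that d by (intro sym_eq.fn_germ) (auto simp: near_eq_def)
qed (auto simp: R_diff intro: sym_eq.refl)

context variety_point
begin

lemma dual_pair_maximal:
 assumes d: "dual_pair X x u t \<xi>1 \<xi>2" and f: "f \<in> R" "f x = 0"
 shows "\<exists>a\<in>R. \<exists>b\<in>R. \<forall>\<^sub>F y in near X x. f y = (u y - u x) * a y + (t y - t x) * b y"
proof -
 obtain U n \<phi> where c: "chart X U n \<phi>" "x \<in> U" using chart_nbhd[OF var pt] .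
 have ut: "u \<in> R" "t \<in> R" using d unfolding dual_pair_def by auto
 have "lin X x (R \<times> {Fn (%y. u y - u x), Fn (%y. t y - t x)}) (Fn f)"
  using fn.dual_pair_span[OF c d f(1)] f(2) by simp
 then obtain a b where ab: "a \<in> R" "b \<in> R"
  "Fn f \<sim> Plus (Times (Fn a) (Fn (%y. u y - u x))) (Times (Fn b) (Fn (%y. t y - t x)))"
  by (rule lin_pair) (use ut R_diff in auto)
 from sym_eq_near[OF ab(3)] near_points
 have "\<forall>\<^sub>F y in near X x. f y = (u y - u x) * a y + (t y - t x) * b y"
 proof eventually_elim
  case (elim y)
  interpret y: variety_point X y by unfold_locales (use var elim in auto)
  \<comment> \<open>The expressions contain no differentials, so evaluation at the zero vector reads
    off the identity of functions.\<close>
  have "(%_. 0) \<in> tangent_space X y" unfolding tangent_space_def by simp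
  from y.contract_tangent[OF this elim(1)] show ?case by (simp add: algebra_simps)
 qed
 with ab(1,2) show ?thesis by blast
qed

end

lemma (in variety_point) tangent_power:
 assumes \<xi>: "\<xi> \<in> tangent_space X x" and f: "f \<in> R"
 shows "\<xi> (%y. f y ^ n) = of_nat n * f x ^ (n - 1) * \<xi> f"
proof (induction n)
 case 0
 show ?case using tangent_const[OF \<xi>, of 1] by simp
next
 case (Suc n)
 have p: "(%y. f y ^ n) \<in> R" by (induction n) (use f R_mult in auto)
 have "\<xi> (%y. f y * f y ^ n) = f x * (of_nat n * f x ^ (n - 1) * \<xi> f) + f x ^ n * \<xi> f"
  unfolding tangent_rules(5)[OF \<xi> f p] Suc.IH ..
 also have "\<dots> = of_nat (Suc n) * f x ^ n * \<xi> f" by (cases n) (simp_all add: algebra_simps)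
 finally show ?case by simp
qed

lemma (in variety_point) tangent_diff:
 assumes \<xi>: "\<xi> \<in> tangent_space X x" and f: "f \<in> R" "g \<in> R"
 shows "\<xi> (%y. f y - g y) = \<xi> f - \<xi> g"
 using tangent_rules(3)[OF \<xi> f(1) R_minus[OF f(2)]] tangent_rules(4)[OF \<xi> f(2), of "-1"] by simp

locale smooth_surface = irreducible_var X for X :: "'a fspace" +
 assumes smooth: "smooth_variety X" and dim2: "krull_dim (zar X) = 2"
begin

lemma variety_point: "x \<in> points X ==> variety_point X x"
 by unfold_locales (rule var)

lemma dim_tangent_space: "x \<in> points X ==> vector_space.dim (%c \<xi> f. c * \<xi> f) (tangent_space X x) = 2"
 using smooth dim2 unfolding smooth_variety_def by (simp add: numeral_eq_enat)

lemma near_imp_generic: "x \<in> points X ==> eventually P (near X x) ==> eventually P (generic X)"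
 unfolding eventually_near eventually_generic by blast

lemma generic_imp_near:
 assumes "f \<in> reg_at X x" "g \<in> reg_at X x" "x \<in> points X" "GEN y. f y = g y"
 shows "\<forall>\<^sub>F y in near X x. f y = g y"
proof -
 obtain U where "zopen X U" "x \<in> U" "f \<in> reg X U" "g \<in> reg X U" "\<And>y. y \<in> U ==> f y = g y"
  by (rule ev_reg_at_nbhd[OF assms(1,2,4)]) blast
 then show ?thesis unfolding eventually_near[OF assms(3)] by blast
qed

end

text \<open>An etale coordinate system on \<open>V\<close>: \<open>Du\<close> and \<open>Dt\<close>
  are the partial derivatives, and u - u y, t - t y are local parameters at every y in
  \<open>V\<close>.\<close>

locale surface_coords = smooth_surface X for X :: "'a fspace" +
 fixes V :: "'a set" and u t :: "'a => complex" and Du Dt :: "'a vfield"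
 assumes V_open: "zopen X V" and uV: "u \<in> reg X V" and tV: "t \<in> reg X V"
  and partial_tangent: "y \<in> V ==> Du y \<in> tangent_space X y" "y \<in> V ==> Dt y \<in> tangent_space X y"
  and partial_dual: "y \<in> V ==> Du y u = 1" "y \<in> V ==> Du y t = 0" "y \<in> V ==> Dt y u = 0" "y \<in> V ==> Dt y t = 1"
  and partial_reg_at: "y \<in> V ==> f \<in> reg_at X y ==> (%z. Du z f) \<in> reg_at X y"
   "y \<in> V ==> f \<in> reg_at X y ==> (%z. Dt z f) \<in> reg_at X y"
  and Dif_partial: "y \<in> V ==> f \<in> reg_at X y ==> sym_eq X y (Dif f)
   (Plus (Times (Fn (%z. Du z f)) (Dif u)) (Times (Fn (%z. Dt z f)) (Dif t)))"
  and maximal_ideal: "y \<in> V ==> f \<in> reg_at X y ==> f y = 0 ==>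
   \<exists>a\<in>reg_at X y. \<exists>b\<in>reg_at X y. \<forall>\<^sub>F z in generic X. f z = (u z - u y) * a z + (t z - t y) * b z"
begin

lemma V_points: "y \<in> V ==> y \<in> points X"
 using openin_subset[OF V_open] by blast

lemma ut_reg_at: "y \<in> V ==> u \<in> reg_at X y" "y \<in> V ==> t \<in> reg_at X y"
 unfolding reg_at_def using V_open uV tV by auto

lemma tangent_expand:
 assumes y: "y \<in> V" and \<xi>: "\<xi> \<in> tangent_space X y"
 shows "\<xi> f = \<xi> u * Du y f + \<xi> t * Dt y f"
proof -
 interpret y: variety_point X y by (rule variety_point[OF V_points[OF y]])
 show ?thesis
 proof (cases "f \<in> reg_at X y")
  case True
  show ?thesis using y.contract_tangent[OF \<xi> Dif_partial[OF y True]]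
   by (simp add: deriv_of_def algebra_simps)
 qed (simp add: y.tangent_rules(1)[OF \<xi>] y.tangent_rules(1)[OF partial_tangent(1)[OF y]]
   y.tangent_rules(1)[OF partial_tangent(2)[OF y]])
qed

lemma partial_near:
 assumes y: "y \<in> V" and f: "f \<in> reg_at X y" and g: "g \<in> reg_at X y" and eq: "GEN z. f z = g z"
 shows "Du y f = Du y g" "Dt y f = Dt y g"
proof -
 interpret y: variety_point X y by (rule variety_point[OF V_points[OF y]])
 have "near_eq X y f g" using near_eq_iff[OF f g] eq by simp
 then show "Du y f = Du y g" "Dt y f = Dt y g"
  using y.tangent_rules(2)[OF _ f g] partial_tangent[OF y] by blast+
qed

text \<open>Partial derivatives exclude the forbidden relations: applying \<open>Dt\<close> to t^k =
  u c lowers k until 1 = u c', which fails at \<open>y\<close>; applying \<open>Du\<close> to u = t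
  c gives 1 = 0 at \<open>y\<close>.\<close>

lemma regular_local_ring2:
 assumes y: "y \<in> V"
 shows "regular_local_ring2 (generic X) (reg_at X y) y (%z. u z - u y) (%z. t z - t y)"
proof -
 interpret y: variety_point X y by (rule variety_point[OF V_points[OF y]])
 interpret L: generic_local_ring "generic X" "reg_at X y" y
  by (rule generic_local_ring_reg_at[OF V_points[OF y]])
 let ?u = "%z. u z - u y" and ?t = "%z. t z - t y"
 note ut = ut_reg_at[OF y]
 have r: "?u \<in> reg_at X y" "?t \<in> reg_at X y" by (intro y.R_diff ut y.R_const)+
 have d: "Du z ?u = 1" "Du z ?t = 0" "Dt z ?u = 0" "Dt z ?t = 1" if z: "z \<in> V" for z
 proof -
  interpret z: variety_point X z by (rule variety_point[OF V_points[OF z]])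
  note ut = ut_reg_at[OF z]
  show "Du z ?u = 1" "Du z ?t = 0" "Dt z ?u = 0" "Dt z ?t = 1"
   using z.tangent_diff[OF partial_tangent(1)[OF z] ut(1) z.R_const[of "u y"]]
    z.tangent_diff[OF partial_tangent(1)[OF z] ut(2) z.R_const[of "t y"]]
    z.tangent_diff[OF partial_tangent(2)[OF z] ut(1) z.R_const[of "u y"]]
    z.tangent_diff[OF partial_tangent(2)[OF z] ut(2) z.R_const[of "t y"]]
    partial_dual[OF z] z.tangent_const[OF partial_tangent(1)[OF z]] z.tangent_const[OF partial_tangent(2)[OF z]]
   by simp_all
 qed
 have nearV: "\<forall>\<^sub>F z in near X y. z \<in> V \<and> ?u \<in> reg_at X z \<and> ?t \<in> reg_at X z"
 proof -
  have "\<forall>\<^sub>F z in near X y. z \<in> V" unfolding y.near_iff using V_open y by blast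
  with y.near_reg_at[OF r(1)] y.near_reg_at[OF r(2)] show ?thesis by eventually_elim simp
 qed
 have ev: "\<forall>\<^sub>F z in near X y. Dt z f = Dt z g \<and> Du z f = Du z g"
  if "f \<in> reg_at X y" "g \<in> reg_at X y" "GEN z. f z = g z" for f g
  using y.near_reg_at[OF that(1)] y.near_reg_at[OF that(2)] nearV
  by eventually_elim (use partial_near that(3) in blast)
 have tpow: "\<not> (GEN z. ?t z ^ k = ?u z * c z)" if "c \<in> reg_at X y" for k c
  using that
 proof (induction k arbitrary: c)
  case 0
  show ?case
  proof
   assume "GEN z. ?t z ^ 0 = ?u z * c z"
   from L.ev_at[OF L.power_R[OF r(2)] L.mult_R[OF r(1) 0] this] show False by simp
  qed
 next
  case (Suc k)
  show ?case
  proof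
   assume eq: "GEN z. ?t z ^ Suc k = ?u z * c z"
   \<comment> \<open>The relation is differentiated along \<open>Dt\<close>, which kills
     \<open>u\<close>, and divided by k + 1.\<close>
   define c' where "c' = (%z. inverse (of_nat (Suc k)) * Dt z c)"
   have c': "c' \<in> reg_at X y" unfolding c'_def by (intro L.mult_R L.const_R partial_reg_at y Suc.prems)
   have "\<forall>\<^sub>F z in near X y. ?t z ^ k = ?u z * c' z"
    using ev[OF L.power_R[OF r(2)] L.mult_R[OF r(1) Suc.prems] eq] nearV y.near_reg_at[OF Suc.prems]
   proof eventually_elim
    case (elim z)
    then have z: "z \<in> V" by simp
    interpret z: variety_point X z by (rule variety_point[OF V_points[OF z]])
    have "of_nat (Suc k) * ?t z ^ k = ?u z * Dt z c"
     using elim z.tangent_power[OF partial_tangent(2)[OF z], of ?t "Suc k"]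
      z.tangent_rules(5)[OF partial_tangent(2)[OF z], of ?u c] d[OF z] by simp
    moreover have "of_nat (Suc k) ~= (0::complex)" by (simp only: of_nat_eq_0_iff)
    ultimately show ?case unfolding c'_def by (simp add: field_simps del: of_nat_Suc)
   qed
   from near_imp_generic[OF y.pt this] Suc.IH[OF c'] show False by simp
  qed
 qed
 have unot: "\<not> (GEN z. ?u z = ?t z * c z)" if c: "c \<in> reg_at X y" for c
 proof
  assume eq: "GEN z. ?u z = ?t z * c z"
  have "Du y ?u = Du y (%z. ?t z * c z)"
   by (rule partial_near(1)[OF y r(1) L.mult_R[OF r(2) c] eq])
  also have "\<dots> = ?t y * Du y c + c y * Du y ?t"
   by (rule y.tangent_rules(5)[OF partial_tangent(1)[OF y] r(2) c])
  finally show False using d[OF y] by simp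
 qed
 show ?thesis
  by unfold_locales (use r tpow unot maximal_ideal[OF y] in auto)
qed

end

lemma (in irreducible_var) irreducible_in_point: "x \<in> points X ==> irreducible_in (zar X) {x}"
 unfolding irreducible_in_def by auto

context smooth_surface
begin

text \<open>At \<open>x\<close> the differentials of the finitely many chart coordinates are
  combinations of du and dt. These relations persist on a neighbourhood, so du and dt generate
  there, and as the tangent spaces have dimension 2 they form a basis at every nearby point.\<close>

lemma coords_exist:
 assumes x: "x \<in> points X"
 shows "\<exists>V u t Du Dt. surface_coords X V u t Du Dt \<and> x \<in> V"
proof -
 interpret x: variety_point X x by (rule variety_point[OF x])
 obtain u t \<xi>1 \<xi>2 where d: "dual_pair X x u t \<xi>1 \<xi>2"
  using x.dual_pair_exists[OF dim_tangent_space[OF x]] by blast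
 have ut: "u \<in> reg_at X x" "t \<in> reg_at X x" using d unfolding dual_pair_def by auto
 obtain U n \<phi> where c: "chart X U n \<phi>" "x \<in> U" using chart_nbhd[OF var x] .
 let ?S = "{Dif u, Dif t}"
 have "\<forall>\<^sub>F y in near X x. lin X y (reg_at X y \<times> ?S) (Dif (%y. \<phi> y i))" if i: "i < n" for i
 proof -
  obtain a b where ab: "a \<in> reg_at X x" "b \<in> reg_at X x"
   "sym_eq X x (Dif (%y. \<phi> y i)) (Plus (Times (Fn a) (Dif u)) (Times (Fn b) (Dif t)))"
   by (rule x.lin_pair[OF x.dif.dual_pair_span[OF c d x.dif.coordR[OF c i]]]) (use ut in auto)
  from x.near_reg_at[OF ab(1)] x.near_reg_at[OF ab(2)] x.sym_eq_near[OF ab(3)]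
  show ?thesis
  proof eventually_elim
   case (elim y)
   have "lin X y (reg_at X y \<times> ?S) (Plus (Times (Fn a) (Dif u)) (Times (Fn b) (Dif t)))"
    by (intro lin_plus lin_mem) (use elim in auto)
   then show ?case by (rule lin_eq) (rule sym_eq.sym[OF elim(3)])
  qed
 qed
 then have "\<forall>\<^sub>F y in near X x. \<forall>i\<in>{..<n}. lin X y (reg_at X y \<times> ?S) (Dif (%y. \<phi> y i))"
  by (intro eventually_ball_finite) auto
 moreover have "\<forall>\<^sub>F y in near X x. y \<in> U \<and> u \<in> reg_at X y \<and> t \<in> reg_at X y"
 proof -
  have "\<forall>\<^sub>F y in near X x. y \<in> U" unfolding x.near_iff using chart_rules(1)[OF c(1)] c(2) by blast
  with x.near_reg_at[OF ut(1)] x.near_reg_at[OF ut(2)] show ?thesis by eventually_elim simp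
 qed
 ultimately have "\<forall>\<^sub>F y in near X x. (y \<in> U \<and> u \<in> reg_at X y \<and> t \<in> reg_at X y) \<and>
   (\<forall>i\<in>{..<n}. lin X y (reg_at X y \<times> ?S) (Dif (%y. \<phi> y i)))" by eventually_elim simp
 then obtain W where W: "zopen X W" "x \<in> W" "\<And>y. y \<in> W ==> y \<in> U" "\<And>y. y \<in> W ==> u \<in> reg_at X y"
  "\<And>y. y \<in> W ==> t \<in> reg_at X y"
  "\<And>y i. y \<in> W ==> i < n ==> lin X y (reg_at X y \<times> ?S) (Dif (%y. \<phi> y i))"
  unfolding x.near_iff by auto
 obtain U1 U2 where U12: "zopen X U1" "x \<in> U1" "u \<in> reg X U1" "zopen X U2" "x \<in> U2" "t \<in> reg X U2"
  using ut unfolding reg_at_def by blast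
 define V where "V = W \<inter> U1 \<inter> U2"
 have V: "zopen X V" "x \<in> V" "u \<in> reg X V" "t \<in> reg X V" "V \<subseteq> W"
 proof -
  show o: "zopen X V" "x \<in> V" "V \<subseteq> W" unfolding V_def using W U12 by auto
  show "u \<in> reg X V" by (rule reg_restrict[OF var U12(1) o(1) _ U12(3)]) (auto simp: V_def)
  show "t \<in> reg X V" by (rule reg_restrict[OF var U12(4) o(1) _ U12(6)]) (auto simp: V_def)
 qed
 have pts: "y \<in> points X" if "y \<in> V" for y using that openin_subset[OF V(1)] by blast
 have dec: "\<exists>a\<in>reg_at X y. \<exists>b\<in>reg_at X y. sym_eq X y (Dif f) (Plus (Times (Fn a) (Dif u)) (Times (Fn b) (Dif t)))"
  if y: "y \<in> V" and f: "f \<in> reg_at X y" for y f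
 proof -
  interpret y: variety_point X y by (rule variety_point[OF pts[OF y]])
  have yU: "y \<in> U" and ut: "u \<in> reg_at X y" "t \<in> reg_at X y" using y V(5) W by auto
  have "lin X y (reg_at X y \<times> ?S) (Times (Fn c) w)" if cw: "(c, w) \<in> reg_at X y \<times> y.dif.coords n \<phi>" for c w
  proof -
   obtain i where "i < n" "w = Dif (%y. \<phi> y i)" using cw unfolding y.dif.coords_def[OF c(1) yU] by auto
   then have "lin X y (reg_at X y \<times> ?S) w" using W(6) y V(5) by auto
   then show ?thesis by (rule y.lin_ideal_scale) (use cw ut in auto)
  qed
  then have l: "lin X y (reg_at X y \<times> ?S) (Dif f)" by (rule lin_trans[OF y.dif.coords_span[OF c(1) yU f]])
  obtain a b where "a \<in> reg_at X y" "b \<in> reg_at X y" "sym_eq X y (Dif f) (Plus (Times (Fn a) (Dif u)) (Times (Fn b) (Dif t)))"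
   by (rule y.lin_pair[OF l]) (use ut in auto)
  then show ?thesis by blast
 qed
 have "\<exists>\<xi>1 \<xi>2. dual_pair X y u t \<xi>1 \<xi>2" if y: "y \<in> V" for y
 proof -
  interpret y: variety_point X y by (rule variety_point[OF pts[OF y]])
  show ?thesis
  proof (rule y.dual_pair_of_injective[OF dim_tangent_space[OF y.pt]])
   show "u \<in> reg_at X y" "t \<in> reg_at X y" using W y V(5) by auto
   fix \<xi> assume \<xi>: "\<xi> \<in> tangent_space X y" "\<xi> u = 0" "\<xi> t = 0"
   show "\<forall>f. \<xi> f = 0"
   proof
    fix f show "\<xi> f = 0"
    proof (cases "f \<in> reg_at X y")
     case True
     then obtain a b where "sym_eq X y (Dif f) (Plus (Times (Fn a) (Dif u)) (Times (Fn b) (Dif t)))"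
      using dec[OF y] by blast
     from y.contract_tangent[OF \<xi>(1) this] show ?thesis using \<xi> by (simp add: deriv_of_def)
    qed (rule y.tangent_rules(1)[OF \<xi>(1)])
   qed
  qed
 qed
 \<comment> \<open>The dual bases are chosen point by point. They vary regularly because their
   values on f are the regular coefficients of df, as \<open>dec2\<close> shows.\<close>
 then have "\<forall>y\<in>V. \<exists>p. dual_pair X y u t (fst p) (snd p)" by (intro ballI) (metis fst_conv snd_conv)
 then obtain D where D: "\<forall>y\<in>V. dual_pair X y u t (fst (D y)) (snd (D y))" by (elim exE[OF bchoice])
 define Du Dt where "Du y = fst (D y)" and "Dt y = snd (D y)" for y
 have dp: "dual_pair X y u t (Du y) (Dt y)" if "y \<in> V" for y
  using D that unfolding Du_def Dt_def by blast
 have dec2: "(%z. Du z f) \<in> reg_at X y \<and> (%z. Dt z f) \<in> reg_at X y \<and> sym_eq X y (Dif f)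
   (Plus (Times (Fn (%z. Du z f)) (Dif u)) (Times (Fn (%z. Dt z f)) (Dif t)))"
  if y: "y \<in> V" and f: "f \<in> reg_at X y" for y f
 proof -
  interpret y: variety_point X y by (rule variety_point[OF pts[OF y]])
  have ut: "u \<in> reg_at X y" "t \<in> reg_at X y" using y V(5) W by auto
  obtain a b where ab: "a \<in> reg_at X y" "b \<in> reg_at X y"
   "sym_eq X y (Dif f) (Plus (Times (Fn a) (Dif u)) (Times (Fn b) (Dif t)))" using dec[OF y f] by blast
  have "\<forall>\<^sub>F z in near X y. z \<in> V" unfolding y.near_iff using V(1) y by blast
  with y.sym_eq_near[OF ab(3)] have ev: "\<forall>\<^sub>F z in near X y. Du z f = a z \<and> Dt z f = b z"
  proof eventually_elim
   case (elim z)
   interpret z: variety_point X z by (rule variety_point[OF pts[OF elim(2)]])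
   have t: "Du z \<in> tangent_space X z" "Dt z \<in> tangent_space X z" and
    e: "Du z u = 1" "Du z t = 0" "Dt z u = 0" "Dt z t = 1"
    using dp[OF elim(2)] unfolding dual_pair_def by auto
   show ?case using z.contract_tangent[OF t(1) elim(1)] z.contract_tangent[OF t(2) elim(1)] e
    by (simp add: deriv_of_def)
  qed
  then obtain N where N: "zopen X N" "y \<in> N" "\<forall>z\<in>N. Du z f = a z \<and> Dt z f = b z"
   unfolding y.near_iff by blast
  have r: "(%z. Du z f) \<in> reg_at X y" "(%z. Dt z f) \<in> reg_at X y"
   by (rule reg_at_ev_cong[OF ab(1) N(1,2)], use N(3) in simp)
     (rule reg_at_ev_cong[OF ab(2) N(1,2)], use N(3) in simp)
  have "sym_eq X y (Fn a) (Fn (%z. Du z f))" "sym_eq X y (Fn b) (Fn (%z. Dt z f))"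
   by (rule y.Fn_cong(1)[OF ab(1) r(1)], use ev in "simp add: eventually_mono")
     (rule y.Fn_cong(1)[OF ab(2) r(2)], use ev in "simp add: eventually_mono")
  then have "sym_eq X y (Plus (Times (Fn a) (Dif u)) (Times (Fn b) (Dif t)))
    (Plus (Times (Fn (%z. Du z f)) (Dif u)) (Times (Fn (%z. Dt z f)) (Dif t)))"
   using ut by (intro sym_eq.cong_plus y.times_congL) simp_all
  with r sym_eq.trans[OF ab(3)] show ?thesis by blast
 qed
 have "surface_coords X V u t Du Dt"
 proof
  fix y assume y: "y \<in> V"
  interpret y: variety_point X y by (rule variety_point[OF pts[OF y]])
  show "Du y \<in> tangent_space X y" "Dt y \<in> tangent_space X y" "Du y u = 1" "Du y t = 0" "Dt y u = 0" "Dt y t = 1"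
   using dp[OF y] unfolding dual_pair_def by auto
  fix f assume f: "f \<in> reg_at X y"
  show "(%z. Du z f) \<in> reg_at X y" "(%z. Dt z f) \<in> reg_at X y"
   "sym_eq X y (Dif f) (Plus (Times (Fn (%z. Du z f)) (Dif u)) (Times (Fn (%z. Dt z f)) (Dif t)))"
   using dec2[OF y f] by auto
  assume "f y = 0"
  from y.dual_pair_maximal[OF dp[OF y] f this]
  show "\<exists>a\<in>reg_at X y. \<exists>b\<in>reg_at X y. GEN z. f z = (u z - u y) * a z + (t z - t y) * b z"
   by (elim bexE) (rule bexI, rule bexI, rule near_imp_generic[OF y.pt])
 qed (use V in auto)
 with V(2) show ?thesis by blast
qed

section \<open>Invariant germs give invariant curves\<close>

lemma irreducible_in_Union:
 assumes "finite \<Z>" "irreducible_in (zar X) Z" "\<And>K. K \<in> \<Z> ==> closedin (zar X) K" "Z \<subseteq> \<Union>\<Z>"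
 shows "\<exists>K\<in>\<Z>. Z \<subseteq> K"
 using assms
proof (induction \<Z> rule: finite_induct)
 case empty
 then show ?case unfolding irreducible_in_def by auto
next
 case (insert K \<Z>)
 have "closedin (zar X) K" "closedin (zar X) (\<Union>\<Z>)" "Z \<subseteq> K \<union> \<Union>\<Z>"
  using insert by (auto intro: closedin_Union)
 then have "Z \<subseteq> K \<or> Z \<subseteq> \<Union>\<Z>" using insert.prems(1) unfolding irreducible_in_def by blast
 then show ?case using insert by auto
qed

lemma irreducible_in_subtopology:
 assumes "closedin (zar X) Z" "A \<subseteq> Z"
 shows "irreducible_in (subtopology (zar X) Z) A \<longleftrightarrow> irreducible_in (zar X) A"
proof -
 have Z: "Z \<subseteq> points X" by (rule closedin_subset[OF assms(1)])
 have top: "topspace (subtopology (zar X) Z) = Z" using Z by (simp add: topspace_subtopology Int_absorb1)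
 show ?thesis
 proof
  assume L: "irreducible_in (subtopology (zar X) Z) A"
  show "irreducible_in (zar X) A" unfolding irreducible_in_def
  proof (intro conjI allI impI)
   show "A ~= {}" "A \<subseteq> points X" using L assms(2) Z unfolding irreducible_in_def by auto
   fix B C assume BC: "closedin (zar X) B \<and> closedin (zar X) C \<and> A \<subseteq> B \<union> C"
   have "closedin (subtopology (zar X) Z) (B \<inter> Z)" "closedin (subtopology (zar X) Z) (C \<inter> Z)"
    using BC unfolding closedin_subtopology by auto
   moreover have "A \<subseteq> B \<inter> Z \<union> C \<inter> Z" using BC assms(2) by blast
   ultimately have "A \<subseteq> B \<inter> Z \<or> A \<subseteq> C \<inter> Z" using L unfolding irreducible_in_def by metis
   then show "A \<subseteq> B \<or> A \<subseteq> C" by blast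
  qed
 next
  assume L: "irreducible_in (zar X) A"
  show "irreducible_in (subtopology (zar X) Z) A" unfolding irreducible_in_def top
  proof (intro conjI allI impI)
   show "A ~= {}" "A \<subseteq> Z" using L assms(2) unfolding irreducible_in_def by auto
   fix B C assume "closedin (subtopology (zar X) Z) B \<and> closedin (subtopology (zar X) Z) C \<and> A \<subseteq> B \<union> C"
   then show "A \<subseteq> B \<or> A \<subseteq> C"
    using L closedin_trans_full[OF _ assms(1)] unfolding irreducible_in_def by metis
  qed
 qed
qed

text \<open>A chain of length two inside \<open>Z\<close> would be prolonged by the whole surface to
  length three; a point of \<open>Z\<close> followed by \<open>Z\<close> is a chain of length
  one.\<close>

lemma krull_dim_curve:
 assumes Z: "closedin (zar X) Z" "irreducible_in (zar X) Z" "\<And>x. Z ~= {x}" "Z ~= points X"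
 shows "krull_dim (subtopology (zar X) Z) = 1"
proof -
 let ?T = "subtopology (zar X) Z"
 let ?A = "{n. \<exists>C. (\<forall>i\<le>n. closedin ?T (C i) \<and> irreducible_in ?T (C i)) \<and> (\<forall>i<n. C i \<subset> C (Suc i))}"
 have irrX: "irreducible_in (zar X) (points X)" using irr unfolding irreducible_variety_def by simp
 have "n \<le> 1" if "n \<in> ?A" for n
 proof (rule ccontr)
  assume n: "\<not> n \<le> 1"
  obtain C where C: "\<And>i. i \<le> n ==> closedin ?T (C i) \<and> irreducible_in ?T (C i)" "\<And>i. i < n ==> C i \<subset> C (Suc i)"
   using \<open>n \<in> ?A\<close> by blast
  have sub: "C i \<subseteq> Z" if "i \<le> n" for i using closedin_subset[of ?T "C i"] C(1)[OF that] by auto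
  define D where "D i = (if i \<le> 2 then C i else points X)" for i :: nat
  have cl: "closedin (zar X) (C i) \<and> irreducible_in (zar X) (C i)" if "i \<le> n" for i
   using C(1)[OF that] closedin_trans_full[OF _ Z(1)] irreducible_in_subtopology[OF Z(1) sub[OF that]] by blast
  have "\<forall>i\<le>3. closedin (zar X) (D i) \<and> irreducible_in (zar X) (D i)"
   unfolding D_def using cl n irrX by auto
  moreover have "D i \<subset> D (Suc i)" if "i < 3" for i
  proof (cases "i = 2")
   case True
   have "Z \<subset> points X" using closedin_subset[OF Z(1)] Z(4) by blast
   then show ?thesis using sub[of 2] n unfolding D_def True by auto
  next
   case False
   then show ?thesis using C(2)[of i] n that unfolding D_def by auto
  qed
  ultimately have "3 \<in> {n. \<exists>C. (\<forall>i\<le>n. closedin (zar X) (C i) \<and> irreducible_in (zar X) (C i)) \<and> (\<forall>i<n. C i \<subset> C (Suc i))}"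
   by blast
  then have "enat 3 \<le> krull_dim (zar X)" unfolding krull_dim_def by (rule SUP_upper)
  then show False using dim2 by (simp add: numeral_eq_enat)
 qed
 then have "krull_dim ?T \<le> 1" unfolding krull_dim_def
  by (intro SUP_least) (auto simp: one_enat_def)
 moreover have "1 \<in> ?A"
 proof -
  obtain z where z: "z \<in> Z" using Z(2) unfolding irreducible_in_def by blast
  have zp: "z \<in> points X" using z closedin_subset[OF Z(1)] by blast
  define C where "C i = (if i = 0 then {z} else Z)" for i :: nat
  have "closedin (zar X) (C i) \<and> irreducible_in (zar X) (C i) \<and> C i \<subseteq> Z" for i
   unfolding C_def using Z z closedin_point[OF var zp] irreducible_in_point[OF zp] by auto
  then have "closedin ?T (C i) \<and> irreducible_in ?T (C i)" for i
   using irreducible_in_subtopology[OF Z(1)] closedin_subset_topspace[of "zar X" "C i" Z]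
   by (metis closedin_closed_subtopology[OF Z(1)])
  moreover have "C 0 \<subset> C (Suc 0)" unfolding C_def using z Z(3)[of z] by auto
  ultimately show ?thesis by (intro CollectI exI[of _ C]) auto
 qed
 then have "1 \<le> krull_dim ?T" unfolding krull_dim_def one_enat_def by (rule SUP_upper)
 ultimately show ?thesis by (rule antisym)
qed

text \<open>If \<open>x\<close> were the only zero in \<open>W\<close>, the Nullstellensatz would
  make \<open>h\<close> divide powers of both local parameters.\<close>

lemma zero_not_isolated:
 assumes W: "zopen X W" and h: "h \<in> reg X W" and x: "x \<in> W" "h x = 0"
 shows "\<exists>y\<in>W. y ~= x \<and> h y = 0"
proof (rule ccontr)
 assume no: "\<not> ?thesis"
 have xp: "x \<in> points X" using openin_subset[OF W] x by blast
 obtain V u t Du Dt where c: "surface_coords X V u t Du Dt" "x \<in> V" using coords_exist[OF xp] by blast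
 interpret surface_coords X V u t Du Dt by (rule c(1))
 interpret L: regular_local_ring2 "generic X" "reg_at X x" x "%z. u z - u x" "%z. t z - t x"
  by (rule regular_local_ring2[OF c(2)])
 have hx: "h \<in> reg_at X x" unfolding reg_at_def using W h x by blast
 have dvd: "\<exists>k. L.dvdR h (%z. f z ^ k)" if f: "f \<in> reg_at X x" "f x = 0" for f
 proof -
  have "f y = 0" if "y \<in> W" "h y = 0" for y using no that f(2) by auto
  from local_nullstellensatz[OF xp hx f(1) W x(1) this]
  show ?thesis unfolding L.dvdR_def .
 qed
 obtain k where k: "L.dvdR h (%z. (u z - u x) ^ k)" using dvd[OF L.ut_R(1)] by auto
 obtain m where m: "L.dvdR h (%z. (t z - t x) ^ m)" using dvd[OF L.ut_R(2)] by auto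
 show False by (rule L.no_isolated_zero[OF hx x(2) k m])
qed

text \<open>The radical of a differential ideal is differential in characteristic 0. Each
  differentiation, followed by multiplication with \<delta> f, trades one factor f for two factors
  \<delta> f; the extra factor makes the term with the second derivative a multiple of the previous
  relation.\<close>

lemma radical_differential:
 assumes v: "vector_field X v" and x: "x \<in> points X"
  and h: "h \<in> reg_at X x" and g: "g \<in> reg_at X x" "GEN y. v y h = g y * h y"
  and f: "f \<in> reg_at X x" and c: "c \<in> reg_at X x" "GEN y. f y ^ k = h y * c y"
 shows "\<exists>c\<in>reg_at X x. GEN y. v y f ^ (2 * k) = h y * c y"
proof -
 interpret x: variety_point X x by (rule variety_point[OF x])
 interpret L: generic_local_ring "generic X" "reg_at X x" x by (rule generic_local_ring_reg_at[OF x])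
 have d: "(%y. v y f) \<in> reg_at X x" if "f \<in> reg_at X x" for f
  using deriv_of_reg_at[OF v that] unfolding deriv_of_def .
 have vt: "v y \<in> tangent_space X y" if "y \<in> points X" for y using v that unfolding vector_field_def by blast
 let ?e = "%y. v y f"
 have "\<exists>c\<in>reg_at X x. GEN y. f y ^ m * ?e y ^ (2 * j) = h y * c y" if "m + j = k" for m j
  using that
 proof (induction j arbitrary: m)
  case 0
  with c show ?case by (intro bexI[OF _ c(1)]) simp
 next
  case (Suc j)
  then obtain c where c: "c \<in> reg_at X x" "GEN y. f y ^ Suc m * ?e y ^ (2 * j) = h y * c y"
   using Suc.IH[of "Suc m"] by auto
  define c' where "c' = (%y. inverse (of_nat (Suc m)) * (?e y * (g y * c y + v y c) - of_nat (2 * j) * v y ?e * c y))"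
  have c': "c' \<in> reg_at X x" unfolding c'_def by (intro L.mult_R L.diff_R L.add_R L.const_R d f g c)
  have "\<forall>\<^sub>F y in near X x. f y ^ m * ?e y ^ (2 * Suc j) = h y * c' y"
   using generic_imp_near[OF d[OF h] L.mult_R[OF g(1) h] x g(2)]
    generic_imp_near[OF L.mult_R[OF L.power_R[OF f] L.power_R[OF d[OF f]]] L.mult_R[OF h c(1)] x c(2)]
    x.near_reg_at[OF h] x.near_reg_at[OF g(1)] x.near_reg_at[OF f] x.near_reg_at[OF c(1)] x.near_reg_at[OF d[OF f]] x.near_points
  proof eventually_elim
   case (elim y)
   interpret y: variety_point X y by (rule variety_point[OF elim(8)])
   interpret Ly: generic_local_ring "generic X" "reg_at X y" y by (rule generic_local_ring_reg_at[OF elim(8)])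
   note vy = vt[OF elim(8)]
   note rules = y.tangent_rules[OF vy]
   note r = Ly.mult_R[OF Ly.power_R[OF elim(5), of "Suc m"] Ly.power_R[OF elim(7), of "2 * j"]] Ly.mult_R[OF elim(3,6)]
   have "v y (%y. f y ^ Suc m * ?e y ^ (2 * j)) = v y (%y. h y * c y)"
    by (rule rules(2)[OF r iffD2[OF near_eq_iff[OF r] c(2)]])
   then have "f y ^ Suc m * (of_nat (2 * j) * ?e y ^ (2 * j - 1) * v y ?e) + ?e y ^ (2 * j) * (of_nat (Suc m) * f y ^ m * ?e y)
     = h y * v y c + c y * (g y * h y)"
    using rules(5)[OF Ly.power_R[OF elim(5)] Ly.power_R[OF elim(7)], of "Suc m" "2 * j"]
     y.tangent_power[OF vy elim(5), of "Suc m"] y.tangent_power[OF vy elim(7), of "2 * j"] rules(5)[OF elim(3,6)] elim(1) by simp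
   then have "?e y * (f y ^ Suc m * (of_nat (2 * j) * ?e y ^ (2 * j - 1) * v y ?e) + ?e y ^ (2 * j) * (of_nat (Suc m) * f y ^ m * ?e y))
     = ?e y * (h y * v y c + c y * (g y * h y))" by simp
   moreover have "?e y * (of_nat (2 * j) * ?e y ^ (2 * j - 1)) = of_nat (2 * j) * ?e y ^ (2 * j)"
    by (cases j) simp_all
   moreover have "?e y * (F * (N * w) + E2 * Y) = M * w * (F * E2) + ?e y * E2 * Y" if "?e y * N = M * E2"
    for F N w E2 Y M using arg_cong[OF that, of "%z. z * F * w"] by (simp add: algebra_simps)
   ultimately have "of_nat (2 * j) * v y ?e * (f y ^ Suc m * ?e y ^ (2 * j)) +
     ?e y * ?e y ^ (2 * j) * (of_nat (Suc m) * f y ^ m * ?e y) = ?e y * (h y * v y c + c y * (g y * h y))"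
    by metis
   then have "of_nat (2 * j) * v y ?e * (f y ^ Suc m * ?e y ^ (2 * j)) + of_nat (Suc m) * (f y ^ m * ?e y ^ (2 * Suc j))
     = ?e y * (h y * v y c + c y * (g y * h y))"
    by (simp add: algebra_simps)
   then have "of_nat (Suc m) * (f y ^ m * ?e y ^ (2 * Suc j)) =
     h y * (?e y * (g y * c y + v y c) - of_nat (2 * j) * v y ?e * c y)"
    unfolding elim(2) by (simp add: algebra_simps)
   moreover have "of_nat (Suc m) ~= (0::complex)" by (simp only: of_nat_eq_0_iff)
   ultimately show ?case unfolding c'_def by (simp add: field_simps del: of_nat_Suc)
  qed
  from near_imp_generic[OF x this] c' show ?case by blast
 qed
 from this[of 0 k] show ?thesis by simp
qed

text \<open>The curve is the closure of the zero set \<open>S\<close> of \<open>h\<close>. Since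
  every open set that meets the closure meets \<open>S\<close>, its dimension and its invariance
  need only be tested at points of \<open>S\<close>, where \<open>h\<close> generates an invariant
  ideal.\<close>

theorem invariant_germ_curve:
 assumes v: "vector_field X v" and p: "p \<in> points X"
  and h: "h \<in> reg_at X p" "h p = 0" "\<not> (GEN y. h y = 0)"
  and g: "g \<in> reg_at X p" "GEN y. v y h = g y * h y"
 shows "\<exists>C. closed_curve X C \<and> p \<in> C \<and> invariant_closed X v C"
proof -
 obtain U1 U2 where U12: "zopen X U1" "p \<in> U1" "h \<in> reg X U1" "zopen X U2" "p \<in> U2" "g \<in> reg X U2"
  using h(1) g(1) unfolding reg_at_def by blast
 define U where "U = U1 \<inter> U2"
 have U: "zopen X U" "p \<in> U" unfolding U_def using U12 by auto
 have hU: "h \<in> reg X U" by (rule reg_restrict[OF var U12(1) U(1) _ U12(3)]) (auto simp: U_def)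
 have gU: "g \<in> reg X U" by (rule reg_restrict[OF var U12(4) U(1) _ U12(6)]) (auto simp: U_def)
 have at: "h \<in> reg_at X x" "g \<in> reg_at X x" "x \<in> points X" if "x \<in> U" for x
  using that U(1) hU gU openin_subset[OF U(1)] unfolding reg_at_def by auto
 define S where "S = {y\<in>U. h y = 0}"
 define C where "C = zar X closure_of S"
 have Sp: "S \<subseteq> points X" unfolding S_def using openin_subset[OF U(1)] by blast
 have SC: "S \<subseteq> C" unfolding C_def by (rule closure_of_subset[OF Sp])
 have Ccl: "closedin (zar X) C" unfolding C_def by simp
 have meets: "\<exists>y\<in>S. y \<in> O'" if "zopen X O'" "x \<in> O'" "x \<in> C" for O' x
  using that unfolding C_def in_closure_of by blast
 have CU: "C \<inter> U = S"
 proof -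
  have "x \<in> S" if x: "x \<in> C" "x \<in> U" for x
  proof (rule ccontr)
   assume "x \<notin> S"
   then have "x \<in> {y\<in>U. h y ~= 0}" using x unfolding S_def by auto
   from meets[OF open_nonzero[OF var U(1) hU] this x(1)] show False unfolding S_def by blast
  qed
  then show ?thesis using SC unfolding S_def by blast
 qed
 have pC: "p \<in> C" using SC U(2) h(2) unfolding S_def by blast
 have Cne: "C ~= points X"
 proof
  assume "C = points X"
  then have "\<forall>y\<in>U. h y = 0" using CU openin_subset[OF U(1)] unfolding S_def by blast
  then have "GEN y. h y = 0" using U by (intro eventually_genericI) auto
  with h(3) show False by simp
 qed
 have "closed_curve X C" unfolding closed_curve_def
 proof (intro conjI Ccl allI impI)
  show "C ~= {}" using pC by blast
  fix Z assume "irreducible_component (zar X) C Z"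
  then have Z: "irreducible_in (zar X) Z" "Z \<subseteq> C"
   and max: "\<And>Z'. irreducible_in (zar X) Z' ==> Z \<subseteq> Z' ==> Z' \<subseteq> C ==> Z' = Z"
   unfolding irreducible_component_def by blast+
  obtain \<Z> where D: "finite \<Z>" "\<And>K. K \<in> \<Z> ==> closedin (zar X) K" "\<And>K. K \<in> \<Z> ==> irreducible_in (zar X) K" "\<Union>\<Z> = C"
   using irreducible_decomposition[OF var Ccl] by blast
  obtain K where "K \<in> \<Z>" "Z \<subseteq> K" using irreducible_in_Union[OF D(1) Z(1) D(2)] Z(2) D(4) by blast
  moreover have "K = Z" by (rule max) (use calculation D in auto)
  ultimately have ZZ: "Z \<in> \<Z>" by simp
  show "krull_dim (subtopology (zar X) Z) = 1"
  proof (rule krull_dim_curve[OF D(2)[OF ZZ] Z(1)])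
   show "Z ~= points X" using Z(2) Cne closedin_subset[OF Ccl] by blast
   fix x show "Z ~= {x}"
   proof
    assume Zx: "Z = {x}"
    \<comment> \<open>A component reduced to a point would have a neighbourhood free of all other
      components, in which it would be an isolated zero of \<open>h\<close>.\<close>
    define W where "W = points X - \<Union>(\<Z> - {Z})"
    have Wo: "zopen X W" unfolding W_def
     by (intro openin_diff openin_topspace closedin_Union) (use D in auto)
    have xr: "x \<notin> \<Union>(\<Z> - {Z})"
    proof
     assume "x \<in> \<Union>(\<Z> - {Z})"
     then obtain K where K: "K \<in> \<Z>" "K ~= Z" "x \<in> K" by blast
     have "K = Z" by (rule max) (use K D Zx in auto)
     with K show False by simp
    qed
    have xC: "x \<in> C" using Z(2) Zx by blast
    then have xW: "x \<in> W" unfolding W_def using xr closedin_subset[OF Ccl] by blast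
    have only: "y = x" if "y \<in> W" "y \<in> S" for y
    proof -
     have "y \<in> \<Union>\<Z>" using that SC D(4) by blast
     then show ?thesis using that(1) Zx unfolding W_def by blast
    qed
    have xS: "x \<in> S" using meets[OF Wo xW xC] only by blast
    have WU: "zopen X (W \<inter> U)" "x \<in> W \<inter> U" "h x = 0" using Wo U xW xS unfolding S_def by auto
    have "h \<in> reg X (W \<inter> U)" by (rule reg_restrict[OF var U(1) WU(1) _ hU]) auto
    from zero_not_isolated[OF WU(1) this WU(2,3)] show False using only unfolding S_def by blast
   qed
  qed
 qed
 moreover have "invariant_closed X v C" unfolding invariant_closed_def
 proof (intro allI impI)
  fix Q f assume Qf: "zopen X Q \<and> f \<in> ideal_sheaf X C Q"
  then have Q: "zopen X Q" and f: "f \<in> reg X Q" "\<And>x. x \<in> C ==> x \<in> Q ==> f x = 0"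
   unfolding ideal_sheaf_def by auto
  have d: "deriv_of v f \<in> reg X Q" using v Q f(1) unfolding vector_field_def deriv_of_def by blast
  have "deriv_of v f x = 0" if x: "x \<in> C" "x \<in> Q" for x
  proof (rule ccontr)
   \<comment> \<open>The locus where \<delta> f is nonzero is open, so it meets \<open>S\<close>;
     there \<open>h\<close> is regular and a power of \<delta> f is a multiple of
     \<open>h\<close>.\<close>
   assume "deriv_of v f x ~= 0"
   then have "x \<in> {y\<in>Q. deriv_of v f y ~= 0}" using x by simp
   from meets[OF open_nonzero[OF var Q d] this x(1)] obtain y
    where y: "y \<in> S" "y \<in> Q" "deriv_of v f y ~= 0" by blast
   have yU: "y \<in> U" "h y = 0" using y unfolding S_def by auto
   have fy: "f \<in> reg_at X y" unfolding reg_at_def using Q f y by blast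
   have QU: "zopen X (Q \<inter> U)" "y \<in> Q \<inter> U" using Q U y yU by auto
   have "f z = 0" if "z \<in> Q \<inter> U" "h z = 0" for z using f(2)[of z] that SC unfolding S_def by blast
   from local_nullstellensatz[OF at(3)[OF yU(1)] at(1)[OF yU(1)] fy QU this]
   obtain k c where kc: "c \<in> reg_at X y" "GEN z. f z ^ k = h z * c z" by blast
   obtain c' where c': "c' \<in> reg_at X y" "GEN z. v z f ^ (2 * k) = h z * c' z"
    using radical_differential[OF v at(3)[OF yU(1)] at(1)[OF yU(1)] at(2)[OF yU(1)] g(2) fy kc] by blast
   interpret L: generic_local_ring "generic X" "reg_at X y" y by (rule generic_local_ring_reg_at[OF at(3)[OF yU(1)]])
   have "(%z. v z f) \<in> reg_at X y" using deriv_of_reg_at[OF v fy] unfolding deriv_of_def .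
   from L.ev_at[OF L.power_R[OF this] L.mult_R[OF at(1)[OF yU(1)] c'(1)] c'(2)]
   show False using y(3) yU(2) unfolding deriv_of_def by simp
  qed
  with d show "deriv_of v f \<in> ideal_sheaf X C Q" unfolding ideal_sheaf_def by blast
 qed
 ultimately show ?thesis using pC by blast
qed

end

section \<open>Symmetric forms as functions on the tangent bundle\<close>

abbreviation eval_at :: "'a sexp => 'a => (('a => complex) => complex) => complex" where
 "eval_at s z \<xi> \<equiv> contract (%_. \<xi>) s z"

lemma contract_eval_at: "contract v s z = eval_at s z (v z)"
 by (induction s) (simp_all add: deriv_of_def)

primrec spow :: "'a sexp => nat => 'a sexp" where
 "spow \<alpha> 0 = Fn (%_. 1)"
| "spow \<alpha> (Suc r) = Times \<alpha> (spow \<alpha> r)"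

text \<open>The form with value \<open>\<Sum>i\<le>r. c i * du ^ i * dt ^ (r - i)\<close>.\<close>

primrec nform :: "('a => complex) => ('a => complex) => nat => (nat => 'a => complex) => 'a sexp" where
 "nform u t 0 c = Fn (c 0)"
| "nform u t (Suc r) c = Plus (Times (Dif u) (nform u t r (%i. c (Suc i)))) (Times (Fn (c 0)) (spow (Dif t) (Suc r)))"

lemma homog_spow: "homog 1 \<alpha> ==> homog r (spow \<alpha> r)"
proof (induction r)
 case (Suc r)
 from homog.intros(4)[OF Suc.prems Suc.IH[OF Suc.prems]] show ?case by simp
qed (auto intro: homog.intros)

lemma homog_scale: "homog r s ==> homog r (Times (Fn f) s)"
 using homog.intros(4)[OF homog.intros(1)] by fastforce

lemma homog_nform: "homog r (nform u t r c)"
proof (induction r arbitrary: c)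
 case (Suc r)
 have "homog (1 + r) (Times (Dif u) (nform u t r (%i. c (Suc i))))"
  by (intro homog.intros(4) homog.intros(2) Suc.IH)
 moreover have "homog (Suc r) (Times (Fn (c 0)) (spow (Dif t) (Suc r)))"
  by (intro homog_scale homog_spow homog.intros(2))
 ultimately show ?case by (auto intro: homog.intros(3))
qed (auto intro: homog.intros)

lemma homog_lie: "homog r s ==> homog r (lie v s)"
 by (induction rule: homog.induct) (auto intro: homog.intros homog.intros(2)[unfolded One_nat_def])

lemma leaves_spow: "leaves \<alpha> \<subseteq> A ==> (%_. 1) \<in> A ==> leaves (spow \<alpha> r) \<subseteq> A"
 by (induction r) auto

lemma leaves_nform: "u \<in> A ==> t \<in> A ==> (\<And>i. c i \<in> A) ==> (%_. 1) \<in> A ==> leaves (nform u t r c) \<subseteq> A"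
proof (induction r arbitrary: c)
 case (Suc r)
 have "leaves (spow (Dif t) (Suc r)) \<subseteq> A" by (rule leaves_spow) (use Suc.prems in auto)
 then show ?case using Suc by simp
qed simp

lemma eval_spow: "eval_at (spow \<alpha> r) z \<xi> = eval_at \<alpha> z \<xi> ^ r"
 by (induction r) auto

lemma eval_nform: "eval_at (nform u t r c) z \<xi> = (\<Sum>i\<le>r. c i z * \<xi> u ^ i * \<xi> t ^ (r - i))"
proof (induction r arbitrary: c)
 case (Suc r)
 have "(\<Sum>i\<le>Suc r. c i z * \<xi> u ^ i * \<xi> t ^ (Suc r - i)) =
   c 0 z * \<xi> t ^ Suc r + (\<Sum>i\<le>r. c (Suc i) z * \<xi> u ^ Suc i * \<xi> t ^ (r - i))"
  by (subst sum.atMost_Suc_shift) simp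
 also have "(\<Sum>i\<le>r. c (Suc i) z * \<xi> u ^ Suc i * \<xi> t ^ (r - i)) =
   \<xi> u * (\<Sum>i\<le>r. c (Suc i) z * \<xi> u ^ i * \<xi> t ^ (r - i))"
  by (simp add: sum_distrib_left ac_simps)
 finally show ?case by (simp add: Suc.IH eval_spow deriv_of_def)
qed simp

context surface_coords
begin

lemma vec_tangent: "y \<in> V ==> (%f. a * Du y f + b * Dt y f) \<in> tangent_space X y"
 by (intro tangent_space_combine partial_tangent)

lemma vec_ut: "y \<in> V ==> a * Du y u + b * Dt y u = a" "y \<in> V ==> a * Du y t + b * Dt y t = b"
 using partial_dual by simp_all

context
 fixes y assumes y: "y \<in> V"
begin

interpretation y: variety_point X y by (rule variety_point[OF V_points[OF y]])

lemma wf_ut: "y.wf (Dif u)" "y.wf (Dif t)" "y.wf (spow (Dif t) r)"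
 using ut_reg_at[OF y] leaves_spow[of "Dif t" y.R] by auto

lemma wf_nform: "(\<And>i. c i \<in> y.R) ==> y.wf (nform u t r c)"
 using ut_reg_at[OF y] by (intro leaves_nform) auto

lemma nform_add:
 "(\<And>i. c i \<in> y.R) ==> (\<And>i. d i \<in> y.R) ==>
  sym_eq X y (Plus (nform u t r c) (nform u t r d)) (nform u t r (%i z. c i z + d i z))"
proof (induction r arbitrary: c d)
 case 0
 then show ?case by (simp add: y.Fn_plus)
next
 case (Suc r)
 let ?A = "nform u t r (%i. c (Suc i))" and ?B = "nform u t r (%i. d (Suc i))" and ?T = "spow (Dif t) (Suc r)"
 have w: "y.wf ?A" "y.wf ?B" "y.wf ?T" "y.wf (Dif u)" "y.wf (Fn (c 0))" "y.wf (Fn (d 0))"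
  using Suc.prems wf_ut wf_nform by auto
 have "y.seq (Plus (nform u t (Suc r) c) (nform u t (Suc r) d))
   (Plus (Plus (Times (Dif u) ?A) (Times (Dif u) ?B)) (Plus (Times (Fn (c 0)) ?T) (Times (Fn (d 0)) ?T)))"
  unfolding nform.simps using w by (intro sym_eq_plus_swap) simp_all
 also have "y.seq \<dots> (Plus (Times (Dif u) (Plus ?A ?B)) (Times (Fn (%z. c 0 z + d 0 z)) ?T))"
  using w Suc.prems by (intro sym_eq.cong_plus sym_eq.sym[OF sym_eq.distrib] y.scale_add) simp_all
 also have "y.seq \<dots> (nform u t (Suc r) (%i z. c i z + d i z))"
  unfolding nform.simps using w Suc.prems by (intro y.plus_congL y.times_congR Suc.IH) (simp_all add: y.R_add)
 finally show ?case .
qed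

lemma times_left_comm:
 assumes "y.wf a" "y.wf b" "y.wf c"
 shows "sym_eq X y (Times a (Times b c)) (Times b (Times a c))"
proof -
 have "y.seq (Times a (Times b c)) (Times (Times a b) c)" using assms by (intro sym_eq.sym[OF sym_eq.times_assoc])
 also have "y.seq \<dots> (Times (Times b a) c)" using assms by (intro y.times_congL sym_eq.times_comm)
 also have "y.seq \<dots> (Times b (Times a c))" using assms by (intro sym_eq.times_assoc)
 finally show ?thesis .
qed

lemma nform_scale:
 "f \<in> y.R ==> (\<And>i. c i \<in> y.R) ==>
  sym_eq X y (Times (Fn f) (nform u t r c)) (nform u t r (%i z. f z * c i z))"
proof (induction r arbitrary: c)
 case 0
 then show ?case by (simp add: y.Fn_times)
next
 case (Suc r)
 let ?A = "nform u t r (%i. c (Suc i))" and ?T = "spow (Dif t) (Suc r)"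
 have w: "y.wf ?A" "y.wf ?T" "y.wf (Dif u)" "y.wf (Fn (c 0))" "y.wf (Fn f)"
  using Suc.prems wf_ut wf_nform by auto
 have "y.seq (Times (Fn f) (nform u t (Suc r) c))
   (Plus (Times (Fn f) (Times (Dif u) ?A)) (Times (Fn f) (Times (Fn (c 0)) ?T)))"
  unfolding nform.simps using w Suc.prems by (intro y.scale_distrib) simp_all
 also have "y.seq \<dots> (Plus (Times (Dif u) (Times (Fn f) ?A)) (Times (Fn (%z. f z * c 0 z)) ?T))"
  using w Suc.prems by (intro sym_eq.cong_plus times_left_comm y.scale_scale) simp_all
 also have "y.seq \<dots> (nform u t (Suc r) (%i z. f z * c i z))"
  unfolding nform.simps using w Suc.prems by (intro y.plus_congL y.times_congR Suc.IH) (simp_all add: y.R_mult)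
 finally show ?case .
qed

lemma nform_du:
 assumes "\<And>i. c i \<in> y.R"
 shows "sym_eq X y (Times (Dif u) (nform u t r c)) (nform u t (Suc r) (%i. case i of 0 => %_. 0 | Suc j => c j))"
proof -
 have w: "y.wf (nform u t r c)" "y.wf (spow (Dif t) (Suc r))" "y.wf (Dif u)" using assms wf_ut wf_nform by auto
 have "y.seq (Times (Dif u) (nform u t r c)) (Plus (Times (Dif u) (nform u t r c)) (Fn (%_. 0)))"
  using w by (intro sym_eq.sym[OF y.plus_zeroR]) simp
 also have "y.seq \<dots> (Plus (Times (Dif u) (nform u t r c)) (Times (Fn (%_. 0)) (spow (Dif t) (Suc r))))"
  using w by (intro y.plus_congR sym_eq.sym[OF y.times_zeroL]) simp_all
 finally show ?thesis by simp
qed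

lemma nform_dt:
 "(\<And>i. c i \<in> y.R) ==> \<exists>d. (\<forall>i. d i \<in> y.R) \<and> sym_eq X y (Times (Dif t) (nform u t r c)) (nform u t (Suc r) d)"
proof (induction r arbitrary: c)
 case 0
 define d where "d i = (if i = (0::nat) then c 0 else (%_. 0))" for i
 have w: "y.wf (Dif u)" "y.wf (Dif t)" "y.wf (Fn (c 0))" using wf_ut 0 by auto
 have "y.seq (Times (Dif t) (Fn (c 0))) (Times (Fn (c 0)) (Dif t))" using w by (intro sym_eq.times_comm)
 also have "y.seq \<dots> (Times (Fn (c 0)) (Times (Dif t) (Fn (%_. 1))))"
  using w by (intro y.times_congR sym_eq.sym[OF sym_eq.trans[OF sym_eq.times_comm y.times_oneL]]) simp_all
 also have "y.seq \<dots> (Plus (Fn (%_. 0)) (Times (Fn (c 0)) (Times (Dif t) (Fn (%_. 1)))))"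
  using w by (intro sym_eq.sym[OF y.plus_zeroL]) simp
 also have "y.seq \<dots> (Plus (Times (Dif u) (Fn (%_. 0))) (Times (Fn (c 0)) (Times (Dif t) (Fn (%_. 1)))))"
  using w by (intro y.plus_congL sym_eq.sym[OF y.times_zeroR]) simp_all
 finally have "y.seq (Times (Dif t) (nform u t 0 c)) (nform u t (Suc 0) d)" unfolding d_def by simp
 moreover have "\<forall>i. d i \<in> y.R" unfolding d_def using 0 by simp
 ultimately show ?case by blast
next
 case (Suc r)
 let ?A = "nform u t r (%i. c (Suc i))" and ?T = "spow (Dif t) (Suc r)"
 obtain d where d: "\<forall>i. d i \<in> y.R" "y.seq (Times (Dif t) ?A) (nform u t (Suc r) d)"
  using Suc.IH[of "%i. c (Suc i)"] Suc.prems by blast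
 define e where "e i = (case i of 0 => c 0 | Suc j => d j)" for i
 have w: "y.wf ?A" "y.wf ?T" "y.wf (Dif u)" "y.wf (Dif t)" "y.wf (Fn (c 0))"
  using Suc.prems wf_ut wf_nform by auto
 have "y.seq (Times (Dif t) (nform u t (Suc r) c))
   (Plus (Times (Dif t) (Times (Dif u) ?A)) (Times (Dif t) (Times (Fn (c 0)) ?T)))"
  unfolding nform.simps using w by (intro sym_eq.distrib) simp_all
 also have "y.seq \<dots> (Plus (Times (Dif u) (Times (Dif t) ?A)) (Times (Fn (c 0)) (Times (Dif t) ?T)))"
  using w by (intro sym_eq.cong_plus times_left_comm) simp_all
 also have "y.seq \<dots> (Plus (Times (Dif u) (nform u t (Suc r) d)) (Times (Fn (c 0)) (Times (Dif t) ?T)))"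
  using w by (intro y.plus_congL y.times_congR d(2)) simp_all
 finally have "y.seq (Times (Dif t) (nform u t (Suc r) c)) (nform u t (Suc (Suc r)) e)" unfolding e_def by simp
 moreover have "\<forall>i. e i \<in> y.R" unfolding e_def using d Suc.prems by (simp split: nat.split)
 ultimately show ?case by blast
qed

text \<open>Induction on the expression. \<open>q\<close> and \<open>c\<close> must vary because in
  a product the second factor is absorbed into the normal form before the first.\<close>

lemma times_nform:
 assumes "homog r s" "y.wf s" "\<And>i. c i \<in> y.R"
 shows "\<exists>d. (\<forall>i. d i \<in> y.R) \<and> sym_eq X y (Times s (nform u t q c)) (nform u t (r + q) d)"
 using assms
proof (induction arbitrary: q c rule: homog.induct)
 case (1 f)
 then show ?case using nform_scale[of f c q] y.R_mult[of f]
  by (intro exI[of _ "%i z. f z * c i z"]) auto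
next
 case (2 f)
 have f: "f \<in> y.R" using 2 by simp
 let ?a = "%z. Du z f" and ?b = "%z. Dt z f" and ?N = "nform u t q c"
 have ab: "?a \<in> y.R" "?b \<in> y.R" using partial_reg_at[OF y f] by auto
 have w: "y.wf ?N" "y.wf (Dif u)" "y.wf (Dif t)" using wf_nform 2 wf_ut by auto
 define c1 where "c1 i = (case i of 0 => %_. 0 | Suc j => c j)" for i
 have c1: "\<And>i. c1 i \<in> y.R" unfolding c1_def using 2 by (simp split: nat.split)
 have e1: "y.seq (Times (Dif u) ?N) (nform u t (Suc q) c1)" unfolding c1_def by (rule nform_du) (use 2 in auto)
 have "\<exists>d. (\<forall>i. d i \<in> y.R) \<and> y.seq (Times (Dif t) ?N) (nform u t (Suc q) d)"
  by (rule nform_dt) (use 2 in auto)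
 then obtain c2 where c2: "\<forall>i. c2 i \<in> y.R" "y.seq (Times (Dif t) ?N) (nform u t (Suc q) c2)" by (elim exE conjE)
 define d where "d i z = ?a z * c1 i z + ?b z * c2 i z" for i z
 have "y.seq (Times (Dif f) ?N) (Times (Plus (Times (Fn ?a) (Dif u)) (Times (Fn ?b) (Dif t))) ?N)"
  by (rule y.times_congL[OF Dif_partial[OF y f] w(1)])
 also have "y.seq \<dots> (Plus (Times (Times (Fn ?a) (Dif u)) ?N) (Times (Times (Fn ?b) (Dif t)) ?N))"
  using w ab by (intro sym_eq_distrib2) simp_all
 also have "y.seq \<dots> (Plus (Times (Fn ?a) (Times (Dif u) ?N)) (Times (Fn ?b) (Times (Dif t) ?N)))"
  using w ab by (intro sym_eq.cong_plus sym_eq.times_assoc) simp_all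
 also have "y.seq \<dots> (Plus (Times (Fn ?a) (nform u t (Suc q) c1)) (Times (Fn ?b) (nform u t (Suc q) c2)))"
  using ab by (intro sym_eq.cong_plus y.times_congR e1 c2) simp_all
 also have "y.seq \<dots> (Plus (nform u t (Suc q) (%i z. ?a z * c1 i z)) (nform u t (Suc q) (%i z. ?b z * c2 i z)))"
  using ab c1 c2 by (intro sym_eq.cong_plus nform_scale) simp_all
 also have "y.seq \<dots> (nform u t (Suc q) d)"
  unfolding d_def using ab c1 c2 by (intro nform_add y.R_mult) simp_all
 finally have "y.seq (Times (Dif f) ?N) (nform u t (1 + q) d)" by simp
 moreover have "\<forall>i. d i \<in> y.R" unfolding d_def using ab c1 c2 by (auto intro!: y.R_add y.R_mult)
 ultimately show ?case by blast
next
 case (3 r s s')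
 let ?N = "nform u t q c"
 have wf: "y.wf s" "y.wf s'" using 3 by auto
 have "\<exists>d. (\<forall>i. d i \<in> y.R) \<and> y.seq (Times s ?N) (nform u t (r + q) d)"
  by (rule "3.IH"(1)) (use wf 3(6) in auto)
 then obtain d where d: "\<forall>i. d i \<in> y.R" "y.seq (Times s ?N) (nform u t (r + q) d)" by (elim exE conjE)
 have "\<exists>d. (\<forall>i. d i \<in> y.R) \<and> y.seq (Times s' ?N) (nform u t (r + q) d)"
  by (rule "3.IH"(2)) (use wf 3(6) in auto)
 then obtain d' where d': "\<forall>i. d' i \<in> y.R" "y.seq (Times s' ?N) (nform u t (r + q) d')" by (elim exE conjE)
 note d = d d'
 have "y.seq (Times (Plus s s') ?N) (Plus (Times s ?N) (Times s' ?N))"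
  using 3 wf_nform by (intro sym_eq_distrib2) simp_all
 also have "y.seq \<dots> (Plus (nform u t (r + q) d) (nform u t (r + q) d'))"
  by (rule sym_eq.cong_plus[OF d(2,4)])
 also have "y.seq \<dots> (nform u t (r + q) (%i z. d i z + d' i z))" using d by (intro nform_add) simp_all
 finally show ?case using d by (intro exI[of _ "%i z. d i z + d' i z"]) (auto intro: y.R_add)
next
 case (4 r s r' s')
 let ?N = "nform u t q c"
 have wf: "y.wf s" "y.wf s'" using 4 by auto
 have "\<exists>d. (\<forall>i. d i \<in> y.R) \<and> y.seq (Times s' ?N) (nform u t (r' + q) d)"
  by (rule "4.IH"(2)) (use wf 4(6) in auto)
 then obtain d where d: "\<forall>i. d i \<in> y.R" "y.seq (Times s' ?N) (nform u t (r' + q) d)" by (elim exE conjE)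
 have "\<exists>e. (\<forall>i. e i \<in> y.R) \<and> y.seq (Times s (nform u t (r' + q) d)) (nform u t (r + (r' + q)) e)"
  by (rule "4.IH"(1)) (use wf d(1) in auto)
 then obtain e where e: "\<forall>i. e i \<in> y.R" "y.seq (Times s (nform u t (r' + q) d)) (nform u t (r + (r' + q)) e)"
  by (elim exE conjE)
 have "y.seq (Times (Times s s') ?N) (Times s (Times s' ?N))"
  using wf wf_nform 4(6) by (intro sym_eq.times_assoc) simp_all
 also have "y.seq \<dots> (Times s (nform u t (r' + q) d))" by (rule y.times_congR[OF d(2) wf(1)])
 also note e(2)
 finally show ?case using e(1) by (intro exI[of _ e]) (simp add: add.assoc)
qed

lemma nform_exists:
 assumes "homog r s" "y.wf s"
 shows "\<exists>d. (\<forall>i. d i \<in> y.R) \<and> sym_eq X y s (nform u t r d)"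
proof -
 have "\<exists>d. (\<forall>i. d i \<in> y.R) \<and> y.seq (Times s (nform u t 0 (%_ _. 1))) (nform u t (r + 0) d)"
  by (rule times_nform[OF assms]) simp
 then obtain d where d: "\<forall>i. d i \<in> y.R" "y.seq (Times s (Fn (%_. 1))) (nform u t r d)"
  unfolding nform.simps add_0_right by (elim exE conjE)
 have "y.seq s (Times s (Fn (%_. 1)))"
  using assms(2) by (intro sym_eq.sym[OF sym_eq.trans[OF sym_eq.times_comm y.times_oneL]]) simp_all
 then have "y.seq s (nform u t r d)" using d(2) by (rule sym_eq.trans)
 then show ?thesis by (intro exI[of _ d] conjI d(1))
qed

lemma nform_cong:
 "(\<And>i. c i \<in> y.R) ==> (\<And>i. d i \<in> y.R) ==> (\<And>i. i \<le> r ==> \<forall>\<^sub>F z in near X y. c i z = d i z) ==>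
  sym_eq X y (nform u t r c) (nform u t r d)"
proof (induction r arbitrary: c d)
 case 0
 then show ?case by (simp add: y.Fn_cong)
next
 case (Suc r)
 have "y.seq (nform u t r (%i. c (Suc i))) (nform u t r (%i. d (Suc i)))" by (rule Suc.IH) (use Suc.prems in auto)
 moreover have "y.seq (Fn (c 0)) (Fn (d 0))" by (rule y.Fn_cong) (use Suc.prems in auto)
 ultimately show ?case unfolding nform.simps
  by (intro sym_eq.cong_plus y.times_congR y.times_congL wf_ut)
qed

text \<open>Testing on a Du + Dt for all complex a gives an identity of polynomials in a.\<close>

lemma nform_unique:
 assumes "z \<in> V" "\<And>\<xi>. \<xi> \<in> tangent_space X z ==> eval_at (nform u t r c) z \<xi> = eval_at (nform u t r d) z \<xi>" "i \<le> r"
 shows "c i z = d i z"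
proof -
 have "(\<Sum>i\<le>r. c i z * a ^ i) = (\<Sum>i\<le>r. d i z * a ^ i)" for a
  using assms(2)[OF vec_tangent[OF assms(1), of a 1]] unfolding eval_nform vec_ut[OF assms(1)] by simp
 then have "\<forall>i\<le>r. c i z = d i z" unfolding polyfun_eq_coeffs[symmetric] by (rule allI)
 with assms(3) show ?thesis by simp
qed

end

end

lemma (in irreducible_var) reg_of_reg_at:
 assumes "zopen X W" "\<And>y. y \<in> W ==> f \<in> reg_at X y"
 shows "f \<in> reg X W"
proof (rule reg_local[OF var assms(1)])
 fix y assume y: "y \<in> W"
 obtain U where U: "zopen X U" "y \<in> U" "f \<in> reg X U" using reg_atE[OF var assms(2)[OF y]] .
 have o: "zopen X (U \<inter> W)" using U assms(1) by auto
 have "f \<in> reg X (U \<inter> W)" by (rule reg_restrict[OF var U(1) o _ U(3)]) auto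
 then show "\<exists>V. zopen X V \<and> y \<in> V \<and> V \<subseteq> W \<and> f \<in> reg X V" using o U y by (intro exI[of _ "U \<inter> W"]) auto
qed

context smooth_surface
begin

text \<open>Both expressions have normal forms in du and dt, whose coefficients are determined by
  the values. From here on, identities in the symmetric algebra can be proved as identities of
  polynomial functions on the tangent planes at general points.\<close>

lemma sym_eq_by_values:
 assumes y: "y \<in> points X" and s: "homog r s" "sexp_at X y s" and t: "homog r s'" "sexp_at X y s'"
  and ev: "GEN z. \<forall>\<xi>\<in>tangent_space X z. eval_at s z \<xi> = eval_at s' z \<xi>"
 shows "sym_eq X y s s'"
proof -
 obtain V u t Du Dt where V: "surface_coords X V u t Du Dt" "y \<in> V" using coords_exist[OF y] by blast
 interpret surface_coords X V u t Du Dt by (rule V(1))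
 interpret y: variety_point X y by (rule variety_point[OF y])
 obtain c where c0: "\<forall>i. c i \<in> y.R" "y.seq s (nform u t r c)" using nform_exists[OF V(2) s] by (elim exE conjE)
 obtain d where d0: "\<forall>i. d i \<in> y.R" "y.seq s' (nform u t r d)" using nform_exists[OF V(2) t] by (elim exE conjE)
 note c = spec[OF c0(1)] c0(2) and d = spec[OF d0(1)] d0(2)
 have "\<forall>\<^sub>F z in near X y. z \<in> V" unfolding y.near_iff using V_open V(2) by blast
 with y.sym_eq_near[OF c(2)] y.sym_eq_near[OF d(2)]
 have "\<forall>\<^sub>F z in near X y. z \<in> V \<and> (\<forall>\<xi>\<in>tangent_space X z. eval_at s z \<xi> = eval_at (nform u t r c) z \<xi> \<and>
   eval_at s' z \<xi> = eval_at (nform u t r d) z \<xi>)"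
 proof eventually_elim
  case (elim z)
  interpret z: variety_point X z by (rule variety_point[OF V_points[OF elim(3)]])
  show ?case
   by (intro conjI ballI elim(3) z.contract_tangent[OF _ elim(1)] z.contract_tangent[OF _ elim(2)])
 qed
 from near_imp_generic[OF y this] ev
 have eq: "GEN z. \<forall>i\<le>r. c i z = d i z"
 proof eventually_elim
  case (elim z)
  have zV: "z \<in> V" using elim(1) by (rule conjunct1)
  have e: "eval_at (nform u t r c) z \<xi> = eval_at (nform u t r d) z \<xi>" if "\<xi> \<in> tangent_space X z" for \<xi>
  proof -
   note A = bspec[OF conjunct2[OF elim(1)] that]
   show ?thesis
    by (rule HOL.trans[OF HOL.trans[OF HOL.sym[OF conjunct1[OF A]] bspec[OF elim(2) that]] conjunct2[OF A]])
  qed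
  show ?case by (intro allI impI nform_unique[OF V(2) zV e])
 qed
 have "y.seq (nform u t r c) (nform u t r d)"
 proof (rule nform_cong[OF V(2) c(1) d(1)])
  fix i assume i: "i \<le> r"
  have "GEN z. c i z = d i z" by (rule eventually_mono[OF eq]) (use i in simp)
  then show "\<forall>\<^sub>F z in near X y. c i z = d i z" by (rule generic_imp_near[OF c(1) d(1) y])
 qed
 with c(2) have "y.seq s (nform u t r d)" by (rule sym_eq.trans)
 then show ?thesis using sym_eq.sym[OF d(2)] by (rule sym_eq.trans)
qed

lemma values_near:
 assumes y: "y \<in> points X" and eq: "sym_eq X y s s'"
 shows "\<forall>\<^sub>F z in near X y. \<forall>\<xi>\<in>tangent_space X z. eval_at s z \<xi> = eval_at s' z \<xi>"
proof -
 interpret y: variety_point X y by (rule variety_point[OF y])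
 from y.sym_eq_near[OF eq] y.near_points show ?thesis
 proof eventually_elim
  case (elim z)
  interpret z: variety_point X z by (rule variety_point[OF elim(2)])
  show ?case by (intro ballI z.contract_tangent[OF _ elim(1)])
 qed
qed

lemma values_generic:
 "y \<in> points X ==> sym_eq X y s s' ==>
  GEN z. \<forall>\<xi>\<in>tangent_space X z. eval_at s z \<xi> = eval_at s' z \<xi>"
 by (rule near_imp_generic[OF _ values_near])

section \<open>Sections given by a single expression\<close>

definition cls :: "'a set => 'a sexp => 'a symsec" where
 "cls U s = (%z. if z \<in> U then stalk_class X z s else {})"

lemma leaves_at: "leaves s \<subseteq> reg X U ==> zopen X U ==> z \<in> U ==> sexp_at X z s"
 unfolding reg_at_def by blast

lemma cls_Sym: "zopen X U ==> leaves s \<subseteq> reg X U ==> homog r s ==> cls U s \<in> Sym X r U"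
 unfolding Sym_def cls_def by auto

lemma cls_restrict: "V \<subseteq> U ==> sec_restrict V (cls U s) = cls V s"
 unfolding sec_restrict_def cls_def by (rule ext) auto

lemma sec_fn_cls: "sec_fn X U f = cls U (Fn f)"
 unfolding sec_fn_def cls_def ..

lemma stalk_class_eq:
 assumes "sym_eq X z s s'" shows "stalk_class X z s = stalk_class X z s'"
 unfolding stalk_class_def
proof (rule Collect_cong, rule iffI)
 fix e
 show "sym_eq X z s e ==> sym_eq X z s' e" by (rule sym_eq.trans[OF sym_eq.sym[OF assms]])
 show "sym_eq X z s' e ==> sym_eq X z s e" by (rule sym_eq.trans[OF assms])
qed

lemma stalk_class_self: "sexp_at X z s ==> s \<in> stalk_class X z s"
 unfolding stalk_class_def by (rule CollectI) (rule sym_eq.refl)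

lemma stalk_classD: "s' \<in> stalk_class X z s ==> sym_eq X z s' s"
 unfolding stalk_class_def by (drule CollectD) (rule sym_eq.sym)

lemma cls_eqI:
 assumes "\<And>z. z \<in> U ==> sym_eq X z s s'" shows "cls U s = cls U s'"
 unfolding cls_def
proof
 fix z show "(if z \<in> U then stalk_class X z s else {}) = (if z \<in> U then stalk_class X z s' else {})"
  using stalk_class_eq[OF assms[of z]] by simp
qed

lemma cls_eqD:
 assumes "cls U s = cls U s'" "z \<in> U" "sexp_at X z s'"
 shows "sym_eq X z s s'"
 using stalk_classD[of s' z s] stalk_class_self[OF assms(3)] fun_cong[OF assms(1), of z] assms(2)
 unfolding cls_def by (simp add: sym_eq.sym)

lemma UN_stalk_const:
 assumes "a \<in> A" "\<And>t. t \<in> A ==> F t = B" shows "(\<Union>t\<in>A. F t) = B"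
 using assms by (rule_tac SUP_eq_const) auto

lemma sec_times_cls:
 assumes "\<And>z. z \<in> U ==> sexp_at X z s" "\<And>z. z \<in> U ==> sexp_at X z s'"
 shows "sec_times X (cls U s) (cls U s') = cls U (Times s s')"
proof
 fix z
 show "sec_times X (cls U s) (cls U s') z = cls U (Times s s') z"
 proof (cases "z \<in> U")
  case True
  have "(\<Union>t1\<in>stalk_class X z s. \<Union>t2\<in>stalk_class X z s'. stalk_class X z (Times t1 t2)) = stalk_class X z (Times s s')"
   by (intro UN_stalk_const[OF stalk_class_self[OF assms(1)[OF True]]] UN_stalk_const[OF stalk_class_self[OF assms(2)[OF True]]]
     stalk_class_eq sym_eq.cong_times stalk_classD)
  then show ?thesis using True unfolding sec_times_def cls_def by simp
 qed (simp add: sec_times_def cls_def)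
qed

lemma sec_lie_cls:
 assumes v: "vector_field X v" and "U \<subseteq> points X" "\<And>z. z \<in> U ==> sexp_at X z s"
 shows "sec_lie X v (cls U s) = cls U (lie v s)"
proof
 fix z
 show "sec_lie X v (cls U s) z = cls U (lie v s) z"
 proof (cases "z \<in> U")
  case True
  then have "(\<Union>t\<in>stalk_class X z s. stalk_class X z (lie v t)) = stalk_class X z (lie v s)"
   by (intro UN_stalk_const[OF stalk_class_self[OF assms(3)[OF True]]] stalk_class_eq lie_sym_eq[OF var v] stalk_classD subsetD[OF assms(2)])
  then show ?thesis using True unfolding sec_lie_def cls_def by simp
 qed (simp add: sec_lie_def cls_def)
qed

lemma SymE:
 assumes "s \<in> Sym X r U" "x \<in> U"
 obtains V e where "zopen X V" "x \<in> V" "V \<subseteq> U" "leaves e \<subseteq> reg X V" "homog r e" "sec_restrict V s = cls V e"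
proof -
 obtain V e where V: "zopen X V" "x \<in> V" "V \<subseteq> U" "leaves e \<subseteq> reg X V" "homog r e" "\<forall>y\<in>V. s y = stalk_class X y e"
  using assms unfolding Sym_def by blast
 then have "sec_restrict V s = cls V e" unfolding sec_restrict_def cls_def by (intro ext) auto
 with V that show thesis by blast
qed

lemma restrict_restrict: "W \<subseteq> V ==> sec_restrict W (sec_restrict V s) = sec_restrict W s"
 unfolding sec_restrict_def by (rule ext) auto

lemma contract_reg:
 assumes v: "vector_field X v" and W: "zopen X W"
 shows "leaves s \<subseteq> reg X W ==> contract v s \<in> reg X W"
proof (induction s)
 case (Plus s t)
 then show ?case using reg_add[OF var W] by (simp add: plus_fun_def)
next
 case (Times s t)
 then show ?case using reg_mult[OF var W] by (simp add: times_fun_def)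
qed (use v W in "auto simp: deriv_of_def vector_field_def")

lemma contract_reg_at:
 assumes v: "vector_field X v" and y: "y \<in> points X"
 shows "sexp_at X y s ==> contract v s \<in> reg_at X y"
proof (induction s)
 case (Plus s t)
 then show ?case using reg_at_ring(2)[OF var y] by (simp add: plus_fun_def)
next
 case (Times s t)
 then show ?case using reg_at_ring(3)[OF var y] by (simp add: times_fun_def)
qed (use deriv_of_reg_at[OF v] in auto)

lemma contract_lie:
 assumes v: "vector_field X v" and y: "y \<in> points X"
 shows "sexp_at X y s ==> contract v (lie v s) y = v y (contract v s)"
proof (induction s)
 case (Plus s t)
 then show ?case using vector_field_rules(1)[OF v y contract_reg_at[OF v y] contract_reg_at[OF v y], of s t] by (simp add: plus_fun_def)
next
 case (Times s t)
 then show ?case using vector_field_rules(2)[OF v y contract_reg_at[OF v y] contract_reg_at[OF v y], of s t] by (simp add: times_fun_def)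
qed (simp_all add: deriv_of_def)

end

section \<open>Coprime pairs of germs\<close>

context generic_ring
begin

text \<open>The only syzygies of (a, b) are the trivial ones, the multiples of (b, a). This form is
  symmetric, passes to powers and does not mention factorisations.\<close>

definition coprime_pair :: "('a => complex) => ('a => complex) => bool" where
 "coprime_pair a b \<longleftrightarrow> (\<forall>e\<in>R. \<forall>f\<in>R. (GEN y. a y * e y = b y * f y) -->
   (\<exists>k\<in>R. (GEN y. e y = b y * k y) \<and> (GEN y. f y = a y * k y)))"

lemma coprime_pairE:
 assumes "coprime_pair a b" "e \<in> R" "f \<in> R" "GEN y. a y * e y = b y * f y"
 obtains k where "k \<in> R" "GEN y. e y = b y * k y" "GEN y. f y = a y * k y"
proof -
 have "\<exists>k\<in>R. (GEN y. e y = b y * k y) \<and> (GEN y. f y = a y * k y)"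
  using assms unfolding coprime_pair_def by simp
 then show thesis by (elim bexE conjE) (rule that)
qed

lemma coprime_pairI:
 assumes "\<And>e f. e \<in> R ==> f \<in> R ==> GEN y. a y * e y = b y * f y ==>
   \<exists>k\<in>R. (GEN y. e y = b y * k y) \<and> (GEN y. f y = a y * k y)"
 shows "coprime_pair a b"
 unfolding coprime_pair_def by (intro ballI impI) (rule assms)

lemma coprime_pair_sym:
 assumes "coprime_pair a b" shows "coprime_pair b a"
proof (rule coprime_pairI)
 fix e f assume ef: "e \<in> R" "f \<in> R" "GEN y. b y * e y = a y * f y"
 have "GEN y. a y * f y = b y * e y" using ef(3) by eventually_elim simp
 then obtain k where "k \<in> R" "GEN y. f y = b y * k y" "GEN y. e y = a y * k y"
  by (rule coprime_pairE[OF assms ef(2,1)])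
 then show "\<exists>k\<in>R. (GEN y. e y = a y * k y) \<and> (GEN y. f y = b y * k y)"
  by (intro bexI[of _ k] conjI)
qed

lemma coprime_pair_mult:
 assumes a: "a \<in> R" "a' \<in> R" "coprime_pair a b" "coprime_pair a' b"
 shows "coprime_pair (%y. a y * a' y) b"
proof (rule coprime_pairI)
 fix e f assume ef: "e \<in> R" "f \<in> R" "GEN y. a y * a' y * e y = b y * f y"
 have "GEN y. a y * (a' y * e y) = b y * f y" using ef(3) by eventually_elim (simp add: ac_simps)
 then obtain k where k: "k \<in> R" "GEN y. a' y * e y = b y * k y" "GEN y. f y = a y * k y"
  by (rule coprime_pairE[OF a(3) mult_R[OF a(2) ef(1)] ef(2)])
 obtain m where m: "m \<in> R" "GEN y. e y = b y * m y" "GEN y. k y = a' y * m y"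
  by (rule coprime_pairE[OF a(4) ef(1) k(1,2)])
 have "GEN y. f y = a y * a' y * m y" using k(3) m(3) by eventually_elim simp
 with m show "\<exists>k\<in>R. (GEN y. e y = b y * k y) \<and> (GEN y. f y = a y * a' y * k y)"
  by (intro bexI[of _ m] conjI)
qed

lemma coprime_pair_one: "coprime_pair (%_. 1) b"
proof (rule coprime_pairI)
 fix e f assume "e \<in> R" "f \<in> R" "GEN y. 1 * e y = b y * f y"
 then show "\<exists>k\<in>R. (GEN y. e y = b y * k y) \<and> (GEN y. f y = 1 * k y)"
  by (intro bexI[of _ f]) simp_all
qed

lemma coprime_pair_power_left: "a \<in> R ==> coprime_pair a b ==> coprime_pair (%y. a y ^ n) b"
proof (induction n)
 case (Suc n)
 from coprime_pair_mult[OF Suc.prems(1) power_R[OF Suc.prems(1)] Suc.prems(2) Suc.IH[OF Suc.prems]]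
 show ?case by simp
qed (simp add: coprime_pair_one)

lemma coprime_pair_power:
 assumes "a \<in> R" "b \<in> R" "coprime_pair a b"
 shows "coprime_pair (%y. a y ^ n) (%y. b y ^ m)"
 by (rule coprime_pair_power_left[OF assms(1) coprime_pair_sym[OF coprime_pair_power_left[OF assms(2) coprime_pair_sym[OF assms(3)]]]])

lemma coprime_pairI_dvd:
 assumes a: "a \<in> R" "\<not> a \<doteq> (%_. 0)" and d: "\<And>c. c \<in> R ==> a dvd\<^sub>R (%y. b y * c y) ==> a dvd\<^sub>R c"
 shows "coprime_pair a b"
proof (rule coprime_pairI)
 fix e f assume ef: "e \<in> R" "f \<in> R" "GEN y. a y * e y = b y * f y"
 have "GEN y. b y * f y = a y * e y" using ef(3) by eventually_elim simp
 then have "a dvd\<^sub>R f" by (rule d[OF ef(2) dvdRI[OF ef(1)]])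
 then obtain k where k: "k \<in> R" "GEN y. f y = a y * k y" by (rule dvdRE)
 have "GEN y. a y * e y = a y * (b y * k y)" using ef(3) k(2) by eventually_elim simp
 then have "GEN y. e y = b y * k y" by (rule ev_cancel[OF a(1) _ a(2)])
 with k show "\<exists>k\<in>R. (GEN y. e y = b y * k y) \<and> (GEN y. f y = a y * k y)"
  by (intro bexI[of _ k] conjI)
qed

lemma coprime_pair_cong:
 assumes "coprime_pair a b" "GEN y. a' y = a y" "GEN y. b' y = b y"
 shows "coprime_pair a' b'"
proof (rule coprime_pairI)
 fix e f assume ef: "e \<in> R" "f \<in> R" "GEN y. a' y * e y = b' y * f y"
 have "GEN y. a y * e y = b y * f y" using ef(3) assms(2,3) by eventually_elim simp
 then obtain k where k: "k \<in> R" "GEN y. e y = b y * k y" "GEN y. f y = a y * k y"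
  by (rule coprime_pairE[OF assms(1) ef(1,2)])
 have "GEN y. e y = b' y * k y" "GEN y. f y = a' y * k y"
  using k(2,3) assms(2,3) by (eventually_elim; simp)+
 with k(1) show "\<exists>k\<in>R. (GEN y. e y = b' y * k y) \<and> (GEN y. f y = a' y * k y)"
  by (intro bexI[of _ k] conjI)
qed

end

lemma (in generic_local_ring) coprime_pair_unit:
 assumes ab: "coprime_pair a b" and g: "g \<in> R" "g x ~= 0"
 shows "coprime_pair (%y. g y * a y) (%y. g y * b y)"
proof (rule coprime_pairI)
 fix e f assume ef: "e \<in> R" "f \<in> R" "GEN y. g y * a y * e y = g y * b y * f y"
 note nz = unit_nonzero[OF g]
 have "GEN y. a y * e y = b y * f y" using ef(3) nz by eventually_elim simp
 then obtain k where k: "k \<in> R" "GEN y. e y = b y * k y" "GEN y. f y = a y * k y"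
  by (rule coprime_pairE[OF ab ef(1,2)])
 have "GEN y. e y = g y * b y * (inverse (g y) * k y)" "GEN y. f y = g y * a y * (inverse (g y) * k y)"
  using k(2,3) nz by (eventually_elim; simp)+
 with k(1) g show "\<exists>k\<in>R. (GEN y. e y = g y * b y * k y) \<and> (GEN y. f y = g y * a y * k y)"
  by (intro bexI[of _ "%y. inverse (g y) * k y"] conjI mult_R inverse_R)
qed

context irreducible_var
begin

abbreviation coprime_at :: "'a => ('a => complex) => ('a => complex) => bool" where
 "coprime_at x \<equiv> generic_ring.coprime_pair (generic X) (reg_at X x)"

text \<open>The syzygies of \<open>(a, b)\<close> with polynomial coefficients form an ideal, which is noetherian;
  hence one neighbourhood serves for the divisions by \<open>a\<close> at \<open>x\<close> of all of them.\<close>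

lemma coprime_at_open:
 assumes x: "x \<in> points X" and a: "a \<in> reg_at X x" "\<not> (GEN y. a y = 0)" and ab: "coprime_at x a b"
 obtains V where "zopen X V" "x \<in> V" "\<And>y. y \<in> V ==> coprime_at y a b"
proof -
 obtain U n \<phi> where U: "chart X U n \<phi>" "x \<in> U" using chart_nbhd[OF var x] .
 note oU = chart_rules(1)[OF U(1)]
 have Upt: "y \<in> points X" if "y \<in> U" for y using that openin_subset[OF oU] by blast
 obtain A where A: "zopen X A" "x \<in> A" "a \<in> reg X A" using reg_atE[OF var a(1)] .
 note rx = generic_ring_reg_at[OF x]
 \<comment> \<open>Second components of polynomial syzygies that are divisible by \<open>a\<close>
   on all of \<open>V\<close>; shrinking \<open>V\<close> can only enlarge this ideal.\<close>
 define I where "I V = {F \<in> polyfun n. (\<exists>E\<in>polyfun n. GEN y. a y * E (\<phi> y) = b y * F (\<phi> y)) \<and>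
   (\<exists>k\<in>reg X V. GEN y. F (\<phi> y) = a y * k y)}" for V
 have II: "F \<in> I V" if "F \<in> polyfun n" "E \<in> polyfun n" "k \<in> reg X V"
  "GEN y. a y * E (\<phi> y) = b y * F (\<phi> y)" "GEN y. F (\<phi> y) = a y * k y" for F E k V
  unfolding I_def
 proof (intro CollectI conjI)
  show "\<exists>E\<in>polyfun n. GEN y. a y * E (\<phi> y) = b y * F (\<phi> y)" by (rule bexI[of _ E]; fact)
  show "\<exists>k\<in>reg X V. GEN y. F (\<phi> y) = a y * k y" by (rule bexI[of _ k]; fact)
 qed fact
 define N where "N = {V. zopen X V \<and> x \<in> V \<and> V \<subseteq> U \<inter> A}"
 have ideal: "poly_ideal n (I V)" if V: "V \<in> N" for V
  unfolding poly_ideal_def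
 proof (intro conjI ballI)
  have oV: "zopen X V" "V \<subseteq> U" using V unfolding N_def by auto
  note rc = reg_const[OF var oV(1)]
  show "I V \<subseteq> polyfun n" unfolding I_def by blast
  show "(%_. 0) \<in> I V"
   by (rule II[OF polyfun.const polyfun.const rc, of 0 0 0]) simp_all
  fix F assume "F \<in> I V"
  then obtain E k where F: "F \<in> polyfun n" "E \<in> polyfun n" "k \<in> reg X V"
   "GEN y. a y * E (\<phi> y) = b y * F (\<phi> y)" "GEN y. F (\<phi> y) = a y * k y"
   unfolding I_def by (elim CollectE conjE bexE)
  {
   fix F' assume "F' \<in> I V"
   then obtain E' k' where F': "F' \<in> polyfun n" "E' \<in> polyfun n" "k' \<in> reg X V"
    "GEN y. a y * E' (\<phi> y) = b y * F' (\<phi> y)" "GEN y. F' (\<phi> y) = a y * k' y"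
    unfolding I_def by (elim CollectE conjE bexE)
   show "(%z. F z + F' z) \<in> I V"
   proof (rule II[OF polyfun_add[OF F(1) F'(1)] polyfun_add[OF F(2) F'(2)] reg_add[OF var oV(1) F(3) F'(3)]])
    show "GEN y. a y * (E (\<phi> y) + E' (\<phi> y)) = b y * (F (\<phi> y) + F' (\<phi> y))"
     using F(4) F'(4) by eventually_elim (simp add: algebra_simps)
    show "GEN y. F (\<phi> y) + F' (\<phi> y) = a y * (k y + k' y)"
     using F(5) F'(5) by eventually_elim (simp add: algebra_simps)
   qed
  }
  fix H assume H: "H \<in> polyfun n"
  have "(%y. H (\<phi> y) * k y) \<in> reg X V"
   by (intro reg_mult[OF var oV(1)] F reg_restrict[OF var oU oV] chart_rules(7)[OF U(1) H])
  then show "(%z. H z * F z) \<in> I V"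
  proof (rule II[OF polyfun_mult[OF H F(1)] polyfun_mult[OF H F(2)]])
   show "GEN y. a y * (H (\<phi> y) * E (\<phi> y)) = b y * (H (\<phi> y) * F (\<phi> y))"
    using F(4)
   proof eventually_elim
    case (elim y)
    then show ?case by algebra
   qed
   show "GEN y. H (\<phi> y) * F (\<phi> y) = a y * (H (\<phi> y) * k y)"
    using F(5) by eventually_elim simp
  qed
 qed
 have "\<exists>Q\<in>I ` N. \<forall>J\<in>I ` N. Q \<subseteq> J --> J = Q"
 proof (rule poly_ideal_maximal[where n = n])
  have "U \<inter> A \<in> N" unfolding N_def using oU A U(2) by auto
  then show "I ` N ~= {}" by blast
 qed (use ideal in auto)
 then obtain V where V: "V \<in> N" and max: "\<And>V'. V' \<in> N ==> I V \<subseteq> I V' ==> I V' = I V" by auto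
 have oV: "zopen X V" "x \<in> V" "V \<subseteq> U" "V \<subseteq> A" using V unfolding N_def by auto
 have all: "F \<in> I V" if F: "F \<in> polyfun n" "E \<in> polyfun n" "GEN y. a y * E (\<phi> y) = b y * F (\<phi> y)" for E F
 proof -
  have r: "(%y. E (\<phi> y)) \<in> reg_at X x" "(%y. F (\<phi> y)) \<in> reg_at X x"
   by (intro poly_reg_at[OF var U] F)+
  obtain k where k: "k \<in> reg_at X x" "GEN y. F (\<phi> y) = a y * k y"
   using generic_ring.coprime_pairE[OF rx ab r F(3)] .
  obtain W where W: "zopen X W" "x \<in> W" "k \<in> reg X W" using reg_atE[OF var k(1)] .
  have o: "zopen X (V \<inter> W)" using oV(1) W(1) by auto
  have VW: "V \<inter> W \<in> N" using V W(2) o unfolding N_def by auto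
  have sub: "I V \<subseteq> I (V \<inter> W)"
  proof
   fix F' assume "F' \<in> I V"
   then obtain E' k' where F': "F' \<in> polyfun n" "E' \<in> polyfun n" "k' \<in> reg X V"
    "GEN y. a y * E' (\<phi> y) = b y * F' (\<phi> y)" "GEN y. F' (\<phi> y) = a y * k' y"
    unfolding I_def by (elim CollectE conjE bexE)
   have k': "k' \<in> reg X (V \<inter> W)" by (rule reg_restrict[OF var oV(1) o Int_lower1 F'(3)])
   show "F' \<in> I (V \<inter> W)" by (rule II[OF F'(1,2) k' F'(4,5)])
  qed
  have k': "k \<in> reg X (V \<inter> W)" by (rule reg_restrict[OF var W(1) o Int_lower2 W(3)])
  have "F \<in> I (V \<inter> W)" by (rule II[OF F(1,2) k' F(3) k(2)])
  then show ?thesis using max[OF VW sub] by simp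
 qed
 have "coprime_at y a b" if y: "y \<in> V" for y
 proof -
  have yU: "y \<in> U" using y oV(3) by blast
  interpret y: generic_local_ring "generic X" "reg_at X y" y by (rule generic_local_ring_reg_at[OF Upt[OF yU]])
  have ay: "a \<in> reg_at X y" unfolding reg_at_def using A(1,3) y oV(4) by blast
  show ?thesis
  proof (rule y.coprime_pairI)
   fix e f assume ef: "e \<in> reg_at X y" "f \<in> reg_at X y" "GEN z. a z * e z = b z * f z"
   obtain E D W where E: "E \<in> polyfun n" "D \<in> polyfun n" "zopen X W" "y \<in> W" "W \<subseteq> U"
    "\<forall>z\<in>W. D (\<phi> z) ~= 0 \<and> e z = E (\<phi> z) / D (\<phi> z)" using reg_at_fraction[OF var U(1) yU ef(1)] .
   obtain F D' W' where F: "F \<in> polyfun n" "D' \<in> polyfun n" "zopen X W'" "y \<in> W'" "W' \<subseteq> U"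
    "\<forall>z\<in>W'. D' (\<phi> z) ~= 0 \<and> f z = F (\<phi> z) / D' (\<phi> z)" using reg_at_fraction[OF var U(1) yU ef(2)] .
   have e': "GEN z. D (\<phi> z) ~= 0 \<and> e z = E (\<phi> z) / D (\<phi> z)"
    by (rule eventually_genericI[OF E(3,4)]) (rule bspec[OF E(6)])
   have f': "GEN z. D' (\<phi> z) ~= 0 \<and> f z = F (\<phi> z) / D' (\<phi> z)"
    by (rule eventually_genericI[OF F(3,4)]) (rule bspec[OF F(6)])
   have "GEN z. a z * (E (\<phi> z) * D' (\<phi> z)) = b z * (F (\<phi> z) * D (\<phi> z))"
    using e' f' ef(3)
   proof eventually_elim
    case (elim z)
    then have "a z * E (\<phi> z) / D (\<phi> z) = b z * F (\<phi> z) / D' (\<phi> z)" by simp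
    then show ?case using elim by (simp add: frac_eq_eq ac_simps)
   qed
   from all[OF polyfun_mult[OF F(1) E(2)] polyfun_mult[OF E(1) F(2)] this]
   obtain k where k: "k \<in> reg X V" "GEN z. F (\<phi> z) * D (\<phi> z) = a z * k z"
    unfolding I_def by (elim CollectE conjE bexE)
   have ky: "k \<in> reg_at X y" unfolding reg_at_def using k(1) oV(1) y by blast
   have DD: "(%z. D (\<phi> z) * D' (\<phi> z)) \<in> reg_at X y" by (intro y.mult_R poly_reg_at[OF var U(1) yU] E F)
   have D0: "D (\<phi> y) * D' (\<phi> y) ~= 0" using E(4,6) F(4,6) by simp
   let ?k = "%z. inverse (D (\<phi> z) * D' (\<phi> z)) * k z"
   have kk: "?k \<in> reg_at X y" by (rule y.mult_R[OF y.inverse_R[OF DD D0] ky])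
   have f2: "GEN z. f z = a z * ?k z" using k(2) e' f'
   proof eventually_elim
    case (elim z)
    then have "f z = F (\<phi> z) * D (\<phi> z) * inverse (D (\<phi> z) * D' (\<phi> z))" by (simp add: field_simps)
    then show ?case unfolding elim(1) by (simp add: ac_simps)
   qed
   have "GEN z. a z * e z = a z * (b z * ?k z)" using ef(3) f2
   proof eventually_elim
    case (elim z)
    then show ?case by algebra
   qed
   then have "GEN z. e z = b z * ?k z" by (rule y.ev_cancel[OF ay _ a(2)])
   with f2 kk show "\<exists>k\<in>reg_at X y. (GEN z. e z = b z * k z) \<and> (GEN z. f z = a z * k z)"
    by (intro bexI[of _ ?k] conjI)
  qed
 qed
 then show thesis by (rule that[OF oV(1,2)])
qed

end

section \<open>Forms invariant under translation along a vector field\<close>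

text \<open>Translating (b A, b B) by -B times (a, b) kills the second coordinate, and P(x, 0) = c_r
  x^r; homogeneity accounts for the factor b^r. The second formula exchanges the
  coordinates.\<close>

lemma translation_invariant_binary_form:
 fixes c :: "nat => complex" and r :: nat
 defines "P \<equiv> %A B. \<Sum>i\<le>r. c i * A ^ i * B ^ (r - i)"
 assumes inv: "\<And>A B k. P (A + k * a) (B + k * b) = P A B"
 shows "b ^ r * P A B = c r * (b * A - a * B) ^ r" "a ^ r * P A B = c 0 * (a * B - b * A) ^ r"
proof -
 have hom: "P (q * A) (q * B) = q ^ r * P A B" for q
  unfolding P_def by (auto simp: sum_distrib_left power_mult_distrib power_add[symmetric] intro!: sum.cong)
 have B0: "P x 0 = c r * x ^ r" for x
 proof -
  have "P x 0 = (\<Sum>i\<in>{r}. c i * x ^ i * 0 ^ (r - i))" unfolding P_def by (rule sum.mono_neutral_right) auto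
  then show ?thesis by simp
 qed
 have A0: "P 0 x = c 0 * x ^ r" for x
 proof -
  have "P 0 x = (\<Sum>i\<in>{0}. c i * 0 ^ i * x ^ (r - i))" unfolding P_def by (rule sum.mono_neutral_right) auto
  then show ?thesis by simp
 qed
 show "b ^ r * P A B = c r * (b * A - a * B) ^ r"
  using inv[of "b * A" "- B" "b * B"] hom[of b] B0[of "b * A - a * B"] by (simp add: mult.commute)
 show "a ^ r * P A B = c 0 * (a * B - b * A) ^ r"
  using inv[of "a * A" "- A" "a * B"] hom[of a] A0[of "a * B - b * A"] by (simp add: mult.commute)
qed

lemma eval_at_line: "\<exists>q. \<forall>s. eval_at e z (%f. \<xi> f + s * \<eta> f) = poly q s"
proof (induction e)
 case (Fn f)
 show ?case by (intro exI[of _ "[:f z:]"]) simp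
next
 case (Dif f)
 show ?case by (intro exI[of _ "[:\<xi> f, \<eta> f:]"]) (simp add: deriv_of_def)
next
 case (Plus e1 e2)
 then obtain q1 q2 where "\<forall>s. eval_at e1 z (%f. \<xi> f + s * \<eta> f) = poly q1 s"
  "\<forall>s. eval_at e2 z (%f. \<xi> f + s * \<eta> f) = poly q2 s" by (elim exE)
 then show ?case by (intro exI[of _ "q1 + q2"]) simp
next
 case (Times e1 e2)
 then obtain q1 q2 where "\<forall>s. eval_at e1 z (%f. \<xi> f + s * \<eta> f) = poly q1 s"
  "\<forall>s. eval_at e2 z (%f. \<xi> f + s * \<eta> f) = poly q2 s" by (elim exE)
 then show ?case by (intro exI[of _ "q1 * q2"]) simp
qed

context irreducible_var
begin

text \<open>On the line \<xi> + s \<eta> both sides are polynomials in s and \<open>l\<close> is a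
  nonzero polynomial that can be cancelled, so vectors on which \<open>l\<close> vanishes are
  covered too.\<close>

lemma eval_at_cancel:
 assumes lin: "\<And>\<xi> \<eta> s. l (%f. \<xi> f + s * \<eta> f) = l \<xi> + s * l \<eta>"
  and \<eta>: "\<eta> \<in> tangent_space X z" "l \<eta> ~= (0::complex)" and \<xi>: "\<xi> \<in> tangent_space X z"
  and eq: "\<And>\<xi>. \<xi> \<in> tangent_space X z ==> l \<xi> * eval_at e z \<xi> = l \<xi> * eval_at e' z \<xi>"
 shows "eval_at e z \<xi> = eval_at e' z \<xi>"
proof -
 obtain q where q: "\<forall>s. eval_at e z (%f. \<xi> f + s * \<eta> f) = poly q s" using eval_at_line ..
 obtain q' where q': "\<forall>s. eval_at e' z (%f. \<xi> f + s * \<eta> f) = poly q' s" using eval_at_line ..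
 have "poly ([:l \<xi>, l \<eta>:] * (q - q')) s = 0" for s
  using eq[OF tangent_space_combine[OF \<xi> \<eta>(1), of 1 s]] lin[of \<xi> s \<eta>] q q' by (simp add: algebra_simps)
 then have "[:l \<xi>, l \<eta>:] * (q - q') = 0" using poly_all_0_iff_0 by blast
 moreover have "[:l \<xi>, l \<eta>:] ~= 0" using \<eta>(2) by simp
 ultimately have "q - q' = 0" by (metis mult_eq_0_iff)
 then have "q = q'" by simp
 then show ?thesis using spec[OF q, of 0] spec[OF q', of 0] by simp
qed

text \<open>The form descends to the quotient of the tangent space by \<open>v\<close>. On a surface
  this quotient is a line wherever \<open>v\<close> is nonzero, so a form of degree r is then a
  multiple of the r-th power of a form that kills \<open>v\<close>.\<close>

definition translation_inv :: "'a vfield => 'a sexp => 'a => bool" where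
 "translation_inv v e z \<longleftrightarrow>
   (\<forall>\<xi>\<in>tangent_space X z. \<forall>k. eval_at e z (%f. \<xi> f + k * v z f) = eval_at e z \<xi>)"

lemma translation_inv_cong:
 assumes "v z \<in> tangent_space X z" "\<And>\<xi>. \<xi> \<in> tangent_space X z ==> eval_at e z \<xi> = eval_at e' z \<xi>"
 shows "translation_inv v e z \<longleftrightarrow> translation_inv v e' z"
 using assms(2) tangent_space_combine[of _ X z "v z" 1] assms(1) unfolding translation_inv_def by simp

end

locale isolated_surface = smooth_surface X for X :: "'a fspace" +
 fixes v :: "'a vfield" and p :: 'a
 assumes v: "vector_field X v" and zero: "zero_of_field X v p"
  and no_curve: "\<not> (\<exists>C. closed_curve X C \<and> p \<in> C \<and> invariant_closed X v C)"
begin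

lemma p_point: "p \<in> points X"
 using zero unfolding zero_of_field_def by simp

lemma v_tangent: "z \<in> points X ==> v z \<in> tangent_space X z"
 using v unfolding vector_field_def by simp

lemma v_at_p: "v p f = 0"
 using zero v_tangent[OF p_point] unfolding zero_of_field_def tangent_space_def by (cases "f \<in> reg_at X p") auto

text \<open>The absence of invariant curves through \<open>p\<close> enters the proof through this
  lemma alone.\<close>

lemma invariant_germ_zero:
 assumes "h \<in> reg_at X p" "h p = 0" "g \<in> reg_at X p" "GEN y. v y h = g y * h y"
 shows "GEN y. h y = 0"
 using invariant_germ_curve[OF v p_point assms(1,2) _ assms(3,4)] no_curve by (rule_tac ccontr) simp

end

locale field_coords = isolated_surface X v p + surface_coords X V u t Du Dt
 for X :: "'a fspace" and v p V u t Du Dt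
begin

lemma v_expand: "z \<in> V ==> v z f = v z u * Du z f + v z t * Dt z f"
 by (rule tangent_expand[OF _ v_tangent[OF V_points]])

lemma v_coords_reg: "deriv_of v u \<in> reg X V" "deriv_of v t \<in> reg X V"
 using v uV tV V_open unfolding vector_field_def deriv_of_def by auto

end

context isolated_surface
begin

lemma field_coords_exist:
 assumes "x \<in> points X"
 obtains V u t Du Dt where "field_coords X v p V u t Du Dt" "x \<in> V"
proof -
 obtain V u t Du Dt where V: "surface_coords X V u t Du Dt" "x \<in> V" using coords_exist[OF assms] by (elim exE conjE)
 have "field_coords X v p V u t Du Dt" by (intro field_coords.intro V(1) isolated_surface_axioms)
 then show thesis using V(2) by (rule that)
qed

text \<open>If \<open>v\<close> killed the coordinate \<open>u\<close>, then u - u p would be a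
  nonzero invariant germ at \<open>p\<close>.\<close>

lemma v_generic_nonzero: "GEN z. \<exists>f. v z f ~= 0"
proof -
 obtain V u t Du Dt where V: "field_coords X v p V u t Du Dt" "p \<in> V" using field_coords_exist[OF p_point] .
 interpret field_coords X v p V u t Du Dt by (rule V(1))
 interpret L: regular_local_ring2 "generic X" "reg_at X p" p "%z. u z - u p" "%z. t z - t p"
  by (rule regular_local_ring2[OF V(2)])
 have d: "deriv_of v u \<in> reg_at X p" unfolding reg_at_def using v_coords_reg V_open V(2) by blast
 have "\<not> (GEN z. deriv_of v u z = 0)"
 proof
  assume "GEN z. deriv_of v u z = 0"
  moreover have "GEN z. z \<in> V" by (rule eventually_genericI[OF V_open V(2)])
  ultimately have "GEN z. v z (%z. u z - u p) = 0 * (u z - u p)"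
  proof eventually_elim
   case (elim z)
   interpret z: variety_point X z by (rule variety_point[OF V_points[OF elim(2)]])
   show ?case using elim z.tangent_diff[OF v_tangent[OF z.pt] ut_reg_at(1)[OF elim(2)] z.R_const]
     z.tangent_const[OF v_tangent[OF z.pt]] by (simp add: deriv_of_def)
  qed
  from invariant_germ_zero[OF L.ut_R(1) L.ut_at(1) L.const_R this] L.u_nonzero show False by simp
 qed
 then have "GEN z. deriv_of v u z ~= 0" by (rule L.ev_nonzero[OF d])
 then show ?thesis unfolding deriv_of_def by eventually_elim auto
qed

end

text \<open>The form \<open>\<alpha> = b du - a dt\<close> generates \<open>\<F>(v)\<close>: the vector field is \<open>\<gamma> (a \<partial>\<^sub>u + b \<partial>\<^sub>t)\<close>.\<close>

locale primitive_coords = field_coords X v p V u t Du Dt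
 for X :: "'a fspace" and v p V u t Du Dt +
 fixes \<gamma> a b :: "'a => complex"
 assumes ab_reg: "a \<in> reg X V" "b \<in> reg X V" "\<gamma> \<in> reg X V"
  and v_ut: "z \<in> V ==> v z u = \<gamma> z * a z" "z \<in> V ==> v z t = \<gamma> z * b z"
  and coprime_ab: "z \<in> V ==> coprime_at z a b"
  and V_nonempty: "V ~= {}"
begin

definition \<alpha> :: "'a sexp" where
 "\<alpha> = Plus (Times (Fn b) (Dif u)) (Times (Fn (%z. - a z)) (Dif t))"

lemma eval_\<alpha>: "eval_at \<alpha> z \<xi> = b z * \<xi> u - a z * \<xi> t"
 unfolding \<alpha>_def by (simp add: deriv_of_def)

lemma leaves_\<alpha>: "leaves \<alpha> \<subseteq> reg X V"
 unfolding \<alpha>_def using ab_reg uV tV reg_minus[OF var V_open] by simp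

lemma homog_\<alpha>: "homog 1 \<alpha>"
 unfolding \<alpha>_def by (intro homog.intros(3) homog_scale homog.intros(2))

lemma leaves_\<alpha>_pow: "leaves (spow \<alpha> r) \<subseteq> reg X V"
 by (rule leaves_spow[OF leaves_\<alpha> reg_const[OF var V_open]])

lemma ab_reg_at: "z \<in> V ==> a \<in> reg_at X z" "z \<in> V ==> b \<in> reg_at X z" "z \<in> V ==> \<gamma> \<in> reg_at X z"
 unfolding reg_at_def using ab_reg V_open by blast+

lemma generic_V: "GEN z. z \<in> V \<and> \<gamma> z ~= 0 \<and> (a z ~= 0 \<or> b z ~= 0)"
proof -
 obtain x where "x \<in> V" using V_nonempty by blast
 then have "GEN z. z \<in> V" by (intro eventually_genericI[OF V_open])
 with v_generic_nonzero show ?thesis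
 proof eventually_elim
  case (elim z)
  then obtain f where "v z f ~= 0" by blast
  then show ?case using v_expand[OF elim(2), of f] v_ut[OF elim(2)] elim(2) by auto
 qed
qed

text \<open>Translation invariance forces a^r c_r = b^r c_0 up to sign. Coprimality of a^r and b^r
  makes the common quotient regular at \<open>y\<close>, so the multiple exists there and not only
  at general points.\<close>

theorem translation_inv_multiple:
 assumes y: "y \<in> V" and e: "homog r e" "sexp_at X y e" and ti: "GEN z. translation_inv v e z"
 shows "\<exists>f\<in>reg_at X y. sym_eq X y e (Times (Fn f) (spow \<alpha> r))"
proof -
 interpret y: generic_local_ring "generic X" "reg_at X y" y by (rule generic_local_ring_reg_at[OF V_points[OF y]])
 interpret yp: variety_point X y by (rule variety_point[OF V_points[OF y]])
 obtain c where c0: "\<forall>i. c i \<in> reg_at X y" "sym_eq X y e (nform u t r c)" using nform_exists[OF y e] by (elim exE conjE)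
 note c = spec[OF c0(1)]
 let ?P = "%z A B. \<Sum>i\<le>r. c i z * A ^ i * B ^ (r - i)"
 have val: "GEN z. \<forall>\<xi>\<in>tangent_space X z. eval_at e z \<xi> = ?P z (\<xi> u) (\<xi> t)"
  using values_generic[OF V_points[OF y] c0(2)] unfolding eval_nform .
 have P: "GEN z. \<forall>A B. b z ^ r * ?P z A B = c r z * (b z * A - a z * B) ^ r \<and>
   a z ^ r * ?P z A B = c 0 z * (a z * B - b z * A) ^ r"
  using val ti generic_V
 proof eventually_elim
  case (elim z)
  then have z: "z \<in> V" "\<gamma> z ~= 0" by auto
  have "?P z (A + k * a z) (B + k * b z) = ?P z A B" for A B k
  proof -
   let ?\<xi> = "%f. A * Du z f + B * Dt z f" and ?k = "k / \<gamma> z"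
   have \<xi>: "?\<xi> \<in> tangent_space X z" by (rule vec_tangent[OF z(1)])
   have \<xi>': "(%f. 1 * ?\<xi> f + ?k * v z f) \<in> tangent_space X z"
    by (rule tangent_space_combine[OF \<xi> v_tangent[OF V_points[OF z(1)]]])
   have "eval_at e z (%f. ?\<xi> f + ?k * v z f) = eval_at e z ?\<xi>"
    by (rule spec[OF bspec[OF elim(2)[unfolded translation_inv_def] \<xi>]])
   moreover have "eval_at e z (%f. ?\<xi> f + ?k * v z f) = ?P z (A + k * a z) (B + k * b z)"
    using bspec[OF elim(1) \<xi>'] v_ut[OF z(1)] vec_ut[OF z(1)] z(2) by simp
   moreover have "eval_at e z ?\<xi> = ?P z A B"
    using bspec[OF elim(1) \<xi>] vec_ut[OF z(1)] by simp
   ultimately show ?thesis by simp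
  qed
  then show ?case using translation_invariant_binary_form[where r = r and c = "%i. c i z" and a = "a z" and b = "b z"] by simp
 qed
 have "GEN z. a z ^ r * ((-1) ^ r * c r z) = b z ^ r * c 0 z"
  using P
 proof eventually_elim
  case (elim z)
  have "?P z 0 1 = (\<Sum>i\<in>{0}. c i z * 0 ^ i * 1 ^ (r - i))" by (rule sum.mono_neutral_right) auto
  then have "b z ^ r * c 0 z = c r z * (- a z) ^ r" using elim[rule_format, of 0 1] by simp
  then show ?case by (simp add: power_minus[of "a z"] ac_simps)
 qed
 then obtain k where k: "k \<in> reg_at X y" "GEN z. (-1) ^ r * c r z = b z ^ r * k z"
  "GEN z. c 0 z = a z ^ r * k z"
  by (rule y.coprime_pairE[OF y.coprime_pair_power[OF ab_reg_at(1,2)[OF y] coprime_ab[OF y]]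
     y.mult_R[OF y.const_R c] c])
 \<comment> \<open>The sign comes from \<alpha> = b du - a dt: the extreme coefficients have to be f
   b^r and f (-a)^r.\<close>
 define f where "f z = (-1) ^ r * k z" for z
 have f: "f \<in> reg_at X y" unfolding f_def using k(1) by (intro y.mult_R y.const_R)
 have "GEN z. \<forall>\<xi>\<in>tangent_space X z. eval_at e z \<xi> = eval_at (Times (Fn f) (spow \<alpha> r)) z \<xi>"
  using val P k(2,3) generic_V
 proof eventually_elim
  case (elim z)
  have cr: "c r z = f z * b z ^ r"
   using arg_cong[OF elim(3), of "%x. (-1) ^ r * x"] unfolding f_def by (simp add: power_add[symmetric] mult.assoc[symmetric])
  have "?P z A B = f z * (b z * A - a z * B) ^ r" for A B
  proof (cases "b z = 0")
   case False
   have "b z ^ r * ?P z A B = b z ^ r * (f z * (b z * A - a z * B) ^ r)"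
    using elim(2)[rule_format, of A B] cr by (simp add: ac_simps)
   then show ?thesis using False by (simp only: mult_cancel_left power_eq_0_iff) simp
  next
   case True
   have "(a z * B - b z * A) ^ r = (-1) ^ r * (b z * A - a z * B) ^ r"
    by (simp add: power_mult_distrib[symmetric])
   then have "a z ^ r * ?P z A B = a z ^ r * (f z * (b z * A - a z * B) ^ r)"
    using elim(2)[rule_format, of A B] elim(4) by (simp add: ac_simps f_def)
   moreover have "a z ~= 0" using elim(5) True by simp
   ultimately show ?thesis by (simp only: mult_cancel_left power_eq_0_iff) simp
  qed
  then show ?case using elim(1) by (simp add: eval_spow eval_\<alpha>)
 qed
 moreover have "sexp_at X y (Times (Fn f) (spow \<alpha> r))"
  using f leaves_at[OF leaves_\<alpha>_pow V_open y] by simp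
 ultimately have "sym_eq X y e (Times (Fn f) (spow \<alpha> r))"
  by (intro sym_eq_by_values[OF V_points[OF y] e] homog_scale homog_spow homog_\<alpha>)
 then show ?thesis using f by (rule_tac bexI)
qed

end

lemma homog_0_eval:
 assumes "homog 0 s" shows "eval_at s z \<xi> = eval_at s z \<eta>"
proof -
 have "r = 0 ==> eval_at s z \<xi> = eval_at s z \<eta>" if "homog r s" for r using that by induction auto
 then show ?thesis using assms by blast
qed

lemma homog_eval_0: "homog (Suc n) s ==> (\<And>f. \<xi> f = 0) ==> eval_at s z \<xi> = 0"
proof (induction "Suc n" s arbitrary: n rule: homog.induct)
 case (4 r s q t)
 then show ?case by (cases r; cases q) auto
qed (auto simp: deriv_of_def)

lemma (in surface_coords) surface_coords_subset:
 assumes "zopen X W" "W \<subseteq> V"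
 shows "surface_coords X W u t Du Dt"
proof (intro surface_coords.intro smooth_surface_axioms surface_coords_axioms.intro assms(1))
 show "u \<in> reg X W" "t \<in> reg X W"
  by (rule reg_restrict[OF var V_open assms uV], rule reg_restrict[OF var V_open assms tV])
qed (use assms(2) partial_tangent partial_dual partial_reg_at Dif_partial maximal_ideal in "auto dest!: subsetD[OF assms(2)]")

lemma (in field_coords) field_coords_subset:
 assumes "zopen X W" "W \<subseteq> V"
 shows "field_coords X v p W u t Du Dt"
 by (intro field_coords.intro isolated_surface_axioms surface_coords_subset assms)

context isolated_surface
begin

text \<open>The components of \<open>v\<close> are divided by their greatest common divisor at
  \<open>x\<close>; coprimality of the quotients spreads to a neighbourhood by
  \<open>coprime_at_open\<close>.\<close>

lemma primitive_coords_exist: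
 assumes x: "x \<in> points X"
 obtains V u t Du Dt \<gamma> a b where "primitive_coords X v p V u t Du Dt \<gamma> a b" "x \<in> V"
proof -
 obtain V u t Du Dt where V: "field_coords X v p V u t Du Dt" "x \<in> V" using field_coords_exist[OF x] .
 interpret field_coords X v p V u t Du Dt by (rule V(1))
 interpret L: regular_local_ring2 "generic X" "reg_at X x" x "%z. u z - u x" "%z. t z - t x"
  by (rule regular_local_ring2[OF V(2)])
 have d: "deriv_of v u \<in> reg_at X x" "deriv_of v t \<in> reg_at X x"
  unfolding reg_at_def using v_coords_reg V_open V(2) by blast+
 show thesis
 proof (cases "GEN z. deriv_of v u z = 0")
  \<comment> \<open>Here \<open>v\<close> is a multiple of \<open>Dt\<close>, and (a, b) = (0, 1) is
    coprime at every point.\<close>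
  case True
  have du: "deriv_of v u z = 0" if "z \<in> V" for z
   by (rule reg_identity[OF V_open v_coords_reg(1) reg_const[OF var V_open] True that])
  have "primitive_coords X v p V u t Du Dt (deriv_of v t) (%_. 0) (%_. 1)"
  proof (intro primitive_coords.intro V(1) primitive_coords_axioms.intro reg_const[OF var V_open] v_coords_reg)
   fix z assume z: "z \<in> V"
   show "v z u = deriv_of v t z * 0" using du[OF z] by (simp add: deriv_of_def)
   interpret z: generic_ring "generic X" "reg_at X z" by (rule generic_ring_reg_at[OF V_points[OF z]])
   show "coprime_at z (%_. 0) (%_. 1)" by (rule z.coprime_pair_sym[OF z.coprime_pair_one])
  qed (use V(2) in "auto simp: deriv_of_def")
  then show thesis using V(2) by (rule that)
 next
  case False
  obtain g a b where g: "g \<in> reg_at X x" "a \<in> reg_at X x" "b \<in> reg_at X x" "\<not> (GEN z. a z = 0)"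
   "\<not> (GEN z. g z = 0)"
   "GEN z. deriv_of v u z = g z * a z" "GEN z. deriv_of v t z = g z * b z"
   "\<And>c. c \<in> reg_at X x ==> L.dvdR a (%z. b z * c z) ==> L.dvdR a c"
   by (rule L.coprime_decomposition[OF d(1) False d(2)]) (rule that; assumption)
  have "coprime_at x a b" by (rule L.coprime_pairI_dvd[OF g(2,4,8)])
  then obtain W where W: "zopen X W" "x \<in> W" "\<And>y. y \<in> W ==> coprime_at y a b"
   using coprime_at_open[OF x g(2,4)] by metis
  obtain G where G: "zopen X G" "x \<in> G" "g \<in> reg X G" using reg_atE[OF var g(1)] .
  obtain A where A: "zopen X A" "x \<in> A" "a \<in> reg X A" using reg_atE[OF var g(2)] .
  obtain B where B: "zopen X B" "x \<in> B" "b \<in> reg X B" using reg_atE[OF var g(3)] .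
  define N where "N = V \<inter> W \<inter> G \<inter> A \<inter> B"
  have N: "zopen X N" "N \<subseteq> V" "N \<subseteq> W" "N \<subseteq> G" "N \<subseteq> A" "N \<subseteq> B" "x \<in> N"
   unfolding N_def using V_open V(2) W(1,2) G(1,2) A(1,2) B(1,2) by auto
  have r: "g \<in> reg X N" "a \<in> reg X N" "b \<in> reg X N" "deriv_of v u \<in> reg X N" "deriv_of v t \<in> reg X N"
   using reg_restrict[OF var G(1) N(1,4) G(3)] reg_restrict[OF var A(1) N(1,5) A(3)] reg_restrict[OF var B(1) N(1,6) B(3)]
    reg_restrict[OF var V_open N(1,2) v_coords_reg(1)] reg_restrict[OF var V_open N(1,2) v_coords_reg(2)] by auto
  have "primitive_coords X v p N u t Du Dt g a b"
  proof (intro primitive_coords.intro field_coords_subset N(1,2) primitive_coords_axioms.intro r(1-3))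
   fix z assume z: "z \<in> N"
   show "v z u = g z * a z"
    using reg_identity[OF N(1) r(4) reg_mult[OF var N(1) r(1,2)] g(6) z] by (simp add: deriv_of_def)
   show "v z t = g z * b z"
    using reg_identity[OF N(1) r(5) reg_mult[OF var N(1) r(1,3)] g(7) z] by (simp add: deriv_of_def)
   show "coprime_at z a b" using W(3) N(3) z by blast
  qed (use N(7) in blast)
  then show thesis using N(7) by (rule that)
 qed
qed

end

section \<open>Eigenforms of the Lie derivative at \<open>p\<close>\<close>

context primitive_coords
begin

abbreviation \<delta>u :: "'a => complex" where "\<delta>u \<equiv> deriv_of v u"
abbreviation \<delta>t :: "'a => complex" where "\<delta>t \<equiv> deriv_of v t"

text \<open>This is \<gamma> \<alpha>, not divided by the common factor. It is used at
  \<open>p\<close>, where \<gamma> is a unit, because its Lie derivative is explicit.\<close>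

definition \<alpha>v :: "'a sexp" where
 "\<alpha>v = Plus (Times (Fn \<delta>t) (Dif u)) (Times (Fn (%z. - \<delta>u z)) (Dif t))"

lemma eval_\<alpha>v: "eval_at \<alpha>v z \<xi> = \<delta>t z * \<xi> u - \<delta>u z * \<xi> t"
 unfolding \<alpha>v_def by (simp add: deriv_of_def)

lemma homog_\<alpha>v: "homog 1 \<alpha>v"
 unfolding \<alpha>v_def by (intro homog.intros(3) homog_scale homog.intros(2))

lemma v_coords_reg_at: "z \<in> V ==> \<delta>u \<in> reg_at X z" "z \<in> V ==> \<delta>t \<in> reg_at X z"
 unfolding reg_at_def using v_coords_reg V_open by blast+

lemma generic_V': "GEN z. z \<in> V \<and> (\<delta>u z ~= 0 \<or> \<delta>t z ~= 0)"
 using generic_V by eventually_elim (auto simp: deriv_of_def v_ut)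

text \<open>\<open>L\<^sub>v \<alpha>v\<close> is the divergence of \<open>v\<close> times \<open>\<alpha>v\<close>.\<close>

lemma eval_lie_\<alpha>v:
 assumes z: "z \<in> V" and \<xi>: "\<xi> \<in> tangent_space X z"
 shows "eval_at (lie v \<alpha>v) z \<xi> = (Du z \<delta>u + Dt z \<delta>t) * eval_at \<alpha>v z \<xi>"
proof -
 interpret z: variety_point X z by (rule variety_point[OF V_points[OF z]])
 have m: "v z (%y. - \<delta>u y) = - v z \<delta>u"
  using z.tangent_rules(4)[OF v_tangent[OF z.pt] v_coords_reg_at(1)[OF z], of "-1"] by simp
 have "eval_at (lie v \<alpha>v) z \<xi> = v z \<delta>t * \<xi> u + \<delta>t z * \<xi> \<delta>u + (- v z \<delta>u * \<xi> t - \<delta>u z * \<xi> \<delta>t)"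
  unfolding \<alpha>v_def by (simp add: deriv_of_def m[unfolded deriv_of_def])
 also have "\<dots> = (Du z \<delta>u + Dt z \<delta>t) * eval_at \<alpha>v z \<xi>"
  unfolding eval_\<alpha>v v_expand[OF z, of \<delta>t] v_expand[OF z, of \<delta>u] tangent_expand[OF z \<xi>, of \<delta>t] tangent_expand[OF z \<xi>, of \<delta>u]
  by (simp add: deriv_of_def algebra_simps)
 finally show ?thesis .
qed

context
 assumes pV: "p \<in> V"
begin

interpretation L: generic_local_ring "generic X" "reg_at X p" p by (rule generic_local_ring_reg_at[OF p_point])
interpretation Lp: variety_point X p by (rule variety_point[OF p_point])

text \<open>The common factor \<gamma> of the components of \<open>v\<close> divides \<delta>
  \<gamma>; if it vanished at \<open>p\<close> it would be an invariant germ. So \<gamma> is a unit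
  at \<open>p\<close>.\<close>

lemma coprime_at_p: "coprime_at p \<delta>u \<delta>t"
proof -
 have "\<gamma> p ~= 0"
 proof
  assume 0: "\<gamma> p = 0"
  have r: "(%z. a z * Du z \<gamma> + b z * Dt z \<gamma>) \<in> reg_at X p"
   by (intro L.add_R L.mult_R ab_reg_at partial_reg_at pV)
  have "GEN z. v z \<gamma> = (a z * Du z \<gamma> + b z * Dt z \<gamma>) * \<gamma> z"
   by (rule eventually_genericI[OF V_open pV]) (simp add: v_expand[of _ \<gamma>] v_ut algebra_simps)
  then have "GEN z. \<gamma> z = 0" by (rule invariant_germ_zero[OF ab_reg_at(3)[OF pV] 0 r])
  moreover have "GEN z. \<gamma> z ~= 0" using generic_V by eventually_elim simp
  ultimately show False using L.not_ev_zeroI by blast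
 qed
 then have "coprime_at p (%z. \<gamma> z * a z) (%z. \<gamma> z * b z)"
  by (rule L.coprime_pair_unit[OF coprime_ab[OF pV] ab_reg_at(3)[OF pV]])
 then show ?thesis
  by (rule L.coprime_pair_cong)
   (rule eventually_genericI[OF V_open pV], simp add: deriv_of_def v_ut)+
qed

text \<open>Modulo du only a multiple c_0 of the top power of dt survives. As e(v) = 0 and the
  components of \<open>v\<close> are coprime at \<open>p\<close>, c_0 is divisible by
  \<delta>u.\<close>

lemma du_peel:
 assumes e: "homog (Suc n) e" "sexp_at X p e" and h: "GEN z. contract v e z = 0"
 obtains A k where "homog n A" "sexp_at X p A" "k \<in> reg_at X p"
  "GEN z. \<forall>\<xi>\<in>tangent_space X z. eval_at e z \<xi> = \<xi> u * eval_at A z \<xi> - \<delta>u z * k z * \<xi> t ^ Suc n"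
  "GEN z. contract v A z = k z * \<delta>t z ^ Suc n"
proof -
 obtain c where c0: "\<forall>i. c i \<in> reg_at X p" "sym_eq X p e (nform u t (Suc n) c)"
  using nform_exists[OF pV e] by (elim exE conjE)
 note c = spec[OF c0(1)]
 define A where "A = nform u t n (%i. c (Suc i))"
 have A: "homog n A" "sexp_at X p A" unfolding A_def by (rule homog_nform, rule wf_nform[OF pV c])
 have val: "GEN z. \<forall>\<xi>\<in>tangent_space X z. eval_at e z \<xi> = \<xi> u * eval_at A z \<xi> + c 0 z * \<xi> t ^ Suc n"
  using values_generic[OF p_point c0(2)] unfolding A_def by (simp add: deriv_of_def eval_spow)
 have "GEN z. \<delta>u z * contract v A z = \<delta>t z ^ Suc n * (- c 0 z)"
  using val h generic_V'
 proof eventually_elim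
  case (elim z)
  have "v z \<in> tangent_space X z" by (rule v_tangent[OF V_points[OF conjunct1[OF elim(3)]]])
  from bspec[OF elim(1) this] elim(2)
  have "\<delta>u z * contract v A z + \<delta>t z ^ Suc n * c 0 z = 0"
   by (simp add: contract_eval_at[of v] deriv_of_def mult.commute)
  then show ?case by (simp only: eq_neg_iff_add_eq_0 mult_minus_right)
 qed
 then obtain k where k: "k \<in> reg_at X p" "GEN z. contract v A z = \<delta>t z ^ Suc n * k z"
  "GEN z. - c 0 z = \<delta>u z * k z"
  by (rule L.coprime_pairE[OF L.coprime_pair_sym[OF L.coprime_pair_power_left[OF v_coords_reg_at(2)[OF pV]
     L.coprime_pair_sym[OF coprime_at_p]]] contract_reg_at[OF v p_point A(2)] L.minus_R[OF c]])
 have "GEN z. \<forall>\<xi>\<in>tangent_space X z. eval_at e z \<xi> = \<xi> u * eval_at A z \<xi> - \<delta>u z * k z * \<xi> t ^ Suc n"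
  using val k(3)
 proof eventually_elim
  case (elim z)
  have "c 0 z = - (\<delta>u z * k z)" using arg_cong[OF elim(2), of uminus] by simp
  then show ?case using elim(1) by simp
 qed
 moreover have "GEN z. contract v A z = k z * \<delta>t z ^ Suc n" using k(2) by eventually_elim simp
 ultimately show thesis by (rule that[OF A k(1)])
qed

text \<open>Write e = du A - \<delta>u k dt^(n+1). For n > 0 the form A - k \<delta>t dt^n has one
  degree less and vanishes on \<open>v\<close> again; with B' its quotient by \<alpha>v, e =
  \<alpha>v (du B' + k dt^n).\<close>

lemma form_division:
 assumes "homog (Suc n) e" "sexp_at X p e" "GEN z. contract v e z = 0"
 shows "\<exists>e'. homog n e' \<and> sexp_at X p e' \<and>
  (GEN z. \<forall>\<xi>\<in>tangent_space X z. eval_at e z \<xi> = eval_at \<alpha>v z \<xi> * eval_at e' z \<xi>)"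
 using assms
proof (induction n arbitrary: e)
 case 0
 obtain A k where A: "homog 0 A" "sexp_at X p A" "k \<in> reg_at X p"
  "GEN z. \<forall>\<xi>\<in>tangent_space X z. eval_at e z \<xi> = \<xi> u * eval_at A z \<xi> - \<delta>u z * k z * \<xi> t ^ Suc 0"
  "GEN z. contract v A z = k z * \<delta>t z ^ Suc 0" by (rule du_peel[OF 0])
 have "GEN z. \<forall>\<xi>\<in>tangent_space X z. eval_at e z \<xi> = eval_at \<alpha>v z \<xi> * eval_at (Fn k) z \<xi>"
  using A(4,5)
 proof eventually_elim
  case (elim z)
  have "eval_at A z \<xi> = \<delta>t z * k z" for \<xi> using homog_0_eval[OF A(1), where z = z and \<xi> = \<xi> and \<eta> = "v z"] elim(2) by (simp add: contract_eval_at[of v])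
  then show ?case using elim(1) by (simp add: eval_\<alpha>v algebra_simps)
 qed
 moreover have "homog 0 (Fn k)" "sexp_at X p (Fn k)" using A(3) by (auto intro: homog.intros)
 ultimately show ?case by (intro exI[of _ "Fn k"] conjI)
next
 case (Suc n)
 obtain A k where A: "homog (Suc n) A" "sexp_at X p A" "k \<in> reg_at X p"
  "GEN z. \<forall>\<xi>\<in>tangent_space X z. eval_at e z \<xi> = \<xi> u * eval_at A z \<xi> - \<delta>u z * k z * \<xi> t ^ Suc (Suc n)"
  "GEN z. contract v A z = k z * \<delta>t z ^ Suc (Suc n)" by (rule du_peel[OF Suc.prems])
 let ?T = "spow (Dif t) (Suc n)"
 let ?B = "Plus A (Times (Fn (%z. - (k z * \<delta>t z))) ?T)"
 have T: "homog (Suc n) ?T" "sexp_at X p ?T" by (intro homog_spow homog.intros(2), rule wf_ut(3)[OF pV])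
 have kd: "(%z. - (k z * \<delta>t z)) \<in> reg_at X p" by (intro L.minus_R L.mult_R A v_coords_reg_at pV)
 have B: "homog (Suc n) ?B" "sexp_at X p ?B"
  using A(2) T(2) kd by (intro homog.intros(3) A homog_scale T, simp)
 have "GEN z. contract v ?B z = 0"
  using A(5) by eventually_elim (simp add: contract_eval_at[of v] eval_spow deriv_of_def)
 from Suc.IH[OF B this] obtain B' where B': "homog n B'" "sexp_at X p B'"
  "GEN z. \<forall>\<xi>\<in>tangent_space X z. eval_at ?B z \<xi> = eval_at \<alpha>v z \<xi> * eval_at B' z \<xi>" by (elim exE conjE)
 let ?e = "Plus (Times (Dif u) B') (Times (Fn k) ?T)"
 have "homog (1 + n) (Times (Dif u) B')" by (intro homog.intros B')
 then have "homog (Suc n) ?e" by (intro homog.intros(3) homog_scale T) simp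
 moreover have "sexp_at X p ?e" using B'(2) T(2) A(3) wf_ut[OF pV] by simp
 moreover have "GEN z. \<forall>\<xi>\<in>tangent_space X z. eval_at e z \<xi> = eval_at \<alpha>v z \<xi> * eval_at ?e z \<xi>"
  using A(4) B'(3)
 proof (eventually_elim, intro ballI)
  fix z \<xi> assume 1: "\<forall>\<xi>\<in>tangent_space X z. eval_at e z \<xi> = \<xi> u * eval_at A z \<xi> - \<delta>u z * k z * \<xi> t ^ Suc (Suc n)"
   and 2: "\<forall>\<xi>\<in>tangent_space X z. eval_at ?B z \<xi> = eval_at \<alpha>v z \<xi> * eval_at B' z \<xi>" and \<xi>: "\<xi> \<in> tangent_space X z"
  have 3: "eval_at A z \<xi> = eval_at \<alpha>v z \<xi> * eval_at B' z \<xi> + k z * \<delta>t z * \<xi> t ^ Suc n"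
   using bspec[OF 2 \<xi>] by (simp add: eval_spow deriv_of_def algebra_simps)
  show "eval_at e z \<xi> = eval_at \<alpha>v z \<xi> * eval_at ?e z \<xi>"
   unfolding bspec[OF 1 \<xi>] 3 by (simp add: eval_\<alpha>v eval_spow deriv_of_def algebra_simps)
 qed
 ultimately show ?case by (intro exI[of _ ?e] conjI)
qed

text \<open>Once e is \<alpha>v times a form e', the quotient is an eigenform again, because the Lie
  derivative multiplies \<alpha>v by the divergence of \<open>v\<close>; the new factor is g minus
  the divergence. In degree 0 the condition is empty.\<close>

theorem invariant_form_translation_inv:
 assumes "homog r e" "sexp_at X p e" "g \<in> reg_at X p" "sym_eq X p (lie v e) (Times (Fn g) e)"
 shows "GEN z. translation_inv v e z"
 using assms
proof (induction r arbitrary: e g)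
 case 0
 show ?case unfolding translation_inv_def by (intro always_eventually allI ballI homog_0_eval[OF 0(1)])
next
 case (Suc n)
 note e = Suc.prems
 let ?h = "contract v e"
 have h: "?h \<in> reg_at X p" by (rule contract_reg_at[OF v p_point e(2)])
 have "\<forall>\<^sub>F z in near X p. v z ?h = g z * ?h z"
  using Lp.near_points Lp.near_sexp_at[OF e(2)] Lp.sym_eq_near[OF e(4)]
 proof eventually_elim
  case (elim z)
  then show ?case using contract_lie[OF v elim(1,2)] contract_sym_eq[OF var v elim(1,3)] by (simp add: times_fun_def)
 qed
 from near_imp_generic[OF p_point this] have "GEN z. ?h z = 0"
  by (rule invariant_germ_zero[OF h _ e(3), rotated]) (simp add: contract_eval_at[of v] homog_eval_0[OF e(1)] v_at_p)
 from form_division[OF e(1,2) this] obtain e' where e': "homog n e'" "sexp_at X p e'"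
  "GEN z. \<forall>\<xi>\<in>tangent_space X z. eval_at e z \<xi> = eval_at \<alpha>v z \<xi> * eval_at e' z \<xi>" by (elim exE conjE)
 let ?ae = "Times \<alpha>v e'"
 have \<alpha>: "sexp_at X p \<alpha>v" unfolding \<alpha>v_def using wf_ut[OF pV] v_coords_reg_at[OF pV] Lp.R_minus by simp
 have ae: "homog (Suc n) ?ae" "sexp_at X p ?ae" using homog.intros(4)[OF homog_\<alpha>v e'(1)] \<alpha> e'(2) by auto
 have "sym_eq X p e ?ae"
  by (rule sym_eq_by_values[OF p_point e(1,2) ae]) (use e'(3) in simp)
 from lie_sym_eq[OF var v p_point this]
 have "sym_eq X p (Times (Fn g) e) (lie v ?ae)" using sym_eq.sym[OF e(4)] by (rule sym_eq.trans[rotated])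
 note val = values_generic[OF p_point this]
 define m where "m z = g z - (Du z \<delta>u + Dt z \<delta>t)" for z
 have m: "m \<in> reg_at X p" unfolding m_def
  by (intro L.diff_R L.add_R e partial_reg_at v_coords_reg_at pV)
 have "GEN z. \<forall>\<xi>\<in>tangent_space X z. eval_at (lie v e') z \<xi> = eval_at (Times (Fn m) e') z \<xi>"
  using val e'(3) generic_V'
 proof eventually_elim
  case (elim z)
  have z: "z \<in> V" by (rule conjunct1[OF elim(3)])
  \<comment> \<open>A vector on which \<alpha>v is nonzero, as needed to cancel \<alpha>v by
    \<open>eval_at_cancel\<close>.\<close>
  obtain \<eta> where \<eta>: "\<eta> \<in> tangent_space X z" "eval_at \<alpha>v z \<eta> ~= 0"
  proof (cases "\<delta>t z = 0")
   case True
   then show ?thesis using that[of "Dt z"] elim(3) partial_tangent(2)[OF z] partial_dual(3,4)[OF z] by (simp add: eval_\<alpha>v)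
  next
   case False
   then show ?thesis using that[of "Du z"] partial_tangent(1)[OF z] partial_dual(1,2)[OF z] by (simp add: eval_\<alpha>v)
  qed
  show ?case
  proof
   fix \<xi> assume \<xi>: "\<xi> \<in> tangent_space X z"
   show "eval_at (lie v e') z \<xi> = eval_at (Times (Fn m) e') z \<xi>"
   proof (rule eval_at_cancel[of "eval_at \<alpha>v z", OF _ \<eta> \<xi>])
    fix \<xi> \<eta> s show "eval_at \<alpha>v z (%f. \<xi> f + s * \<eta> f) = eval_at \<alpha>v z \<xi> + s * eval_at \<alpha>v z \<eta>"
     by (simp add: eval_\<alpha>v algebra_simps)
   next
    fix \<xi> assume \<xi>: "\<xi> \<in> tangent_space X z"
    have "g z * (eval_at \<alpha>v z \<xi> * eval_at e' z \<xi>) = eval_at (lie v \<alpha>v) z \<xi> * eval_at e' z \<xi> + eval_at \<alpha>v z \<xi> * eval_at (lie v e') z \<xi>"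
     using bspec[OF elim(1) \<xi>] bspec[OF elim(2) \<xi>] by simp
    then show "eval_at \<alpha>v z \<xi> * eval_at (lie v e') z \<xi> = eval_at \<alpha>v z \<xi> * eval_at (Times (Fn m) e') z \<xi>"
     unfolding eval_lie_\<alpha>v[OF z \<xi>] by (simp add: m_def algebra_simps)
   qed
  qed
 qed
 then have "sym_eq X p (lie v e') (Times (Fn m) e')"
  using e'(2) m by (intro sym_eq_by_values[OF p_point homog_lie[OF e'(1)] leaves_lie[OF v e'(2)] homog_scale[OF e'(1)]]) simp_all
 from Suc.IH[OF e'(1,2) m this] have "GEN z. translation_inv v e' z" .
 with e'(3) generic_V' show ?case
 proof eventually_elim
  case (elim z)
  have vz: "v z \<in> tangent_space X z" by (rule v_tangent[OF V_points[OF conjunct1[OF elim(2)]]])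
  show ?case unfolding translation_inv_def
  proof (intro ballI allI)
   fix \<xi> k assume \<xi>: "\<xi> \<in> tangent_space X z"
   have \<xi>': "(%f. \<xi> f + k * v z f) \<in> tangent_space X z" using tangent_space_combine[OF \<xi> vz, of 1 k] by simp
   have "eval_at e' z (%f. \<xi> f + k * v z f) = eval_at e' z \<xi>"
    by (rule spec[OF bspec[OF elim(3)[unfolded translation_inv_def] \<xi>]])
   moreover have "eval_at \<alpha>v z (%f. \<xi> f + k * v z f) = eval_at \<alpha>v z \<xi>"
    unfolding eval_\<alpha>v by (simp add: deriv_of_def algebra_simps)
   ultimately show "eval_at e z (%f. \<xi> f + k * v z f) = eval_at e z \<xi>"
    using bspec[OF elim(1) \<xi>] bspec[OF elim(1) \<xi>'] by simp
  qed
 qed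
qed

end

end

section \<open>Invariant webs\<close>

lemma sec_restrict_self: "x \<in> V ==> sec_restrict V s x = s x"
 unfolding sec_restrict_def by simp

lemma sec_restrict_times: "sec_restrict N (sec_times X s t) = sec_times X (sec_restrict N s) (sec_restrict N t)"
 unfolding sec_restrict_def sec_times_def by (rule ext) simp

lemma Sym_restrict:
 assumes X: "variety X" and s: "s \<in> Sym X r U" and V: "zopen X V" "V \<subseteq> U"
 shows "sec_restrict V s \<in> Sym X r V"
 unfolding Sym_def
proof (intro CollectI conjI allI impI ballI)
 fix x assume x: "x \<in> V"
 obtain N e where N: "zopen X N" "x \<in> N" "N \<subseteq> U" "leaves e \<subseteq> reg X N" "homog r e" "\<forall>y\<in>N. s y = stalk_class X y e"
  using s x V(2) unfolding Sym_def by blast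
 have o: "zopen X (N \<inter> V)" using N(1) V(1) by auto
 have "leaves e \<subseteq> reg X (N \<inter> V)" using reg_restrict[OF X N(1) o] N(4) by blast
 then show "\<exists>Va t. zopen X Va \<and> x \<in> Va \<and> Va \<subseteq> V \<and> leaves t \<subseteq> reg X Va \<and> homog r t \<and>
   (\<forall>y\<in>Va. sec_restrict V s y = stalk_class X y t)"
  using o N x by (intro exI[of _ "N \<inter> V"] exI[of _ e]) (auto simp: sec_restrict_def)
qed (simp add: sec_restrict_def)

lemma local_generator_cong:
 assumes "\<And>U. zopen X U ==> W U = W' U"
 shows "local_generator X W U \<omega> \<longleftrightarrow> local_generator X W' U \<omega>"
 unfolding local_generator_def using assms by auto

lemma local_generatorD:
 assumes "local_generator X W U \<omega>"
 shows "zopen X U" "\<omega> \<in> W U"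
  "zopen X V ==> V \<subseteq> U ==> W V = {sec_times X (sec_fn X V f) (sec_restrict V \<omega>) | f. f \<in> reg X V}"
  "zopen X V ==> V \<subseteq> U ==> f \<in> reg X V ==>
   sec_times X (sec_fn X V f) (sec_restrict V \<omega>) = sec_fn X V (%_. 0) ==> x \<in> V ==> f x = 0"
proof -
 note a = assms[unfolded local_generator_def]
 show "zopen X U" "\<omega> \<in> W U" by (rule conjunct1[OF a], rule conjunct1[OF conjunct2[OF a]])
 show "zopen X V ==> V \<subseteq> U ==> W V = {sec_times X (sec_fn X V f) (sec_restrict V \<omega>) | f. f \<in> reg X V}"
  "zopen X V ==> V \<subseteq> U ==> f \<in> reg X V ==>
   sec_times X (sec_fn X V f) (sec_restrict V \<omega>) = sec_fn X V (%_. 0) ==> x \<in> V ==> f x = 0"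
  using spec[OF conjunct2[OF conjunct2[OF a]], of V] by simp_all
qed

context isolated_surface
begin

text \<open>The expected r-th power of \<F>(v), described without generators. The condition is only
  generic, so on a nonempty open set it can be checked after restriction to any smaller one.\<close>

definition vpow :: "nat => 'a subsheaf" where
 "vpow r U = {s \<in> Sym X r U. GEN z. \<forall>e\<in>s z. translation_inv v e z}"

lemma vpowD: "s \<in> vpow r U ==> s \<in> Sym X r U" "s \<in> vpow r U ==> GEN z. \<forall>e\<in>s z. translation_inv v e z"
 unfolding vpow_def by simp_all

lemma vpowI: "s \<in> Sym X r U ==> GEN z. \<forall>e\<in>s z. translation_inv v e z ==> s \<in> vpow r U"
 unfolding vpow_def by (rule CollectI) (rule conjI)

lemma translation_inv_sym_eq:
 assumes "z \<in> points X" "sym_eq X z e e'"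
 shows "translation_inv v e z \<longleftrightarrow> translation_inv v e' z"
proof (rule translation_inv_cong[where v = v and z = z, OF v_tangent[OF assms(1)]])
 interpret z: variety_point X z by (rule variety_point[OF assms(1)])
 show "eval_at e z \<xi> = eval_at e' z \<xi>" if "\<xi> \<in> tangent_space X z" for \<xi>
  by (rule z.contract_tangent[OF that assms(2)])
qed

lemma vpow_clsI:
 assumes U: "zopen X U" and e: "leaves e \<subseteq> reg X U" "homog r e" and ti: "GEN z. translation_inv v e z"
 shows "cls U e \<in> vpow r U"
proof (rule vpowI[OF cls_Sym[OF U e]])
 show "GEN z. \<forall>e\<in>cls U e z. translation_inv v e z"
  using ti
 proof (eventually_elim, intro ballI)
  fix z e' assume z: "translation_inv v e z" "e' \<in> cls U e z"
  then have "z \<in> U" "e' \<in> stalk_class X z e" unfolding cls_def by (auto split: if_splits)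
  then show "translation_inv v e' z"
   using translation_inv_sym_eq[OF _ stalk_classD] z(1) openin_subset[OF U] by blast
 qed
qed

lemma vpow_clsD:
 assumes U: "zopen X U" "x \<in> U" and e: "leaves e \<subseteq> reg X U" and s: "cls U e \<in> vpow r U"
 shows "GEN z. translation_inv v e z"
proof -
 have "GEN z. z \<in> U" by (rule eventually_genericI[OF U])
 with vpowD(2)[OF s] show ?thesis
 proof eventually_elim
  case (elim z)
  have "e \<in> cls U e z" unfolding cls_def using elim(2) stalk_class_self[OF leaves_at[OF e U(1) elim(2)]] by simp
  then show ?case by (rule bspec[OF elim(1)])
 qed
qed

lemma vpow_restrict:
 assumes "s \<in> vpow r U" "zopen X V" "V \<subseteq> U"
 shows "sec_restrict V s \<in> vpow r V"
proof (rule vpowI[OF Sym_restrict[OF var vpowD(1)[OF assms(1)] assms(2,3)]])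
 show "GEN z. \<forall>e\<in>sec_restrict V s z. translation_inv v e z"
  using vpowD(2)[OF assms(1)] by eventually_elim (simp add: sec_restrict_def)
qed

lemma vpow_of_restrict:
 assumes s: "s \<in> Sym X r U" and V: "zopen X V" "x \<in> V" "sec_restrict V s \<in> vpow r V"
 shows "s \<in> vpow r U"
proof (rule vpowI[OF s])
 have "GEN z. z \<in> V" by (rule eventually_genericI[OF V(1,2)])
 with vpowD(2)[OF V(3)] show "GEN z. \<forall>e\<in>s z. translation_inv v e z"
  by eventually_elim (simp add: sec_restrict_self)
qed

lemma Sym_outside: "s \<in> Sym X r U ==> x \<notin> U ==> s x = {}"
 unfolding Sym_def by blast

lemma vpow_empty: "s \<in> Sym X r {} ==> s \<in> vpow r {}"
 by (rule vpowI) (simp_all add: Sym_outside[of s r "{}"])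

end

context primitive_coords
begin

lemma translation_inv_\<alpha>: "GEN z. translation_inv v (Times (Fn f) (spow \<alpha> r)) z"
 using generic_V
proof eventually_elim
 case (elim z)
 then have "z \<in> V" by simp
 then show ?case unfolding translation_inv_def by (simp add: eval_spow eval_\<alpha> v_ut algebra_simps)
qed

lemma cls_\<alpha>_vpow:
 assumes W: "zopen X W" "W \<subseteq> V" and f: "f \<in> reg X W"
 shows "cls W (Times (Fn f) (spow \<alpha> r)) \<in> vpow r W"
proof (rule vpow_clsI[OF W(1) _ _ translation_inv_\<alpha>])
 show "leaves (Times (Fn f) (spow \<alpha> r)) \<subseteq> reg X W" using f leaves_\<alpha>_pow reg_restrict[OF var V_open W] by auto
qed (intro homog_scale homog_spow homog_\<alpha>)

lemma \<alpha>_multiple_unique: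
 assumes z: "z \<in> V" and f: "f \<in> reg_at X z" "f' \<in> reg_at X z"
  and eq: "sym_eq X z (Times (Fn f) (spow \<alpha> r)) (Times (Fn f') (spow \<alpha> r))"
 shows "f z = f' z"
proof -
 interpret z: generic_local_ring "generic X" "reg_at X z" z by (rule generic_local_ring_reg_at[OF V_points[OF z]])
 have "GEN y. f y = f' y"
  using values_generic[OF V_points[OF z] eq] generic_V
 proof eventually_elim
  case (elim y)
  then have y: "y \<in> V" by simp
  have "f y * (b y * \<xi> u - a y * \<xi> t) ^ r = f' y * (b y * \<xi> u - a y * \<xi> t) ^ r" if "\<xi> \<in> tangent_space X y" for \<xi>
   using bspec[OF elim(1) that] by (simp add: eval_spow eval_\<alpha>)
  from this[OF partial_tangent(1)[OF y]] this[OF partial_tangent(2)[OF y]] show ?case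
   using elim(2) partial_dual[OF y] by auto
 qed
 then show ?thesis by (rule z.ev_at[OF f])
qed

lemma \<alpha>_wf: "z \<in> V ==> f \<in> reg_at X z ==> sexp_at X z (Times (Fn f) (spow \<alpha> r))"
 using leaves_at[OF leaves_\<alpha>_pow V_open, of z r] by simp

text \<open>Local factors exist by \<open>translation_inv_multiple\<close>. They are unique, hence
  glue, because \<alpha>^r is generically nonzero.\<close>

lemma vpow_\<alpha>_multiple:
 assumes W: "zopen X W" "W \<subseteq> V" and s: "s \<in> vpow r W"
 obtains f where "f \<in> reg X W" "s = cls W (Times (Fn f) (spow \<alpha> r))"
proof -
 have loc: "\<exists>f N. zopen X N \<and> y \<in> N \<and> f \<in> reg X N \<and> (\<forall>z\<in>N. s z = stalk_class X z (Times (Fn f) (spow \<alpha> r)))"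
  if y: "y \<in> W" for y
 proof -
  have yV: "y \<in> V" using y W(2) by blast
  interpret y: variety_point X y by (rule variety_point[OF V_points[OF yV]])
  obtain N e where N: "zopen X N" "y \<in> N" "N \<subseteq> W" "leaves e \<subseteq> reg X N" "homog r e" "sec_restrict N s = cls N e"
   by (rule SymE[OF vpowD(1)[OF s] y])
  have "cls N e \<in> vpow r N" using vpow_restrict[OF s N(1,3)] N(6) by simp
  from translation_inv_multiple[OF yV N(5) leaves_at[OF N(4,1,2)] vpow_clsD[OF N(1,2,4) this]]
  obtain f where f: "f \<in> reg_at X y" "sym_eq X y e (Times (Fn f) (spow \<alpha> r))" by (elim bexE)
  obtain F where F: "zopen X F" "y \<in> F" "f \<in> reg X F" using reg_atE[OF var f(1)] .
  obtain M where M: "zopen X M" "y \<in> M" "\<forall>z\<in>M. sym_eq X z e (Times (Fn f) (spow \<alpha> r))"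
   using y.sym_eq_near[OF f(2)] unfolding y.near_iff by (elim exE conjE)
  have o: "zopen X (N \<inter> F \<inter> M)" using N(1) F(1) M(1) by auto
  have "s z = stalk_class X z (Times (Fn f) (spow \<alpha> r))" if z: "z \<in> N \<inter> F \<inter> M" for z
  proof -
   have "s z = cls N e z" using fun_cong[OF N(6), of z] z by (simp add: sec_restrict_def)
   also have "\<dots> = stalk_class X z e" using z by (simp add: cls_def)
   also have "\<dots> = stalk_class X z (Times (Fn f) (spow \<alpha> r))" by (rule stalk_class_eq[OF bspec[OF M(3)]]) (use z in simp)
   finally show ?thesis .
  qed
  then show ?thesis using o N(2) F(2) M(2) reg_restrict[OF var F(1) o _ F(3)]
   by (intro exI[of _ f] exI[of _ "N \<inter> F \<inter> M"]) auto
 qed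
 define Q where "Q y f \<longleftrightarrow> f \<in> reg_at X y \<and> s y = stalk_class X y (Times (Fn f) (spow \<alpha> r))" for y f
 \<comment> \<open>The glued factor is defined pointwise: choose a local factor at each point and
   take its value there; \<open>FQ\<close> shows that the choice does not matter.\<close>
 define F where "F y = (SOME f. Q y f) y" for y
 have FQ: "F z = f z" if "z \<in> W" "Q z f" for z f
 proof -
  have "Q z (SOME f. Q z f)" by (rule someI[of "Q z", OF that(2)])
  moreover have zV: "z \<in> V" using that(1) W(2) by blast
  ultimately have g: "(SOME f. Q z f) \<in> reg_at X z" "f \<in> reg_at X z"
   "stalk_class X z (Times (Fn (SOME f. Q z f)) (spow \<alpha> r)) = stalk_class X z (Times (Fn f) (spow \<alpha> r))"
   using that(2) unfolding Q_def by auto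
  have "sym_eq X z (Times (Fn (SOME f. Q z f)) (spow \<alpha> r)) (Times (Fn f) (spow \<alpha> r))"
   using stalk_class_self[OF \<alpha>_wf[OF zV g(1), of r]] unfolding g(3) by (rule stalk_classD)
  then show ?thesis unfolding F_def by (rule \<alpha>_multiple_unique[OF zV g(1,2)])
 qed
 have FW: "F \<in> reg X W"
 proof (rule reg_of_reg_at[OF W(1)])
  fix y assume y: "y \<in> W"
  obtain f N where N: "zopen X N" "y \<in> N" "f \<in> reg X N" "\<forall>z\<in>N. s z = stalk_class X z (Times (Fn f) (spow \<alpha> r))"
   using loc[OF y] by (elim exE conjE)
  have o: "zopen X (N \<inter> W)" using N(1) W(1) by auto
  have fN: "f \<in> reg_at X z" if "z \<in> N" for z unfolding reg_at_def using N(1,3) that by blast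
  have eq: "F z = f z" if "z \<in> N \<inter> W" for z
   by (rule FQ) (use that fN N(4) in "simp_all add: Q_def")
  show "F \<in> reg_at X y" by (rule reg_at_ev_cong[OF fN[OF N(2)] o _ eq]) (use N(2) y in simp)
 qed
 have "s = cls W (Times (Fn F) (spow \<alpha> r))"
 proof
  fix y show "s y = cls W (Times (Fn F) (spow \<alpha> r)) y"
  proof (cases "y \<in> W")
   case False
   then show ?thesis using Sym_outside[OF vpowD(1)[OF s]] by (simp add: cls_def)
  next
   case True
   obtain f N where N: "zopen X N" "y \<in> N" "f \<in> reg X N" "\<forall>z\<in>N. s z = stalk_class X z (Times (Fn f) (spow \<alpha> r))"
    using loc[OF True] by (elim exE conjE)
   have yV: "y \<in> V" using True W(2) by blast
   interpret y: variety_point X y by (rule variety_point[OF V_points[OF yV]])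
   have r: "f \<in> reg_at X y" "F \<in> reg_at X y" unfolding reg_at_def using N FW W(1) True by blast+
   have fN: "f \<in> reg_at X z" if "z \<in> N" for z unfolding reg_at_def using N(1,3) that by blast
   have "F z = f z" if "z \<in> N \<inter> W" for z
    by (rule FQ) (use that fN N(4) in "simp_all add: Q_def")
   then have "\<forall>\<^sub>F z in near X y. f z = F z"
    unfolding y.near_iff using N(1,2) W(1) True by (intro exI[of _ "N \<inter> W"]) auto
   then have "sym_eq X y (Times (Fn f) (spow \<alpha> r)) (Times (Fn F) (spow \<alpha> r))"
    using leaves_at[OF leaves_\<alpha>_pow V_open yV] by (intro y.times_congL y.Fn_cong(1) r)
   from stalk_class_eq[OF this] show ?thesis using N(2,4) True by (simp add: cls_def)
  qed
 qed
 with FW show thesis by (rule that)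
qed

lemma fn_times_cls_\<alpha>:
 assumes W: "zopen X W" "W \<subseteq> V" and f: "f \<in> reg X W" "g \<in> reg X W"
 shows "sec_times X (sec_fn X W g) (cls W (Times (Fn f) (spow \<alpha> r))) = cls W (Times (Fn (%z. g z * f z)) (spow \<alpha> r))"
proof -
 have r: "f \<in> reg_at X z" "g \<in> reg_at X z" if "z \<in> W" for z unfolding reg_at_def using f W(1) that by blast+
 have wf: "sexp_at X z (Times (Fn f) (spow \<alpha> r))" if "z \<in> W" for z by (rule \<alpha>_wf) (use W(2) that r in blast)+
 have "sec_times X (sec_fn X W g) (cls W (Times (Fn f) (spow \<alpha> r))) = cls W (Times (Fn g) (Times (Fn f) (spow \<alpha> r)))"
  unfolding sec_fn_cls by (rule sec_times_cls) (use r wf in auto)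
 also have "\<dots> = cls W (Times (Fn (%z. g z * f z)) (spow \<alpha> r))"
 proof (rule cls_eqI)
  fix z assume z: "z \<in> W"
  interpret z: variety_point X z by (rule variety_point) (use z openin_subset[OF W(1)] in blast)
  show "sym_eq X z (Times (Fn g) (Times (Fn f) (spow \<alpha> r))) (Times (Fn (%z. g z * f z)) (spow \<alpha> r))"
   by (rule z.scale_scale[OF r(2,1)[OF z]]) (use wf[OF z] in simp)
 qed
 finally show ?thesis .
qed

lemma vpow_local_generator:
 assumes W: "zopen X W" "W \<subseteq> V"
 shows "local_generator X (vpow r) W (cls W (Times (Fn (%_. 1)) (spow \<alpha> r)))"
 unfolding local_generator_def
proof (intro conjI allI impI ballI)
 let ?g = "%W. cls W (Times (Fn (%_. 1)) (spow \<alpha> r))"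
 show "zopen X W" by (rule W(1))
 show "?g W \<in> vpow r W" by (rule cls_\<alpha>_vpow[OF W reg_const[OF var W(1)]])
 fix U assume "zopen X U \<and> U \<subseteq> W"
 then have U: "zopen X U" "U \<subseteq> W" "U \<subseteq> V" using W(2) by auto
 have m: "sec_times X (sec_fn X U f) (sec_restrict U (?g W)) = cls U (Times (Fn f) (spow \<alpha> r))" if "f \<in> reg X U" for f
  unfolding cls_restrict[OF U(2)] using fn_times_cls_\<alpha>[OF U(1,3) reg_const[OF var U(1)] that, of 1] by simp
 show "vpow r U = {sec_times X (sec_fn X U f) (sec_restrict U (?g W)) |f. f \<in> reg X U}" (is "_ = ?S")
 proof
  show "vpow r U \<subseteq> ?S"
  proof
   fix s assume "s \<in> vpow r U"
   then obtain f where f: "f \<in> reg X U" "s = cls U (Times (Fn f) (spow \<alpha> r))" by (rule vpow_\<alpha>_multiple[OF U(1,3)])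
   show "s \<in> ?S" by (rule CollectI, rule exI[of _ f]) (simp add: m f)
  qed
  show "?S \<subseteq> vpow r U" using cls_\<alpha>_vpow[OF U(1,3)] by (auto simp: m)
 qed
 fix f x assume f: "f \<in> reg X U" and eq: "sec_times X (sec_fn X U f) (sec_restrict U (?g W)) = sec_fn X U (%_. 0)" and x: "x \<in> U"
 have xV: "x \<in> V" using x U by blast
 interpret x: variety_point X x by (rule variety_point[OF V_points[OF xV]])
 have fx: "f \<in> reg_at X x" unfolding reg_at_def using f U(1) x by blast
 have "cls U (Times (Fn f) (spow \<alpha> r)) = cls U (Fn (%_. 0))" using eq unfolding m[OF f] unfolding sec_fn_cls .
 from cls_eqD[OF this x] have "sym_eq X x (Times (Fn f) (spow \<alpha> r)) (Fn (%_. 0))" by simp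
 also have "sym_eq X x \<dots> (Times (Fn (%_. 0)) (spow \<alpha> r))"
  by (rule sym_eq.sym[OF x.times_zeroL[OF leaves_at[OF leaves_\<alpha>_pow V_open xV]]])
 finally show "f x = 0" by (rule \<alpha>_multiple_unique[OF xV fx x.R_const])
qed

end

context isolated_surface
begin

lemma sec_times_Sym_local:
 assumes \<omega>: "\<omega>1 \<in> vpow r V" "\<omega>2 \<in> vpow q V" and V: "zopen X V" "x \<in> V" and f: "f \<in> reg X V"
 obtains N e where "zopen X N" "x \<in> N" "N \<subseteq> V" "leaves e \<subseteq> reg X N" "homog (r + q) e"
  "sec_restrict N (sec_times X (sec_fn X V f) (sec_times X \<omega>1 \<omega>2)) = cls N e" "GEN z. translation_inv v e z"
proof -
 obtain V1 e1 where 1: "zopen X V1" "x \<in> V1" "V1 \<subseteq> V" "leaves e1 \<subseteq> reg X V1" "homog r e1" "sec_restrict V1 \<omega>1 = cls V1 e1"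
  by (rule SymE[OF vpowD(1)[OF \<omega>(1)] V(2)])
 obtain V2 e2 where 2: "zopen X V2" "x \<in> V2" "V2 \<subseteq> V" "leaves e2 \<subseteq> reg X V2" "homog q e2" "sec_restrict V2 \<omega>2 = cls V2 e2"
  by (rule SymE[OF vpowD(1)[OF \<omega>(2)] V(2)])
 define N where "N = V1 \<inter> V2"
 have N: "zopen X N" "x \<in> N" "N \<subseteq> V1" "N \<subseteq> V2" "N \<subseteq> V" unfolding N_def using 1(1-3) 2(1-3) by auto
 have fN: "f \<in> reg X N" by (rule reg_restrict[OF var V(1) N(1,5) f])
 have l: "leaves e1 \<subseteq> reg X N" "leaves e2 \<subseteq> reg X N"
  using reg_restrict[OF var 1(1) N(1,3)] 1(4) reg_restrict[OF var 2(1) N(1,4)] 2(4) by blast+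
 have wf: "sexp_at X z (Fn f)" "sexp_at X z e1" "sexp_at X z e2" "sexp_at X z (Times e1 e2)" if "z \<in> N" for z
  using leaves_at[of "Fn f" N z] leaves_at[OF l(1) N(1) that] leaves_at[OF l(2) N(1) that] fN N(1) that by auto
 let ?e = "Times (Fn f) (Times e1 e2)"
 have r: "sec_restrict N \<omega>1 = cls N e1" "sec_restrict N \<omega>2 = cls N e2"
  using restrict_restrict[OF N(3), of \<omega>1] restrict_restrict[OF N(4), of \<omega>2] cls_restrict[OF N(3), of e1] cls_restrict[OF N(4), of e2] 1(6) 2(6)
  by simp_all
 have "sec_restrict N (sec_times X (sec_fn X V f) (sec_times X \<omega>1 \<omega>2)) = cls N ?e"
 proof -
  have "sec_times X (cls N e1) (cls N e2) = cls N (Times e1 e2)" by (rule sec_times_cls[OF wf(2,3)])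
  then show ?thesis unfolding sec_restrict_times sec_fn_cls r cls_restrict[OF N(5)]
   by (simp only:) (rule sec_times_cls[OF wf(1,4)])
 qed
 moreover have "leaves ?e \<subseteq> reg X N" using l fN by simp
 moreover have "homog (r + q) ?e" by (intro homog_scale homog.intros(4) 1 2)
 moreover have "GEN z. translation_inv v ?e z"
 proof -
  have "cls V1 e1 \<in> vpow r V1" "cls V2 e2 \<in> vpow q V2"
   using vpow_restrict[OF \<omega>(1) 1(1,3)] vpow_restrict[OF \<omega>(2) 2(1,3)] 1(6) 2(6) by simp_all
  from vpow_clsD[OF 1(1,2,4) this(1)] vpow_clsD[OF 2(1,2,4) this(2)] show ?thesis
   by eventually_elim (simp add: translation_inv_def)
 qed
 ultimately show thesis using N by (intro that[of N ?e])
qed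

text \<open>A product of translation invariant forms is translation invariant; conversely
  \<alpha>^(r+q) is the product of the local generators \<alpha>^r and \<alpha>^q.\<close>

lemma web_prod_vpow:
 assumes W: "\<And>U. zopen X U ==> W1 U = vpow r U" "\<And>U. zopen X U ==> W2 U = vpow q U"
  and U: "zopen X U"
 shows "web_prod X W1 W2 U = vpow (r + q) U"
proof
 have gen: "local_generator X W1 V \<omega> \<longleftrightarrow> local_generator X (vpow r) V \<omega>"
  "local_generator X W2 V \<omega> \<longleftrightarrow> local_generator X (vpow q) V \<omega>" for V \<omega>
  by (rule local_generator_cong[OF W(1)], assumption, rule local_generator_cong[OF W(2)], assumption)
 show "web_prod X W1 W2 U \<subseteq> vpow (r + q) U"
 proof
  fix s assume s: "s \<in> web_prod X W1 W2 U"
  have out: "x \<notin> U ==> s x = {}" for x using s unfolding web_prod_def by simp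
  have loc: "\<exists>N e. zopen X N \<and> x \<in> N \<and> N \<subseteq> U \<and> leaves e \<subseteq> reg X N \<and> homog (r + q) e \<and>
    sec_restrict N s = cls N e \<and> (GEN z. translation_inv v e z)" if x: "x \<in> U" for x
  proof -
   have "\<exists>V \<omega>1 \<omega>2 f. x \<in> V \<and> V \<subseteq> U \<and> local_generator X W1 V \<omega>1 \<and> local_generator X W2 V \<omega>2 \<and> f \<in> reg X V \<and>
    sec_restrict V s = sec_times X (sec_fn X V f) (sec_times X \<omega>1 \<omega>2)"
    using s x unfolding web_prod_def by simp
   then obtain V \<omega>1 \<omega>2 f where V: "x \<in> V" "V \<subseteq> U" "local_generator X W1 V \<omega>1" "local_generator X W2 V \<omega>2"
    "f \<in> reg X V" "sec_restrict V s = sec_times X (sec_fn X V f) (sec_times X \<omega>1 \<omega>2)" by (elim exE conjE)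
   have g: "local_generator X (vpow r) V \<omega>1" "local_generator X (vpow q) V \<omega>2" using V(3,4) unfolding gen .
   obtain N e where N: "zopen X N" "x \<in> N" "N \<subseteq> V" "leaves e \<subseteq> reg X N" "homog (r + q) e"
    "sec_restrict N (sec_times X (sec_fn X V f) (sec_times X \<omega>1 \<omega>2)) = cls N e" "GEN z. translation_inv v e z"
    by (rule sec_times_Sym_local[OF local_generatorD(2)[OF g(1)] local_generatorD(2)[OF g(2)] local_generatorD(1)[OF g(1)] V(1,5)])
   have "sec_restrict N s = cls N e" using N(6) unfolding V(6)[symmetric] restrict_restrict[OF N(3)] .
   then show ?thesis using N(1-5,7) V(2) by (intro exI[of _ N] exI[of _ e]) auto
  qed
  have sS: "s \<in> Sym X (r + q) U" unfolding Sym_def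
  proof (intro CollectI conjI allI impI ballI out)
   fix x assume "x \<in> U"
   from loc[OF this] obtain N e where N: "zopen X N" "x \<in> N" "N \<subseteq> U" "leaves e \<subseteq> reg X N" "homog (r + q) e"
    "sec_restrict N s = cls N e" by (elim exE conjE)
   have "s y = stalk_class X y e" if "y \<in> N" for y
    using fun_cong[OF N(6), of y] that by (simp add: sec_restrict_def cls_def)
   then have "\<forall>y\<in>N. s y = stalk_class X y e" by (rule ballI)
   then show "\<exists>V t. zopen X V \<and> x \<in> V \<and> V \<subseteq> U \<and> leaves t \<subseteq> reg X V \<and> homog (r + q) t \<and>
     (\<forall>y\<in>V. s y = stalk_class X y t)" by (intro exI[of _ N] exI[of _ e] conjI N(1-5))
  qed
  show "s \<in> vpow (r + q) U"
  proof (cases "U = {}")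
   case True
   then show ?thesis using vpow_empty sS by simp
  next
   case False
   then obtain x where "x \<in> U" by blast
   from loc[OF this] obtain N e where N: "zopen X N" "x \<in> N" "N \<subseteq> U" "leaves e \<subseteq> reg X N" "homog (r + q) e"
    "sec_restrict N s = cls N e" "GEN z. translation_inv v e z" by (elim exE conjE)
   show ?thesis by (rule vpow_of_restrict[OF sS N(1,2)]) (unfold N(6), rule vpow_clsI[OF N(1,4,5,7)])
  qed
 qed
 show "vpow (r + q) U \<subseteq> web_prod X W1 W2 U"
 proof
  fix s assume s: "s \<in> vpow (r + q) U"
  show "s \<in> web_prod X W1 W2 U" unfolding web_prod_def
  proof (intro CollectI conjI allI impI ballI)
   fix x assume "x \<notin> U"
   then show "s x = {}" by (rule Sym_outside[OF vpowD(1)[OF s]])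
  next
   fix x assume x: "x \<in> U"
   then have xp: "x \<in> points X" using openin_subset[OF U] by blast
   obtain V u t Du Dt \<gamma> a b where V: "primitive_coords X v p V u t Du Dt \<gamma> a b" "x \<in> V"
    using primitive_coords_exist[OF xp] .
   interpret primitive_coords X v p V u t Du Dt \<gamma> a b by (rule V(1))
   define N where "N = V \<inter> U"
   have N: "zopen X N" "N \<subseteq> V" "N \<subseteq> U" "x \<in> N" unfolding N_def using V_open U V(2) x by auto
   obtain f where f: "f \<in> reg X N" "sec_restrict N s = cls N (Times (Fn f) (spow \<alpha> (r + q)))"
    by (rule vpow_\<alpha>_multiple[OF N(1,2) vpow_restrict[OF s N(1,3)]])
   let ?\<omega> = "%r. Times (Fn (%_. 1)) (spow \<alpha> r)"
   have wf: "sexp_at X z (Fn f)" "sexp_at X z (?\<omega> r)" "sexp_at X z (?\<omega> q)" "sexp_at X z (Times (?\<omega> r) (?\<omega> q))" if "z \<in> N" for z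
   proof -
    have zV: "z \<in> V" using that N(2) by blast
    have "f \<in> reg_at X z" unfolding reg_at_def using that f(1) N(1) by blast
    moreover have "(%_. 1) \<in> reg_at X z" by (rule reg_at_ring(1)[OF var V_points[OF zV]])
    ultimately show "sexp_at X z (Fn f)" "sexp_at X z (?\<omega> r)" "sexp_at X z (?\<omega> q)" "sexp_at X z (Times (?\<omega> r) (?\<omega> q))"
     using \<alpha>_wf[OF zV, of "%_. 1"] by auto
   qed
   have "sec_times X (sec_fn X N f) (sec_times X (cls N (?\<omega> r)) (cls N (?\<omega> q))) = cls N (Times (Fn f) (Times (?\<omega> r) (?\<omega> q)))"
   proof -
    have "sec_times X (cls N (?\<omega> r)) (cls N (?\<omega> q)) = cls N (Times (?\<omega> r) (?\<omega> q))" by (rule sec_times_cls[OF wf(2,3)])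
    then show ?thesis unfolding sec_fn_cls by (simp only:) (rule sec_times_cls[OF wf(1,4)])
   qed
   also have "\<dots> = cls N (Times (Fn f) (spow \<alpha> (r + q)))"
   proof (rule cls_eqI)
    fix z assume z: "z \<in> N"
    then have zV: "z \<in> V" using N(2) by blast
    show "sym_eq X z (Times (Fn f) (Times (?\<omega> r) (?\<omega> q))) (Times (Fn f) (spow \<alpha> (r + q)))"
    proof (rule sym_eq_by_values[OF V_points[OF zV]])
     show "homog (r + q) (Times (Fn f) (Times (?\<omega> r) (?\<omega> q)))" "homog (r + q) (Times (Fn f) (spow \<alpha> (r + q)))"
      by (intro homog_scale homog.intros(4) homog_spow homog_\<alpha>)+
     show "sexp_at X z (Times (Fn f) (Times (?\<omega> r) (?\<omega> q)))" using wf[OF z] by auto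
     show "sexp_at X z (Times (Fn f) (spow \<alpha> (r + q)))" using wf(1)[OF z] by (intro \<alpha>_wf[OF zV]) simp
    qed (simp add: eval_spow power_add)
   qed
   finally have "sec_restrict N s = sec_times X (sec_fn X N f) (sec_times X (cls N (?\<omega> r)) (cls N (?\<omega> q)))" using f(2) by simp
   moreover have "local_generator X W1 N (cls N (?\<omega> r))" "local_generator X W2 N (cls N (?\<omega> q))"
    unfolding gen by (rule vpow_local_generator[OF N(1,2)])+
   ultimately show "\<exists>V \<omega>1 \<omega>2 f. x \<in> V \<and> V \<subseteq> U \<and> local_generator X W1 V \<omega>1 \<and> local_generator X W2 V \<omega>2 \<and> f \<in> reg X V \<and>
    sec_restrict V s = sec_times X (sec_fn X V f) (sec_times X \<omega>1 \<omega>2)"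
    using N f(1) by (intro exI[of _ N] exI[of _ "cls N (?\<omega> r)"] exI[of _ "cls N (?\<omega> q)"] exI[of _ f] conjI)
  qed
 qed
qed

lemma eval_linear: "homog 1 e ==> eval_at e z (%f. \<xi> f + k * \<eta> f) = eval_at e z \<xi> + k * eval_at e z \<eta>"
proof -
 have "r = 1 ==> eval_at e z (%f. \<xi> f + k * \<eta> f) = eval_at e z \<xi> + k * eval_at e z \<eta>" if "homog r e" for r
  using that
 proof induction
  case (4 r s q t)
  then consider "r = 0" "q = 1" | "r = 1" "q = 0" by linarith
  then show ?case
  proof cases
   case 1
   note h = homog_0_eval[OF 4(1)[unfolded 1], where z = z]
   show ?thesis using 4(4)[OF 1(2)] h[of "%f. \<xi> f + k * \<eta> f" \<xi>] h[of \<eta> \<xi>] by (simp add: algebra_simps)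
  next
   case 2
   note h = homog_0_eval[OF 4(2)[unfolded 2], where z = z]
   show ?thesis using 4(3)[OF 2(1)] h[of "%f. \<xi> f + k * \<eta> f" \<xi>] h[of \<eta> \<xi>] by (simp add: algebra_simps)
  qed
 qed (auto simp: deriv_of_def algebra_simps)
 then show "homog 1 e ==> ?thesis" by blast
qed

text \<open>In degree 1 evaluation is linear, so invariance under translation by \<open>v\<close>
  means that the form kills \<open>v\<close>. Passing from general points to all points is the
  identity principle for e(v).\<close>

lemma foliation_vpow:
 assumes U: "zopen X U"
 shows "foliation_of X v U = vpow 1 U"
proof -
 have ti: "translation_inv v e z \<longleftrightarrow> contract v e z = 0" if "homog 1 e" "z \<in> points X" for e z
 proof
  assume "translation_inv v e z"
  from spec[OF bspec[OF this[unfolded translation_inv_def] v_tangent[OF that(2)]], of 1]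
  show "contract v e z = 0" unfolding eval_linear[OF that(1)] contract_eval_at[of v] by simp
 next
  assume "contract v e z = 0"
  then show "translation_inv v e z"
   unfolding translation_inv_def eval_linear[OF that(1)] contract_eval_at[of v] by simp
 qed
 show ?thesis
 proof
  show "foliation_of X v U \<subseteq> vpow 1 U"
  proof
   fix s assume "s \<in> foliation_of X v U"
   then have s: "s \<in> Sym X 1 U" "\<And>x t. x \<in> U ==> t \<in> s x ==> contract v t x = 0" unfolding foliation_of_def by auto
   show "s \<in> vpow 1 U"
   proof (cases "U = {}")
    case True
    then show ?thesis using vpow_empty s(1) by simp
   next
    case False
    then obtain x where x: "x \<in> U" by blast
    obtain N e where N: "zopen X N" "x \<in> N" "N \<subseteq> U" "leaves e \<subseteq> reg X N" "homog 1 e" "sec_restrict N s = cls N e"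
     by (rule SymE[OF s(1) x])
    have "GEN z. translation_inv v e z"
    proof (rule eventually_genericI[OF N(1,2)])
     fix z assume z: "z \<in> N"
     have "e \<in> s z" using fun_cong[OF N(6), of z] stalk_class_self[OF leaves_at[OF N(4,1) z]] z
      by (simp add: sec_restrict_def cls_def)
     then show "translation_inv v e z"
      using s(2)[of z e] z N(3) openin_subset[OF U] by (subst ti[OF N(5)]) auto
    qed
    from vpow_clsI[OF N(1,4,5) this] show ?thesis unfolding N(6)[symmetric] by (rule vpow_of_restrict[OF s(1) N(1,2)])
   qed
  qed
  show "vpow 1 U \<subseteq> foliation_of X v U"
  proof
   fix s assume s: "s \<in> vpow 1 U"
   have "contract v t x = 0" if x: "x \<in> U" and t: "t \<in> s x" for x t
   proof -
    obtain N e where N: "zopen X N" "x \<in> N" "N \<subseteq> U" "leaves e \<subseteq> reg X N" "homog 1 e" "sec_restrict N s = cls N e"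
     by (rule SymE[OF vpowD(1)[OF s] x])
    have "cls N e \<in> vpow 1 N" using vpow_restrict[OF s N(1,3)] unfolding N(6) .
    note e = vpow_clsD[OF N(1,2,4) this]
    have "GEN z. z \<in> N" by (rule eventually_genericI[OF N(1,2)])
    with e have "GEN z. contract v e z = 0"
    proof eventually_elim
     case (elim z)
     have "z \<in> points X" using elim(2) openin_subset[OF N(1)] by blast
     with elim(1) show ?case using ti[OF N(5)] by simp
    qed
    then have "contract v e x = 0"
     by (rule reg_identity[OF N(1) contract_reg[OF v N(1,4)] reg_const[OF var N(1)] _ N(2)])
    moreover have "t \<in> stalk_class X x e" using fun_cong[OF N(6), of x] t N(2) by (simp add: sec_restrict_def cls_def)
    then have "contract v t x = contract v e x"
     by (intro contract_sym_eq[OF var v _ stalk_classD]) (use x openin_subset[OF U] in blast)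
    ultimately show ?thesis by simp
   qed
   then show "s \<in> foliation_of X v U" unfolding foliation_of_def using vpowD(1)[OF s] by simp
  qed
 qed
qed

lemma web_power_vpow:
 assumes "r \<ge> 1" "zopen X U"
 shows "web_power X (foliation_of X v) r U = vpow r U"
proof -
 have "zopen X U ==> (web_prod X (foliation_of X v) ^^ n) (foliation_of X v) U = vpow (Suc n) U" for n U
 proof (induction n arbitrary: U)
  case 0
  then show ?case using foliation_vpow by simp
 next
  case (Suc n)
  have "web_prod X (foliation_of X v) ((web_prod X (foliation_of X v) ^^ n) (foliation_of X v)) U = vpow (1 + Suc n) U"
   by (rule web_prod_vpow[OF foliation_vpow Suc.IH Suc.prems])
  then show ?case by simp
 qed
 from this[OF assms(2), of "r - 1"] assms(1) show ?thesis unfolding web_power_def by simp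
qed

text \<open>A generator of \<open>W\<close> at \<open>p\<close> is an eigenform of the Lie
  derivative, hence translation invariant at general points, and irreducibility carries this to
  sections on all open sets. The converse inclusion uses that the quotient by \<open>W\<close> is
  torsion-free.\<close>

theorem invariant_web_vpow:
 assumes web: "web X r W" and inv: "invariant_web X v W" and U: "zopen X U"
 shows "W U = vpow r U"
proof -
 have sheaf: "Sym_subsheaf X r W" and invs: "invertible_sheaf X W" and tf: "torsion_free_quotient X r W"
  using web unfolding web_def by auto
 note a = mp[OF spec[OF sheaf[unfolded Sym_subsheaf_def]]]
 note a4 = conjunct2[OF conjunct2[OF conjunct2[OF a]]]
 have Sym: "W U \<subseteq> Sym X r U" if "zopen X U" for U by (rule conjunct1[OF a[OF that]])
 have restr: "sec_restrict V s \<in> W V" if "zopen X U" "zopen X V" "V \<subseteq> U" "s \<in> W U" for U V s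
  using conjunct1[OF conjunct2[OF a4[OF that(1)]]] that by simp
 have mult: "sec_times X (sec_fn X U f) s \<in> W U" if "zopen X U" "f \<in> reg X U" "s \<in> W U" for U f s
  using bspec[OF bspec[OF conjunct1[OF a4[OF that(1)]] that(2)] that(3)] .
 have glue: "s \<in> W U" if "zopen X U" "s \<in> Sym X r U"
  "\<And>x. x \<in> U ==> \<exists>V. zopen X V \<and> x \<in> V \<and> V \<subseteq> U \<and> sec_restrict V s \<in> W V" for U s
  using bspec[OF conjunct2[OF conjunct2[OF a4[OF that(1)]]] that(2)] that(3) by simp
 have gen: "\<exists>U \<omega>. x \<in> U \<and> local_generator X W U \<omega>" if "x \<in> points X" for x
  by (rule bspec[OF invs[unfolded invertible_sheaf_def] that])
 obtain P \<omega> where P: "p \<in> P" "local_generator X W P \<omega>" using gen[OF p_point] by (elim exE conjE)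
 note g = local_generatorD[OF P(2)]
 obtain Vp u t Du Dt \<gamma> a b where Vp: "primitive_coords X v p Vp u t Du Dt \<gamma> a b" "p \<in> Vp"
  using primitive_coords_exist[OF p_point] .
 have "\<omega> \<in> Sym X r P" using Sym[OF g(1)] g(2) by blast
 then obtain N e where N: "zopen X N" "p \<in> N" "N \<subseteq> P" "leaves e \<subseteq> reg X N" "homog r e" "sec_restrict N \<omega> = cls N e"
  using P(1) by (rule SymE)
 have Npt: "N \<subseteq> points X" by (rule openin_subset[OF N(1)])
 have wf: "sexp_at X z e" if "z \<in> N" for z by (rule leaves_at[OF N(4,1) that])
 have ti: "GEN z. translation_inv v e z"
 proof -
  interpret primitive_coords X v p Vp u t Du Dt \<gamma> a b by (rule Vp(1))
  have "cls N e \<in> W N" using restr[OF g(1) N(1,3) g(2)] N(6) by simp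
  then have "sec_lie X v (cls N e) \<in> W N" using inv N(1) unfolding invariant_web_def by simp
  moreover have "sec_lie X v (cls N e) = cls N (lie v e)" by (rule sec_lie_cls[OF v Npt wf])
  ultimately have "cls N (lie v e) \<in> W N" by simp
  then obtain f where f: "cls N (lie v e) = sec_times X (sec_fn X N f) (cls N e)" "f \<in> reg X N"
   unfolding g(3)[OF N(1,3)] N(6) by (elim CollectE exE conjE)
  have fz: "f \<in> reg_at X z" if "z \<in> N" for z unfolding reg_at_def using f(2) N(1) that by blast
  have "cls N (lie v e) = cls N (Times (Fn f) e)"
   unfolding f(1) sec_fn_cls by (rule sec_times_cls) (use fz wf in auto)
  then have "sym_eq X p (lie v e) (Times (Fn f) e)" by (rule cls_eqD[OF _ N(2)]) (use fz wf N(2) in auto)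
  then show ?thesis by (rule invariant_form_translation_inv[OF Vp(2) N(5) wf[OF N(2)] fz[OF N(2)]])
 qed
 \<comment> \<open>Every nonempty open set meets the neighbourhood \<open>N\<close> of
   \<open>p\<close>, where a section of \<open>W\<close> is a function times
   \<open>e\<close>.\<close>
 have sub: "W U \<subseteq> vpow r U" if U: "zopen X U" for U
 proof
  fix s assume s: "s \<in> W U"
  then have sS: "s \<in> Sym X r U" using Sym[OF U] by blast
  show "s \<in> vpow r U"
  proof (cases "U = {}")
   case True
   then show ?thesis using vpow_empty sS by simp
  next
   case False
   then have "N \<inter> U ~= {}" using open_Int_nonempty[OF N(1) _ U] N(2) by blast
   then obtain x where x: "x \<in> N \<inter> U" by blast
   have M: "zopen X (N \<inter> U)" "N \<inter> U \<subseteq> P" using N U by auto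
   have "sec_restrict (N \<inter> U) s \<in> W (N \<inter> U)" by (rule restr[OF U M(1) _ s]) simp
   then obtain f where f: "sec_restrict (N \<inter> U) s = sec_times X (sec_fn X (N \<inter> U) f) (sec_restrict (N \<inter> U) \<omega>)" "f \<in> reg X (N \<inter> U)"
    unfolding g(3)[OF M] by (elim CollectE exE conjE)
   have \<omega>: "sec_restrict (N \<inter> U) \<omega> = cls (N \<inter> U) e"
    using restrict_restrict[of "N \<inter> U" N \<omega>] cls_restrict[of "N \<inter> U" N e] N(6) by simp
   have fz: "f \<in> reg_at X z" if "z \<in> N \<inter> U" for z unfolding reg_at_def using f(2) M(1) that by blast
   have eq: "sec_restrict (N \<inter> U) s = cls (N \<inter> U) (Times (Fn f) e)"
    unfolding f(1) \<omega> sec_fn_cls by (rule sec_times_cls) (use fz wf in auto)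
   have l: "leaves (Times (Fn f) e) \<subseteq> reg X (N \<inter> U)" using f(2) N(4) reg_restrict[OF var N(1) M(1)] by auto
   have "GEN z. translation_inv v (Times (Fn f) e) z"
    using ti by eventually_elim (simp add: translation_inv_def)
   from vpow_clsI[OF M(1) l homog_scale[OF N(5)] this] show ?thesis
    unfolding eq[symmetric] by (rule vpow_of_restrict[OF sS M(1) x])
  qed
 qed
 moreover have "vpow r U \<subseteq> W U"
 proof
  fix s assume s: "s \<in> vpow r U"
  show "s \<in> W U"
  proof (rule glue[OF U vpowD(1)[OF s]])
   fix x assume x: "x \<in> U"
   then have xp: "x \<in> points X" using openin_subset[OF U] by blast
   obtain V u t Du Dt \<gamma> a b where V: "primitive_coords X v p V u t Du Dt \<gamma> a b" "x \<in> V"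
    using primitive_coords_exist[OF xp] .
   interpret primitive_coords X v p V u t Du Dt \<gamma> a b by (rule V(1))
   obtain Q \<omega>' where Q: "x \<in> Q" "local_generator X W Q \<omega>'" using gen[OF xp] by (elim exE conjE)
   note h = local_generatorD[OF Q(2)]
   define M where "M = V \<inter> U \<inter> Q"
   have M: "zopen X M" "M \<subseteq> V" "M \<subseteq> U" "M \<subseteq> Q" "x \<in> M" unfolding M_def using V_open U h(1) V(2) x Q(1) by auto
   have wM: "sec_restrict M \<omega>' \<in> W M" by (rule restr[OF h(1) M(1,4) h(2)])
   obtain f where f: "f \<in> reg X M" "sec_restrict M \<omega>' = cls M (Times (Fn f) (spow \<alpha> r))"
    by (rule vpow_\<alpha>_multiple[OF M(1,2) subsetD[OF sub[OF M(1)] wM]])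
   obtain k where k: "k \<in> reg X M" "sec_restrict M s = cls M (Times (Fn k) (spow \<alpha> r))"
    by (rule vpow_\<alpha>_multiple[OF M(1,2) vpow_restrict[OF s M(1,3)]])
   \<comment> \<open>The generator of \<open>W\<close> is f \<alpha>^r and s is k \<alpha>^r, so f s
     is k times the generator and lies in \<open>W\<close>. Once f is a nonzerodivisor,
     torsion-freeness puts s itself into \<open>W\<close>.\<close>
   have "\<not> (\<forall>y\<in>M. f y = 0)"
   proof
    assume 0: "\<forall>y\<in>M. f y = 0"
    have "sec_times X (sec_fn X M (%_. 1)) (sec_restrict M \<omega>') = cls M (Times (Fn (%z. 1 * f z)) (spow \<alpha> r))"
     unfolding f(2) by (rule fn_times_cls_\<alpha>[OF M(1,2) f(1) reg_const[OF var M(1)]])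
    also have "\<dots> = cls M (Fn (%_. 0))"
    proof (rule cls_eqI)
     fix z assume z: "z \<in> M"
     then have zV: "z \<in> V" using M(2) by blast
     interpret z: variety_point X z by (rule variety_point[OF V_points[OF zV]])
     have w: "sexp_at X z (spow \<alpha> r)" by (rule leaves_at[OF leaves_\<alpha>_pow V_open zV])
     have fz: "f \<in> reg_at X z" unfolding reg_at_def using f(1) M(1) z by blast
     have "sym_eq X z (Times (Fn (%z. 1 * f z)) (spow \<alpha> r)) (Times (Fn (%_. 0)) (spow \<alpha> r))"
     proof (intro z.times_congL z.Fn_cong w z.R_const)
      show "\<forall>\<^sub>F y in near X z. 1 * f y = 0" unfolding z.near_iff using M(1) z 0 by (intro exI[of _ M]) simp
     qed (use fz in simp)
     also have "sym_eq X z \<dots> (Fn (%_. 0))" by (rule z.times_zeroL[OF w])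
     finally show "sym_eq X z (Times (Fn (%z. 1 * f z)) (spow \<alpha> r)) (Fn (%_. 0))" .
    qed
    finally have "sec_times X (sec_fn X M (%_. 1)) (sec_restrict M \<omega>') = sec_fn X M (%_. 0)" unfolding sec_fn_cls .
    from h(4)[OF M(1,4) reg_const[OF var M(1)] this M(5)] show False by simp
   qed
   then have fnz: "GEN y. f y ~= 0" using reg_dichotomy[OF M(1) f(1)] by blast
   have "nonzerodivisor X M f" unfolding nonzerodivisor_def
   proof (intro conjI f(1) allI impI ballI)
    fix A q z assume A: "zopen X A \<and> A \<subseteq> M \<and> q \<in> reg X A \<and> (\<forall>x\<in>A. f x * q x = 0)" and z: "z \<in> A"
    have "GEN y. f y * q y = 0" by (rule eventually_genericI[of A z]) (use A z in auto)
    with fnz have "GEN y. q y = 0" by eventually_elim simp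
    then show "q z = 0" using A reg_identity[of A q "%_. 0" z] reg_const[OF var, of A 0] z by simp
   qed
   moreover have "sec_restrict M s \<in> Sym X r M" by (rule Sym_restrict[OF var vpowD(1)[OF s] M(1,3)])
   moreover have "sec_times X (sec_fn X M f) (sec_restrict M s) \<in> W M"
   proof -
    have "sec_times X (sec_fn X M f) (sec_restrict M s) = cls M (Times (Fn (%z. f z * k z)) (spow \<alpha> r))"
     unfolding k(2) by (rule fn_times_cls_\<alpha>[OF M(1,2) k(1) f(1)])
    also have "(%z. f z * k z) = (%z. k z * f z)" by (rule ext) simp
    also have "cls M (Times (Fn (%z. k z * f z)) (spow \<alpha> r)) = sec_times X (sec_fn X M k) (sec_restrict M \<omega>')"
     unfolding f(2) by (rule fn_times_cls_\<alpha>[OF M(1,2) f(1) k(1), symmetric])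
    also have "\<dots> \<in> W M" by (rule mult[OF M(1) k(1) wM])
    finally show ?thesis .
   qed
   ultimately have "sec_restrict M s \<in> W M" using tf M(1) unfolding torsion_free_quotient_def by simp
   then show "\<exists>V. zopen X V \<and> x \<in> V \<and> V \<subseteq> U \<and> sec_restrict V s \<in> W V" using M by (intro exI[of _ M] conjI)
  qed
 qed
 ultimately show ?thesis using U by blast
qed

end

section \<open>Images of rational maps\<close>

lemma polyfun_shift: "F \<in> polyfun n ==> (%z. F (%i. z (i + m))) \<in> polyfun (m + n)"
 by (induction rule: polyfun.induct) (auto simp: plus_fun_def times_fun_def intro: polyfun_rules)

lemma polyfun_last_variable:
 assumes "F \<in> polyfun (Suc m)"
 shows "\<exists>d c. (\<forall>i. c i \<in> polyfun m) \<and> (\<forall>z. F z = (\<Sum>i<d. c i z * z m ^ i))"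
proof -
 have *: "\<exists>c. (\<forall>i. c i \<in> polyfun m) \<and> (\<forall>z. G z = (\<Sum>i<d. c i z * z m ^ i))" if "G \<in> deg_less m d" for G d
  using that
 proof (induction d arbitrary: G)
  case 0
  then have "G = (%_. 0)" by simp
  then show ?case by (intro exI[of _ "%_ _. 0"]) (simp add: polyfun.const)
 next
  case (Suc d)
  obtain g c where g: "g \<in> deg_less m d" "c \<in> polyfun m" "G = (%z. g z + c z * z m ^ d)" using deg_less_SucE[OF Suc.prems] .
  obtain c' where c': "\<forall>i. c' i \<in> polyfun m" "\<forall>z. g z = (\<Sum>i<d. c' i z * z m ^ i)" using Suc.IH[OF g(1)] by (elim exE conjE)
  show ?case by (intro exI[of _ "c'(d := c)"] conjI) (use g c' in auto)
 qed
 show ?thesis using polyfun_Suc[OF assms] by (elim exE) (rule exI, rule *)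
qed

context irreducible_var
begin

lemma ratfun_poly:
 assumes "F \<in> polyfun m" "\<And>i. i < m ==> g i \<in> ratfun X"
 shows "(%x. F (%i. g i x)) \<in> ratfun X"
 using assms by (induction rule: polyfun.induct) (auto simp: plus_fun_def times_fun_def)

lemma ratfun_common_finite:
 fixes m :: nat
 assumes "\<And>i. i < m ==> g i \<in> ratfun X" "zopen X S" "S ~= {}"
 shows "\<exists>W. zopen X W \<and> W ~= {} \<and> W \<subseteq> S \<and> (\<forall>i<m. g i \<in> reg X W)"
 using assms(1)
proof (induction m)
 case (Suc m)
 have "\<exists>W. zopen X W \<and> W ~= {} \<and> W \<subseteq> S \<and> (\<forall>i<m. g i \<in> reg X W)"
  by (rule Suc.IH) (use Suc.prems in simp)
 then obtain W where W: "zopen X W" "W ~= {}" "W \<subseteq> S" "\<forall>i<m. g i \<in> reg X W" by (elim exE conjE)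
 obtain U where U: "zopen X U" "U ~= {}" "g m \<in> reg X U" using Suc.prems[of m] unfolding ratfun_def by auto
 have o: "zopen X (W \<inter> U)" "W \<inter> U ~= {}" using W U open_Int_nonempty by auto
 have "g i \<in> reg X (W \<inter> U)" if "i < Suc m" for i
  using that W(4) U(3) reg_restrict[OF var W(1) o(1)] reg_restrict[OF var U(1) o(1)] by (cases "i = m") auto
 then show ?case using o W(3) by (intro exI[of _ "W \<inter> U"]) auto
qed (use assms in auto)

text \<open>The graph, read in a chart of the
  source, is cut out by a prime ideal to which \<open>extension_lemma\<close> applies.\<close>

theorem image_constructible:
 assumes g: "\<And>i. i < m ==> g i \<in> ratfun X" and S: "zopen X S" "S ~= {}"
 shows "\<exists>b\<in>polyfun m. \<not> (GEN x. b (%i. g i x) = 0) \<and>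
  (\<forall>\<eta>. (\<forall>F\<in>polyfun m. (GEN x. F (%i. g i x) = 0) --> F \<eta> = 0) \<and> b \<eta> ~= 0 -->
    (\<exists>x\<in>S. \<forall>i<m. g i x = \<eta> i))"
proof -
 have "\<exists>W. zopen X W \<and> W ~= {} \<and> W \<subseteq> S \<and> (\<forall>i<m. g i \<in> reg X W)" by (rule ratfun_common_finite[OF g S])
 then obtain W where W: "zopen X W" "W ~= {}" "W \<subseteq> S" "\<forall>i<m. g i \<in> reg X W" by (elim exE conjE)
 then obtain x0 where x0: "x0 \<in> W" by blast
 have "x0 \<in> points X" using x0 openin_subset[OF W(1)] by blast
 then obtain B n \<phi> where B: "chart X B n \<phi>" "x0 \<in> B" using chart_nbhd[OF var] by blast
 note oB = chart_rules(1)[OF B(1)]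
 have oWB: "zopen X (W \<inter> B)" using W(1) oB by auto
 obtain h where h: "h \<in> polyfun n" "h (\<phi> x0) ~= 0" "{y\<in>B. h (\<phi> y) ~= 0} \<subseteq> W \<inter> B"
  using chart_rules(6)[OF B(1) oWB, of x0] x0 B(2) by auto
 \<comment> \<open>The point (g x, \<phi> x) of the graph; the values come first, so that the
   coordinates to be recovered by \<open>extension_lemma\<close> are those of the chart.\<close>
 define \<Theta> where "\<Theta> x = (%i. if i < m then g i x else \<phi> x (i - m))" for x
 define Q where "Q = {F \<in> polyfun (m + n). GEN x. F (\<Theta> x) = 0}"
 have \<Theta>m: "F (\<Theta> x) = F (%i. g i x)" if "F \<in> polyfun m" for F x
  by (rule polyfun_cong[OF that]) (simp add: \<Theta>_def)
 have \<Theta>s: "F (%i. \<Theta> x (i + m)) = F (\<phi> x)" for F and x :: 'a by (simp add: \<Theta>_def)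
 have \<Theta>r: "(%x. F (\<Theta> x)) \<in> ratfun X" if "F \<in> polyfun (m + n)" for F
  using that
 proof (rule ratfun_poly[where g = "%i x. \<Theta> x i"])
  fix i assume i: "i < m + n"
  show "(%x. \<Theta> x i) \<in> ratfun X"
  proof (cases "i < m")
   case False
   have "(%x. \<phi> x (i - m)) \<in> reg X B" by (rule chart_rules(7)[OF B(1) polyfun.coord]) (use False i in simp)
   then show ?thesis using ratfunI[OF oB B(2)] False by (simp add: \<Theta>_def)
  qed (simp add: \<Theta>_def g)
 qed
 have Q: "poly_prime (m + n) Q" unfolding poly_prime_def poly_ideal_def
 proof (intro conjI ballI impI)
  show "Q \<subseteq> polyfun (m + n)" "(%_. 0) \<in> Q" unfolding Q_def by (auto intro: polyfun.const)
  show "(%_. 1) \<notin> Q" unfolding Q_def using generic_not_bot by simp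
  fix f assume f: "f \<in> Q"
  show "(%z. f z + f' z) \<in> Q" if "f' \<in> Q" for f'
   using f that unfolding Q_def by (auto intro: polyfun_add elim: eventually_elim2)
 next
  fix f f' assume f: "f \<in> polyfun (m + n)" "f' \<in> Q"
  then show "(%z. f z * f' z) \<in> Q" unfolding Q_def by (auto intro: polyfun_mult elim: eventually_mono)
 next
  fix f f' assume f: "f \<in> polyfun (m + n)" "f' \<in> polyfun (m + n)" "(%z. f z * f' z) \<in> Q"
  then have "GEN x. f (\<Theta> x) * f' (\<Theta> x) = 0" unfolding Q_def by simp
  then show "f \<in> Q \<or> f' \<in> Q" using rat.ev_mult_zero[OF \<Theta>r[OF f(1)], of "%x. f' (\<Theta> x)"] f(1,2)
   unfolding Q_def mem_Collect_eq by argo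
 qed
 have h': "(%z. h (%i. z (i + m))) \<in> polyfun (m + n)" by (rule polyfun_shift[OF h(1)])
 have "GEN x. h (\<phi> x) ~= 0"
  by (rule eventually_genericI[OF chart_rules(5)[OF B(1) h(1)], of x0]) (use B(2) h(2) in auto)
 then have "\<not> (GEN x. h (\<phi> x) = 0)" by (rule rat.not_ev_zeroI)
 then have hQ: "(%z. h (%i. z (i + m))) \<notin> Q" unfolding Q_def by (simp add: \<Theta>s)
 obtain b where b: "b \<in> polyfun m" "b \<notin> Q" "\<forall>\<eta>. (\<forall>F\<in>Q \<inter> polyfun m. F \<eta> = 0) \<and> b \<eta> ~= 0 -->
   (\<exists>\<eta>'. (\<forall>i<m. \<eta>' i = \<eta> i) \<and> (\<forall>F\<in>Q. F \<eta>' = 0) \<and> h (%i. \<eta>' (i + m)) ~= 0)"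
  using extension_lemma[OF Q le_add1 h' hQ] by (elim bexE conjE)
 show ?thesis
 proof (intro bexI[OF _ b(1)] conjI allI impI)
  show "\<not> (GEN x. b (%i. g i x) = 0)"
   using b(2) subsetD[OF polyfun_mono b(1), of "m + n"] unfolding Q_def by (simp add: \<Theta>m[OF b(1)])
  fix \<eta> assume \<eta>: "(\<forall>F\<in>polyfun m. (GEN x. F (%i. g i x) = 0) --> F \<eta> = 0) \<and> b \<eta> ~= 0"
  have "\<forall>F\<in>Q \<inter> polyfun m. F \<eta> = 0"
  proof
   fix F assume F: "F \<in> Q \<inter> polyfun m"
   then show "F \<eta> = 0" using \<eta> \<Theta>m[of F] unfolding Q_def by simp
  qed
  with b(3) \<eta> obtain \<eta>' where \<eta>': "\<forall>i<m. \<eta>' i = \<eta> i" "\<forall>F\<in>Q. F \<eta>' = 0" "h (%i. \<eta>' (i + m)) ~= 0" by auto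
  define \<zeta> where "\<zeta> = restrict (%i. \<eta>' (i + m)) {..<n}"
  have shift: "F (%i. \<eta>' (i + m)) = F \<zeta>" if "F \<in> polyfun n" for F
   by (rule polyfun_cong[OF that]) (simp add: \<zeta>_def)
  have "\<zeta> \<in> \<phi> ` B"
  proof (rule chart_rules(4)[OF B(1)])
   show "\<zeta> \<in> cspace n" unfolding \<zeta>_def cspace_def by simp
   fix F assume F: "F \<in> polyfun n" "\<And>y. y \<in> B ==> F (\<phi> y) = 0"
   have "GEN x. F (\<phi> x) = 0" by (rule eventually_genericI[OF oB B(2) F(2)])
   then have "(%z. F (%i. z (i + m))) \<in> Q" unfolding Q_def using polyfun_shift[OF F(1)] by (simp add: \<Theta>s)
   then show "F \<zeta> = 0" using bspec[OF \<eta>'(2)] shift[OF F(1)] by force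
  qed
  then obtain x where x: "x \<in> B" "\<zeta> = \<phi> x" by blast
  have xW: "x \<in> W" using x h(3) \<eta>'(3) shift[OF h(1)] by auto
  have "g i x = \<eta> i" if i: "i < m" for i
  proof -
   have "g i \<in> reg_at X x" unfolding reg_at_def using W(1,4) xW i by blast
   then obtain a c N where N: "a \<in> polyfun n" "c \<in> polyfun n" "zopen X N" "x \<in> N" "N \<subseteq> B"
    "\<forall>y\<in>N. c (\<phi> y) ~= 0 \<and> g i y = a (\<phi> y) / c (\<phi> y)" by (rule reg_at_fraction[OF var B(1) x(1)])
   \<comment> \<open>With g_i = a / c near \<open>x\<close>, the relation c g_i - a = 0 holds on the
     graph, so it holds at the extended point and returns the prescribed value.\<close>
   let ?F = "%z. c (%i. z (i + m)) * z i - a (%i. z (i + m))"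
   have "GEN y. c (\<phi> y) * g i y - a (\<phi> y) = 0"
    by (rule eventually_genericI[OF N(3,4)]) (use N(6) in simp)
   then have "?F \<in> Q" unfolding Q_def
    using i by (intro CollectI conjI polyfun_diff polyfun_mult polyfun_shift N polyfun.coord) (simp_all add: \<Theta>s, simp add: \<Theta>_def)
   from bspec[OF \<eta>'(2) this] show ?thesis
    using shift[OF N(1)] shift[OF N(2)] N(4,6) x(2) \<eta>'(1) i by (simp add: field_simps)
  qed
  then show "\<exists>x\<in>S. \<forall>i<m. g i x = \<eta> i" using xW W(3) by blast
 qed
qed

end

section \<open>Derivations of function fields\<close>

text \<open>A function that equals none of the finitely many roots of q generically differs
  generically from all of them.\<close>

lemma (in generic_field) root_const:
 assumes f: "f \<in> R" and q: "q ~= 0" "GEN x. poly q (f x) = 0"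
 shows "\<exists>k. GEN x. f x = k"
proof (rule ccontr)
 assume no: "\<nexists>k. GEN x. f x = k"
 have "GEN x. f x ~= k" for k
  using dichotomy[OF diff_R[OF f const_R[of k]]] no by auto
 then have "GEN x. \<forall>k\<in>{k. poly q k = 0}. f x ~= k"
  by (intro eventually_ball_finite poly_roots_finite q(1)) simp
 with q(2) have "GEN x. False" by eventually_elim auto
 then show False using G_ne_bot by simp
qed

text \<open>The rules are only generic because \<open>D\<close> acts on representatives with
  arbitrary values outside their domain.\<close>

locale gderiv = generic_field G R for G :: "'a filter" and R +
 fixes D :: "('a => complex) => 'a => complex"
 assumes D_R [intro]: "f \<in> R ==> D f \<in> R"
  and D_add: "f \<in> R ==> g \<in> R ==> \<forall>\<^sub>F x in G. D (%x. f x + g x) x = D f x + D g x"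
  and D_mult: "f \<in> R ==> g \<in> R ==> \<forall>\<^sub>F x in G. D (%x. f x * g x) x = f x * D g x + g x * D f x"
  and D_cong: "f \<in> R ==> g \<in> R ==> \<forall>\<^sub>F x in G. f x = g x ==> \<forall>\<^sub>F x in G. D f x = D g x"
  and D_const: "\<forall>\<^sub>F x in G. D (%_. c) x = 0"
begin

lemma D_zero:
 assumes "f \<in> R" "GEN x. f x = 0" shows "GEN x. D f x = 0"
 using D_cong[OF assms(1) const_R assms(2)] D_const[of 0] by eventually_elim simp

lemma D_scale:
 assumes "f \<in> R" shows "GEN x. D (%x. c * f x) x = c * D f x"
 using D_mult[OF const_R assms, of c] D_const[of c] by eventually_elim simp

lemma D_diff:
 assumes "f \<in> R" "g \<in> R" shows "GEN x. D (%x. f x - g x) x = D f x - D g x"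
 using D_add[OF assms(1) mult_R[OF const_R assms(2)], of "-1"] D_scale[OF assms(2), of "-1"]
 by eventually_elim simp

lemma D_power: "f \<in> R ==> GEN x. D (%x. f x ^ n) x = of_nat n * f x ^ (n - 1) * D f x"
proof (induction n)
 case 0
 show ?case using D_const[of 1] by simp
next
 case (Suc n)
 from D_mult[OF Suc.prems power_R[OF Suc.prems, of n]] Suc.IH[OF Suc.prems] show ?case
  by eventually_elim (cases n; simp add: algebra_simps)
qed

end

subsection \<open>Dual numbers\<close>

text \<open>The graph of a derivation is a subring of the dual numbers; it need not be defined everywhere.\<close>

context generic_field
begin

text \<open>A pair (g, g') stands for g + \<epsilon> g' with \<epsilon>^2 = 0. The last condition
  makes g' depend on g alone, generically, so that \<open>S\<close> is the graph of a
  derivation.\<close>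

definition dual_ring :: "(('a => complex) \<times> ('a => complex)) set => bool" where
 "dual_ring S \<longleftrightarrow> (\<forall>c. (%_. c, %_. 0) \<in> S) \<and>
   (\<forall>g g' h h'. (g, g') \<in> S --> (h, h') \<in> S -->
    (%x. g x + h x, %x. g' x + h' x) \<in> S \<and> (%x. g x * h x, %x. g x * h' x + h x * g' x) \<in> S) \<and>
   (\<forall>g g'. (g, g') \<in> S --> (GEN x. g x = 0) --> (GEN x. g' x = 0))"

context
 fixes S assumes S: "dual_ring S"
begin

lemma dual_const: "(%_. c, %_. 0) \<in> S"
 and dual_add: "(g, g') \<in> S ==> (h, h') \<in> S ==> (%x. g x + h x, %x. g' x + h' x) \<in> S"
 and dual_mult: "(g, g') \<in> S ==> (h, h') \<in> S ==> (%x. g x * h x, %x. g x * h' x + h x * g' x) \<in> S"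
 and dual_single: "(g, g') \<in> S ==> GEN x. g x = 0 ==> GEN x. g' x = 0"
 using S unfolding dual_ring_def by simp_all

lemma dual_poly: "(f, e) \<in> S ==> (%x. poly q (f x), %x. poly (pderiv q) (f x) * e x) \<in> S"
proof (induction q)
 case (pCons a q)
 from dual_add[OF dual_const[of a] dual_mult[OF pCons.prems pCons.IH[OF pCons.prems]]]
 show ?case by (simp add: pderiv_pCons algebra_simps)
qed (use dual_const[of 0] in simp)

lemma dual_power: "(s, s') \<in> S ==> (%x. s x ^ n, %x. of_nat n * s x ^ (n - 1) * s' x) \<in> S"
proof (induction n)
 case (Suc n)
 have "(%x. s x * (of_nat n * s x ^ (n - 1) * s' x) + s x ^ n * s' x) = (%x. of_nat (Suc n) * s x ^ (Suc n - 1) * s' x)"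
  by (cases n) (auto simp: algebra_simps)
 with dual_mult[OF Suc.prems Suc.IH[OF Suc.prems]] show ?case by simp
qed (use dual_const[of 1] in simp)

lemma dual_relation:
 assumes "(f, e) \<in> S" "(s, s') \<in> S"
 shows "(%x. \<Sum>j<n. poly (r j) (f x) * s x ^ j,
  %x. (\<Sum>j<n. poly (pderiv (r j)) (f x) * s x ^ j) * e x + (\<Sum>j<n. poly (r j) (f x) * (of_nat j * s x ^ (j - 1))) * s' x) \<in> S"
proof (induction n)
 case (Suc n)
 from dual_add[OF Suc dual_mult[OF dual_poly[OF assms(1), of "r n"] dual_power[OF assms(2), of n]]]
 show ?case by (simp add: algebra_simps)
qed (use dual_const[of 0] in simp)

end

lemma poly_R: "f \<in> R ==> (%x. poly q (f x)) \<in> R"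
 by (induction q) auto

text \<open>On elements algebraic over \<open>\<complex>(f)\<close> any two derivations are proportional.\<close>

lemma dual_rings_proportional:
 assumes S: "dual_ring S" "(f, e) \<in> S" "(s, e') \<in> S" and T: "dual_ring T" "(f, k) \<in> T" "(s, k') \<in> T"
  and R: "f \<in> R" "s \<in> R" and nc: "\<nexists>c. GEN x. f x = c"
  and rel: "\<exists>n r. r n ~= 0 \<and> (GEN x. (\<Sum>j<Suc n. poly (r j) (f x) * s x ^ j) = 0)"
 shows "GEN x. e' x * k x = e x * k' x"
proof -
 let ?P = "%n. \<exists>r. r n ~= 0 \<and> (GEN x. (\<Sum>j<Suc n. poly (r j) (f x) * s x ^ j) = 0)"
 define n where "n = (LEAST n. ?P n)"
 have "?P n" unfolding n_def using rel by (rule LeastI_ex)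
 then obtain r where r: "r n ~= 0" "GEN x. (\<Sum>j<Suc n. poly (r j) (f x) * s x ^ j) = 0" by (elim exE conjE)
 have n0: "n ~= 0"
 proof
  assume "n = 0"
  then have "\<exists>k. GEN x. f x = k" using r by (intro root_const[OF R(1), of "r 0"]) auto
  with nc show False by simp
 qed
 \<comment> \<open>The derivative of the minimal relation with respect to s. If it vanished
   generically, it would be a relation of degree n - 1.\<close>
 let ?y = "%x. \<Sum>j<Suc n. poly (r j) (f x) * (of_nat j * s x ^ (j - 1))"
 have yR: "?y \<in> R" by (intro sum_R mult_R poly_R R const_R power_R)
 have "\<not> (GEN x. ?y x = 0)"
 proof
  assume y0: "GEN x. ?y x = 0"
  have "?y x = (\<Sum>j<Suc (n - 1). poly (smult (of_nat (Suc j)) (r (Suc j))) (f x) * s x ^ j)" for x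
   using n0 by (subst sum.lessThan_Suc_shift) (auto simp: algebra_simps intro!: sum.cong)
  with y0 have "?P (n - 1)" using r(1) n0 by (intro exI[of _ "%j. smult (of_nat (Suc j)) (r (Suc j))"]) auto
  then have "n \<le> n - 1" unfolding n_def by (rule Least_le)
  with n0 show False by simp
 qed
 then have y: "GEN x. ?y x ~= 0" by (rule ev_nonzero[OF yR])
 from dual_single[OF S(1) dual_relation[OF S] r(2)] dual_single[OF T(1) dual_relation[OF T] r(2)] y
 show ?thesis
 proof eventually_elim
  case (elim x)
  let ?x = "\<Sum>j<Suc n. poly (pderiv (r j)) (f x) * s x ^ j"
  \<comment> \<open>Both derivations satisfy the same linear equation x e + y e' = 0, with y
    nonzero.\<close>
  have "?y x * (e' x * k x) = ?y x * (e x * k' x)" using elim(1,2) by algebra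
  then show ?case using elim(3) by (simp only: mult_cancel_left) simp
 qed
qed

end

lemma (in gderiv) dual_ring_D: "dual_ring {(g, g'). g \<in> R \<and> g' \<in> R \<and> (GEN x. g' x = D g x)}"
 unfolding dual_ring_def
proof (intro conjI allI impI)
 fix g g' h h'
 assume "(g, g') \<in> {(g, g'). g \<in> R \<and> g' \<in> R \<and> (GEN x. g' x = D g x)}"
 then have g: "g \<in> R" "g' \<in> R" "GEN x. g' x = D g x" by auto
 show "GEN x. g' x = 0" if "GEN x. g x = 0"
  using g(3) D_zero[OF g(1) that] by eventually_elim simp
 assume "(h, h') \<in> {(g, g'). g \<in> R \<and> g' \<in> R \<and> (GEN x. g' x = D g x)}"
 then have h: "h \<in> R" "h' \<in> R" "GEN x. h' x = D h x" by auto
 have "GEN x. g' x + h' x = D (%x. g x + h x) x" "GEN x. g x * h' x + h x * g' x = D (%x. g x * h x) x"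
  using g(3) h(3) D_add[OF g(1) h(1)] D_mult[OF g(1) h(1)] by (eventually_elim, simp)+
 then show "(%x. g x + h x, %x. g' x + h' x) \<in> {(g, g'). g \<in> R \<and> g' \<in> R \<and> (GEN x. g' x = D g x)}"
  "(%x. g x * h x, %x. g x * h' x + h x * g' x) \<in> {(g, g'). g \<in> R \<and> g' \<in> R \<and> (GEN x. g' x = D g x)}"
  using g h by auto
next
 fix c
 have "GEN x. 0 = D (%_. c) x" using D_const[of c] by eventually_elim simp
 then show "(%_. c, %_. 0) \<in> {(g, g'). g \<in> R \<and> g' \<in> R \<and> (GEN x. g' x = D g x)}" by simp
qed

subsection \<open>Algebraic extensions\<close>

definition pol :: "(nat => 'a => complex) => nat => 'a => complex poly" where
 "pol c n z = (\<Sum>i<n. monom (c i z) i)"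

lemma coeff_pol: "coeff (pol c n z) i = (if i < n then c i z else 0)"
 unfolding pol_def by (simp add: coeff_sum)

lemma poly_pol: "poly (pol c n z) y = (\<Sum>i<n. c i z * y ^ i)"
 unfolding pol_def by (simp add: poly_sum poly_monom)

lemma pol_Suc: "pol c (Suc n) z = pol c n z + monom (c n z) n"
 unfolding pol_def by simp

text \<open>A generically finite dominant map seen through function fields: pullback along \<psi>
  embeds \<open>R\<close> into \<open>R'\<close> compatibly with the derivations, and
  \<open>algebraic\<close> stands for finiteness of the fibres.\<close>

locale alg_ext = gderiv G' R' \<delta>' + base: gderiv G R \<delta>
 for G' :: "'b filter" and R' \<delta>' and G :: "'a filter" and R \<delta> +
 fixes \<psi> :: "'b => 'a"
 assumes lim: "filterlim \<psi> G G'"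
  and pull_R [intro]: "c \<in> R ==> (%x. c (\<psi> x)) \<in> R'"
  and pull_D: "c \<in> R ==> \<forall>\<^sub>F x in G'. \<delta>' (%x. c (\<psi> x)) x = \<delta> c (\<psi> x)"
  and algebraic: "g \<in> R' ==> \<exists>n c. (\<forall>i. c i \<in> R) \<and> (\<exists>i<n. \<not> (\<forall>\<^sub>F z in G. c i z = 0)) \<and>
   (\<forall>\<^sub>F x in G'. poly (pol c n (\<psi> x)) (g x) = 0)"
begin

abbreviation above :: "('b => bool) => bool" (binder "UP " 10) where
 "above P \<equiv> eventually P G'"

abbreviation below :: "('a => bool) => bool" (binder "LOW " 10) where
 "below P \<equiv> eventually P G"

lemma pull: "LOW z. P z ==> UP x. P (\<psi> x)"
 using lim unfolding filterlim_iff by simp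

lemma pol_R:
 assumes "\<forall>i. c i \<in> R" "g \<in> R'"
 shows "(%x. poly (pol c n (\<psi> x)) (g x)) \<in> R'" "(%x. poly (pderiv (pol c n (\<psi> x))) (g x)) \<in> R'"
proof -
 show "(%x. poly (pol c n (\<psi> x)) (g x)) \<in> R'" unfolding poly_pol using assms by (intro sum_R mult_R power_R pull_R) auto
 show "(%x. poly (pderiv (pol c n (\<psi> x))) (g x)) \<in> R'"
  using assms by (induction n) (auto simp: pol_def pderiv_add pderiv_monom poly_monom intro!: add_R mult_R power_R)
qed

lemma D_pol:
 assumes c: "\<forall>i. c i \<in> R" and g: "g \<in> R'"
 shows "UP x. \<delta>' (%x. poly (pol c n (\<psi> x)) (g x)) x =
  poly (pol (%i. \<delta> (c i)) n (\<psi> x)) (g x) + poly (pderiv (pol c n (\<psi> x))) (g x) * \<delta>' g x"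
proof (induction n)
 case 0
 show ?case using D_const[of 0] by (simp add: pol_def)
next
 case (Suc n)
 have cR: "(%x. c n (\<psi> x)) \<in> R'" using c by auto
 note r = pol_R(1)[OF c g, of n] cR power_R[OF g, of n]
 from Suc D_add[OF r(1) mult_R[OF r(2,3)]] D_mult[OF r(2,3)] pull_D[OF spec[OF c, of n]] D_power[OF g, of n]
 show ?case by eventually_elim (simp add: pol_Suc poly_monom pderiv_add pderiv_monom algebra_simps)
qed

text \<open>Minimality is stated as linear independence of 1, g, ..., g^(d-1) over the base field,
  the form in which it is applied: a relation of degree below d has zero coefficients.\<close>

definition minpoly :: "('b => complex) => nat => (nat => 'a => complex) => bool" where
 "minpoly g d a \<longleftrightarrow> (\<forall>i. a i \<in> R) \<and> a d = (%_. 1) \<and> (UP x. poly (pol a (Suc d) (\<psi> x)) (g x) = 0) \<and>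
   (\<forall>c. (\<forall>i. c i \<in> R) --> (UP x. poly (pol c d (\<psi> x)) (g x) = 0) --> (\<forall>i<d. LOW z. c i z = 0))"

lemma minpolyD:
 assumes "minpoly g d a"
 shows "\<forall>i. a i \<in> R" "a d = (%_. 1)" "UP x. poly (pol a (Suc d) (\<psi> x)) (g x) = 0"
  "\<forall>i. c i \<in> R ==> UP x. poly (pol c d (\<psi> x)) (g x) = 0 ==> i < d ==> LOW z. c i z = 0"
 using assms unfolding minpoly_def by simp_all

lemma minpoly_pos:
 assumes "minpoly g d a" shows "d ~= 0"
proof
 assume "d = 0"
 with minpolyD(2,3)[OF assms] have "UP x. False" by (simp add: pol_def)
 then show False using G_ne_bot by simp
qed

lemma minpoly_exists:
 assumes g: "g \<in> R'"
 shows "\<exists>d a. minpoly g d a"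
proof -
 let ?P = "%n. \<exists>c. (\<forall>i. c i \<in> R) \<and> (\<exists>i<n. \<not> (LOW z. c i z = 0)) \<and> (UP x. poly (pol c n (\<psi> x)) (g x) = 0)"
 define n where "n = (LEAST n. ?P n)"
 have "?P n" unfolding n_def using algebraic[OF g] by (rule LeastI_ex)
 then obtain c where c': "(\<forall>i. c i \<in> R) \<and> (\<exists>i<n. \<not> (LOW z. c i z = 0)) \<and> (UP x. poly (pol c n (\<psi> x)) (g x) = 0)"
  by (rule exE)
 note c = conjunct1[OF c'] conjunct1[OF conjunct2[OF c']] conjunct2[OF conjunct2[OF c']]
 have "n ~= 0" using c(2) by (intro notI) simp
 then obtain d where d: "n = Suc d" by (cases n) simp_all
 have min: "LOW z. b i z = 0" if "\<forall>i. b i \<in> R" "UP x. poly (pol b d (\<psi> x)) (g x) = 0" "i < d" for b i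
 proof (rule ccontr)
  assume "\<not> (LOW z. b i z = 0)"
  then have "?P d" using that by (intro exI[of _ b] conjI exI[of _ i])
  then have "n \<le> d" unfolding n_def by (rule Least_le)
  then show False using d by simp
 qed
 have lead: "\<not> (LOW z. c d z = 0)"
 proof
  assume 0: "LOW z. c d z = 0"
  from c(3) pull[OF 0] have "UP x. poly (pol c d (\<psi> x)) (g x) = 0"
   by eventually_elim (simp add: d pol_Suc poly_monom)
  from min[OF c(1) this] 0 have "\<forall>i<n. LOW z. c i z = 0" unfolding d by (simp add: less_Suc_eq)
  then show False using c(2) by (elim exE conjE notE) (drule spec, drule mp, assumption+)
 qed
 define a where "a i = (if i = d then %_. 1 else (%z. inverse (c d z) * c i z))" for i
 have aR: "\<forall>i. a i \<in> R" unfolding a_def using c(1) by (simp add: base.mult_R base.inverse_K)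
 have "UP x. poly (pol a (Suc d) (\<psi> x)) (g x) = 0"
  using c(3) pull[OF base.ev_nonzero[OF spec[OF c(1)] lead]]
 proof eventually_elim
  case (elim x)
  have "pol a (Suc d) (\<psi> x) = smult (inverse (c d (\<psi> x))) (pol c n (\<psi> x))"
   using elim(2) by (intro poly_eqI) (simp add: coeff_pol a_def d)
  then show ?case using elim(1) by simp
 qed
 then have "minpoly g d a" unfolding minpoly_def using aR min by (simp add: a_def)
 then show ?thesis by (intro exI)
qed

text \<open>Differentiating the minimal equation of g lowers its degree, as the leading coefficient
  is 1 and \<delta>' g = 0. So all coefficients are first integrals of the base, hence constants,
  and g is a root of a polynomial over \<complex>.\<close>

theorem const_of_D_zero:
 assumes fi: "\<And>c. c \<in> R ==> LOW z. \<delta> c z = 0 ==> \<exists>k. LOW z. c z = k"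
  and g: "g \<in> R'" "UP x. \<delta>' g x = 0"
 shows "\<exists>k. UP x. g x = k"
proof -
 obtain d a where da: "minpoly g d a" using minpoly_exists[OF g(1)] by (elim exE)
 note m = minpolyD[OF da]
 have aR: "\<forall>i. \<delta> (a i) \<in> R" using m(1) by auto
 from D_pol[OF m(1) g(1), of "Suc d"] D_zero[OF pol_R(1)[OF m(1) g(1)] m(3)] g(2) pull[OF base.D_const[of 1]]
 have "UP x. poly (pol (%i. \<delta> (a i)) d (\<psi> x)) (g x) = 0"
  by eventually_elim (simp add: pol_Suc m(2) poly_monom)
 then have "LOW z. \<delta> (a i) z = 0" if "i < d" for i by (rule m(4)[OF aR _ that])
 then have "\<forall>i. \<exists>k. i < d --> (LOW z. a i z = k)" using fi[OF spec[OF m(1)]] by auto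
 from choice[OF this] obtain k where k: "\<forall>i. i < d --> (LOW z. a i z = k i)" by (elim exE)
 define k' where "k' i = (%_::'a. if i = d then 1 else k i)" for i
 define q where "q = pol k' (Suc d) undefined"
 have "coeff q d ~= 0" unfolding q_def coeff_pol by (simp add: k'_def)
 then have q: "q ~= 0" by auto
 have "LOW z. \<forall>i\<in>{..<d}. a i z = k i" using k by (intro eventually_ball_finite) auto
 from pull[OF this] m(3) have "UP x. poly q (g x) = 0"
 proof eventually_elim
  case (elim x)
  have "pol a (Suc d) (\<psi> x) = q" using elim(1) m(2) unfolding q_def by (intro poly_eqI) (auto simp: coeff_pol k'_def)
  with elim(2) show ?case by simp
 qed
 then show ?thesis by (rule root_const[OF g(1) q])
qed

text \<open>The equation is affine over the base field, so the mean of the conjugates of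
  \<open>A\<close> solves it as well. With d the degree and a_(d-1) the second coefficient of the
  minimal polynomial, this mean is - a_(d-1) / d.\<close>

theorem average_solution:
 assumes A: "A \<in> R'" and mn: "\<mu> \<in> R" "\<nu> \<in> R" and eq: "UP x. \<delta>' A x = \<mu> (\<psi> x) * A x + \<nu> (\<psi> x)"
 shows "\<exists>A0\<in>R. LOW z. \<delta> A0 z = \<mu> z * A0 z + \<nu> z"
proof -
 obtain d a where da: "minpoly A d a" using minpoly_exists[OF A] by (elim exE)
 note m = minpolyD[OF da]
 obtain e where e: "d = Suc e" using minpoly_pos[OF da] by (cases d) auto
 \<comment> \<open>Coefficients of \<delta>(P) + P' (\<mu> T + \<nu>) - d \<mu> P, with P the
   minimal polynomial in T and \<delta> acting on coefficients. The last term removes degree d, so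
   by minimality all coefficients vanish; the one of degree d - 1 is the desired equation.\<close>
 define r where "r i z = \<delta> (a i) z + of_nat i * \<mu> z * a i z + of_nat (Suc i) * \<nu> z * a (Suc i) z - of_nat d * \<mu> z * a i z" for i z
 have aR: "a i \<in> R" for i using m(1) by simp
 have rR: "\<forall>i. r i \<in> R" unfolding r_def using aR mn
  by (intro allI base.add_R base.diff_R base.mult_R base.const_R base.D_R)
 from D_pol[OF m(1) A, of "Suc d"] D_zero[OF pol_R(1)[OF m(1) A] m(3)] eq m(3) pull[OF base.D_const[of 1]]
 have "UP x. poly (pol r d (\<psi> x)) (A x) = 0"
 proof eventually_elim
  case (elim x)
  let ?P = "pol a (Suc d) (\<psi> x)"
  have "pol r d (\<psi> x) = pol (%i. \<delta> (a i)) (Suc d) (\<psi> x) + pderiv ?P * [:\<nu> (\<psi> x), \<mu> (\<psi> x):] - smult (of_nat d * \<mu> (\<psi> x)) ?P"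
  proof (rule poly_eqI)
   fix i
   have c: "coeff (pderiv ?P * [:\<nu> (\<psi> x), \<mu> (\<psi> x):]) i =
    of_nat (Suc i) * \<nu> (\<psi> x) * coeff ?P (Suc i) + of_nat i * \<mu> (\<psi> x) * coeff ?P i"
    by (cases i) (simp_all add: coeff_pderiv del: of_nat_Suc)
   consider "i < d" | "i = d" | "i > d" by linarith
   then show "coeff (pol r d (\<psi> x)) i =
    coeff (pol (%i. \<delta> (a i)) (Suc d) (\<psi> x) + pderiv ?P * [:\<nu> (\<psi> x), \<mu> (\<psi> x):] - smult (of_nat d * \<mu> (\<psi> x)) ?P) i"
    unfolding coeff_add coeff_diff coeff_smult c using elim(5) m(2) by cases (simp_all add: coeff_pol r_def del: of_nat_Suc)
  qed
  then have "poly (pol r d (\<psi> x)) (A x) = poly (pol (%i. \<delta> (a i)) (Suc d) (\<psi> x)) (A x) +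
   poly (pderiv ?P) (A x) * poly [:\<nu> (\<psi> x), \<mu> (\<psi> x):] (A x) - of_nat d * \<mu> (\<psi> x) * poly ?P (A x)"
   by (simp only: poly_add poly_diff poly_mult poly_smult)
  then show ?case using elim(1-4) by (simp add: ac_simps)
 qed
 from m(4)[OF rR this, of e, unfolded e, OF lessI] base.D_scale[OF aR, of "- 1 / of_nat d" e]
 have "LOW z. \<delta> (%z. - 1 / of_nat d * a e z) z = \<mu> z * (- 1 / of_nat d * a e z) + \<nu> z"
 proof eventually_elim
  case (elim z)
  have "\<delta> (a e) z = \<mu> z * a e z - of_nat d * \<nu> z"
   using elim(1) m(2) by (simp add: r_def e algebra_simps)
  then show ?case unfolding elim(2) using e by (simp add: divide_simps del: of_nat_Suc)
 qed
 then show ?thesis using aR by (intro bexI[of _ "%z. - 1 / of_nat d * a e z"] base.mult_R base.const_R)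
qed

end

text \<open>Extension of a derivation by the quotient rule. It is needed for \<delta>' f, which lies
  in the ring of polynomial expressions in f only after multiplication with the derivative of the
  minimal polynomial.\<close>

lemma (in generic_field) dual_ring_fractions:
 assumes S: "dual_ring S"
 shows "dual_ring {(g, g'). \<exists>b b'. (b, b') \<in> S \<and> b \<in> R \<and> (GEN x. b x ~= 0) \<and>
  (%x. b x * g x, %x. b x * g' x + b' x * g x) \<in> S}" (is "dual_ring ?F")
 unfolding dual_ring_def
proof (intro conjI allI impI)
 note ops = dual_const[OF S] dual_add[OF S] dual_mult[OF S]
 have FI: "(g, g') \<in> ?F" if "(b, b') \<in> S" "b \<in> R" "GEN x. b x ~= 0"
  "(%x. b x * g x, %x. b x * g' x + b' x * g x) \<in> S" for g g' b b'
  by (rule CollectI, rule case_prodI, intro exI[of _ b] exI[of _ b'] conjI that)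
 show "(%_. c, %_. 0) \<in> ?F" for c
  using ops(1)[of c] by (intro FI[OF ops(1)[of 1]]) simp_all
 fix g g' h h' assume "(g, g') \<in> ?F"
 then obtain b b' where b: "(b, b') \<in> S" "b \<in> R" "GEN x. b x ~= 0" "(%x. b x * g x, %x. b x * g' x + b' x * g x) \<in> S"
  by (elim CollectE case_prodE exE conjE) simp
 show "GEN x. g' x = 0" if g0: "GEN x. g x = 0"
 proof -
  have "GEN x. b x * g x = 0" using g0 by eventually_elim simp
  from dual_single[OF S b(4) this] b(3) g0 show ?thesis by eventually_elim simp
 qed
 assume "(h, h') \<in> ?F"
 then obtain c c' where c: "(c, c') \<in> S" "c \<in> R" "GEN x. c x ~= 0" "(%x. c x * h x, %x. c x * h' x + c' x * h x) \<in> S"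
  by (elim CollectE case_prodE exE conjE) simp
 have nz: "GEN x. b x * c x ~= 0" using b(3) c(3) by eventually_elim simp
 note bc = ops(3)[OF b(1) c(1)] mult_R[OF b(2) c(2)] nz
 show "(%x. g x + h x, %x. g' x + h' x) \<in> ?F"
  by (rule FI[OF bc]) (use ops(2)[OF ops(3)[OF c(1) b(4)] ops(3)[OF b(1) c(4)]] in "simp add: algebra_simps")
 show "(%x. g x * h x, %x. g x * h' x + h x * g' x) \<in> ?F"
  by (rule FI[OF bc]) (use ops(3)[OF b(4) c(4)] in "simp add: algebra_simps")
qed

context alg_ext
begin

lemma pull_pol_cong:
 assumes "\<And>i. i < n ==> LOW z. b i z = c i z"
 shows "UP x. pol b n (\<psi> x) = pol c n (\<psi> x)"
proof -
 have "LOW z. \<forall>i\<in>{..<n}. b i z = c i z" using assms by (intro eventually_ball_finite) auto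
 from pull[OF this] show ?thesis by eventually_elim (rule poly_eqI, simp add: coeff_pol)
qed

text \<open>The extension to \<open>K[f]\<close> of a derivation \<open>D\<close> of the base field \<open>K\<close>, given by \<open>D f = e\<close>.\<close>

context
 fixes D f d a e
 assumes D: "gderiv G R D" and f: "f \<in> R'" and a: "minpoly f d a" and e: "e \<in> R'"
  and De: "UP x. poly (pol (%i. D (a i)) (Suc d) (\<psi> x)) (f x) + poly (pderiv (pol a (Suc d) (\<psi> x))) (f x) * e x = 0"
begin

interpretation D: gderiv G R D by (rule D)

definition val :: "nat => (nat => 'a => complex) => 'b => complex" where
 "val n c x = poly (pol c n (\<psi> x)) (f x)"

definition der :: "nat => (nat => 'a => complex) => 'b => complex" where
 "der n c x = poly (pol (%i. D (c i)) n (\<psi> x)) (f x) + poly (pderiv (pol c n (\<psi> x))) (f x) * e x"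

text \<open>Each element is given by its expression of degree below d in f; uniqueness of the
  coefficients makes the derivative well defined.\<close>

definition simple_ext :: "(('b => complex) \<times> ('b => complex)) set" where
 "simple_ext = {(g, g'). \<exists>c. (\<forall>i. c i \<in> R) \<and> (UP x. g x = val d c x) \<and> (UP x. g' x = der d c x)}"

lemma simple_extI:
 "\<forall>i. c i \<in> R ==> UP x. g x = val d c x ==> UP x. g' x = der d c x ==> (g, g') \<in> simple_ext"
 unfolding simple_ext_def by (rule CollectI, rule case_prodI, rule exI, intro conjI)

lemma simple_extE:
 assumes "(g, g') \<in> simple_ext"
 obtains c where "\<forall>i. c i \<in> R" "UP x. g x = val d c x" "UP x. g' x = der d c x"
 using assms unfolding simple_ext_def by (elim CollectE case_prodE exE conjE) simp

lemma simple_ext_cong: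
 assumes "(g, g') \<in> simple_ext" "UP x. h x = g x" "UP x. h' x = g' x"
 shows "(h, h') \<in> simple_ext"
proof -
 obtain c where c: "\<forall>i. c i \<in> R" "UP x. g x = val d c x" "UP x. g' x = der d c x"
  using simple_extE[OF assms(1)] .
 show ?thesis
  by (rule simple_extI[OF c(1)]) (use c(2) assms(2) in eventually_elim, simp, use c(3) assms(3) in eventually_elim, simp)
qed

lemma simple_ext_pull:
 assumes k: "k \<in> R" shows "(%x. k (\<psi> x), %x. D k (\<psi> x)) \<in> simple_ext"
proof -
 let ?c = "%i::nat. if i = 0 then k else (%_. 0)"
 have p: "pol (%i. if i = 0 then q else (%_. 0)) d z = [:q z:]" for q :: "'a => complex" and z
  using minpoly_pos[OF a] by (intro poly_eqI) (auto simp: coeff_pol coeff_pCons split: nat.split)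
 have "UP x. pol (%i. D (?c i)) d (\<psi> x) = pol (%i. if i = 0 then D k else (%_. 0)) d (\<psi> x)"
  by (rule pull_pol_cong) (use D.D_const[of 0] in simp)
 then have "UP x. D k (\<psi> x) = der d ?c x"
  by eventually_elim (simp add: der_def p pderiv_pCons)
 then show ?thesis using k by (intro simple_extI[of ?c]) (simp_all add: val_def p)
qed

lemma simple_ext_add:
 assumes "(g, g') \<in> simple_ext" "(h, h') \<in> simple_ext"
 shows "(%x. g x + h x, %x. g' x + h' x) \<in> simple_ext"
proof -
 obtain c where c: "\<forall>i. c i \<in> R" "UP x. g x = val d c x" "UP x. g' x = der d c x" using simple_extE[OF assms(1)] .
 obtain b where b: "\<forall>i. b i \<in> R" "UP x. h x = val d b x" "UP x. h' x = der d b x" using simple_extE[OF assms(2)] .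
 let ?q = "%i z. c i z + b i z"
 have p: "pol (%i z. u i z + w i z) d z = pol u d z + pol w d z" for u w and z :: 'a
  by (rule poly_eqI) (simp add: coeff_pol)
 have "UP x. pol (%i. D (?q i)) d (\<psi> x) = pol (%i z. D (c i) z + D (b i) z) d (\<psi> x)"
  by (rule pull_pol_cong) (rule D.D_add[OF spec[OF c(1)] spec[OF b(1)]])
 with c(3) b(3) have "UP x. g' x + h' x = der d ?q x"
  by eventually_elim (simp add: der_def p pderiv_add algebra_simps)
 moreover have "UP x. g x + h x = val d ?q x" using c(2) b(2) by eventually_elim (simp add: val_def p)
 ultimately show ?thesis using c(1) b(1) by (intro simple_extI[of ?q]) (auto intro: base.add_R)
qed

lemma simple_ext_scale:
 assumes k: "k \<in> R" and "(g, g') \<in> simple_ext"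
 shows "(%x. k (\<psi> x) * g x, %x. k (\<psi> x) * g' x + D k (\<psi> x) * g x) \<in> simple_ext"
proof -
 obtain c where c: "\<forall>i. c i \<in> R" "UP x. g x = val d c x" "UP x. g' x = der d c x" using simple_extE[OF assms(2)] .
 let ?q = "%i z. k z * c i z"
 have p: "pol ?q d z = smult (k z) (pol c d z)"
  "pol (%i z. k z * D (c i) z + c i z * D k z) d z = smult (k z) (pol (%i. D (c i)) d z) + smult (D k z) (pol c d z)" for z :: 'a
  by (rule poly_eqI, simp add: coeff_pol)+
 have "UP x. pol (%i. D (?q i)) d (\<psi> x) = pol (%i z. k z * D (c i) z + c i z * D k z) d (\<psi> x)"
  by (rule pull_pol_cong) (rule D.D_mult[OF k spec[OF c(1)]])
 with c(2,3) have "UP x. k (\<psi> x) * g' x + D k (\<psi> x) * g x = der d ?q x"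
  by eventually_elim (simp only: der_def val_def p pderiv_smult poly_smult poly_add, simp add: algebra_simps)
 moreover have "UP x. k (\<psi> x) * g x = val d ?q x" using c(2) by eventually_elim (simp add: val_def p)
 ultimately show ?thesis using c(1) k by (intro simple_extI[of ?q]) (auto intro: base.mult_R)
qed

text \<open>Multiplication by \<open>f\<close>, reduced modulo the minimal polynomial.\<close>

lemma simple_ext_shift:
 assumes "(g, g') \<in> simple_ext"
 shows "(%x. f x * g x, %x. f x * g' x + e x * g x) \<in> simple_ext"
proof -
 obtain c where c: "\<forall>i. c i \<in> R" "UP x. g x = val d c x" "UP x. g' x = der d c x" using simple_extE[OF assms] .
 note m = minpolyD[OF a]
 obtain n where n: "d = Suc n" using minpoly_pos[OF a] by (cases d) auto
 let ?q = "%i z. (if i = 0 then 0 else c (i - 1) z) - c n z * a i z"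
 let ?dq = "%i z. (if i = 0 then 0 else D (c (i - 1)) z) - (c n z * D (a i) z + a i z * D (c n) z)"
 have sR: "(%z. if i = 0 then 0 else c (i - 1) z) \<in> R" for i using c(1) by (cases "i = 0") auto
 have ca: "c n \<in> R" "a i \<in> R" for i using c(1) m(1) by auto
 have qR: "\<forall>i. ?q i \<in> R" using sR ca by (intro allI base.diff_R base.mult_R)
 have p: "pol ?q d z = pCons 0 (pol c d z) - smult (c n z) (pol a (Suc d) z)" for z
  using m(2) by (intro poly_eqI) (auto simp: coeff_pol coeff_pCons n less_Suc_eq split: nat.split)
 have "UP x. pol (%i. D (?q i)) d (\<psi> x) = pol ?dq d (\<psi> x)"
 proof (rule pull_pol_cong)
  fix i
  from D.D_diff[OF sR[of i] base.mult_R[OF ca(1) ca(2)[of i]]] D.D_mult[OF ca(1) ca(2)[of i]] D.D_const[of 0]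
  show "LOW z. D (?q i) z = ?dq i z" by eventually_elim (cases "i = 0"; simp)
 qed
 moreover have "LOW z. pol ?dq d z = pCons 0 (pol (%i. D (c i)) d z) - smult (c n z) (pol (%i. D (a i)) (Suc d) z) - smult (D (c n) z) (pol a (Suc d) z)"
  using D.D_const[of 1]
 proof eventually_elim
  case (elim z)
  show ?case using m(2) elim by (intro poly_eqI) (auto simp: coeff_pol coeff_pCons n less_Suc_eq split: nat.split)
 qed
 note pull[OF this]
 ultimately have "UP x. f x * g' x + e x * g x = der d ?q x" using c(2,3) De m(3)
 proof eventually_elim
  case (elim x)
  have De': "poly (pol (%i. D (a i)) (Suc d) (\<psi> x)) (f x) = - (poly (pderiv (pol a (Suc d) (\<psi> x))) (f x) * e x)"
   using elim(5) by (simp add: eq_neg_iff_add_eq_0)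
  show ?case using elim(3,4,6) unfolding der_def val_def elim(1,2) p pderiv_diff pderiv_smult pderiv_pCons
   by (simp add: De' algebra_simps)
 qed
 moreover have "UP x. f x * g x = val d ?q x" using c(2) m(3) by eventually_elim (simp add: val_def p)
 ultimately show ?thesis by (intro simple_extI[OF qR])
qed

lemma simple_ext_power: "(g, g') \<in> simple_ext ==>
  (%x. f x ^ n * g x, %x. f x ^ n * g' x + of_nat n * f x ^ (n - 1) * e x * g x) \<in> simple_ext"
proof (induction n)
 case (Suc n)
 have "(%x. f x * (f x ^ n * g' x + of_nat n * f x ^ (n - 1) * e x * g x) + e x * (f x ^ n * g x)) =
  (%x. f x ^ Suc n * g' x + of_nat (Suc n) * f x ^ (Suc n - 1) * e x * g x)"
  by (cases n) (auto simp: algebra_simps)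
 with simple_ext_shift[OF Suc.IH[OF Suc.prems]] show ?case by (simp add: ac_simps)
qed simp

lemma simple_ext_mult_val:
 assumes c: "\<forall>i. c i \<in> R" and g: "(g, g') \<in> simple_ext"
 shows "(%x. val n c x * g x, %x. val n c x * g' x + g x * der n c x) \<in> simple_ext"
proof (induction n)
 case 0
 have "(%_. 0, %_. 0) \<in> simple_ext"
  by (rule simple_ext_cong[OF simple_ext_pull[OF base.const_R[of 0]]]) (use pull[OF D.D_const[of 0]] in "auto elim: eventually_mono")
 then show ?case by (simp add: val_def der_def pol_def)
next
 case (Suc n)
 from simple_ext_add[OF Suc simple_ext_scale[OF spec[OF c] simple_ext_power[OF g], of n n]]
 show ?case by (rule simple_ext_cong)
  (simp_all add: val_def der_def pol_Suc poly_monom pderiv_add pderiv_monom algebra_simps)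
qed

lemma simple_ext_val:
 assumes "\<forall>i. c i \<in> R" shows "(val n c, der n c) \<in> simple_ext"
proof (rule simple_ext_cong[OF simple_ext_mult_val[OF assms simple_ext_pull[OF base.const_R[of 1]]]])
 show "UP x. der n c x = val n c x * D (%_. 1) (\<psi> x) + 1 * der n c x"
  using pull[OF D.D_const[of 1]] by eventually_elim simp
qed simp

lemma dual_ring_simple_ext: "dual_ring simple_ext"
 unfolding dual_ring_def
proof (intro conjI allI impI)
 show "(%_. k, %_. 0) \<in> simple_ext" for k
  by (rule simple_ext_cong[OF simple_ext_pull[OF base.const_R[of k]]]) (simp, use pull[OF D.D_const[of k]] in eventually_elim, simp)
 fix g g' h h' assume g: "(g, g') \<in> simple_ext"
 obtain c where c: "\<forall>i. c i \<in> R" "UP x. g x = val d c x" "UP x. g' x = der d c x" using simple_extE[OF g] .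
 show "UP x. g' x = 0" if g0: "UP x. g x = 0"
 proof -
  have "UP x. poly (pol c d (\<psi> x)) (f x) = 0" using g0 c(2) by eventually_elim (simp add: val_def)
  then have z: "LOW z. c i z = 0" if "i < d" for i by (rule minpolyD(4)[OF a c(1) _ that])
  have "UP x. pol c d (\<psi> x) = pol (%_ _. 0) d (\<psi> x)" by (rule pull_pol_cong[OF z])
  moreover have "UP x. pol (%i. D (c i)) d (\<psi> x) = pol (%_ _. 0) d (\<psi> x)"
   by (rule pull_pol_cong[OF D.D_zero[OF spec[OF c(1)] z]])
  ultimately show ?thesis using c(3) by eventually_elim (simp add: der_def pol_def)
 qed
 assume h: "(h, h') \<in> simple_ext"
 show "(%x. g x + h x, %x. g' x + h' x) \<in> simple_ext" by (rule simple_ext_add[OF g h])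
 show "(%x. g x * h x, %x. g x * h' x + h x * g' x) \<in> simple_ext"
  by (rule simple_ext_cong[OF simple_ext_mult_val[OF c(1) h, of d]])
   (use c(2) in eventually_elim, simp, use c(2,3) in eventually_elim, simp)
qed

lemma simple_ext_generator: "(f, e) \<in> simple_ext"
 by (rule simple_ext_cong[OF simple_ext_shift[OF simple_ext_pull[OF base.const_R[of 1]]]])
  (simp, use pull[OF D.D_const[of 1]] in eventually_elim, simp)

end

end

context alg_ext
begin

lemma pderiv_pol: "pderiv (pol c (Suc n) z) = pol (%i z. of_nat (Suc i) * c (Suc i) z) n z"
 by (rule poly_eqI) (simp add: coeff_pderiv coeff_pol del: of_nat_Suc)

text \<open>Here \<open>A = D1 f / \<delta>' f\<close>; in the application \<open>A du + B dt\<close> is the form \<open>df / \<delta>' f\<close>,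
  the pullback of the invariant form of a curve.\<close>

theorem vertical_component:
 assumes d1: "gderiv G R D1" and d2: "gderiv G R D2"
  and a12: "a1 \<in> R" "a2 \<in> R" "\<not> (LOW z. a2 z = 0)"
  and split: "\<And>c. c \<in> R ==> LOW z. \<delta> c z = a1 z * D1 c z + a2 z * D2 c z"
  and comm: "\<And>c. c \<in> R ==> LOW z. \<delta> (D1 c) z = D1 (\<delta> c) z - D1 a1 z * D1 c z - D1 a2 z * D2 c z"
  and f: "f \<in> R'" and s: "s \<in> R'" "UP x. \<delta>' f x = s x" "\<not> (UP x. s x = 0)"
  and rel: "\<exists>n r. r n ~= 0 \<and> (UP x. (\<Sum>j<Suc n. poly (r j) (f x) * s x ^ j) = 0)"
 shows "\<exists>A0\<in>R. LOW z. \<delta> A0 z = - D1 a1 z * A0 z - D1 a2 z * ((1 - a1 z * A0 z) / a2 z)"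
proof -
 interpret D1: gderiv G R D1 by (rule d1)
 interpret D2: gderiv G R D2 by (rule d2)
 obtain d a where da: "minpoly f d a" using minpoly_exists[OF f] by (elim exE)
 note m = minpolyD[OF da]
 have aR: "a i \<in> R" for i using m(1) by simp
 obtain n where n: "d = Suc n" using minpoly_pos[OF da] by (cases d) auto
 define b where "b i z = of_nat (Suc i) * a (Suc i) z" for i z
 have bR: "\<forall>i. b i \<in> R" unfolding b_def using aR by (intro allI base.mult_R base.const_R)
 have pb: "pderiv (pol a (Suc d) z) = pol b d z" for z unfolding pderiv_pol b_def ..
 \<comment> \<open>The derivative of the minimal polynomial at f, nonzero by minimality. Implicit
   differentiation then determines \<open>e1\<close> and \<open>e2\<close> as D1 f and D2 f.\<close>
 define \<beta> where "\<beta> x = poly (pol b d (\<psi> x)) (f x)" for x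
 have \<beta>R: "\<beta> \<in> R'" unfolding \<beta>_def by (rule pol_R(1)[OF bR f])
 have \<beta>: "UP x. \<beta> x ~= 0"
 proof (rule ev_nonzero[OF \<beta>R], rule notI)
  assume "UP x. \<beta> x = 0"
  then have "LOW z. b n z = 0" unfolding \<beta>_def by (rule m(4)[OF bR]) (simp add: n)
  then have "LOW z. False" using m(2) by (simp add: b_def n del: of_nat_Suc)
  then show False using base.G_ne_bot by simp
 qed
 define P where "P c x = poly (pol c (Suc d) (\<psi> x)) (f x)" for c x
 define e1 where "e1 x = - P (%i. D1 (a i)) x * inverse (\<beta> x)" for x
 define e2 where "e2 x = - P (%i. D2 (a i)) x * inverse (\<beta> x)" for x
 have DaR: "\<forall>i. D1 (a i) \<in> R" "\<forall>i. D2 (a i) \<in> R" "\<forall>i. \<delta> (a i) \<in> R" using aR by auto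
 have eR: "e1 \<in> R'" "e2 \<in> R'" unfolding e1_def e2_def P_def
  by (intro mult_R minus_R inverse_K \<beta>R pol_R(1) DaR f)+
 have q: "UP x. P (%i. D1 (a i)) x = - (\<beta> x * e1 x)" "UP x. P (%i. D2 (a i)) x = - (\<beta> x * e2 x)"
  using \<beta> unfolding e1_def e2_def by (eventually_elim, simp)+
 have De: "UP x. poly (pol (%i. D1 (a i)) (Suc d) (\<psi> x)) (f x) + poly (pderiv (pol a (Suc d) (\<psi> x))) (f x) * e1 x = 0"
  using q(1) by eventually_elim (simp add: P_def pb \<beta>_def)
 have sP: "UP x. P (%i. \<delta> (a i)) x = - (\<beta> x * s x)"
  using D_pol[OF m(1) f, of "Suc d"] D_zero[OF pol_R(1)[OF m(1) f] m(3)] s(2)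
  by eventually_elim (simp add: P_def pb \<beta>_def eq_neg_iff_add_eq_0)
 have l: "UP x. pol (%i. \<delta> (a i)) (Suc d) (\<psi> x) = pol (%i z. a1 z * D1 (a i) z + a2 z * D2 (a i) z) (Suc d) (\<psi> x)"
  by (rule pull_pol_cong[OF split[OF aR]])
 have p: "pol (%i z. a1 z * D1 (a i) z + a2 z * D2 (a i) z) k z = smult (a1 z) (pol (%i. D1 (a i)) k z) + smult (a2 z) (pol (%i. D2 (a i)) k z)" for k z
  by (rule poly_eqI) (simp add: coeff_pol)
 from l have "UP x. P (%i. \<delta> (a i)) x = a1 (\<psi> x) * P (%i. D1 (a i)) x + a2 (\<psi> x) * P (%i. D2 (a i)) x"
  by eventually_elim (simp add: P_def p)
 from this sP q \<beta> have se: "UP x. s x = a1 (\<psi> x) * e1 x + a2 (\<psi> x) * e2 x"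
 proof eventually_elim
  case (elim x)
  then have "\<beta> x * s x = \<beta> x * (a1 (\<psi> x) * e1 x + a2 (\<psi> x) * e2 x)" by algebra
  with elim(5) show ?case by simp
 qed
 have sn: "UP x. s x ~= 0" by (rule ev_nonzero[OF s(1,3)])
 have nc: "\<nexists>k. UP x. f x = k"
 proof
  assume "\<exists>k. UP x. f x = k"
  then obtain k where "UP x. f x = k" by (rule exE)
  from D_cong[OF f const_R this] D_const[of k] s(2) sn have "UP x. False" by eventually_elim simp
  then show False using G_ne_bot by simp
 qed
 note ctx = d1 f da eR(1) De
 define S where "S = simple_ext D1 f d e1"
 note S = dual_ring_simple_ext[OF ctx, folded S_def]
 define W where "W = der D1 f e1 (Suc d) (%i. \<delta> (a i))"
 define \<beta>' where "\<beta>' = der D1 f e1 d b"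
 have val: "val f d b = \<beta>" "val f (Suc d) (%i. \<delta> (a i)) = P (%i. \<delta> (a i))"
  by (auto simp: val_def[OF ctx] \<beta>_def P_def)
 have \<beta>S: "(\<beta>, \<beta>') \<in> S" and WS: "(P (%i. \<delta> (a i)), W) \<in> S"
  using simple_ext_val[OF ctx bR, of d] simple_ext_val[OF ctx DaR(3), of "Suc d"] unfolding val \<beta>'_def W_def S_def by auto
 \<comment> \<open>The value D1 s, obtained by differentiating the relation \<beta> s = - P(\<delta>
   a).\<close>
 define s1 where "s1 x = - (W x + \<beta>' x * s x) * inverse (\<beta> x)" for x
 have bs1: "UP x. \<beta> x * s1 x = - (W x + \<beta>' x * s x)"
  using \<beta> unfolding s1_def by eventually_elim simp
 let ?F = "{(g, g'). \<exists>b b'. (b, b') \<in> S \<and> b \<in> R' \<and> (UP x. b x ~= 0) \<and>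
  (%x. b x * g x, %x. b x * g' x + b' x * g x) \<in> S}"
 have fF: "(f, e1) \<in> ?F"
  using simple_ext_generator[OF ctx, folded S_def] dual_const[OF S, of 1]
  by (intro CollectI case_prodI, rule_tac exI[of _ "%_. 1"], rule_tac exI[of _ "%_. 0"]) simp
 have sF: "(s, s1) \<in> ?F"
 proof (intro CollectI case_prodI, rule exI[of _ \<beta>], rule exI[of _ \<beta>'], intro conjI \<beta>S \<beta>R \<beta>)
  have 1: "(%x. - 1 * P (%i. \<delta> (a i)) x, %x. - 1 * W x + P (%i. \<delta> (a i)) x * 0) \<in> S"
   by (rule dual_mult[OF S dual_const[OF S] WS])
  have 2: "UP x. \<beta> x * s x = - 1 * P (%i. \<delta> (a i)) x" using sP by eventually_elim simp
  have 3: "UP x. \<beta> x * s1 x + \<beta>' x * s x = - 1 * W x + P (%i. \<delta> (a i)) x * 0" using bs1 by eventually_elim simp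
  show "(%x. \<beta> x * s x, %x. \<beta> x * s1 x + \<beta>' x * s x) \<in> S"
   unfolding S_def by (rule simple_ext_cong[OF ctx 1[unfolded S_def] 2 3])
 qed
 have sD: "UP x. s x = \<delta>' f x" using s(2) by eventually_elim simp
 \<comment> \<open>As s is algebraic over \<complex>(f) by \<open>rel\<close>, the derivations D1
   and \<delta>' are proportional on f and s.\<close>
 have pr: "UP x. s1 x * s x = e1 x * \<delta>' s x"
  by (rule dual_rings_proportional[OF dual_ring_fractions[OF S] fF sF dual_ring_D _ _ f s(1) nc rel])
   (use f s(1) sD in auto)
 have pd: "UP x. pol (%i z. of_nat (Suc i) * E (a (Suc i)) z) d (\<psi> x) = pol (%i. E (b i)) d (\<psi> x)" if E: "gderiv G R E" for E
 proof (rule pull_pol_cong)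
  interpret E: gderiv G R E by (rule E)
  fix i show "LOW z. of_nat (Suc i) * E (a (Suc i)) z = E (b i) z"
   using E.D_scale[OF aR, of "of_nat (Suc i)" "Suc i"] unfolding b_def by eventually_elim simp
 qed
 have l': "UP x. pol (%i. \<delta> (D1 (a i))) (Suc d) (\<psi> x) =
   pol (%i z. D1 (\<delta> (a i)) z - D1 a1 z * D1 (a i) z - D1 a2 z * D2 (a i) z) (Suc d) (\<psi> x)"
  by (rule pull_pol_cong[OF comm[OF aR]])
 have p': "pol (%i z. D1 (\<delta> (a i)) z - D1 a1 z * D1 (a i) z - D1 a2 z * D2 (a i) z) k z =
   pol (%i. D1 (\<delta> (a i))) k z - smult (D1 a1 z) (pol (%i. D1 (a i)) k z) - smult (D1 a2 z) (pol (%i. D2 (a i)) k z)" for k z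
  by (rule poly_eqI) (simp add: coeff_pol)
 from l' have X2: "UP x. P (%i. \<delta> (D1 (a i))) x = P (%i. D1 (\<delta> (a i))) x
   - D1 a1 (\<psi> x) * P (%i. D1 (a i)) x - D1 a2 (\<psi> x) * P (%i. D2 (a i)) x"
  by eventually_elim (simp add: P_def p')
 define Z1 where "Z1 x = poly (pol (%i. D1 (b i)) d (\<psi> x)) (f x)" for x
 define Zd where "Zd x = poly (pol (%i. \<delta> (b i)) d (\<psi> x)) (f x)" for x
 define pb where "pb x = poly (pderiv (pol b d (\<psi> x))) (f x)" for x
 have W: "UP x. W x = P (%i. D1 (\<delta> (a i))) x + Zd x * e1 x"
  using pd[OF base.gderiv_axioms] by eventually_elim (simp add: W_def der_def[OF ctx] pderiv_pol P_def Zd_def del: of_nat_Suc)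
 have B': "\<beta>' x = Z1 x + pb x * e1 x" for x by (simp add: \<beta>'_def der_def[OF ctx] Z1_def pb_def)
 have DP: "UP x. \<delta>' (P (%i. D1 (a i))) x = P (%i. \<delta> (D1 (a i))) x + Z1 x * s x"
  using D_pol[OF DaR(1) f, of "Suc d"] pd[OF d1] s(2) unfolding P_def[abs_def]
  by eventually_elim (simp add: pderiv_pol Z1_def del: of_nat_Suc)
 have D\<beta>: "UP x. \<delta>' \<beta> x = Zd x + pb x * s x"
  using D_pol[OF bR f, of d] s(2) unfolding \<beta>_def[abs_def] by eventually_elim (simp add: Zd_def pb_def)
 have PR: "P (%i. D1 (a i)) \<in> R'" unfolding P_def[abs_def] by (rule pol_R(1)[OF DaR(1) f])
 have "UP x. P (%i. D1 (a i)) x + \<beta> x * e1 x = 0" using q(1) by eventually_elim simp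
 from D_zero[OF add_R[OF PR mult_R[OF \<beta>R eR(1)]] this] D_add[OF PR mult_R[OF \<beta>R eR(1)]] D_mult[OF \<beta>R eR(1)]
 have "UP x. \<delta>' (P (%i. D1 (a i))) x + \<beta> x * \<delta>' e1 x + e1 x * \<delta>' \<beta> x = 0"
  by eventually_elim (simp add: add.assoc)
 \<comment> \<open>The bracket relation \<open>comm\<close>, lifted from the coefficients of the
   minimal polynomial to f itself.\<close>
 from this DP D\<beta> X2 W bs1 q \<beta> have De1: "UP x. \<delta>' e1 x = s1 x - D1 a1 (\<psi> x) * e1 x - D1 a2 (\<psi> x) * e2 x"
 proof eventually_elim
  case (elim x)
  have "\<beta> x * \<delta>' e1 x = \<beta> x * (s1 x - D1 a1 (\<psi> x) * e1 x - D1 a2 (\<psi> x) * e2 x)"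
   using elim(1-8) B'[of x] by algebra
  with elim(9) show ?case by simp
 qed
 define A where "A x = e1 x * inverse (s x)" for x
 have AR: "A \<in> R'" unfolding A_def by (intro mult_R inverse_K eR s)
 have e1A: "UP x. e1 x = A x * s x" using sn by eventually_elim (simp add: A_def)
 \<comment> \<open>By \<open>pr\<close>, s1 = A \<delta>' s, so s1 cancels in \<delta>' (e1 / s) and
   there remains \<delta>' A = - D1 a1 A - D1 a2 B with B = e2 / s. By \<open>se\<close>, B = (1 -
   a1 A) / a2; \<mu> and \<nu> collect the coefficients.\<close>
 define \<mu> where "\<mu> z = D1 a2 z * a1 z * inverse (a2 z) - D1 a1 z" for z
 define \<nu> where "\<nu> z = - (D1 a2 z * inverse (a2 z))" for z
 have mn: "\<mu> \<in> R" "\<nu> \<in> R" unfolding \<mu>_def \<nu>_def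
  by (intro base.diff_R base.minus_R base.mult_R base.inverse_K D1.D_R a12(1,2))+
 from D_cong[OF eR(1) mult_R[OF AR s(1)] e1A] D_mult[OF AR s(1)] De1 pr se sn e1A sD pull[OF base.ev_nonzero[OF a12(2,3)]]
 have "UP x. \<delta>' A x = \<mu> (\<psi> x) * A x + \<nu> (\<psi> x)"
 proof eventually_elim
  case (elim x)
  have "s x * \<delta>' A x = - D1 a1 (\<psi> x) * e1 x - D1 a2 (\<psi> x) * e2 x"
  proof -
   have "s x * (s x * \<delta>' A x) = s x * (- D1 a1 (\<psi> x) * e1 x - D1 a2 (\<psi> x) * e2 x)"
    using elim(1-4,7,8) by algebra
   with elim(6) show ?thesis by simp
  qed
  then have "s x * (a2 (\<psi> x) * \<delta>' A x) = s x * (D1 a2 (\<psi> x) * a1 (\<psi> x) * A x - D1 a1 (\<psi> x) * a2 (\<psi> x) * A x - D1 a2 (\<psi> x))"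
   using elim(5,7) by algebra
  with elim(6) have "a2 (\<psi> x) * \<delta>' A x = D1 a2 (\<psi> x) * a1 (\<psi> x) * A x - D1 a1 (\<psi> x) * a2 (\<psi> x) * A x - D1 a2 (\<psi> x)"
   by simp
  with right_inverse[OF elim(9)] show ?case unfolding \<mu>_def \<nu>_def by algebra
 qed
 from average_solution[OF AR mn this] obtain A0 where A0: "A0 \<in> R" "LOW z. \<delta> A0 z = \<mu> z * A0 z + \<nu> z" by (elim bexE)
 from A0(2)
 have "LOW z. \<delta> A0 z = - D1 a1 z * A0 z - D1 a2 z * ((1 - a1 z * A0 z) / a2 z)"
  by eventually_elim (simp add: \<mu>_def \<nu>_def divide_inverse algebra_simps)
 then show ?thesis by (rule bexI[OF _ A0(1)])
qed

end

section \<open>Rational first integrals and invariant forms\<close>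

context irreducible_var
begin

lemma local_derivation:
 assumes V: "zopen X V" "V ~= {}"
  and tan: "\<And>y. y \<in> V ==> D y \<in> tangent_space X y"
  and reg: "\<And>y f. y \<in> V ==> f \<in> reg_at X y ==> deriv_of D f \<in> reg_at X y"
 shows "gderiv (generic X) (ratfun X) (deriv_of D)"
proof
 have pt: "y \<in> points X" if "y \<in> V" for y using openin_subset[OF V(1)] that by blast
 have common: "\<exists>U. zopen X U \<and> U ~= {} \<and> (\<forall>y\<in>U. y \<in> V \<and> f \<in> reg_at X y \<and> g \<in> reg_at X y)"
  if fg: "f \<in> ratfun X" "g \<in> ratfun X" for f g
 proof -
  obtain U where U: "zopen X U" "U ~= {}" "f \<in> reg X U" "g \<in> reg X U" using ratfun_common[OF fg] .
  show ?thesis using open_Int_nonempty[OF U(1,2) V] U V(1) unfolding reg_at_def by (intro exI[of _ "U \<inter> V"]) auto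
 qed
 fix f g assume fg: "f \<in> ratfun X" "g \<in> ratfun X"
 obtain U where U: "zopen X U" "U ~= {}" "\<forall>y\<in>U. y \<in> V \<and> f \<in> reg_at X y \<and> g \<in> reg_at X y"
  using common[OF fg] by (elim exE conjE)
 show "deriv_of D f \<in> ratfun X" using U reg[THEN reg_at_ratfun] by blast
 obtain z where z: "z \<in> U" using U(2) by blast
 have tr: "D y (%x. f x + g x) = D y f + D y g" "D y (%x. f x * g x) = f y * D y g + g y * D y f"
  "near_eq X y f g ==> D y f = D y g" if "y \<in> U" for y
 proof -
  have y: "y \<in> V" "f \<in> reg_at X y" "g \<in> reg_at X y" using U(3) that by auto
  interpret y: variety_point X y using var pt[OF y(1)] by unfold_locales
  show "D y (%x. f x + g x) = D y f + D y g" "D y (%x. f x * g x) = f y * D y g + g y * D y f"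
   "near_eq X y f g ==> D y f = D y g"
   by (rule y.tangent_rules(3,5,2)[OF tan[OF y(1)] y(2,3)]; assumption?)+
 qed
 show "GEN x. deriv_of D (%x. f x + g x) x = deriv_of D f x + deriv_of D g x"
  "GEN x. deriv_of D (%x. f x * g x) x = f x * deriv_of D g x + g x * deriv_of D f x"
  unfolding deriv_of_def by (rule eventually_genericI[OF U(1) z tr(1)], assumption, rule eventually_genericI[OF U(1) z tr(2)])
 assume ev: "GEN x. f x = g x"
 have "D y f = D y g" if "y \<in> U" for y
  using tr(3)[OF that] near_eq_iff[of f y g] U(3) ev that by simp
 then show "GEN x. deriv_of D f x = deriv_of D g x"
  unfolding deriv_of_def by (rule eventually_genericI[OF U(1) z])
next
 fix c
 have "D y (%_. c) = 0" if "y \<in> V" for y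
 proof -
  interpret y: variety_point X y using var that openin_subset[OF V(1)] by unfold_locales auto
  show ?thesis by (rule y.tangent_const[OF tan[OF that]])
 qed
 then show "GEN x. deriv_of D (%_. c) x = 0"
  unfolding eventually_generic deriv_of_def using V by blast
qed

lemma gderiv_field: "vector_field X v ==> gderiv (generic X) (ratfun X) (deriv_of v)"
 by (rule local_derivation[OF openin_topspace points_nonempty]) (auto simp: vector_field_def intro: deriv_of_reg_at)

text \<open>A chart around \<open>x\<close> meets the domain of c, where c is a quotient of
  polynomials in the chart coordinates; these polynomials are regular at \<open>x\<close>.\<close>

lemma ratfun_fraction:
 assumes x: "x \<in> points X" and c: "c \<in> ratfun X"
 obtains a b where "a \<in> reg_at X x" "b \<in> reg_at X x" "GEN y. b y ~= 0 \<and> c y * b y = a y"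
proof -
 obtain B n \<phi> where B: "chart X B n \<phi>" "x \<in> B" using chart_nbhd[OF var x] .
 obtain U where U: "zopen X U" "U ~= {}" "c \<in> reg X U" using c unfolding ratfun_def by auto
 obtain y where y: "y \<in> U" "y \<in> B" using open_Int_nonempty[OF U(1,2) chart_rules(1)[OF B(1)]] B(2) by blast
 have "c \<in> reg_at X y" unfolding reg_at_def using U y by blast
 then obtain a b W where W: "a \<in> polyfun n" "b \<in> polyfun n" "zopen X W" "y \<in> W"
  "\<forall>y\<in>W. b (\<phi> y) ~= 0 \<and> c y = a (\<phi> y) / b (\<phi> y)" by (rule reg_at_fraction[OF var B(1) y(2)])
 show thesis
  by (rule that[OF poly_reg_at[OF var B W(1)] poly_reg_at[OF var B W(2)] eventually_genericI[OF W(3,4)]])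
   (use W(5) in auto)
qed

end

context isolated_surface
begin

sublocale D: gderiv "generic X" "ratfun X" "deriv_of v"
 by (rule gderiv_field[OF v])

lemma local_ring_p:
 obtains u t where "regular_local_ring2 (generic X) (reg_at X p) p u t"
proof -
 obtain V u t Du Dt where V: "surface_coords X V u t Du Dt" "p \<in> V" using coords_exist[OF p_point] by (elim exE conjE)
 show thesis by (rule that[OF surface_coords.regular_local_ring2[OF V]])
qed

text \<open>For c = a' / b' in lowest terms at \<open>p\<close>, \<delta> c = 0 gives \<delta> a' =
  h a' and \<delta> b' = h b' with the same h. So all members of the pencil b' - k a' are invariant,
  and one passing through \<open>p\<close> must be zero.\<close>

theorem first_integral_const:
 assumes c: "c \<in> ratfun X" "GEN z. deriv_of v c z = 0"
 shows "\<exists>k. GEN z. c z = k"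
proof (cases "GEN z. c z = 0")
 case False
 obtain u t where "regular_local_ring2 (generic X) (reg_at X p) p u t" using local_ring_p .
 then interpret L: regular_local_ring2 "generic X" "reg_at X p" p u t .
 obtain a b where ab: "a \<in> reg_at X p" "b \<in> reg_at X p" "GEN y. b y ~= 0 \<and> c y * b y = a y"
  using ratfun_fraction[OF p_point c(1)] .
 have "GEN y. a y ~= 0" using rat.ev_nonzero[OF c(1) False] ab(3) by eventually_elim auto
 then have a0: "\<not> (GEN y. a y = 0)" by (rule rat.not_ev_zeroI)
 obtain g a' b' where d: "g \<in> reg_at X p" "a' \<in> reg_at X p" "b' \<in> reg_at X p"
  "\<not> (GEN y. a' y = 0)" "\<not> (GEN y. g y = 0)"
  "GEN y. a y = g y * a' y" "GEN y. b y = g y * b' y"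
  "\<And>c. c \<in> reg_at X p ==> L.dvdR a' (%y. b' y * c y) ==> L.dvdR a' c"
  by (rule L.coprime_decomposition[OF ab(1) a0 ab(2)]) (rule that)
 note r = c(1) d(2,3)[THEN reg_at_ratfun] and dr = d(2,3)[THEN deriv_of_reg_at[OF v]]
 from ab(3) d(6,7) have cb: "GEN y. a' y = c y * b' y" by eventually_elim auto
 have db: "GEN y. b' y * deriv_of v a' y = a' y * deriv_of v b' y"
  using D.D_cong[OF r(2) rat.mult_R[OF r(1,3)] cb] D.D_mult[OF r(1,3)] c(2) cb by eventually_elim simp
 obtain h where h: "h \<in> reg_at X p" "GEN y. deriv_of v a' y = a' y * h y"
  using d(8)[OF dr(1) L.dvdRI[OF dr(2) db]] by (rule L.dvdRE)
 from db h(2) L.ev_nonzero[OF d(2,4)] have hb: "GEN y. deriv_of v b' y = b' y * h y"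
  by eventually_elim simp
 have a'p: "a' p ~= 0"
  using invariant_germ_zero[OF d(2) _ h(1)] h(2) d(4) by (auto simp: deriv_of_def mult.commute)
 \<comment> \<open>Selects the member of the pencil that vanishes at \<open>p\<close>; a' is a unit
   there, being itself an invariant germ.\<close>
 define k where "k = b' p / a' p"
 let ?e = "%y. b' y - k * a' y"
 have e: "?e \<in> reg_at X p" "?e p = 0" using a'p by (intro L.diff_R L.mult_R L.const_R d(2,3), simp add: k_def)
 have "GEN y. v y ?e = h y * ?e y"
  using D.D_diff[OF r(3) rat.mult_R[OF rat.const_R[of k] r(2)]] D.D_scale[OF r(2), of k] h(2) hb
  by eventually_elim (simp add: deriv_of_def algebra_simps)
 from invariant_germ_zero[OF e h(1) this] cb L.ev_nonzero[OF d(2,4)]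
 have "GEN y. c y = inverse k"
  by eventually_elim (auto simp: field_simps dest: inverse_unique)
 then show ?thesis by (rule exI)
qed blast

end

context field_coords
begin

context
 assumes pV: "p \<in> V"
begin

lemma gderiv_partial:
 shows "gderiv (generic X) (ratfun X) (deriv_of Du)" "gderiv (generic X) (ratfun X) (deriv_of Dt)"
 by (rule local_derivation[OF V_open]; use pV partial_tangent partial_reg_at[folded deriv_of_def] in auto)+

interpretation Du: gderiv "generic X" "ratfun X" "deriv_of Du" by (rule gderiv_partial)
interpretation Dt: gderiv "generic X" "ratfun X" "deriv_of Dt" by (rule gderiv_partial)

lemma generic_in_V: "GEN z. z \<in> V"
 by (rule eventually_genericI[OF V_open pV])

lemma ut_ratfun: "u \<in> ratfun X" "t \<in> ratfun X"
 by (rule ratfunI[OF V_open pV uV] ratfunI[OF V_open pV tV])+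

lemma v_ut_reg_p: "deriv_of v u \<in> reg_at X p" "deriv_of v t \<in> reg_at X p"
 using deriv_of_reg_at[OF v] ut_reg_at[OF pV] by auto

lemma v_partial: "GEN z. deriv_of v c z = deriv_of v u z * deriv_of Du c z + deriv_of v t z * deriv_of Dt c z"
 using generic_in_V by eventually_elim (simp add: deriv_of_def v_expand[of _ c])

text \<open>The bracket of the partial derivatives is a tangent vector that kills \<open>u\<close> and \<open>t\<close>.\<close>

lemma partials_commute:
 assumes c: "c \<in> ratfun X"
 shows "GEN z. deriv_of Du (deriv_of Dt c) z = deriv_of Dt (deriv_of Du c) z"
proof -
 obtain U where U: "zopen X U" "U ~= {}" "c \<in> reg X U" using c unfolding ratfun_def by auto
 have "Du z (deriv_of Dt c) = Dt z (deriv_of Du c)" if z: "z \<in> U" "z \<in> V" for z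
 proof -
  interpret z: variety_point X z by (rule variety_point[OF V_points[OF z(2)]])
  have eq: "\<eta> f = \<eta> g" if "\<eta> \<in> tangent_space X z" "f \<in> z.R" "g \<in> z.R" "GEN y. f y = g y" for \<eta> f g
   using z.tangent_rules(2)[OF that(1-3)] near_eq_iff[OF that(2,3)] that(4) by simp
  have H: "\<eta> (deriv_of Q (%y. f y + g y)) = \<eta> (deriv_of Q f) + \<eta> (deriv_of Q g)"
   "\<eta> (deriv_of Q (%y. k * f y)) = k * \<eta> (deriv_of Q f)"
   "\<eta> (deriv_of Q (%y. f y * g y)) = (f z * \<eta> (deriv_of Q g) + Q z g * \<eta> f) + (g z * \<eta> (deriv_of Q f) + Q z f * \<eta> g)"
   "near_eq X z f g ==> \<eta> (deriv_of Q f) = \<eta> (deriv_of Q g)"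
   if P: "\<eta> \<in> tangent_space X z" and Q: "gderiv (generic X) (ratfun X) (deriv_of Q)" "\<And>f. f \<in> z.R ==> deriv_of Q f \<in> z.R"
    and fg: "f \<in> z.R" "g \<in> z.R" for \<eta> Q f g k
  proof -
   interpret Q: gderiv "generic X" "ratfun X" "deriv_of Q" by (rule Q(1))
   note t = z.tangent_rules[OF P] and q = Q(2)[OF fg(1)] Q(2)[OF fg(2)] and r = fg[THEN reg_at_ratfun]
   note R = z.R_add z.R_mult z.R_const
   show "\<eta> (deriv_of Q (%y. f y + g y)) = \<eta> (deriv_of Q f) + \<eta> (deriv_of Q g)"
    using eq[OF P Q(2)[OF R(1)[OF fg]] R(1)[OF q] Q.D_add[OF r]] t(3)[OF q] by simp
   show "\<eta> (deriv_of Q (%y. k * f y)) = k * \<eta> (deriv_of Q f)"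
    using eq[OF P Q(2)[OF R(2)[OF R(3) fg(1)]] R(2)[OF R(3) q(1)] Q.D_scale[OF r(1)]] t(4)[OF q(1)] by simp
   show "\<eta> (deriv_of Q (%y. f y * g y)) = (f z * \<eta> (deriv_of Q g) + Q z g * \<eta> f) + (g z * \<eta> (deriv_of Q f) + Q z f * \<eta> g)"
    using eq[OF P Q(2)[OF R(2)[OF fg]] R(1)[OF R(2)[OF fg(1) q(2)] R(2)[OF fg(2) q(1)]] Q.D_mult[OF r]]
     t(3)[OF R(2)[OF fg(1) q(2)] R(2)[OF fg(2) q(1)]] t(5)[OF fg(1) q(2)] t(5)[OF fg(2) q(1)] by (simp add: deriv_of_def)
   show "\<eta> (deriv_of Q f) = \<eta> (deriv_of Q g)" if "near_eq X z f g"
    using eq[OF P q Q.D_cong[OF r]] that near_eq_iff[OF fg] by simp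
  qed
  note H1 = H[OF partial_tangent(1)[OF z(2)] gderiv_partial(2) partial_reg_at(2)[OF z(2), folded deriv_of_def]]
  note H2 = H[OF partial_tangent(2)[OF z(2)] gderiv_partial(1) partial_reg_at(1)[OF z(2), folded deriv_of_def]]
  define \<xi> where "\<xi> f = (if f \<in> z.R then Du z (deriv_of Dt f) - Dt z (deriv_of Du f) else 0)" for f
  have \<xi>: "\<xi> \<in> tangent_space X z"
   unfolding tangent_space_def plus_fun_def times_fun_def \<xi>_def
   by (simp add: z.R_rules H1 H2 algebra_simps)
  have *: "\<eta> (deriv_of D f) = 0" if E: "\<eta> \<in> tangent_space X z" "f = u \<or> f = t" "D = Du \<or> D = Dt" for \<eta> D f
  proof -
   have "deriv_of D f \<in> z.R" using E(2,3) partial_reg_at[OF z(2)] ut_reg_at[OF z(2)] unfolding deriv_of_def by auto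
   moreover obtain k where "GEN y. deriv_of D f y = k"
    by (rule that[of "if D = Du \<longleftrightarrow> f = u then 1 else 0"]) (use generic_in_V in \<open>eventually_elim, use E(2,3) partial_dual in \<open>auto simp: deriv_of_def\<close>\<close>)
   ultimately show ?thesis using eq[OF E(1) _ z.R_const] z.tangent_const[OF E(1)] by metis
  qed
  have "\<xi> u = 0" "\<xi> t = 0" by (simp_all add: \<xi>_def *[OF partial_tangent(1)[OF z(2)]] *[OF partial_tangent(2)[OF z(2)]])
  moreover have "c \<in> z.R" unfolding reg_at_def using U z(1) by blast
  ultimately show ?thesis using tangent_expand[OF z(2) \<xi>, of c] by (simp add: \<xi>_def)
 qed
 moreover have "GEN z. z \<in> U" unfolding eventually_generic using U by blast
 ultimately show ?thesis using generic_in_V unfolding deriv_of_def by (auto elim: eventually_elim2)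
qed

text \<open>Write \<open>v\<close> as a combination of \<open>Du\<close> and \<open>Dt\<close>;
  these commute, so only the coefficients of \<open>v\<close> contribute to the bracket.\<close>

lemma v_Du_bracket:
 assumes c: "c \<in> ratfun X"
 shows "GEN z. deriv_of v (deriv_of Du c) z = deriv_of Du (deriv_of v c) z
  - deriv_of Du (deriv_of v u) z * deriv_of Du c z - deriv_of Du (deriv_of v t) z * deriv_of Dt c z"
proof -
 note r = ut_ratfun[THEN D.D_R] Du.D_R[OF c] Dt.D_R[OF c]
 from Du.D_cong[OF D.D_R[OF c] rat.add_R[OF rat.mult_R[OF r(1,3)] rat.mult_R[OF r(2,4)]] v_partial[of c]]
  Du.D_add[OF rat.mult_R[OF r(1,3)] rat.mult_R[OF r(2,4)]] Du.D_mult[OF r(1,3)] Du.D_mult[OF r(2,4)]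
  v_partial[of "deriv_of Du c"] partials_commute[OF c]
 show ?thesis by eventually_elim (simp add: algebra_simps)
qed

lemma v_t_nonzero: "\<not> (GEN z. deriv_of v t z = 0)"
proof
 assume 0: "GEN z. deriv_of v t z = 0"
 let ?h = "%z. t z - t p"
 interpret L: regular_local_ring2 "generic X" "reg_at X p" p "%z. u z - u p" ?h by (rule regular_local_ring2[OF pV])
 from 0 D.D_diff[OF ut_ratfun(2) rat.const_R, of "t p"] D.D_const[of "t p"]
 have "GEN z. v z ?h = 0 * ?h z" by eventually_elim (simp add: deriv_of_def)
 from invariant_germ_zero[OF L.ut_R(2) L.ut_at(2) L.const_R this] L.t_power_not[of "%_. 0" 1]
 show False by simp
qed

text \<open>The denominators of an invariant form form an ideal whose generator is again invariant.\<close>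

theorem no_invariant_form:
 assumes AB: "A \<in> ratfun X" "B \<in> ratfun X"
  and unit: "GEN z. deriv_of v u z * A z + deriv_of v t z * B z = 1"
  and dA: "GEN z. deriv_of v A z = - deriv_of Du (deriv_of v u) z * A z - deriv_of Du (deriv_of v t) z * B z"
  and dB: "GEN z. deriv_of v B z = - deriv_of Dt (deriv_of v u) z * A z - deriv_of Dt (deriv_of v t) z * B z"
 shows False
proof -
 interpret L: regular_local_ring2 "generic X" "reg_at X p" p "%z. u z - u p" "%z. t z - t p" by (rule regular_local_ring2[OF pV])
 let ?R = "reg_at X p"
 obtain a e1 where a: "a \<in> ?R" "e1 \<in> ?R" "GEN y. e1 y ~= 0 \<and> A y * e1 y = a y" using ratfun_fraction[OF p_point AB(1)] .
 obtain b e2 where b: "b \<in> ?R" "e2 \<in> ?R" "GEN y. e2 y ~= 0 \<and> B y * e2 y = b y" using ratfun_fraction[OF p_point AB(2)] .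
 \<comment> \<open>A common denominator of \<open>A\<close> and \<open>B\<close> at
   \<open>p\<close>, which turns denominators into divisibility by \<open>e\<close>.\<close>
 define e where "e y = e1 y * e2 y" for y
 have e: "e \<in> ?R" unfolding e_def using a b by auto
 have en: "GEN y. e y ~= 0" using a(3) b(3) by eventually_elim (simp add: e_def)
 define a' where "a' y = a y * e2 y" for y
 define b' where "b' y = b y * e1 y" for y
 have ab: "a' \<in> ?R" "b' \<in> ?R" unfolding a'_def b'_def using a b by auto
 have ae: "GEN y. a' y = A y * e y" "GEN y. b' y = B y * e y"
  using a(3) b(3) by (eventually_elim, auto simp: a'_def b'_def e_def)+
 have mem: "(\<exists>h\<in>?R. GEN y. c y * F y = h y) \<longleftrightarrow> L.dvdR e (%y. c y * f y)"
  if "GEN y. f y = F y * e y" for c f F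
 proof -
  have "(GEN y. c y * F y = h y) \<longleftrightarrow> (GEN y. c y * f y = e y * h y)" for h
  proof
   assume "GEN y. c y * F y = h y"
   with that show "GEN y. c y * f y = e y * h y" by eventually_elim auto
  next
   assume "GEN y. c y * f y = e y * h y"
   with that en show "GEN y. c y * F y = h y" by eventually_elim auto
  qed
  then show ?thesis unfolding L.dvdR_def by simp
 qed
 have S: "{a', b'} \<subseteq> ?R" using ab by simp
 \<comment> \<open>\<open>D\<close> generates the ideal of the germs c such that c A and c B are
   regular at \<open>p\<close>.\<close>
 obtain D where D: "D \<in> ?R" "\<And>f. f \<in> {a', b'} ==> L.dvdR e (%y. D y * f y)"
  "\<And>c. c \<in> ?R ==> L.dvdR e (%y. c y * a' y) ==> L.dvdR e (%y. c y * b' y) ==> L.dvdR D c"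
  by (rule L.quotient_ideal_principal[OF e rat.not_ev_zeroI[OF en] S]) blast
 obtain \<alpha> where \<alpha>: "\<alpha> \<in> ?R" "GEN y. D y * A y = \<alpha> y" using mem[OF ae(1)] D(2) by blast
 obtain \<beta> where \<beta>: "\<beta> \<in> ?R" "GEN y. D y * B y = \<beta> y" using mem[OF ae(2)] D(2) by blast
 have 1: "L.dvdR D c" if "c \<in> ?R" "h \<in> ?R" "GEN y. c y * A y = h y" "k \<in> ?R" "GEN y. c y * B y = k y" for c h k
  using D(3)[OF that(1)] mem[OF ae(1), of c] mem[OF ae(2), of c] that(2-) by blast
 let ?\<delta> = "deriv_of v"
 \<comment> \<open>The form has value 1 on \<open>v\<close>, so \<open>D\<close> is a combination of
   the components of \<open>v\<close> with regular coefficients and vanishes at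
   \<open>p\<close>.\<close>
 from \<alpha>(2) \<beta>(2) unit have "GEN y. D y = ?\<delta> u y * \<alpha> y + ?\<delta> t y * \<beta> y"
 proof eventually_elim
  case (elim y)
  from arg_cong[OF elim(3), of "%z. D y * z"] show ?case
   unfolding elim(1,2)[symmetric] by (simp add: algebra_simps)
 qed
 from L.ev_at[OF D(1) L.add_R[OF L.mult_R[OF v_ut_reg_p(1) \<alpha>(1)] L.mult_R[OF v_ut_reg_p(2) \<beta>(1)]] this]
 have Dp: "D p = 0" by (simp add: deriv_of_def v_at_p)
 note r = D(1)[THEN reg_at_ratfun]
 \<comment> \<open>The derivative of D F is regular, and D times the derivative of F is regular by
   the equation for F. Hence \<delta> D is again a denominator, that is, a multiple of
   \<open>D\<close>.\<close>
 have dD: "GEN y. ?\<delta> D y * F y = ?\<delta> f y + (Du1 y * \<alpha> y + Du2 y * \<beta> y)"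
  if "F \<in> ratfun X" "f \<in> ?R" "GEN y. D y * F y = f y" "GEN z. ?\<delta> F z = - Du1 z * A z - Du2 z * B z" for F f Du1 Du2
  using D.D_cong[OF rat.mult_R[OF r that(1)] reg_at_ratfun[OF that(2)] that(3)] D.D_mult[OF r that(1)] that(3,4) \<alpha>(2) \<beta>(2)
 proof eventually_elim
  case (elim y)
  then show ?case unfolding elim(5,6)[symmetric] by (simp add: algebra_simps)
 qed
 note P = partial_reg_at(1)[OF pV v_ut_reg_p(1), folded deriv_of_def] partial_reg_at(1)[OF pV v_ut_reg_p(2), folded deriv_of_def]
  partial_reg_at(2)[OF pV v_ut_reg_p(1), folded deriv_of_def] partial_reg_at(2)[OF pV v_ut_reg_p(2), folded deriv_of_def]
 note dr = deriv_of_reg_at[OF v]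
 have "L.dvdR D (?\<delta> D)"
  by (rule 1[OF dr[OF D(1)] _ dD[OF AB(1) \<alpha> dA] _ dD[OF AB(2) \<beta> dB]])
   (intro L.add_R L.mult_R dr \<alpha>(1) \<beta>(1) P)+
 then obtain h where h: "h \<in> ?R" "GEN y. ?\<delta> D y = D y * h y" by (rule L.dvdRE)
 have "GEN y. D y = 0"
  by (rule invariant_germ_zero[OF D(1) Dp h(1)]) (use h(2) in "simp add: deriv_of_def mult.commute")
 moreover have "L.dvdR D e" by (rule 1[OF e ab(1) _ ab(2)]) (use ae in "auto elim: eventually_mono")
 then obtain k where "GEN y. e y = D y * k y" by (rule L.dvdRE)
 ultimately have "GEN y. False" using en by eventually_elim simp
 then show False using generic_not_bot by simp
qed

end

end

section \<open>Rational maps and algebraic factors\<close>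

context irreducible_var
begin

text \<open>One of the finitely many irreducible pieces of \<open>K\<close> is infinite; a point of
  it, the piece and the whole space form a chain of length two.\<close>

lemma infinite_closed_krull_dim:
 assumes K: "closedin (zar X) K" "infinite K" "K ~= points X"
 shows "krull_dim (zar X) \<ge> 2"
proof -
 obtain \<Z> where Z: "finite \<Z>" "\<forall>Z\<in>\<Z>. closedin (zar X) Z \<and> irreducible_in (zar X) Z" "\<Union>\<Z> = K"
  using irreducible_decomposition[OF var K(1)] by (elim exE conjE)
 then obtain Z where Z: "Z \<in> \<Z>" "infinite Z" "closedin (zar X) Z" "irreducible_in (zar X) Z" "Z \<subseteq> K"
  using K(2) finite_Union[of \<Z>] by blast
 then obtain z where z: "z \<in> Z" by fastforce
 have zp: "z \<in> points X" using z closedin_subset[OF Z(3)] by blast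
 define C where "C i = (if i = 0 then {z} else if i = 1 then Z else points X)" for i :: nat
 have "\<forall>i\<le>2. closedin (zar X) (C i) \<and> irreducible_in (zar X) (C i)"
  unfolding C_def using Z(3,4) closedin_point[OF var zp] irreducible_in_point[OF zp] irr irreducible_variety_def by auto
 moreover have "{z} ~= Z" using Z(2) by auto
 then have "\<forall>i<2. C i \<subset> C (Suc i)"
  unfolding C_def using z Z(5) K(3) closedin_subset[OF K(1)] by (auto simp: less_2_cases_iff)
 ultimately have "enat 2 \<le> krull_dim (zar X)" unfolding krull_dim_def by (intro SUP_upper) blast
 then show ?thesis by (simp add: numeral_eq_enat)
qed

text \<open>Positive dimension provides a second point, hence a chart with two points; if all its
  coordinates were constant, these points would coincide.\<close>

lemma nonconstant_exists:
 assumes dim: "krull_dim (zar X) = 1"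
 shows "\<exists>f\<in>ratfun X. \<nexists>k. GEN x. f x = k"
proof (rule ccontr)
 assume const: "\<not> ?thesis"
 have "0 < krull_dim (zar X)" using dim by simp
 then obtain n C where C: "n > 0" "\<forall>i\<le>n. closedin (zar X) (C i) \<and> irreducible_in (zar X) (C i)" "\<forall>i<n. C i \<subset> C (Suc i)"
  unfolding krull_dim_def less_SUP_iff by (elim bexE CollectE exE conjE) (simp add: zero_enat_def)
 then have "C 0 ~= {}" "C 0 \<subset> C 1" "C 1 \<subseteq> points X" unfolding irreducible_in_def by (auto simp: Suc_le_eq)
 then obtain x y where xy: "x \<in> points X" "y \<in> points X" "x ~= y" by blast
 obtain B n \<phi> where B: "chart X B n \<phi>" "x \<in> B" using chart_nbhd[OF var xy(1)] .
 have "B \<inter> (points X - {x}) ~= {}"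
  by (rule open_Int_nonempty) (use B chart_rules(1)[OF B(1)] closedin_point[OF var xy(1)] xy in auto)
 then obtain z where z: "z \<in> B" "z ~= x" by blast
 have "\<phi> z i = \<phi> x i" if i: "i < n" for i
 proof -
  note r = chart_rules(7)[OF B(1) polyfun.coord[OF i]]
  from const have "\<forall>f\<in>ratfun X. \<exists>k. GEN y. f y = k" by simp
  from bspec[OF this ratfunI[OF chart_rules(1)[OF B(1)] B(2) r]]
  obtain k where "GEN y. \<phi> y i = k" by (elim exE)
  from reg_identity[OF chart_rules(1)[OF B(1)] r reg_const[OF var chart_rules(1)[OF B(1)]] this] z(1) B(2)
  show ?thesis by simp
 qed
 then have "\<phi> z = \<phi> x" using chart_rules(2)[OF B(1)] z(1) B(2) unfolding cspace_def by (metis PiE_ext lessThan_iff)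
 then show False using chart_rules(3)[OF B(1)] z B(2) unfolding inj_on_def by blast
qed

lemma polyfun_1: "F \<in> polyfun 1 ==> \<exists>q. \<forall>z. F z = poly q (z 0)"
proof (induction rule: polyfun.induct)
 case (const c)
 show ?case by (rule exI[of _ "[:c:]"]) simp
next
 case (coord i)
 then show ?case by (intro exI[of _ "[:0, 1:]"]) simp
next
 case (add f g)
 then obtain q r where "\<forall>z. f z = poly q (z 0)" "\<forall>z. g z = poly r (z 0)" by blast
 then show ?case by (intro exI[of _ "q + r"]) simp
next
 case (mult f g)
 then obtain q r where "\<forall>z. f z = poly q (z 0)" "\<forall>z. g z = poly r (z 0)" by blast
 then show ?case by (intro exI[of _ "q * r"]) simp
qed

text \<open>If f and s were algebraically independent, (f, s) would take almost all values in the
  plane. Then some fibre f = k would be infinite, and it lies in a proper closed set, which is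
  impossible in dimension 1.\<close>

lemma curve_relation:
 assumes dim: "krull_dim (zar X) = 1" and f: "f \<in> ratfun X" "\<nexists>k. GEN x. f x = k" and s: "s \<in> ratfun X"
 shows "\<exists>n r. r n ~= 0 \<and> (GEN x. (\<Sum>j<Suc n. poly (r j) (f x) * s x ^ j) = 0)"
proof (rule ccontr)
 assume no: "\<not> ?thesis"
 have indep: "\<forall>i<d. r i = 0" if "GEN x. (\<Sum>j<d. poly (r j) (f x) * s x ^ j) = 0" for d r
  using that
 proof (induction d)
  case (Suc d)
  then have "r d = 0" using no by blast
  with Suc show ?case by (simp add: less_Suc_eq)
 qed simp
 have expand: "\<exists>d r. \<forall>z. F z = (\<Sum>i<d. poly (r i) (z 0) * z 1 ^ i)" if F: "F \<in> polyfun 2" for F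
 proof -
  obtain d c where c: "\<forall>i. c i \<in> polyfun 1" "\<forall>z. F z = (\<Sum>i<d. c i z * z 1 ^ i)"
   using polyfun_last_variable[of F 1] F by (auto simp: numeral_2_eq_2)
  then have "\<forall>i. \<exists>q. \<forall>z. c i z = poly q (z 0)" using polyfun_1 by blast
  then obtain r where "\<forall>i z. c i z = poly (r i) (z 0)" by (metis choice)
  with c(2) show ?thesis by (intro exI[of _ d] exI[of _ r]) simp
 qed
 define G where "G i = (if i = 0 then f else s)" for i :: nat
 have GR: "G i \<in> ratfun X" for i unfolding G_def using f(1) s by simp
 obtain S where S: "zopen X S" "S ~= {}" "f \<in> reg X S" using f(1) unfolding ratfun_def by auto
 obtain b where b: "b \<in> polyfun 2" "\<not> (GEN x. b (%i. G i x) = 0)"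
  "\<forall>\<eta>. (\<forall>F\<in>polyfun 2. (GEN x. F (%i. G i x) = 0) --> F \<eta> = 0) \<and> b \<eta> ~= 0 --> (\<exists>x\<in>S. \<forall>i<2. G i x = \<eta> i)"
  using image_constructible[of 2 G, OF GR S(1,2)] by (elim bexE conjE)
 have rel0: "F \<eta> = 0" if F: "F \<in> polyfun 2" "GEN x. F (%i. G i x) = 0" for F \<eta>
 proof -
  obtain d r where r: "\<forall>z. F z = (\<Sum>i<d. poly (r i) (z 0) * z 1 ^ i)" using expand[OF F(1)] by (elim exE)
  have "\<forall>i<d. r i = 0" by (rule indep) (use F(2) r in "simp add: G_def")
  with r show ?thesis by simp
 qed
 obtain d r where r: "\<forall>z. b z = (\<Sum>i<d. poly (r i) (z 0) * z 1 ^ i)" using expand[OF b(1)] by (elim exE)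
 have "\<exists>i<d. r i ~= 0"
 proof (rule ccontr)
  assume "\<not> ?thesis"
  then have "b z = 0" for z using r by simp
  with b(2) show False by simp
 qed
 then obtain i where i: "i < d" "r i ~= 0" by blast
 have "{k. poly (r i) k = 0} ~= UNIV" using poly_roots_finite[OF i(2)] infinite_UNIV_char_0[where 'a = complex] by metis
 \<comment> \<open>A value for which b(k, -) is a nonzero polynomial, so that s takes all but
   finitely many values on the fibre f = k.\<close>
 then obtain k where k: "poly (r i) k ~= 0" by blast
 define q where "q = pol (%j _. poly (r j) k) d ()"
 have "coeff q i ~= 0" unfolding q_def coeff_pol using i k by simp
 then have q: "q ~= 0" by auto
 have sub: "- {z. poly q z = 0} \<subseteq> s ` {x\<in>S. f x = k}"
 proof
  fix z assume z: "z \<in> - {z. poly q z = 0}"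
  define \<eta> where "\<eta> i = (if i = 0 then k else z)" for i :: nat
  have "b \<eta> = poly q z" unfolding q_def poly_pol spec[OF r] by (simp add: \<eta>_def)
  then have "b \<eta> ~= 0" using z by simp
  then obtain x where x: "x \<in> S" "\<forall>i<2. G i x = \<eta> i" using b(3) rel0 by blast
  then show "z \<in> s ` {x\<in>S. f x = k}" using spec[OF x(2), of 0] spec[OF x(2), of 1] by (auto simp: G_def \<eta>_def)
 qed
 have inf: "infinite {x\<in>S. f x = k}"
 proof
  assume "finite {x\<in>S. f x = k}"
  from finite_subset[OF sub finite_imageI[OF this]] poly_roots_finite[OF q] have "finite (UNIV :: complex set)"
   by (metis Compl_eq_Diff_UNIV finite_Diff2)
  then show False by (simp add: infinite_UNIV_char_0)
 qed
 let ?U = "{x\<in>S. f x - k ~= 0}" let ?K = "points X - ?U"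
 have U: "zopen X ?U" by (rule open_nonzero[OF var S(1) reg_diff[OF var S(1,3) reg_const[OF var S(1)]]])
 have "?U ~= {}"
 proof
  assume "?U = {}"
  then have "GEN x. f x = k" unfolding eventually_generic using S by (intro exI[of _ S]) auto
  with f(2) show False by blast
 qed
 then have "?K ~= points X" using openin_subset[OF U] by blast
 moreover have "closedin (zar X) ?K" using U by auto
 moreover have "infinite ?K"
  by (rule infinite_super[OF _ inf]) (use openin_subset[OF S(1)] in auto)
 ultimately have "krull_dim (zar X) \<ge> 2" by (intro infinite_closed_krull_dim)
 with dim show False by (simp add: numeral_eq_enat one_enat_def)
qed

end

locale dominant_map = src: irreducible_var X' + tgt: irreducible_var X
 for X' :: "'b fspace" and X :: "'a fspace" +
 fixes U :: "'b set" and \<psi> :: "'b => 'a"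
 assumes dom: "dominant_rational_map X' U \<psi> X"
begin

lemma preimage_open:
 assumes "zopen X V" "V ~= {}"
 shows "zopen X' {x\<in>U. \<psi> x \<in> V}" "{x\<in>U. \<psi> x \<in> V} ~= {}"
proof -
 show "zopen X' {x\<in>U. \<psi> x \<in> V}"
  using dom assms(1) unfolding dominant_rational_map_def morphism_on_def by blast
 obtain y where y: "y \<in> V" using assms(2) by blast
 then have "y \<in> zar X closure_of (\<psi> ` U)"
  using dom openin_subset[OF assms(1)] unfolding dominant_rational_map_def by blast
 then show "{x\<in>U. \<psi> x \<in> V} ~= {}" using assms(1) y unfolding in_closure_of by blast
qed

text \<open>Dominance says that the generic point is mapped to the generic point.\<close>

lemma lim: "filterlim \<psi> (generic X) (generic X')"
 unfolding filterlim_iff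
proof (intro allI impI)
 fix P assume "eventually P (generic X)"
 then obtain V where V: "zopen X V" "V ~= {}" "\<forall>y\<in>V. P y" unfolding tgt.eventually_generic by blast
 show "\<forall>\<^sub>F x in generic X'. P (\<psi> x)" unfolding src.eventually_generic
  by (intro exI[of _ "{x\<in>U. \<psi> x \<in> V}"] conjI preimage_open[OF V(1,2)]) (use V(3) in blast)
qed

lemma pull_reg: "zopen X V ==> c \<in> reg X V ==> (%x. c (\<psi> x)) \<in> reg X' {x\<in>U. \<psi> x \<in> V}"
 using dom unfolding dominant_rational_map_def morphism_on_def comp_def by blast

lemma pull_ratfun: "c \<in> ratfun X ==> (%x. c (\<psi> x)) \<in> ratfun X'"
 unfolding ratfun_def by (elim CollectE exE conjE, rule CollectI, rule exI, intro conjI, rule preimage_open(1), assumption+,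
   rule preimage_open(2), assumption+, rule pull_reg)

lemma pull_field:
 assumes fr: "field_related X' v' U \<psi> X v" and c: "c \<in> ratfun X"
 shows "\<forall>\<^sub>F x in generic X'. deriv_of v' (%x. c (\<psi> x)) x = deriv_of v c (\<psi> x)"
proof -
 obtain V where V: "zopen X V" "V ~= {}" "c \<in> reg X V" using c unfolding ratfun_def by auto
 have "deriv_of v' (%x. c (\<psi> x)) x = deriv_of v c (\<psi> x)" if "x \<in> {x\<in>U. \<psi> x \<in> V}" for x
 proof -
  have "c \<in> reg_at X (\<psi> x)" unfolding reg_at_def using V that by blast
  then show ?thesis using fr that unfolding field_related_def deriv_of_def comp_def by simp
 qed
 then show ?thesis unfolding src.eventually_generic using preimage_open[OF V(1,2)] by blast
qed

text \<open>If \<open>g\<close> were transcendental, almost every value would be taken by \<open>g\<close> on a general fibre.\<close>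

lemma algebraic_of_finite_fibres:
 assumes V: "zopen X V" "V ~= {}" "\<forall>y\<in>V. finite {x\<in>U. \<psi> x = y}" and g: "g \<in> ratfun X'"
 shows "\<exists>n c. (\<forall>i. c i \<in> ratfun X) \<and> (\<exists>i<n. \<not> (\<forall>\<^sub>F z in generic X. c i z = 0)) \<and>
  (\<forall>\<^sub>F x in generic X'. poly (pol c n (\<psi> x)) (g x) = 0)"
proof (rule ccontr)
 assume no: "\<not> ?thesis"
 have no': False if "\<forall>i. c i \<in> ratfun X" "i < n" "\<not> (\<forall>\<^sub>F z in generic X. c i z = 0)"
  "\<forall>\<^sub>F x in generic X'. poly (pol c n (\<psi> x)) (g x) = 0" for c n i
  using no that by blast
 obtain x0 where x0: "x0 \<in> points X" using tgt.points_nonempty by blast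
 obtain B n \<phi> where B: "chart X B n \<phi>" "x0 \<in> B" using chart_nbhd[OF tgt.var x0] .
 note oB = chart_rules(1)[OF B(1)] and rB = chart_rules(7)[OF B(1)]
 have B0: "B ~= {}" using B(2) by blast
 note S = preimage_open[OF oB B0]
 \<comment> \<open>Chart coordinates of \<psi> x followed by g x; if g is transcendental, the only
   relations among them are those of the chart.\<close>
 define G where "G i = (if i < n then %x. \<phi> (\<psi> x) i else g)" for i
 have GR: "G i \<in> ratfun X'" for i
  unfolding G_def using g pull_ratfun[OF tgt.ratfunI[OF oB B(2) rB[OF polyfun.coord]]] by simp
 obtain b where b: "b \<in> polyfun (Suc n)" "\<not> (\<forall>\<^sub>F x in generic X'. b (%i. G i x) = 0)"
  "\<forall>\<eta>. (\<forall>F\<in>polyfun (Suc n). (\<forall>\<^sub>F x in generic X'. F (%i. G i x) = 0) --> F \<eta> = 0) \<and> b \<eta> ~= 0 -->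
   (\<exists>x\<in>{x\<in>U. \<psi> x \<in> B}. \<forall>i<Suc n. G i x = \<eta> i)"
  using src.image_constructible[of "Suc n" G, OF GR S] by (elim bexE conjE)
 have expand: "\<exists>d c. (\<forall>i. c i \<in> polyfun n) \<and> (\<forall>y z. F (%i. if i < n then \<phi> y i else z) = poly (pol (%i y. c i (\<phi> y)) d y) z)"
  if F: "F \<in> polyfun (Suc n)" for F
 proof -
  obtain d c where c: "\<forall>i. c i \<in> polyfun n" "\<forall>z. F z = (\<Sum>i<d. c i z * z n ^ i)" using polyfun_last_variable[OF F] by (elim exE conjE)
  have "c i (%i. if i < n then \<phi> y i else z) = c i (\<phi> y)" for i y z by (rule polyfun_cong[OF spec[OF c(1)]]) simp
  with c show ?thesis by (intro exI[of _ d] exI[of _ c]) (simp add: poly_pol)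
 qed
 have G: "(%i. G i x) = (%i. if i < n then \<phi> (\<psi> x) i else g x)" for x unfolding G_def by auto
 have cR: "(%y. c (\<phi> y)) \<in> ratfun X" if "c \<in> polyfun n" for c by (rule tgt.ratfunI[OF oB B(2) rB[OF that]])
 have zero: "c (\<phi> y) = 0" if c: "c \<in> polyfun n" "\<forall>\<^sub>F y in generic X. c (\<phi> y) = 0" "y \<in> B" for c y
  by (rule tgt.reg_identity[OF oB rB[OF c(1)] reg_const[OF tgt.var oB] c(2,3)])
 have indep: "F (%i. if i < n then \<phi> y i else z) = 0"
  if F: "F \<in> polyfun (Suc n)" "\<forall>\<^sub>F x in generic X'. F (%i. G i x) = 0" and y: "y \<in> B" for F y z
 proof -
  obtain d c where c: "\<forall>i. c i \<in> polyfun n" "\<forall>y z. F (%i. if i < n then \<phi> y i else z) = poly (pol (%i y. c i (\<phi> y)) d y) z"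
   using expand[OF F(1)] by (elim exE conjE)
  have rel: "\<forall>\<^sub>F x in generic X'. poly (pol (%i y. c i (\<phi> y)) d (\<psi> x)) (g x) = 0" using F(2) c(2) by (simp add: G)
  have "\<forall>i<d. \<forall>\<^sub>F y in generic X. c i (\<phi> y) = 0"
  proof (rule ccontr)
   assume "\<not> ?thesis"
   then obtain i where "i < d" "\<not> (\<forall>\<^sub>F y in generic X. c i (\<phi> y) = 0)" by blast
   then show False by (intro no'[OF _ _ _ rel]) (use cR c(1) in simp_all)
  qed
  then have "pol (%i y. c i (\<phi> y)) d y = 0" using zero[OF spec[OF c(1)] _ y] by (intro poly_eqI) (simp add: coeff_pol)
  then show ?thesis using c(2) by simp
 qed
 obtain d c where c: "\<forall>i. c i \<in> polyfun n" "\<forall>y z. b (%i. if i < n then \<phi> y i else z) = poly (pol (%i y. c i (\<phi> y)) d y) z"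
  using expand[OF b(1)] by (elim exE conjE)
 have "\<exists>i<d. \<exists>y\<in>B. c i (\<phi> y) ~= 0"
 proof (rule ccontr)
  assume "\<not> ?thesis"
  then have "pol (%i y. c i (\<phi> y)) d y = 0" if "y \<in> B" for y using that by (intro poly_eqI) (simp add: coeff_pol)
  then have "\<forall>x\<in>{x\<in>U. \<psi> x \<in> B}. b (%i. G i x) = 0" using c(2) by (simp add: G)
  with b(2) S show False unfolding src.eventually_generic by blast
 qed
 then obtain i where i: "i < d" "{y\<in>B. c i (\<phi> y) ~= 0} ~= {}" by blast
 obtain y where y: "y \<in> V" "y \<in> B" "c i (\<phi> y) ~= 0"
  using tgt.open_Int_nonempty[OF V(1,2) chart_rules(5)[OF B(1) spec[OF c(1)]] i(2)] by blast
 define q where "q = pol (%i y. c i (\<phi> y)) d y"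
 have "coeff q i ~= 0" unfolding q_def coeff_pol using i y by simp
 then have q: "q ~= 0" by auto
 \<comment> \<open>The fibre over y is finite, yet g takes on it every value that is not a root of
   q.\<close>
 have "- {z. poly q z = 0} \<subseteq> g ` {x\<in>U. \<psi> x = y}"
 proof
  fix z assume z: "z \<in> - {z. poly q z = 0}"
  let ?\<eta> = "%i. if i < n then \<phi> y i else z"
  have "b ?\<eta> ~= 0" using z c(2) by (simp add: q_def)
  then obtain x where x: "x \<in> U" "\<psi> x \<in> B" "\<forall>i<Suc n. G i x = ?\<eta> i" using b(3) indep[OF _ _ y(2)] by blast
  have "\<phi> (\<psi> x) i = \<phi> y i" if "i < n" for i using x(3) that by (auto simp: G_def dest: spec[of _ i])
  then have "\<phi> (\<psi> x) = \<phi> y" using chart_rules(2)[OF B(1)] x(2) y(2) unfolding cspace_def by (metis PiE_ext lessThan_iff)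
  then have "\<psi> x = y" using chart_rules(3)[OF B(1)] x(2) y(2) unfolding inj_on_def by blast
  moreover have "g x = z" using spec[OF x(3), of n] by (simp add: G_def)
  ultimately show "z \<in> g ` {x\<in>U. \<psi> x = y}" using x(1) by blast
 qed
 from finite_subset[OF this finite_imageI[OF bspec[OF V(3) y(1)]]] poly_roots_finite[OF q] have "finite (UNIV :: complex set)"
  by (metis Compl_eq_Diff_UNIV finite_Diff2)
 then show False by (simp add: infinite_UNIV_char_0)
qed

end

context isolated_surface
begin

text \<open>A nonconstant function on the curve and its derivative are algebraically dependent.
  Pulled back to the extension they are \<open>f\<close> and \<open>s\<close>, from which
  \<open>vertical_component\<close> produces the first component of an invariant form on the
  surface.\<close>

theorem no_algebraic_factor:
 assumes ext: "generically_finite_extension X v X' v'" and fac: "rational_factor X' v' Y w" and dim: "krull_dim (zar Y) = 1"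
 shows False
proof -
 obtain U \<psi> V where \<psi>: "dominant_rational_map X' U \<psi> X" "field_related X' v' U \<psi> X v"
  "zopen X V" "V ~= {}" "\<forall>y\<in>V. finite {x\<in>U. \<psi> x = y}"
  using ext unfolding generically_finite_extension_def by (elim conjE exE)
 obtain U' \<phi> where \<phi>: "dominant_rational_map X' U' \<phi> Y" "field_related X' v' U' \<phi> Y w"
  using fac unfolding rational_factor_def by (elim conjE exE)
 have irr': "irreducible_variety X'" "irreducible_variety Y" and vf: "vector_field X' v'" "vector_field Y w"
  using fac unfolding rational_factor_def D_variety_def by simp_all
 interpret M: dominant_map X' X U \<psi> by unfold_locales (rule irr' \<psi>)+
 interpret N: dominant_map X' Y U' \<phi> by unfold_locales (rule irr' \<phi>)+
 interpret src: gderiv "generic X'" "ratfun X'" "deriv_of v'" by (rule M.src.gderiv_field[OF vf(1)])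
 interpret E: alg_ext "generic X'" "ratfun X'" "deriv_of v'" "generic X" "ratfun X" "deriv_of v" \<psi>
  by unfold_locales (rule M.lim M.pull_ratfun M.pull_field[OF \<psi>(2)] M.algebraic_of_finite_fibres[OF \<psi>(3-5)]; assumption)+
 interpret W: gderiv "generic Y" "ratfun Y" "deriv_of w" by (rule N.tgt.gderiv_field[OF vf(2)])
 obtain h where h: "h \<in> ratfun Y" "\<nexists>k. \<forall>\<^sub>F y in generic Y. h y = k" using N.tgt.nonconstant_exists[OF dim] by (elim bexE)
 define f where "f x = h (\<phi> x)" for x
 define s where "s x = deriv_of w h (\<phi> x)" for x
 have fs: "f \<in> ratfun X'" "s \<in> ratfun X'" unfolding f_def s_def using h(1) by (intro N.pull_ratfun W.D_R; simp)+
 have df: "\<forall>\<^sub>F x in generic X'. deriv_of v' f x = s x" unfolding f_def s_def by (rule N.pull_field[OF \<phi>(2) h(1)])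
 have pull: "\<forall>\<^sub>F x in generic X'. P (\<phi> x)" if "\<forall>\<^sub>F y in generic Y. P y" for P
  using N.lim that unfolding filterlim_iff by simp
 \<comment> \<open>Pullback along a dominant map is injective on rational functions.\<close>
 have push: "\<forall>\<^sub>F y in generic Y. g y = 0" if "g \<in> ratfun Y" "\<forall>\<^sub>F x in generic X'. g (\<phi> x) = 0" for g
  using N.tgt.rat.dichotomy[OF that(1)] pull[of "%y. g y ~= 0"] M.src.rat.not_ev_zeroI[of "%x. g (\<phi> x)"] that(2) by auto
 have nc: "\<nexists>k. \<forall>\<^sub>F x in generic X'. f x = k"
 proof
  assume "\<exists>k. \<forall>\<^sub>F x in generic X'. f x = k"
  then obtain k where "\<forall>\<^sub>F x in generic X'. f x = k" by blast
  then have "\<forall>\<^sub>F x in generic X'. h (\<phi> x) - k = 0" by (simp add: f_def)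
  from push[OF N.tgt.rat.diff_R[OF h(1) N.tgt.rat.const_R] this] h(2) show False by simp
 qed
 \<comment> \<open>Otherwise \<open>f\<close> would be a first integral of the extension, hence
   constant, since the surface has only constant ones.\<close>
 have s0: "\<not> (\<forall>\<^sub>F x in generic X'. s x = 0)"
 proof
  assume "\<forall>\<^sub>F x in generic X'. s x = 0"
  with df have "\<forall>\<^sub>F x in generic X'. deriv_of v' f x = 0" by eventually_elim simp
  from E.const_of_D_zero[OF first_integral_const fs(1) this] nc show False by blast
 qed
 obtain n r where "r n ~= 0" "\<forall>\<^sub>F y in generic Y. (\<Sum>j<Suc n. poly (r j) (h y) * deriv_of w h y ^ j) = 0"
  using N.tgt.curve_relation[OF dim h W.D_R[OF h(1)]] by (elim exE conjE)
 then have rel: "\<exists>n r. r n ~= 0 \<and> (\<forall>\<^sub>F x in generic X'. (\<Sum>j<Suc n. poly (r j) (f x) * s x ^ j) = 0)"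
  using pull unfolding f_def s_def by blast
 obtain V u t Du Dt where V: "field_coords X v p V u t Du Dt" "p \<in> V" using field_coords_exist[OF p_point] .
 interpret c: field_coords X v p V u t Du Dt by (rule V(1))
 interpret Dt: gderiv "generic X" "ratfun X" "deriv_of Dt" by (rule c.gderiv_partial[OF V(2)])
 note ut = c.ut_ratfun[OF V(2)] and gd = c.gderiv_partial[OF V(2)]
 let ?a = "deriv_of v u" and ?b = "deriv_of v t"
 have ab: "?a \<in> ratfun X" "?b \<in> ratfun X" using ut by auto
 obtain A where A: "A \<in> ratfun X"
  "GEN z. deriv_of v A z = - deriv_of Du ?a z * A z - deriv_of Du ?b z * ((1 - ?a z * A z) / ?b z)"
  by (rule bexE[OF E.vertical_component[OF gd ab c.v_t_nonzero[OF V(2)] c.v_partial[OF V(2)] c.v_Du_bracket[OF V(2)] fs df s0 rel]],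
    assumption) (rule that)
 \<comment> \<open>The second component is fixed by the requirement that the form has value 1 on
   \<open>v\<close>.\<close>
 define B where "B z = (1 - ?a z * A z) * inverse (?b z)" for z
 have B: "B \<in> ratfun X" unfolding B_def using ab A(1) by (intro rat.mult_R rat.diff_R rat.inverse_K rat.const_R)
 note b0 = rat.ev_nonzero[OF ab(2) c.v_t_nonzero[OF V(2)]]
 have unit: "GEN z. ?a z * A z + ?b z * B z = 1" using b0 by eventually_elim (simp add: B_def field_simps)
 have dA: "GEN z. deriv_of v A z = - deriv_of Du ?a z * A z - deriv_of Du ?b z * B z"
  using A(2) by eventually_elim (simp add: B_def divide_inverse)
 \<comment> \<open>Obtained by differentiating the normalisation \<open>unit\<close> and inserting
   the equation for \<open>A\<close>; the coefficient of \<open>B\<close> is generically nonzero and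
   can be cancelled.\<close>
 have dB: "GEN z. deriv_of v B z = - deriv_of Dt ?a z * A z - deriv_of Dt ?b z * B z"
  using D.D_cong[OF rat.add_R[OF rat.mult_R[OF ab(1) A(1)] rat.mult_R[OF ab(2) B]] rat.const_R unit] D.D_const[of 1]
   D.D_add[OF rat.mult_R[OF ab(1) A(1)] rat.mult_R[OF ab(2) B]] D.D_mult[OF ab(1) A(1)] D.D_mult[OF ab(2) B]
   c.v_partial[OF V(2), of ?a] c.v_partial[OF V(2), of ?b] dA b0
 proof eventually_elim
  case (elim z)
  have "?b z * deriv_of v B z = ?b z * (- deriv_of Dt ?a z * A z - deriv_of Dt ?b z * B z)"
  proof -
   have "(?a z * deriv_of v A z + A z * deriv_of v ?a z) + (?b z * deriv_of v B z + B z * deriv_of v ?b z) = 0"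
    using elim(1-5) by simp
   with elim(6-8) show ?thesis by algebra
  qed
  with elim(9) show ?case by simp
 qed
 show False by (rule c.no_invariant_form[OF V(2) A(1) B unit dA dB])
qed

end

theorem theorem2p1p2:
  fixes X :: "'a fspace" and v :: "'a vfield" and p :: 'a
  assumes "D_variety X v" and "irreducible_variety X" and "smooth_variety X"
    and "krull_dim (zar X) = 2"
    and "zero_of_field X v p"
    and "\<not> (\<exists>C. closed_curve X C \<and> p \<in> C \<and> invariant_closed X v C)"
  shows "(\<forall>r W. web X r W \<and> invariant_web X v W \<longrightarrow>
            (\<forall>U. openin (zar X) U \<longrightarrow> W U = web_power X (foliation_of X v) r U)) \<and>
         \<not> (\<exists>(X' :: 'b fspace) v' (Y :: 'c fspace) w.
              generically_finite_extension X v X' v' \<and> rational_factor X' v' Y w \<and>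
              krull_dim (zar Y) = 1)"
proof -
 interpret isolated_surface X v p
  by unfold_locales (use assms in "simp_all add: D_variety_def")
 show ?thesis
 proof (intro conjI allI impI notI)
  fix r W U assume W: "web X r W \<and> invariant_web X v W" and U: "openin (zar X) U"
  then have "r \<ge> 1" unfolding web_def by simp
  then show "W U = web_power X (foliation_of X v) r U"
   using invariant_web_vpow[OF conjunct1[OF W] conjunct2[OF W] U] web_power_vpow[OF _ U] by simp
 qed (use no_algebraic_factor in blast)
qed

end
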